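(* Let $(\mathcal A_n,\mu_n)$, $n\ge1$, be weakly logarithmic, and let $h_j(s)\in\mathbb R$ ($j\in\mathbb N$, $s\in\mathbb Z_+$) satisfy $h_j(0)=0$ for each $j$; put $a_j=h_j(1)$. If $B(n)\to\infty$ as $n\to\infty$ and $$a_j=\mathrm o\bigg(\frac{B(j)}{\sqrt{LL\,B(j)}}\bigg),\qquad j\to\infty,$$ then $$U_m(\sigma,\cdot)\Rightarrow\mathcal K\qquad(\{\mu_n\}\text{-a.s.})$$ in the space $C[0,1]$, that is, the Strassen set $\mathcal K$ is a cluster for the sequence $U_m(\sigma,\cdot)$.
   Context: Notation: $\mathbb Z_+=\{0,1,2,\dots\}$; $\ell(\bar s)=1s_1+\cdots+ns_n$; $Lx=\log\max\{x,e\}$ and $LLx=L(Lx)$. Assemblies: fix positive integers $m_j$, $j\ge1$. An assembly $\sigma$ of size $n$ is a partition of a fixed $n$-point set into nonempty subsets, together with, for each subset of size $j$, a choice of one of $m_j$ possible structures; a subset with its structure is a component. $\mathcal A_n$ is the finite set of assemblies of size $n$; $k_j(\sigma)$ is the number of components of size $j$ of $\sigma$ and $\bar k(\sigma)=(k_1(\sigma),\dots,k_n(\sigma))$. Weakly logarithmic: $\mu_n$ is a probability measure on $\mathcal A_n$, and there are mutually independent Poisson random variables $\xi_1,\xi_2,\dots$ (probability $P$), with means $\lambda_j=\mathbf E\xi_j$ not depending on $n$, and constants $0<\theta'\le\theta''$ such that $\theta'/j\le\lambda_j\le\theta''/j$ for all $j\ge1$ and, with $\bar\xi=(\xi_1,\dots,\xi_n)$,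 $\mu_n(\bar k(\sigma)=\bar s)=P(\bar\xi=\bar s\mid\ell(\bar\xi)=n)$ for each $n$ and each $\bar s\in\mathbb Z_+^n$. Processes: for $1\le m\le n$ and $\sigma\in\mathcal A_n$, $$h(\sigma,m)=\sum_{j\le m}h_j(k_j(\sigma)),\quad A(m)=\sum_{j=1}^m a_j(1-e^{-\lambda_j}),\quad B^2(m)=\sum_{j=1}^m a_j^2e^{-\lambda_j}(1-e^{-\lambda_j}),$$ $B(m)=\sqrt{B^2(m)}$ and $\beta(m)=B(m)\sqrt{2LL\,B(m)}$. Let $u_m(\sigma,t)$, $0\le t\le B^2(m)$, be the polygonal line joining the points $(0,0)$ and $(B^2(i),h(\sigma,i)-A(i))$, $1\le i\le m$, where the vertices are taken at the indices $i$ with $a_i\ne0$ (so that it is the graph of a continuous function). Put $U_m(\sigma,t)=\beta(m)^{-1}u_m(\sigma,B^2(m)t)$, $0\le t\le1$. $C[0,1]$ carries the supremum distance $\rho$. The Strassen set $\mathcal K\subset C[0,1]$ is the set of absolutely continuous functions $g$ on $[0,1]$ with $g(0)=0$ and $\int_0^1(g'(t))^2\,dt\le1$. Cluster: let $(S,d)$ be a separable metric space and, for each $n$, let $X_1,\dots,X_n$ be $S$-valued random variables on a probability space $(\Omega_n,\mathcal F_n,P_n)$; $d(Y,A)=\inf\{d(Y,Z):Z\in A\}$. A compact set $A\subset S$ is a cluster for $X_m$, written $X_m\Rightarrow A$ ($\{P_n\}$-a.s.), if for each $\varepsilon>0$ and each $Y\in A$, $$\lim_{n_1\to\infty}\limsup_{n\to\infty}P_n\Big(\max_{n_1\le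 m\le n}d(X_m,A)\ge\varepsilon\Big)=0,\qquad \lim_{n_1\to\infty}\liminf_{n\to\infty}P_n\Big(\min_{n_1\le m\le n}d(X_m,Y)<\varepsilon\Big)=1.$$ (The quantities $U_m$ are considered only for $m$ so large that $B(m)>0$.) *)

theory Defs
  imports "HOL-Probability.Probability" "HOL-Library.Landau_Symbols"
begin

section \<open>Assemblies\<close>

text \<open>
  A component is a pair of a block and the number of its structure; a block of size \<open>j\<close> has
  the structures \<open>0, \<dots>, ms j - 1\<close>.  The \<open>n\<close>-point ground set is \<open>{1..n}\<close>.
\<close>

type_synonym assembly = "(nat set \<times> nat) set"

definition assemblies :: "(nat \<Rightarrow> nat) \<Rightarrow> nat \<Rightarrow> assembly set" where
  "assemblies ms n =
     {\<sigma>. partition_on {1..n} (fst ` \<sigma>) \<and> inj_on fst \<sigma> \<and> (\<forall>(b, s)\<in>\<sigma>. s < ms (card b))}"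

definition comp_count :: "assembly \<Rightarrow> nat \<Rightarrow> nat" where
  "comp_count \<sigma> j = card {c \<in> \<sigma>. card (fst c) = j}"

text \<open>
  Vectors in \<open>\<int>\<^sub>+\<^sup>n\<close> are functions on \<open>nat\<close> of which only the values on \<open>{1..n}\<close> are used.
  The indices start at 1: the values of \<open>\<xi>\<close> and \<open>lam\<close> at 0 are irrelevant.
\<close>

definition weakly_logarithmic ::
  "(nat \<Rightarrow> nat) \<Rightarrow> (nat \<Rightarrow> assembly pmf) \<Rightarrow> 'w measure \<Rightarrow> (nat \<Rightarrow> 'w \<Rightarrow> nat) \<Rightarrow> (nat \<Rightarrow> real) \<Rightarrow> bool"
where
  "weakly_logarithmic ms \<mu> M \<xi> lam \<longleftrightarrow>
     (\<forall>n\<ge>1. set_pmf (\<mu> n) \<subseteq> assemblies ms n) \<and>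
     prob_space M \<and>
     prob_space.indep_vars M (\<lambda>_. count_space UNIV) \<xi> {1..} \<and>
     (\<exists>\<theta>1 \<theta>2. 0 < \<theta>1 \<and> \<theta>1 \<le> \<theta>2 \<and> (\<forall>j\<ge>1. \<theta>1 / real j \<le> lam j \<and> lam j \<le> \<theta>2 / real j)) \<and>
     (\<forall>j\<ge>1. distr M (count_space UNIV) (\<xi> j) = measure_pmf (poisson_pmf (lam j))) \<and>
     (\<forall>n\<ge>1. \<forall>s :: nat \<Rightarrow> nat.
        measure_pmf.prob (\<mu> n) {\<sigma>. \<forall>j\<in>{1..n}. comp_count \<sigma> j = s j} =
        \<P>(\<omega> in M. (\<forall>j\<in>{1..n}. \<xi> j \<omega> = s j) \<bar> (\<Sum>j=1..n. j * \<xi> j \<omega>) = n))"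


section \<open>The processes\<close>

definition Lg :: "real \<Rightarrow> real" where
  "Lg x = ln (max x (exp 1))"

definition LLg :: "real \<Rightarrow> real" where
  "LLg x = Lg (Lg x)"

definition hsum :: "(nat \<Rightarrow> nat \<Rightarrow> real) \<Rightarrow> assembly \<Rightarrow> nat \<Rightarrow> real" where
  "hsum h \<sigma> m = (\<Sum>j=1..m. h j (comp_count \<sigma> j))"

definition Acen :: "(nat \<Rightarrow> real) \<Rightarrow> (nat \<Rightarrow> real) \<Rightarrow> nat \<Rightarrow> real" where
  "Acen a lam m = (\<Sum>j=1..m. a j * (1 - exp (- lam j)))"

definition Bsq :: "(nat \<Rightarrow> real) \<Rightarrow> (nat \<Rightarrow> real) \<Rightarrow> nat \<Rightarrow> real" where
  "Bsq a lam m = (\<Sum>j=1..m. (a j)\<^sup>2 * exp (- lam j) * (1 - exp (- lam j)))"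

definition Bnorm :: "(nat \<Rightarrow> real) \<Rightarrow> (nat \<Rightarrow> real) \<Rightarrow> nat \<Rightarrow> real" where
  "Bnorm a lam m = sqrt (Bsq a lam m)"

definition \<beta> :: "(nat \<Rightarrow> real) \<Rightarrow> (nat \<Rightarrow> real) \<Rightarrow> nat \<Rightarrow> real" where
  "\<beta> a lam m = Bnorm a lam m * sqrt (2 * LLg (Bnorm a lam m))"

text \<open>
  \<open>polyline ps\<close> is the function whose graph is the polygonal line with the successive vertices
  \<open>ps\<close>, whose abscissas are meant to be strictly increasing; it is constant after the last vertex.
\<close>

fun polyline :: "(real \<times> real) list \<Rightarrow> real \<Rightarrow> real" where
  "polyline [] t = 0"
| "polyline [(x, y)] t = y"
| "polyline ((x, y) # (x', y') # ps) t =
     (if t \<le> x' then y + (t - x) / (x' - x) * (y' - y) else polyline ((x', y') # ps) t)"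

definition u_line :: "(nat \<Rightarrow> nat \<Rightarrow> real) \<Rightarrow> (nat \<Rightarrow> real) \<Rightarrow> nat \<Rightarrow> assembly \<Rightarrow> real \<Rightarrow> real" where
  "u_line h lam m \<sigma> = (let a = (\<lambda>j. h j 1) in
     polyline ((0, 0) #
       map (\<lambda>i. (Bsq a lam i, hsum h \<sigma> i - Acen a lam i)) (filter (\<lambda>i. a i \<noteq> 0) [1..<Suc m])))"

text \<open>If \<open>Bnorm a lam m = 0\<close>, then \<open>U_proc h lam m \<sigma>\<close> is the zero function on \<open>[0,1]\<close>.\<close>

definition U_proc :: "(nat \<Rightarrow> nat \<Rightarrow> real) \<Rightarrow> (nat \<Rightarrow> real) \<Rightarrow> nat \<Rightarrow> assembly \<Rightarrow> real \<Rightarrow> real" where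
  "U_proc h lam m \<sigma> = (let a = (\<lambda>j. h j 1) in
     (\<lambda>t\<in>{0..1}. u_line h lam m \<sigma> (Bsq a lam m * t) / \<beta> a lam m))"


section \<open>The space \<open>C[0,1]\<close> and the Strassen set\<close>

text \<open>The elements of this metric space are extensional: they are \<open>undefined\<close> outside \<open>[0,1]\<close>.\<close>

definition C01 :: "(real \<Rightarrow> real) metric" where
  "C01 = cfunspace (top_of_set {0..1}) euclidean_metric"

definition abs_continuous_on :: "real \<Rightarrow> real \<Rightarrow> (real \<Rightarrow> real) \<Rightarrow> bool" where
  "abs_continuous_on a b g \<longleftrightarrow>
     (\<forall>\<epsilon>>0. \<exists>\<delta>>0. \<forall>D :: (real \<times> real) set.
        finite D \<and> (\<forall>(x, y)\<in>D. a \<le> x \<and> x \<le> y \<and> y \<le> b) \<and>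
        disjoint_family_on (\<lambda>(x, y). {x<..<y}) D \<and> (\<Sum>(x, y)\<in>D. y - x) < \<delta>
        \<longrightarrow> (\<Sum>(x, y)\<in>D. \<bar>g y - g x\<bar>) < \<epsilon>)"

text \<open>
  An absolutely continuous function is differentiable almost everywhere; the value of \<open>deriv g\<close>
  elsewhere does not matter.  The integral may be infinite, hence the non-negative integral.
\<close>

definition strassen_set :: "(real \<Rightarrow> real) set" where
  "strassen_set =
     {g \<in> mspace C01. abs_continuous_on 0 1 g \<and> g 0 = 0 \<and>
        (\<integral>\<^sup>+t\<in>{0..1}. ennreal ((deriv g t)\<^sup>2) \<partial>lebesgue) \<le> 1}"


section \<open>Clusters\<close>

definition dist_to_set :: "'s metric \<Rightarrow> 's \<Rightarrow> 's set \<Rightarrow> real" where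
  "dist_to_set S Y A = (INF Z\<in>A. mdist S Y Z)"

definition metric_borel :: "'s metric \<Rightarrow> 's measure" where
  "metric_borel S = sigma (mspace S) {V. openin (mtopology_of S) V}"

text \<open>
  The random variables \<open>X n 1, \<dots>, X n n\<close> live on the probability space \<open>P n\<close>.  The condition
  \<open>A \<noteq> {}\<close> accounts for the convention that the infimum of the empty set is infinite, which
  the real-valued \<open>Inf\<close> does not respect.  \<open>Max\<close> and \<open>Min\<close> below are over a nonempty set as
  soon as \<open>n1 \<le> n\<close>.
\<close>

definition is_cluster ::
  "'s metric \<Rightarrow> (nat \<Rightarrow> 'b measure) \<Rightarrow> (nat \<Rightarrow> nat \<Rightarrow> 'b \<Rightarrow> 's) \<Rightarrow> 's set \<Rightarrow> bool"
where
  "is_cluster S P X A \<longleftrightarrow>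
     separable_space (mtopology_of S) \<and>
     (\<forall>n\<ge>1. prob_space (P n)) \<and>
     (\<forall>n\<ge>1. \<forall>m\<in>{1..n}. X n m \<in> measurable (P n) (metric_borel S)) \<and>
     compactin (mtopology_of S) A \<and> A \<noteq> {} \<and>
     (\<forall>\<epsilon>>0.
        (\<lambda>n1. limsup (\<lambda>n. ereal
           \<P>(\<omega> in P n. Max ((\<lambda>m. dist_to_set S (X n m \<omega>) A) ` {n1..n}) \<ge> \<epsilon>))) \<longlonglongrightarrow> 0) \<and>
     (\<forall>\<epsilon>>0. \<forall>Y\<in>A.
        (\<lambda>n1. liminf (\<lambda>n. ereal
           \<P>(\<omega> in P n. Min ((\<lambda>m. mdist S (X n m \<omega>) Y) ` {n1..n}) < \<epsilon>))) \<longlonglongrightarrow> 1)"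

end

theory Submission
  imports Defs "HOL-Complex_Analysis.Great_Picard"
begin

text \<open>
  The counts of the components of a random assembly have the law of independent Poisson variables
  \<open>x 1, \<dots>, x n\<close>, with means of order \<open>1 / j\<close>, conditioned on \<open>1 * x 1 + \<dots> + n * x n = n\<close>.  The theorem
  is Strassen's functional law of the iterated logarithm for the independent variables, carried
  over to the conditioned ones.

  \<^item> \<^emph>\<open>Conditioning.\<close>  Poisson variables satisfy the size-bias identity
  \<open>E (x j * F x) = lam j * E (F (x + e j))\<close>, where \<open>e j\<close> is the \<open>j\<close>-th unit vector.  Applied to the
  weighted sum \<open>ell\<close>, it shows that the probability of \<open>ell = n\<close> is of exact order \<open>1 / n\<close>, that the
  point probabilities of \<open>ell\<close> over any block of indices are at most of this order, and that under
  the conditioning the indices up to \<open>\<rho> n\<close> rarely contribute more than \<open>n / 2\<close> to \<open>ell\<close>.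
  Hence an event which depends only on the counts up to \<open>\<rho> n\<close> has a conditional probability of at most
  \<open>\<eta>\<close> plus a constant times its unconditional probability (\<open>transfer\<close>).  The indices between \<open>\<rho> n\<close>
  and \<open>n\<close> are handled without any probabilistic estimate for the path: they carry a bounded
  number of components, these have distinct sizes with probability tending to one, and each of them moves the
  path by a term \<open>a j\<close>, which is small compared to \<open>\<beta>\<close>; nor does the variance change much on this
  range (\<open>far_imp_dist\<close>).

  \<^item> \<^emph>\<open>Reduction to bounded variables.\<close>  By the Borel-Cantelli argument only finitely many independent
  counts exceed one, so \<open>h j (x j)\<close> may be replaced by \<open>a j\<close> times the indicator of \<open>x j \<ge> 1\<close> at the
  expense of one random constant, which is negligible after the division by \<open>\<beta>\<close>
  (\<open>few_irregularities\<close>).  The centred indicators have the variances that add up to \<open>Bsq\<close>.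

  \<^item> \<^emph>\<open>The law for bounded variables, outer half\<close> (\<open>upper_LIL\<close>).  Cut the time axis of length \<open>V m\<close> into
  \<open>N\<close> blocks of equal variance.  If the vector of the normalised block increments lies in a slightly
  enlarged unit ball and the path oscillates little inside the blocks, then an interpolating polygon
  is a nearby element of the Strassen set.  The unit ball is controlled by finitely many directions;
  since the hypothesis on \<open>a\<close> makes the exponential moments Gaussian up to a factor close to one, each
  direction fails with probability at most \<open>exp (- (1 + \<delta>) * L m)\<close>.  This is summable along indices at
  which the variance doubles, and rescaling takes care of the indices between them.

  \<^item> \<^emph>\<open>Inner half\<close> (\<open>lower_LIL\<close>).  A matching lower bound for the exponential moments yields, by an
  exponential change of measure, that the block increments follow those of a given function with
  probability at least a constant times \<open>exp (- L m)\<close>.  Along indices at which the variance grows by a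
  large factor these events use disjoint sets of variables and their probabilities have a divergent sum.
  The first block, which is left out to get independence, is controlled by the outer half.

  \<^item> \<^emph>\<open>The Strassen set.\<close>  All these arguments see a function of the Strassen set only through its
  increments over a grid.  The bridge is \<open>strassen_set_iff_majorant\<close>: membership means that the
  squares of the increments are bounded by \<open>(t - s) * (H t - H s)\<close> for an increasing \<open>H\<close> of
  total increase at most one.  One direction is the Cauchy-Schwarz inequality for the
  derivative, the other one Fatou's lemma.  Both need that an absolutely continuous function is
  differentiable almost everywhere, which is derived from the Vitali covering theorem, and the first
  one also that it is the integral of its derivative.
\<close>


section \<open>Monotone functions are differentiable almost everywhere\<close>

text \<open>
  Peel off the rightmost interval: the remaining ones lie to the left of its left end.
\<close>

lemma sum_increments_le:
  fixes f :: "real \<Rightarrow> real"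
  assumes "finite D" "s \<le> t" "mono_on {s..t} f"
    and "\<And>x y. (x, y) \<in> D \<Longrightarrow> s \<le> x \<and> x \<le> y \<and> y \<le> t"
    and "disjoint_family_on (\<lambda>(x, y). {x<..<y}) D"
  shows "(\<Sum>(x, y)\<in>D. f y - f x) \<le> f t - f s"
  using assms
proof (induction "card D" arbitrary: D t rule: less_induct)
  case less
  show ?case
  proof (cases "D = {}")
    case True
    then show ?thesis using less.prems by (auto simp: monotone_on_def)
  next
    case False
    have "Max (fst ` D) \<in> fst ` D" using False less.prems by (intro Max_in) auto
    then obtain x0 y0' where x0: "(x0, y0') \<in> D" "x0 = Max (fst ` D)" by force
    have xle: "x \<le> x0" if "(x, y) \<in> D" for x y
      using less.prems that by (force simp: x0(2) intro!: Max_ge)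
    have sx: "s \<le> x0" "x0 \<le> t" using less.prems(4)[OF x0(1)] by auto
    show ?thesis
    proof (cases "\<exists>y. (x0, y) \<in> D \<and> x0 < y")
      case True
      then obtain y0 where y0: "(x0, y0) \<in> D" "x0 < y0" by auto
      have yt: "y0 \<le> t" using less.prems(4)[OF y0(1)] by auto
      have yle: "y \<le> x0" if "(x, y) \<in> D - {(x0, y0)}" for x y
      proof (rule ccontr)
        assume "\<not> y \<le> x0"
        then have "min y y0 > x0" using y0 by auto
        then obtain z where z: "x0 < z" "z < min y y0" using dense by blast
        have "disjnt {x<..<y} {x0<..<y0}"
          using less.prems(5) that y0 unfolding disjoint_family_on_def disjnt_def by fastforce
        moreover have "z \<in> {x<..<y}" "z \<in> {x0<..<y0}"
          using z xle[of x y] that by auto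
        ultimately show False by (auto simp: disjnt_def)
      qed
      have "(\<Sum>(x, y)\<in>D - {(x0, y0)}. f y - f x) \<le> f x0 - f s"
      proof (rule less.hyps)
        show "card (D - {(x0, y0)}) < card D" using y0 less.prems by (intro card_Diff1_less) auto
        show "mono_on {s..x0} f" using less.prems(3) sx by (auto simp: monotone_on_def)
        show "disjoint_family_on (\<lambda>(x, y). {x<..<y}) (D - {(x0, y0)})"
          using less.prems(5) by (auto simp: disjoint_family_on_def)
      qed (use less.prems sx yle in auto)
      moreover have "(\<Sum>(x, y)\<in>D. f y - f x) = (f y0 - f x0) + (\<Sum>(x, y)\<in>D - {(x0, y0)}. f y - f x)"
        using y0 less.prems by (subst sum.remove[of _ "(x0, y0)"]) auto
      moreover have "f y0 \<le> f t" using less.prems(3) yt y0 sx by (auto simp: monotone_on_def)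
      ultimately show ?thesis by linarith
    next
      case False
      then have eq: "y0' = x0" using x0 less.prems(4)[OF x0(1)] by force
      have "(\<Sum>(x, y)\<in>D - {(x0, y0')}. f y - f x) \<le> f t - f s"
      proof (rule less.hyps)
        show "card (D - {(x0, y0')}) < card D" using x0(1) less.prems by (intro card_Diff1_less) auto
        show "disjoint_family_on (\<lambda>(x, y). {x<..<y}) (D - {(x0, y0')})"
          using less.prems(5) by (auto simp: disjoint_family_on_def)
      qed (use less.prems in auto)
      moreover have "(\<Sum>(x, y)\<in>D. f y - f x) = (f y0' - f x0) + (\<Sum>(x, y)\<in>D - {(x0, y0')}. f y - f x)"
        using x0(1) less.prems by (subst sum.remove[of _ "(x0, y0')"]) auto
      ultimately show ?thesis using eq by simp
    qed
  qed
qed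

text \<open>
  The covering theorem for balls, in the language of pairs of end points; the predicate \<open>P\<close> is later
  a bound for the slope of a function over the interval.
\<close>

lemma Vitali_intervals:
  fixes S G :: "real set"
  assumes "open G" "S \<subseteq> G"
    and fine: "\<And>x d. x \<in> S \<Longrightarrow> 0 < d \<Longrightarrow> \<exists>u v. u \<le> x \<and> x \<le> v \<and> u < v \<and> v - u < d \<and> P u v"
  obtains C where "countable C" "\<forall>(u, v)\<in>C. u < v \<and> P u v \<and> {u..v} \<subseteq> G"
    "disjoint_family_on (\<lambda>(u, v). {u..v}) C"
    "negligible (S - (\<Union>(u, v)\<in>C. {u..v}))"
proof -
  (* an interval is the ball around its midpoint *)
  let ?a = "\<lambda>(u, v). (u + v) / 2 :: real" and ?r = "\<lambda>(u, v). (v - u) / 2 :: real"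
  have cb: "cball (?a i) (?r i) = (case i of (u, v) \<Rightarrow> {u..v})" for i
    by (auto simp: cball_eq_atLeastAtMost field_simps split: prod.splits)
  let ?K = "{(u, v). u < v \<and> P u v \<and> {u..v} \<subseteq> G}"
  have fn: "\<exists>i. i \<in> ?K \<and> x \<in> cball (?a i) (?r i) \<and> ?r i < d" if xS: "x \<in> S" and d0: "0 < d" for x d
  proof -
    obtain e where e: "e > 0" "ball x e \<subseteq> G"
      using assms \<open>x \<in> S\<close> by (meson open_contains_ball subsetD)
    obtain u v where uv: "u \<le> x" "x \<le> v" "u < v" "v - u < min d e" "P u v"
      using fine[OF xS, of "min d e"] e(1) d0 by auto
    have "{u..v} \<subseteq> ball x e" using uv by (auto simp: dist_real_def abs_if)
    then have "(u, v) \<in> ?K" using uv e by auto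
    moreover have "x \<in> cball (?a (u, v)) (?r (u, v))" unfolding cb using uv by simp
    moreover have "?r (u, v) < d" using uv by simp
    ultimately show ?thesis by blast
  qed
  have pos: "0 < ?r i" if "i \<in> ?K" for i using that by (auto split: prod.splits)
  obtain C where C: "countable C" "C \<subseteq> ?K"
     "pairwise (\<lambda>i j. disjnt (cball (?a i) (?r i)) (cball (?a j) (?r j))) C"
     "negligible(S - (\<Union>i \<in> C. cball (?a i) (?r i)))"
    by (rule Vitali_covering_theorem_cballs[of ?K ?r S ?a, OF pos fn])
  have "disjoint_family_on (\<lambda>(u, v). {u..v}) C"
    using C(3) unfolding cb pairwise_def disjoint_family_on_def disjnt_def by blast
  then show ?thesis
    using C that[of C] unfolding cb by blast
qed

text \<open>
  Intervals that straddle \<open>x\<close>, rather than one-sided difference quotients, spare the four Dini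
  derivatives and are what a Vitali cover needs.  For a differentiable function the derivative is
  the threshold between the slopes for which the function is steep and those for which it is not.
\<close>

definition steep :: "(real \<Rightarrow> real) \<Rightarrow> real \<Rightarrow> real \<Rightarrow> bool" where
  "steep f q x \<longleftrightarrow> (\<forall>d>0. \<exists>u v. u \<le> x \<and> x \<le> v \<and> u < v \<and> v - u < d \<and> q * (v - u) < f v - f u)"

definition shallow :: "(real \<Rightarrow> real) \<Rightarrow> real \<Rightarrow> real \<Rightarrow> bool" where
  "shallow f p x \<longleftrightarrow> (\<forall>d>0. \<exists>u v. u \<le> x \<and> x \<le> v \<and> u < v \<and> v - u < d \<and> f v - f u < p * (v - u))"

lemma disjoint_family_on_open_intervals:
  "disjoint_family_on (\<lambda>(u, v). {u..v}) C \<Longrightarrow> disjoint_family_on (\<lambda>(u, v). {u<..<v}) (C :: (real \<times> real) set)"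
  unfolding disjoint_family_on_def by (fastforce simp: disjoint_iff)

lemma measure_disjoint_intervals:
  fixes F :: "(real \<times> real) set"
  assumes "finite F" "disjoint_family_on (\<lambda>(u, v). {u..v}) F" "\<And>u v. (u, v) \<in> F \<Longrightarrow> u \<le> v"
  shows "measure lebesgue (\<Union>(u, v)\<in>F. {u..v}) = (\<Sum>(u, v)\<in>F. v - u)"
proof -
  have "measure lebesgue (\<Union>(u, v)\<in>F. {u..v}) = (\<Sum>i\<in>F. measure lebesgue (case i of (u, v) \<Rightarrow> {u..v}))"
    using assms by (intro measure_finite_Union) (auto split: prod.splits)
  also have "\<dots> = (\<Sum>(u, v)\<in>F. v - u)" using assms(3) by (intro sum.cong) auto
  finally show ?thesis .
qed

lemma countable_intervals_lmeasurable:
  fixes C :: "(real \<times> real) set"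
  assumes "countable C" and F: "\<And>F. F \<subseteq> C \<Longrightarrow> finite F \<Longrightarrow> measure lebesgue (\<Union>(u, v)\<in>F. {u..v}) \<le> B"
  shows "(\<Union>(u, v)\<in>C. {u..v}) \<in> lmeasurable" "measure lebesgue (\<Union>(u, v)\<in>C. {u..v}) \<le> B"
proof -
  show "(\<Union>(u, v)\<in>C. {u..v}) \<in> lmeasurable"
    by (rule fmeasurable_UN_bound[OF assms(1) _ F]) (auto split: prod.splits)
  show "measure lebesgue (\<Union>(u, v)\<in>C. {u..v}) \<le> B"
    by (rule measure_UN_bound[OF assms(1) _ F]) (auto split: prod.splits)
qed

lemma negligible_countable_set: "countable S \<Longrightarrow> negligible (S :: real set)"
  using negligible_countable_Union[of "(\<lambda>x. {x}) ` S"] by auto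

lemma lmeasurable_outer_open_less:
  assumes "S \<in> lmeasurable" "e > 0"
  obtains T where "open T" "S \<subseteq> T" "T \<in> lmeasurable" "measure lebesgue T < measure lebesgue S + e"
proof -
  obtain T where T: "open T" "S \<subseteq> T" "T - S \<in> lmeasurable" "emeasure lebesgue (T - S) < ennreal e"
    using sets_lebesgue_outer_open[of S e] assms fmeasurableD by blast
  have eq: "T = S \<union> (T - S)" using T by auto
  have "T \<in> lmeasurable" by (subst eq) (intro fmeasurable.Un assms T)
  moreover have "measure lebesgue T \<le> measure lebesgue S + measure lebesgue (T - S)"
    using measure_Un_le[of S lebesgue "T - S"] assms T eq fmeasurableD by metis
  moreover have "measure lebesgue (T - S) < e"
    using T(3,4) assms(2) by (simp add: emeasure_eq_measure2 ennreal_less_iff)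
  ultimately show ?thesis using that T by force
qed

lemma lmeasurable_negligible_Un:
  assumes "U \<in> lmeasurable" "negligible N"
  shows "N \<union> U \<in> lmeasurable" "measure lebesgue (N \<union> U) = measure lebesgue U"
proof -
  show 1: "N \<union> U \<in> lmeasurable" using assms by (meson fmeasurable.Un negligible_imp_measurable)
  have "negligible (U - (N \<union> U) \<union> (N \<union> U - U))" by (rule negligible_subset[OF assms(2)]) auto
  then show "measure lebesgue (N \<union> U) = measure lebesgue U"
    using measure_negligible_symdiff[of U "N \<union> U"] assms by auto
qed

text \<open>
  A cover of the set by intervals with slopes above \<open>q\<close> has total length at most \<open>(f b - f a) / q\<close>,
  since the increments of \<open>f\<close> over disjoint intervals add up to at most \<open>f b - f a\<close>.
\<close>

lemma negligible_steep_inf: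
  fixes f :: "real \<Rightarrow> real"
  assumes "mono f" "a < b"
  shows "negligible {x \<in> {a<..<b}. \<forall>q. steep f q x}" (is "negligible ?S")
  unfolding negligible_outer_le
proof (intro allI impI)
  fix e :: real assume "e > 0"
  (* chosen such that the total length of a cover by intervals of slope q is below e *)
  define q where "q = (f b - f a + 1) / e"
  have q: "q > 0" using \<open>e > 0\<close> assms by (auto simp: q_def mono_def intro!: divide_pos_pos add_nonneg_pos)
  have fn: "\<exists>u v. u \<le> x \<and> x \<le> v \<and> u < v \<and> v - u < d \<and> q * (v - u) < f v - f u"
    if "x \<in> ?S" "0 < d" for x d
  proof -
    have "steep f q x" using that(1) by blast
    then show ?thesis using \<open>0 < d\<close> unfolding steep_def by blast
  qed
  have sub: "?S \<subseteq> {a<..<b}" by blast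
  obtain C where C: "countable C" "\<forall>(u, v)\<in>C. u < v \<and> q * (v - u) < f v - f u \<and> {u..v} \<subseteq> {a<..<b}"
    "disjoint_family_on (\<lambda>(u, v). {u..v}) C" "negligible (?S - (\<Union>(u, v)\<in>C. {u..v}))"
    by (rule Vitali_intervals[OF open_greaterThanLessThan sub fn])
  have C2: "u < v \<and> q * (v - u) < f v - f u \<and> {u..v} \<subseteq> {a<..<b}" if "(u, v) \<in> C" for u v
    using C(2) that by blast
  have B: "measure lebesgue (\<Union>(u, v)\<in>F. {u..v}) \<le> e" if F: "F \<subseteq> C" "finite F" for F
  proof -
    have dF: "disjoint_family_on (\<lambda>(u, v). {u..v}) F" using C(3) F(1) by (rule disjoint_family_on_mono[rotated])
    have uv: "a \<le> u \<and> u \<le> v \<and> v \<le> b" if "(u, v) \<in> F" for u v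
    proof -
      have "u < v" "{u..v} \<subseteq> {a<..<b}" using C2[of u v] F that by auto
      then have "u \<in> {a<..<b}" "v \<in> {a<..<b}" by (auto simp: subset_eq)
      then show ?thesis using \<open>u < v\<close> by auto
    qed
    have "q * (\<Sum>(u, v)\<in>F. v - u) \<le> (\<Sum>(u, v)\<in>F. f v - f u)"
      unfolding sum_distrib_left using C2 F by (intro sum_mono) (auto simp: less_imp_le)
    also have "\<dots> \<le> f b - f a"
      using sum_increments_le[of F a b f] F assms uv disjoint_family_on_open_intervals[OF dF]
      by (auto simp: mono_on_def mono_def)
    finally have "(\<Sum>(u, v)\<in>F. v - u) \<le> (f b - f a) / q" using q by (simp add: field_simps)
    also have "\<dots> \<le> e"
    proof -
      have "f b - f a \<le> e * q" using \<open>e > 0\<close> by (simp add: q_def)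
      then show ?thesis using q by (simp add: field_simps)
    qed
    finally show ?thesis using measure_disjoint_intervals[OF F(2) dF] uv by auto
  qed
  let ?N = "?S - (\<Union>(u, v)\<in>C. {u..v})" and ?U = "\<Union>(u, v)\<in>C. {u..v}"
  have U: "?U \<in> lmeasurable" "measure lebesgue ?U \<le> e"
    using countable_intervals_lmeasurable[OF C(1) B] by auto
  have "measure lebesgue (?N \<union> ?U) = measure lebesgue ?U"
    using lmeasurable_negligible_Un[OF U(1) C(4)] by blast
  moreover have "?N \<union> ?U \<in> lmeasurable"
    using lmeasurable_negligible_Un[OF U(1) C(4)] by blast
  ultimately show "\<exists>T. ?S \<subseteq> T \<and> T \<in> lmeasurable \<and> measure lebesgue T \<le> e"
    using U(2) by (intro exI[of _ "?N \<union> ?U"]) auto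
qed

lemma sum_increments_refine:
  fixes f :: "real \<Rightarrow> real"
  assumes "mono f" "finite F" "disjoint_family_on (\<lambda>(u, v). {u..v}) F"
    "\<And>u v. (u, v) \<in> F \<Longrightarrow> u \<le> v"
    "finite I" "\<And>s t. (s, t) \<in> I \<Longrightarrow> s \<le> t"
    "\<And>u v. (u, v) \<in> F \<Longrightarrow> \<exists>(s, t)\<in>I. s \<le> u \<and> v \<le> t"
  shows "(\<Sum>(u, v)\<in>F. f v - f u) \<le> (\<Sum>(s, t)\<in>I. f t - f s)"
proof -
  obtain \<iota> where \<iota>: "\<And>i. i \<in> F \<Longrightarrow> \<iota> i \<in> I \<and> fst (\<iota> i) \<le> fst i \<and> snd i \<le> snd (\<iota> i)"
    using bchoice[of F "\<lambda>i j. j \<in> I \<and> fst j \<le> fst i \<and> snd i \<le> snd j"] assms(7) by fastforce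
  have "(\<Sum>(u, v)\<in>F. f v - f u) = (\<Sum>j\<in>I. \<Sum>(u, v)\<in>{i\<in>F. \<iota> i = j}. f v - f u)"
    by (rule sum.group[symmetric]) (use assms \<iota> in auto)
  also have "\<dots> \<le> (\<Sum>(s, t)\<in>I. f t - f s)"
  proof (rule sum_mono)
    fix j assume "j \<in> I"
    obtain s t where j: "j = (s, t)" by force
    have "(\<Sum>(u, v)\<in>{i\<in>F. \<iota> i = j}. f v - f u) \<le> f t - f s"
    proof (rule sum_increments_le)
      show "disjoint_family_on (\<lambda>(x, y). {x<..<y}) {i \<in> F. \<iota> i = j}"
        using disjoint_family_on_open_intervals[OF assms(3)] by (auto simp: disjoint_family_on_def)
      show "s \<le> x \<and> x \<le> y \<and> y \<le> t" if "(x, y) \<in> {i \<in> F. \<iota> i = j}" for x y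
        using \<iota>[of "(x, y)"] that assms(4) j by force
    qed (use assms \<open>j \<in> I\<close> j in \<open>auto simp: mono_on_def mono_def\<close>)
    then show "(\<Sum>(u, v)\<in>{i\<in>F. \<iota> i = j}. f v - f u) \<le> (case j of (s, t) \<Rightarrow> f t - f s)"
      using j by simp
  qed
  finally show ?thesis .
qed

text \<open>
  Let \<open>m\<close> be the outer measure of the set.  A Vitali cover of the set by shallow intervals, inside an
  open set of measure close to \<open>m\<close>, gains at most \<open>p * m\<close> in height.  A second Vitali cover, by steep
  intervals inside the shallow ones, gains at least \<open>q * m\<close>.  Hence \<open>q * m \<le> p * m\<close>, so \<open>m = 0\<close>.
\<close>

lemma negligible_shallow_steep:
  fixes f :: "real \<Rightarrow> real"
  assumes f: "mono f" and pq: "0 < p" "p < q"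
  shows "negligible {x \<in> {a<..<b}. shallow f p x \<and> steep f q x}" (is "negligible ?E")
proof -
  define \<M> where "\<M> = {measure lebesgue G | G. open G \<and> ?E \<subseteq> G \<and> G \<subseteq> {a<..<b}}"
  define m where "m = Inf \<M>"
  have ne: "\<M> \<noteq> {}"
  proof -
    have "measure lebesgue {a<..<b} \<in> \<M>" unfolding \<M>_def
      by (intro CollectI exI[of _ "{a<..<b}"] conjI refl open_greaterThanLessThan) auto
    then show ?thesis by blast
  qed
  have bb: "bdd_below \<M>" unfolding \<M>_def by (rule bdd_belowI[of _ 0]) auto
  have m0: "m \<ge> 0" unfolding m_def using ne by (rule cInf_greatest) (auto simp: \<M>_def)
  (* the comparison of the two covers, with an error e for the outer regularity of the measure *)
  have key: "m \<le> p * (m + e) / q + e" if "e > 0" for e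
  proof -
    have "\<exists>x\<in>\<M>. x < m + e"
      using cInf_lessD[OF ne, of "m + e"] that by (auto simp: m_def)
    then obtain G where G: "open G" "?E \<subseteq> G" "G \<subseteq> {a<..<b}" "measure lebesgue G < m + e"
      by (auto simp: \<M>_def)
    have Gm: "G \<in> lmeasurable"
      using G(1,3) by (intro lmeasurable_open bounded_subset[OF bounded_closed_interval[of a b]]) force+
    have fn1: "\<exists>u v. u \<le> x \<and> x \<le> v \<and> u < v \<and> v - u < d \<and> f v - f u < p * (v - u)"
      if "x \<in> ?E" "0 < d" for x d
    proof -
      have "shallow f p x" using that(1) by blast
      then show ?thesis using \<open>0 < d\<close> unfolding shallow_def by blast
    qed
    obtain C where C: "countable C" "\<forall>(u, v)\<in>C. u < v \<and> f v - f u < p * (v - u) \<and> {u..v} \<subseteq> G"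
      "disjoint_family_on (\<lambda>(u, v). {u..v}) C" "negligible (?E - (\<Union>(u, v)\<in>C. {u..v}))"
      by (rule Vitali_intervals[OF G(1,2) fn1])
    have C2: "u < v \<and> f v - f u < p * (v - u) \<and> {u..v} \<subseteq> G" if "(u, v) \<in> C" for u v
      using C(2) that by blast
    let ?O = "\<Union>(u, v)\<in>C. {u<..<v}"
    let ?P = "\<lambda>u v. q * (v - u) < f v - f u \<and> (\<exists>(s, t)\<in>C. s \<le> u \<and> v \<le> t)"
    have fn2: "\<exists>u v. u \<le> x \<and> x \<le> v \<and> u < v \<and> v - u < d \<and> ?P u v"
      if x: "x \<in> ?E \<inter> ?O" and d: "0 < d" for x d
    proof -
      obtain s t where st: "(s, t) \<in> C" "s < x" "x < t" using x by auto
      define d' where "d' = min d (min (x - s) (t - x))"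
      have "d' > 0" using d st by (auto simp: d'_def)
      moreover have "steep f q x" using x by blast
      ultimately obtain u v where uv: "u \<le> x" "x \<le> v" "u < v" "v - u < d'" "q * (v - u) < f v - f u"
        unfolding steep_def by blast
      have "v - u < d" "s \<le> u" "v \<le> t" using uv by (auto simp: d'_def)
      then show ?thesis using st(1) uv by blast
    qed
    have opO: "open ?O" by (intro open_UN) auto
    have subO: "?E \<inter> ?O \<subseteq> ?O" by (rule Int_lower2)
    obtain D where D: "countable D" "\<forall>(u, v)\<in>D. u < v \<and> ?P u v \<and> {u..v} \<subseteq> ?O"
      "disjoint_family_on (\<lambda>(u, v). {u..v}) D" "negligible (?E \<inter> ?O - (\<Union>(u, v)\<in>D. {u..v}))"
      by (rule Vitali_intervals[OF opO subO fn2])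
    have D2: "u < v \<and> ?P u v \<and> {u..v} \<subseteq> ?O" if "(u, v) \<in> D" for u v
      using D(2) that by blast
    have B: "measure lebesgue (\<Union>(u, v)\<in>F. {u..v}) \<le> p * (m + e) / q" if F: "F \<subseteq> D" "finite F" for F
    proof -
      have dF: "disjoint_family_on (\<lambda>(u, v). {u..v}) F" using D(3) F(1) by (rule disjoint_family_on_mono[rotated])
      obtain \<iota> where \<iota>: "\<And>i. i \<in> F \<Longrightarrow> \<iota> i \<in> C \<and> fst (\<iota> i) \<le> fst i \<and> snd i \<le> snd (\<iota> i)"
        using bchoice[of F "\<lambda>i j. j \<in> C \<and> fst j \<le> fst i \<and> snd i \<le> snd j"] D2 F by fastforce
      let ?I = "\<iota> ` F"
      have I: "?I \<subseteq> C" "finite ?I" using \<iota> F by auto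
      have dI: "disjoint_family_on (\<lambda>(u, v). {u..v}) ?I" using C(3) I(1) by (rule disjoint_family_on_mono[rotated])
      have "q * (\<Sum>(u, v)\<in>F. v - u) \<le> (\<Sum>(u, v)\<in>F. f v - f u)"
        unfolding sum_distrib_left using D2 F by (intro sum_mono) (auto simp: less_imp_le)
      also have "\<dots> \<le> (\<Sum>(s, t)\<in>?I. f t - f s)"
      proof (rule sum_increments_refine[OF f F(2) dF])
        show "\<exists>(s, t)\<in>?I. s \<le> u \<and> v \<le> t" if "(u, v) \<in> F" for u v
          using \<iota>[of "(u, v)"] that by (intro bexI[of _ "\<iota> (u, v)"]) (auto simp: split_beta)
        show "s \<le> t" if "(s, t) \<in> ?I" for s t using C2[of s t] I that by auto
        show "u \<le> v" if "(u, v) \<in> F" for u v using D2[of u v] F that by auto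
      qed (use I in auto)
      also have "\<dots> \<le> (\<Sum>(s, t)\<in>?I. p * (t - s))"
        using C2 I by (intro sum_mono) (auto simp: less_imp_le)
      also have "\<dots> = p * measure lebesgue (\<Union>(u, v)\<in>?I. {u..v})"
        by (subst measure_disjoint_intervals) (use I dI C2 in \<open>auto simp: sum_distrib_left split_beta less_imp_le\<close>)
      also have "\<dots> \<le> p * measure lebesgue G"
      proof (intro mult_left_mono measure_mono_fmeasurable)
        show "(\<Union>(u, v)\<in>?I. {u..v}) \<subseteq> G" using C2 I by fast
        show "(\<Union>(u, v)\<in>?I. {u..v}) \<in> sets lebesgue"
          using I by (intro sets.finite_UN) auto
      qed (use Gm pq in auto)
      also have "\<dots> \<le> p * (m + e)" using G pq by (intro mult_left_mono) auto
      finally have "(\<Sum>(u, v)\<in>F. v - u) \<le> p * (m + e) / q" using pq by (simp add: field_simps)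
      moreover have "u \<le> v" if "(u, v) \<in> F" for u v using D2[of u v] F that by auto
      ultimately show ?thesis using measure_disjoint_intervals[OF F(2) dF] by auto
    qed
    let ?U = "\<Union>(u, v)\<in>D. {u..v}"
    have U: "?U \<in> lmeasurable" "measure lebesgue ?U \<le> p * (m + e) / q"
      using countable_intervals_lmeasurable[OF D(1) B] by auto
    have "negligible (?E - ?U)"
    proof (rule negligible_subset)
      let ?Z = "fst ` C \<union> snd ` C"
      show "negligible ((?E - (\<Union>(u, v)\<in>C. {u..v})) \<union> (?E \<inter> ?O - ?U) \<union> ?Z)"
        using C D by (intro negligible_Un) (auto intro!: negligible_countable_set)
      show "?E - ?U \<subseteq> (?E - (\<Union>(u, v)\<in>C. {u..v})) \<union> (?E \<inter> ?O - ?U) \<union> ?Z"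
      proof
        fix x assume x: "x \<in> ?E - ?U"
        show "x \<in> (?E - (\<Union>(u, v)\<in>C. {u..v})) \<union> (?E \<inter> ?O - ?U) \<union> ?Z"
        proof (cases "x \<in> (\<Union>(u, v)\<in>C. {u..v})")
          case True
          then obtain u v where uv: "(u, v) \<in> C" "u \<le> x" "x \<le> v" by auto
          then have "x \<in> ?Z \<or> x \<in> ?O" by (force simp: less_le)
          then show ?thesis using x by blast
        qed (use x in blast)
      qed
    qed
    let ?N = "?E - ?U"
    have meq: "measure lebesgue (?N \<union> ?U) = measure lebesgue ?U"
      using lmeasurable_negligible_Un[OF U(1) \<open>negligible ?N\<close>] by blast
    have NU: "?N \<union> ?U \<in> lmeasurable"
      using lmeasurable_negligible_Un[OF U(1) \<open>negligible ?N\<close>] by blast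
    obtain T where T: "open T" "?N \<union> ?U \<subseteq> T" "T \<in> lmeasurable" "measure lebesgue T < measure lebesgue (?N \<union> ?U) + e"
      using lmeasurable_outer_open_less[OF NU \<open>e > 0\<close>]
      by blast
    have "?E \<subseteq> T" using T(2) by blast
    then have "measure lebesgue (T \<inter> {a<..<b}) \<in> \<M>" unfolding \<M>_def
      by (intro CollectI exI[of _ "T \<inter> {a<..<b}"] conjI refl open_Int[OF T(1)] open_greaterThanLessThan) blast+
    then have "m \<le> measure lebesgue (T \<inter> {a<..<b})" unfolding m_def using bb by (rule cInf_lower)
    also have "\<dots> \<le> measure lebesgue T" using T by (intro measure_mono_fmeasurable) auto
    finally show ?thesis using T meq U by linarith
  qed
  have "m \<le> p * m / q"
  proof (rule field_le_epsilon)
    fix e :: real assume "e > 0"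
    have "m \<le> p * (m + e / 2) / q + e / 2" using key[of "e / 2"] \<open>e > 0\<close> by simp
    also have "\<dots> = p * m / q + (p / q) * (e / 2) + e / 2" by (simp add: distrib_left add_divide_distrib)
    also have "(p / q) * (e / 2) \<le> 1 * (e / 2)" using pq \<open>e > 0\<close> by (intro mult_right_mono) auto
    finally show "m \<le> p * m / q + e" by simp
  qed
  then have "m * (q - p) \<le> 0" using pq by (simp add: field_simps)
  then have "m \<le> 0" using pq by (simp add: mult_le_0_iff)
  with m0 have "m = 0" by simp
  show ?thesis unfolding negligible_outer
  proof (intro allI impI)
    fix e :: real assume "e > 0"
    then have "\<exists>x\<in>\<M>. x < e"
      using cInf_lessD[OF ne, of "e"] \<open>m = 0\<close> by (auto simp: m_def)
    then obtain G where G: "open G" "?E \<subseteq> G" "G \<subseteq> {a<..<b}" "measure lebesgue G < e"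
      by (auto simp: \<M>_def)
    then have "G \<in> lmeasurable"
      by (intro lmeasurable_open bounded_subset[OF bounded_closed_interval[of a b]]) force+
    with G show "\<exists>T. ?E \<subseteq> T \<and> T \<in> lmeasurable \<and> measure lebesgue T < e" by blast
  qed
qed

text \<open>
  If \<open>f\<close> is not steep at \<open>x\<close> for some finite slope, the infimum \<open>L\<close> of the slopes for which it is not
  steep is finite, and unless \<open>f\<close> is differentiable with derivative \<open>L\<close> there are rational \<open>p < q\<close> such
  that \<open>f\<close> is both shallow for \<open>p\<close> and steep for \<open>q\<close> at \<open>x\<close>.
\<close>

lemma mono_differentiable_ae:
  fixes f :: "real \<Rightarrow> real"
  assumes f: "mono f" and "a < b"
  shows "negligible {x \<in> {a<..<b}. \<not> f differentiable (at x)}"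
proof (rule negligible_subset)
  (* the rationals make the exceptional set a countable union *)
  let ?A = "\<lambda>r::rat \<times> rat. if 0 < fst r \<and> fst r < snd r
     then {x \<in> {a<..<b}. shallow f (of_rat (fst r)) x \<and> steep f (of_rat (snd r)) x} else {}"
  let ?N = "{x \<in> {a<..<b}. \<forall>q. steep f q x} \<union> \<Union>(range ?A)"
  have negA: "negligible (?A r)" for r
    using negligible_shallow_steep[OF f, of "of_rat (fst r)" "of_rat (snd r)" a b] by (auto simp: of_rat_less)
  then show "negligible ?N"
    using negA by (intro negligible_Un negligible_steep_inf assms negligible_countable_Union) blast+
  show "{x \<in> {a<..<b}. \<not> f differentiable (at x)} \<subseteq> ?N"
  proof safe
    fix x assume x: "x \<in> {a<..<b}" and nd: "\<not> f differentiable (at x)" and nA: "x \<notin> \<Union>(range ?A)"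
    fix q0
    show "steep f q0 x"
    proof (rule ccontr)
      assume q0: "\<not> steep f q0 x"
      define Q where "Q = {q. \<not> steep f q x}"
      have ge0: "0 \<le> q" if "q \<in> Q" for q
      proof (rule ccontr)
        assume "\<not> 0 \<le> q"
        have "steep f q x" unfolding steep_def
        proof (intro allI impI)
          fix d :: real assume "d > 0"
          have "q * (d / 2) < 0" using \<open>\<not> 0 \<le> q\<close> \<open>d > 0\<close> by (intro mult_neg_pos) auto
          also have "0 \<le> f (x + d / 2) - f x" using f \<open>d > 0\<close> by (simp add: mono_def)
          finally show "\<exists>u v. u \<le> x \<and> x \<le> v \<and> u < v \<and> v - u < d \<and> q * (v - u) < f v - f u"
            using \<open>d > 0\<close> by (intro exI[of _ x] exI[of _ "x + d / 2"]) auto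
        qed
        then show False using that by (simp add: Q_def)
      qed
      have ne: "Q \<noteq> {}" using q0 by (auto simp: Q_def)
      have bb: "bdd_below Q" using ge0 by (intro bdd_belowI[of _ 0]) auto
      define L where "L = Inf Q"
      have up: "\<exists>d>0. \<forall>u v. u \<le> x \<and> x \<le> v \<and> u < v \<and> v - u < d \<longrightarrow> f v - f u \<le> (L + e) * (v - u)" if "e > 0" for e
      proof -
        obtain q where q: "q \<in> Q" "q < L + e"
          using cInf_lessD[OF ne, of "L + e"] \<open>e > 0\<close> by (auto simp: L_def)
        then have "\<not> steep f q x" by (simp add: Q_def)
        then obtain d where d1: "d > 0" "\<not> (\<exists>u v. u \<le> x \<and> x \<le> v \<and> u < v \<and> v - u < d \<and> q * (v - u) < f v - f u)"
          unfolding steep_def by blast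
        have d: "d > 0" "\<And>u v. u \<le> x \<Longrightarrow> x \<le> v \<Longrightarrow> u < v \<Longrightarrow> v - u < d \<Longrightarrow> f v - f u \<le> q * (v - u)"
          using d1 by force+
        have "f v - f u \<le> (L + e) * (v - u)" if "u \<le> x" "x \<le> v" "u < v" "v - u < d" for u v
        proof -
          have "q * (v - u) \<le> (L + e) * (v - u)" using q(2) that(3) by (intro mult_right_mono) auto
          then show ?thesis using d(2)[OF that] by linarith
        qed
        then show ?thesis using d(1) by blast
      qed
      have lo: "\<exists>d>0. \<forall>u v. u \<le> x \<and> x \<le> v \<and> u < v \<and> v - u < d \<longrightarrow> (L - e) * (v - u) \<le> f v - f u" if "e > 0" for e
      proof (rule ccontr)
        assume H: "\<not> ?thesis"
        have sh: "shallow f (L - e) x" unfolding shallow_def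
        proof (intro allI impI)
          fix d :: real assume "d > 0"
          with H have "\<not> (\<forall>u v. u \<le> x \<and> x \<le> v \<and> u < v \<and> v - u < d \<longrightarrow> (L - e) * (v - u) \<le> f v - f u)" by blast
          then show "\<exists>u v. u \<le> x \<and> x \<le> v \<and> u < v \<and> v - u < d \<and> f v - f u < (L - e) * (v - u)"
            unfolding not_all not_imp not_le by blast
        qed
        then obtain u v where "u < v" "f v - f u < (L - e) * (v - u)"
          unfolding shallow_def using zero_less_one by blast
        moreover have "0 \<le> f v - f u" using f \<open>u < v\<close> by (simp add: mono_def)
        ultimately have "0 < (L - e) * (v - u)" by linarith
        then have Le: "0 < L - e" using \<open>u < v\<close> by (simp add: zero_less_mult_iff)
        obtain p where p: "L - e < of_rat p" "of_rat p < L" using of_rat_dense[of "L - e" L] \<open>e > 0\<close> by auto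
        obtain q where q: "of_rat p < (of_rat q :: real)" "of_rat q < L" using of_rat_dense[OF p(2)] by auto
        have "shallow f (of_rat p) x" unfolding shallow_def
        proof (intro allI impI)
          fix d :: real assume "d > 0"
          then obtain u v where uv: "u \<le> x" "x \<le> v" "u < v" "v - u < d" "f v - f u < (L - e) * (v - u)"
            using sh unfolding shallow_def by blast
          have "(L - e) * (v - u) \<le> of_rat p * (v - u)" using p uv by (intro mult_right_mono) auto
          then have "f v - f u < of_rat p * (v - u)" using uv(5) by linarith
          then show "\<exists>u v. u \<le> x \<and> x \<le> v \<and> u < v \<and> v - u < d \<and> f v - f u < of_rat p * (v - u)"
            using uv by blast
        qed
        moreover have pq: "0 < p" "p < q"
        proof -
          have "0 < (of_rat p :: real)" using Le p by linarith
          then show "0 < p" by simp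
          show "p < q" using q(1) by (simp add: of_rat_less)
        qed
        moreover have "x \<notin> ?A (p, q)" using nA by blast
        ultimately have "\<not> steep f (of_rat q) x" using x by auto
        then have "L \<le> of_rat q" unfolding L_def using bb by (intro cInf_lower) (auto simp: Q_def)
        then show False using q by simp
      qed
      have "(f has_real_derivative L) (at x)"
        unfolding has_field_derivative_iff LIM_eq
      proof (intro allI impI)
        fix e :: real assume "e > 0"
        obtain d1 where d1: "d1 > 0" "\<And>u v. u \<le> x \<Longrightarrow> x \<le> v \<Longrightarrow> u < v \<Longrightarrow> v - u < d1 \<Longrightarrow> f v - f u \<le> (L + e / 2) * (v - u)"
          using up[of "e / 2"] \<open>e > 0\<close> by auto
        obtain d2 where d2: "d2 > 0" "\<And>u v. u \<le> x \<Longrightarrow> x \<le> v \<Longrightarrow> u < v \<Longrightarrow> v - u < d2 \<Longrightarrow> (L - e / 2) * (v - u) \<le> f v - f u"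
          using lo[of "e / 2"] \<open>e > 0\<close> by auto
        have slope: "norm ((f v - f u) / (v - u) - L) < e"
          if uv: "u \<le> x" "x \<le> v" "u < v" "v - u < min d1 d2" for u v
        proof -
          have "(f v - f u) / (v - u) \<le> L + e / 2" using d1(2)[of u v] uv by (simp add: pos_divide_le_eq)
          moreover have "L - e / 2 \<le> (f v - f u) / (v - u)" using d2(2)[of u v] uv by (simp add: pos_le_divide_eq)
          ultimately show ?thesis using \<open>e > 0\<close> by (simp add: abs_if)
        qed
        have "norm ((f y - f x) / (y - x) - L) < e" if "y \<noteq> x" "norm (y - x) < min d1 d2" for y
        proof (cases "y > x")
          case True then show ?thesis using slope[of x y] that by auto
        next
          case False
          then have "norm ((f x - f y) / (x - y) - L) < e" using slope[of y x] that by auto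
          moreover have "(f x - f y) / (x - y) = (f y - f x) / (y - x)" using that(1) by (simp add: divide_simps) argo
          ultimately show ?thesis by simp
        qed
        then show "\<exists>s>0. \<forall>xa. xa \<noteq> x \<and> norm (xa - x) < s \<longrightarrow> norm ((f xa - f x) / (xa - x) - L) < e"
          using d1(1) d2(1) by (intro exI[of _ "min d1 d2"]) auto
      qed
      then show False using nd real_differentiable_def by blast
    qed
  qed
qed


section \<open>Absolutely continuous functions are integrals of their derivatives\<close>

lemma abs_continuous_onD:
  assumes "abs_continuous_on a b g" "e > 0"
  obtains d where "d > 0" "\<And>D. finite D \<Longrightarrow> (\<And>x y. (x, y) \<in> D \<Longrightarrow> a \<le> x \<and> x \<le> y \<and> y \<le> b) \<Longrightarrow>
    disjoint_family_on (\<lambda>(x, y). {x<..<y}) D \<Longrightarrow> (\<Sum>(x, y)\<in>D. y - x) < d \<Longrightarrow>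
    (\<Sum>(x, y)\<in>D. \<bar>g y - g x\<bar>) < e"
proof -
  obtain d where d: "d > 0" "\<forall>D :: (real \<times> real) set.
        finite D \<and> (\<forall>(x, y)\<in>D. a \<le> x \<and> x \<le> y \<and> y \<le> b) \<and>
        disjoint_family_on (\<lambda>(x, y). {x<..<y}) D \<and> (\<Sum>(x, y)\<in>D. y - x) < d
        \<longrightarrow> (\<Sum>(x, y)\<in>D. \<bar>g y - g x\<bar>) < e"
    using assms unfolding abs_continuous_on_def by meson
  show ?thesis by (rule that[OF d(1)]) (use d(2) in blast)
qed

text \<open>
  The witness is the variation of \<open>g\<close> on \<open>[s, x]\<close> as a function of \<open>x\<close>.
\<close>

lemma variation_function:
  fixes g :: "real \<Rightarrow> real"
  assumes "s \<le> t"
    and bd: "\<And>D. finite D \<Longrightarrow> (\<And>x y. (x, y) \<in> D \<Longrightarrow> s \<le> x \<and> x \<le> y \<and> y \<le> t) \<Longrightarrow>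
      disjoint_family_on (\<lambda>(x, y). {x<..<y}) D \<Longrightarrow> (\<Sum>(x, y)\<in>D. \<bar>g y - g x\<bar>) \<le> c"
  obtains V where "\<And>x y. s \<le> x \<Longrightarrow> x \<le> y \<Longrightarrow> y \<le> t \<Longrightarrow> \<bar>g y - g x\<bar> \<le> V y - V x"
proof -
  define \<D> where "\<D> = (\<lambda>z. {D. finite D \<and> (\<forall>(x, y)\<in>D. s \<le> x \<and> x \<le> y \<and> y \<le> z) \<and>
     disjoint_family_on (\<lambda>(x, y). {x<..<y}) D})"
  define v where "v = (\<lambda>D. \<Sum>(x, y)\<in>D. \<bar>g y - g x\<bar>)"
  define V where "V = (\<lambda>z. Sup (v ` \<D> z))"
  have "{} \<in> \<D> z" for z by (auto simp: \<D>_def disjoint_family_on_def)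
  then have ne: "v ` \<D> z \<noteq> {}" for z by blast
  have bb: "bdd_above (v ` \<D> z)" if "z \<le> t" for z
  proof (rule bdd_aboveI2)
    fix D assume "D \<in> \<D> z"
    then have "(\<Sum>(x, y)\<in>D. \<bar>g y - g x\<bar>) \<le> c"
      using that by (intro bd) (auto simp: \<D>_def)
    then show "v D \<le> c" by (simp add: v_def)
  qed
  have "\<bar>g y - g x\<bar> \<le> V y - V x" if xy: "s \<le> x" "x \<le> y" "y \<le> t" for x y
  proof (cases "x = y")
    case False
    have "V x \<le> V y - \<bar>g y - g x\<bar>"
      unfolding V_def
    proof (rule cSup_least[OF ne], safe)
      fix D assume D: "D \<in> \<D> x"
      let ?D = "insert (x, y) D"
      have nin: "(x, y) \<notin> D" using D False xy by (auto simp: \<D>_def)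
      have "{u<..<w} \<inter> {x<..<y} = {}" if "(u, w) \<in> D" for u w
        using D that by (fastforce simp: \<D>_def)
      then have "disjoint_family_on (\<lambda>(x, y). {x<..<y}) ?D"
        using D unfolding disjoint_family_on_insert[OF nin] by (fastforce simp: \<D>_def)
      then have "?D \<in> \<D> y" using D xy by (fastforce simp: \<D>_def)
      then have "v ?D \<le> Sup (v ` \<D> y)" using bb[OF xy(3)] by (intro cSup_upper) auto
      moreover have "v ?D = \<bar>g y - g x\<bar> + v D" using D nin by (simp add: v_def \<D>_def)
      ultimately show "v D \<le> Sup (v ` \<D> y) - \<bar>g y - g x\<bar>" by simp
    qed
    then show ?thesis by simp
  qed auto
  then show ?thesis by (rule that)
qed

text \<open>
  Jordan decomposition: \<open>V + g\<close> and \<open>V - g\<close> are monotone.  Clamping the argument to \<open>[s, t]\<close> makes them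
  monotone on the whole line.
\<close>

lemma differentiable_ae_if_variation_bounded:
  fixes g :: "real \<Rightarrow> real"
  assumes "s < t"
    and V: "\<And>x y. s \<le> x \<Longrightarrow> x \<le> y \<Longrightarrow> y \<le> t \<Longrightarrow> \<bar>g y - g x\<bar> \<le> V y - V x"
  shows "negligible {x \<in> {s<..<t}. \<not> g differentiable (at x)}"
proof -
  let ?c = "\<lambda>x. max s (min t x)"
  let ?f = "\<lambda>x. V (?c x) + g (?c x)" and ?h = "\<lambda>x. V (?c x) - g (?c x)"
  have m: "mono ?f" "mono ?h"
  proof -
    have "\<bar>g (?c y) - g (?c x)\<bar> \<le> V (?c y) - V (?c x)" if "x \<le> y" for x y
      using that assms(1) by (intro V) auto
    note * = this
    show "mono ?f" by (intro monoI) (drule *, linarith)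
    show "mono ?h" by (intro monoI) (drule *, linarith)
  qed
  show ?thesis
  proof (rule negligible_subset)
    show "negligible ({x \<in> {s<..<t}. \<not> ?f differentiable (at x)} \<union> {x \<in> {s<..<t}. \<not> ?h differentiable (at x)})"
      using m assms(1) by (intro negligible_Un mono_differentiable_ae)
    show "{x \<in> {s<..<t}. \<not> g differentiable (at x)} \<subseteq>
      {x \<in> {s<..<t}. \<not> ?f differentiable (at x)} \<union> {x \<in> {s<..<t}. \<not> ?h differentiable (at x)}"
    proof (rule subsetI, rule ccontr)
      fix x assume x: "x \<in> {x \<in> {s<..<t}. \<not> g differentiable (at x)}"
        and "x \<notin> {x \<in> {s<..<t}. \<not> ?f differentiable (at x)} \<union> {x \<in> {s<..<t}. \<not> ?h differentiable (at x)}"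
      then have "?f differentiable (at x)" "?h differentiable (at x)" by auto
      then have "(\<lambda>x. ?f x - ?h x) differentiable (at x)" by (rule differentiable_diff)
      from differentiable_mult[OF differentiable_const this, of "1/2"]
      have "(\<lambda>x. g (?c x)) differentiable (at x)" by (simp add: field_simps)
      then have "g differentiable (at x)"
      proof (rule differentiable_transform_within[where d = "min (x - s) (t - x)"])
        fix y assume "dist y x < min (x - s) (t - x)"
        then have "s < y" "y < t" by (auto simp: dist_real_def abs_less_iff)
        then show "g (?c y) = g y" by simp
      qed (use x in auto)
      then show False using x by auto
    qed
  qed
qed

text \<open>
  On intervals shorter than the modulus of absolute continuity for the value one, the variation is at
  most one; finitely many of them cover \<open>[0, 1]\<close> up to their end points.
\<close>

theorem abs_continuous_on_imp_differentiable_ae: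
  fixes g :: "real \<Rightarrow> real"
  assumes g: "abs_continuous_on 0 1 g"
  shows "negligible {x \<in> {0<..<1}. \<not> g differentiable (at x)}"
proof -
  obtain d where d: "d > 0" "\<And>D. finite D \<Longrightarrow> (\<And>x y. (x, y) \<in> D \<Longrightarrow> 0 \<le> x \<and> x \<le> y \<and> y \<le> 1) \<Longrightarrow>
    disjoint_family_on (\<lambda>(x, y). {x<..<y}) D \<Longrightarrow> (\<Sum>(x, y)\<in>D. y - x) < d \<Longrightarrow>
    (\<Sum>(x, y)\<in>D. \<bar>g y - g x\<bar>) < 1"
    using abs_continuous_onD[OF g zero_less_one] by metis
  obtain n where n: "n > 0" "1 / real n < d"
    using d(1) by (metis inverse_eq_divide nat_approx_posE of_nat_0_less_iff zero_less_Suc)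
  have loc: "negligible {x \<in> {real i / n<..<real (Suc i) / n}. \<not> g differentiable (at x)}" if "i < n" for i
  proof -
    let ?s = "real i / n" and ?t = "real (Suc i) / n"
    have st: "?s < ?t" "?t - ?s < d" "0 \<le> ?s" "?t \<le> 1"
      using n that by (auto simp: divide_strict_right_mono add_divide_distrib[symmetric] diff_divide_distrib[symmetric] field_simps)
    obtain V where "\<And>x y. ?s \<le> x \<Longrightarrow> x \<le> y \<Longrightarrow> y \<le> ?t \<Longrightarrow> \<bar>g y - g x\<bar> \<le> V y - V x"
    proof (rule variation_function[of ?s ?t g 1])
      fix D :: "(real \<times> real) set"
      assume D: "finite D" "\<And>x y. (x, y) \<in> D \<Longrightarrow> ?s \<le> x \<and> x \<le> y \<and> y \<le> ?t"
        "disjoint_family_on (\<lambda>(x, y). {x<..<y}) D"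
      have "(\<Sum>(x, y)\<in>D. y - x) \<le> ?t - ?s"
        using sum_increments_le[OF D(1) less_imp_le[OF st(1)] _ D(2,3), of "\<lambda>x. x"] by (auto simp: mono_on_def)
      then have "(\<Sum>(x, y)\<in>D. \<bar>g y - g x\<bar>) < 1"
        using st D(2) by (intro d(2)[OF D(1) _ D(3)]) (meson order_trans, linarith)
      then show "(\<Sum>(x, y)\<in>D. \<bar>g y - g x\<bar>) \<le> 1" by simp
    qed (use st in auto)
    then show ?thesis using differentiable_ae_if_variation_bounded[OF st(1)] by blast
  qed
  show ?thesis
  proof (rule negligible_subset)
    let ?N = "(\<Union>i<n. {x \<in> {real i / n<..<real (Suc i) / n}. \<not> g differentiable (at x)}) \<union> (\<lambda>i. real i / n) ` {..n}"
    show "negligible ?N" using loc by (intro negligible_Un negligible_Union) (auto intro: negligible_finite)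
    show "{x \<in> {0<..<1}. \<not> g differentiable (at x)} \<subseteq> ?N"
    proof
      fix x assume x: "x \<in> {x \<in> {0<..<1}. \<not> g differentiable (at x)}"
      define i where "i = nat \<lfloor>x * n\<rfloor>"
      have xn: "0 \<le> x * n" "x * n < n" using x n by auto
      have i: "real i \<le> x * n" "x * n < real i + 1" using xn by (auto simp: i_def)
      have "i < n" using i xn by linarith
      have "real i / n \<le> x" "x < real (Suc i) / n" using i n by (auto simp: field_simps)
      then show "x \<in> ?N" using \<open>i < n\<close> x by (cases "x = real i / n") auto
    qed
  qed
qed

text \<open>
  Intervals around \<open>x\<close> obey the same linear approximation as intervals that start at \<open>x\<close>.
\<close>

lemma straddle:
  fixes g :: "real \<Rightarrow> real"
  assumes "(g has_real_derivative L) (at x)" "e > 0"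
  obtains d where "d > 0" "\<And>u v. u \<le> x \<Longrightarrow> x \<le> v \<Longrightarrow> x - u < d \<Longrightarrow> v - x < d \<Longrightarrow> \<bar>g v - g u - L * (v - u)\<bar> \<le> e * (v - u)"
proof -
  obtain d where d: "d > 0" "\<And>y. norm (y - x) < d \<Longrightarrow> norm (g y - g x - L * (y - x)) \<le> e * norm (y - x)"
    using assms unfolding has_field_derivative_def has_derivative_at_alt by blast
  show ?thesis
  proof (rule that[OF d(1)])
    fix u v assume "u \<le> x" "x \<le> v" "x - u < d" "v - x < d"
    then have "\<bar>g v - g x - L * (v - x)\<bar> \<le> e * (v - x)" "\<bar>g u - g x - L * (u - x)\<bar> \<le> e * (x - u)"
      using d(2)[of v] d(2)[of u] by auto
    then show "\<bar>g v - g u - L * (v - u)\<bar> \<le> e * (v - u)" by (auto simp: algebra_simps abs_le_iff)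
  qed
qed

lemma sum_lengths_le_measure:
  fixes D :: "(real \<times> real) set"
  assumes "finite D" "disjoint_family_on (\<lambda>(x, y). {x<..<y}) D" "\<And>x y. (x, y) \<in> D \<Longrightarrow> x \<le> y"
    "\<And>x y. (x, y) \<in> D \<Longrightarrow> {x<..<y} \<subseteq> O'" "O' \<in> lmeasurable"
  shows "(\<Sum>(x, y)\<in>D. y - x) \<le> measure lebesgue O'"
proof -
  have "(\<Sum>(x, y)\<in>D. y - x) = (\<Sum>i\<in>D. measure lebesgue (case i of (x, y) \<Rightarrow> {x<..<y}))"
    using assms(3) by (intro sum.cong) auto
  also have "\<dots> = measure lebesgue (\<Union>i\<in>D. case i of (x, y) \<Rightarrow> {x<..<y})"
    using assms by (intro measure_finite_Union[symmetric]) (auto split: prod.splits)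
  also have "\<dots> \<le> measure lebesgue O'"
    using assms(1,4,5) by (intro measure_mono_fmeasurable) (fastforce intro!: sets.finite_UN split: prod.splits)+
  finally show ?thesis .
qed

lemma tagged_division_intervals:
  assumes D: "D tagged_division_of {s..t::real}" "(x, K) \<in> D"
  shows "K = {Inf K..Sup K}" "Inf K \<le> x" "x \<le> Sup K" "s \<le> Inf K" "Sup K \<le> t" "measure lborel K = Sup K - Inf K"
    "interior K = {Inf K<..<Sup K}"
proof -
  obtain a b where K: "K = cbox a b" using tagged_division_ofD(4)[OF D] by auto
  have "x \<in> K" "K \<subseteq> {s..t}" using tagged_division_ofD(2,3)[OF D] by auto
  then have "a \<le> b" "a \<in> {s..t}" "b \<in> {s..t}" using K by auto
  then show "K = {Inf K..Sup K}" "Inf K \<le> x" "x \<le> Sup K" "s \<le> Inf K" "Sup K \<le> t" "measure lborel K = Sup K - Inf K"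
    "interior K = {Inf K<..<Sup K}"
    using K \<open>x \<in> K\<close> by auto
qed

text \<open>
  Pairs of end points forget the tags and identify all degenerate intervals; this does no harm because
  the sums below vanish on degenerate intervals (\<open>sum_tagged_reindex\<close>).
\<close>

lemma tagged_division_disjoint:
  assumes D: "D tagged_division_of {s..t::real}" "E \<subseteq> D"
  shows "disjoint_family_on (\<lambda>(x, y). {x<..<y}) ((\<lambda>(x, K). (Inf K, Sup K)) ` E)"
  unfolding disjoint_family_on_def
proof (intro ballI impI)
  fix p q assume p: "p \<in> (\<lambda>(x, K). (Inf K, Sup K)) ` E" and q: "q \<in> (\<lambda>(x, K). (Inf K, Sup K)) ` E" and "p \<noteq> q"
  obtain x K where xK: "(x, K) \<in> E" "p = (Inf K, Sup K)" using p by auto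
  obtain y L where yL: "(y, L) \<in> E" "q = (Inf L, Sup L)" using q by auto
  have "interior K \<inter> interior L = {}"
    using tagged_division_ofD(5)[OF D(1), of x K y L] xK yL D(2) \<open>p \<noteq> q\<close> by blast
  moreover have "interior K = {Inf K<..<Sup K}"
    using tagged_division_intervals(7)[OF D(1), of x K] xK D(2) by blast
  moreover have "interior L = {Inf L<..<Sup L}"
    using tagged_division_intervals(7)[OF D(1), of y L] yL D(2) by blast
  ultimately show "(case p of (x, y) \<Rightarrow> {x<..<y}) \<inter> (case q of (x, y) \<Rightarrow> {x<..<y}) = {}"
    using xK yL by auto
qed

lemma sum_tagged_reindex:
  assumes D: "D tagged_division_of {s..t::real}" "E \<subseteq> D" and z: "\<And>a. h a a = (0::real)"
  shows "(\<Sum>(x, K)\<in>E. h (Inf K) (Sup K)) = (\<Sum>(u, v)\<in>(\<lambda>(x, K). (Inf K, Sup K)) ` E. h u v)"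
proof -
  let ?\<iota> = "\<lambda>(x::real, K::real set). (Inf K, Sup K)"
  have fE: "finite E" using tagged_division_ofD(1)[OF D(1)] D(2) finite_subset by blast
  have "(\<Sum>p\<in>?\<iota> ` E. (\<lambda>(u, v). h u v) p) = (\<Sum>e\<in>E. ((\<lambda>(u, v). h u v) \<circ> ?\<iota>) e)"
  proof (rule sum.reindex_nontrivial[OF fE])
    fix e e' assume e: "e \<in> E" "e' \<in> E" "e \<noteq> e'" "?\<iota> e = ?\<iota> e'"
    obtain x K y L where ee: "e = (x, K)" "e' = (y, L)" by (metis surj_pair)
    have K: "K = {Inf K..Sup K}" using tagged_division_intervals(1)[OF D(1), of x K] e ee D(2) by blast
    have L: "L = {Inf L..Sup L}" using tagged_division_intervals(1)[OF D(1), of y L] e ee D(2) by blast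
    have KL: "K = L" using e(4) ee K L by auto
    have "interior K \<inter> interior L = {}"
      using tagged_division_ofD(5)[OF D(1), of x K y L] e ee D(2) by blast
    then have "{Inf K<..<Sup K} = {}" using KL tagged_division_intervals(7)[OF D(1), of x K] e ee D(2) by blast
    moreover have "Inf K \<le> Sup K" using tagged_division_intervals(2,3)[OF D(1), of x K] e ee D(2) by fastforce
    ultimately have "Inf K = Sup K" by auto
    then show "(\<lambda>(u, v). h u v) (?\<iota> e) = 0" using ee z by simp
  qed
  also have "\<dots> = (\<Sum>(x, K)\<in>E. h (Inf K) (Sup K))" by (intro sum.cong) auto
  finally show ?thesis by simp
qed

text \<open>
  Use the gauge integral.  At points outside \<open>N\<close> the gauge follows from differentiability.  At points of \<open>N\<close>
  it confines the intervals to an open set of measure below the modulus of absolute continuity, so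
  that these intervals together carry a small increment of \<open>g\<close>.
\<close>

lemma abs_continuous_on_FTC:
  fixes g f :: "real \<Rightarrow> real"
  assumes g: "abs_continuous_on 0 1 g" and st: "0 \<le> s" "s \<le> t" "t \<le> 1"
    and N: "negligible N" and der: "\<And>x. x \<in> {0..1} - N \<Longrightarrow> (g has_real_derivative f x) (at x)"
    and f0: "\<And>x. x \<in> N \<Longrightarrow> f x = 0"
  shows "(f has_integral (g t - g s)) {s..t}"
  unfolding has_integral_real
proof (intro allI impI)
  fix e :: real assume e: "e > 0"
  obtain d where d: "d > 0" "\<And>D. finite D \<Longrightarrow> (\<And>x y. (x, y) \<in> D \<Longrightarrow> 0 \<le> x \<and> x \<le> y \<and> y \<le> 1) \<Longrightarrow>
    disjoint_family_on (\<lambda>(x, y). {x<..<y}) D \<Longrightarrow> (\<Sum>(x, y)\<in>D. y - x) < d \<Longrightarrow>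
    (\<Sum>(x, y)\<in>D. \<bar>g y - g x\<bar>) < e / 2"
    using abs_continuous_onD[OF g, of "e / 2"] e by (metis half_gt_zero)
  have N': "N \<in> lmeasurable" "measure lebesgue N = 0"
    using N by (auto simp: negligible_imp_measurable negligible_imp_measure0)
  obtain O' where O': "open O'" "N \<subseteq> O'" "O' \<in> lmeasurable" "measure lebesgue O' < d"
    using lmeasurable_outer_open_less[OF N'(1) d(1)] N'(2) by auto
  have "\<exists>r>0. \<forall>u v. u \<le> x \<and> x \<le> v \<and> x - u < r \<and> v - x < r \<longrightarrow> \<bar>g v - g u - f x * (v - u)\<bar> \<le> (e / 4) * (v - u)"
    if "x \<in> {0..1} - N" for x
    using straddle[OF der[OF that], of "e / 4"] e by (metis zero_less_divide_iff zero_less_numeral)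
  then obtain r where r: "\<And>x. x \<in> {0..1} - N \<Longrightarrow> r x > 0"
    "\<And>x u v. x \<in> {0..1} - N \<Longrightarrow> u \<le> x \<Longrightarrow> x \<le> v \<Longrightarrow> x - u < r x \<Longrightarrow> v - x < r x \<Longrightarrow>
      \<bar>g v - g u - f x * (v - u)\<bar> \<le> (e / 4) * (v - u)"
    by metis
  define \<gamma> where "\<gamma> = (\<lambda>x. if x \<in> N then O' else if x \<in> {0..1} then ball x (r x) else UNIV)"
  have gg: "gauge \<gamma>" unfolding gauge_def \<gamma>_def using O' r(1) by auto
  have "norm ((\<Sum>(x, K)\<in>D. measure lborel K *\<^sub>R f x) - (g t - g s)) < e"
    if D: "D tagged_division_of {s..t}" and fine: "\<gamma> fine D" for D
  proof -
    define E where "E = {(x, K) \<in> D. x \<in> N}"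
    have fD: "finite D" and ED: "E \<subseteq> D" using D by (auto simp: E_def)
    have fE: "finite E" using fD ED finite_subset by blast
    let ?\<iota> = "\<lambda>(x::real, K::real set). (Inf K, Sup K)"
    have TI: "s \<le> Inf K \<and> Inf K \<le> Sup K \<and> Sup K \<le> t" if "(x, K) \<in> D" for x K
      using tagged_division_intervals(2-5)[OF D that] by linarith
    have EI: "s \<le> u \<and> u \<le> v \<and> v \<le> t" if uv: "(u, v) \<in> ?\<iota> ` E" for u v
    proof -
      obtain x K where "(x, K) \<in> E" "u = Inf K" "v = Sup K" using uv by auto
      then show ?thesis using TI[of x K] ED by blast
    qed
    have "(\<Sum>(u, v)\<in>?\<iota> ` E. \<bar>g v - g u\<bar>) < e / 2"
    proof (rule d(2))
      show "finite (?\<iota> ` E)" using fE by simp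
      show "0 \<le> u \<and> u \<le> v \<and> v \<le> 1" if "(u, v) \<in> ?\<iota> ` E" for u v
        using EI[OF that] st by linarith
      show dj: "disjoint_family_on (\<lambda>(x, y). {x<..<y}) (?\<iota> ` E)" by (rule tagged_division_disjoint[OF D ED])
      have "(\<Sum>(u, v)\<in>?\<iota> ` E. v - u) \<le> measure lebesgue O'"
      proof (rule sum_lengths_le_measure[OF _ dj])
        show "u \<le> v" if "(u, v) \<in> ?\<iota> ` E" for u v
          using EI[OF that] by linarith
        show "{u<..<v} \<subseteq> O'" if uv: "(u, v) \<in> ?\<iota> ` E" for u v
        proof -
          obtain x K where xK: "(x, K) \<in> E" "u = Inf K" "v = Sup K" using uv by auto
          have xD: "(x, K) \<in> D" "x \<in> N" using xK(1) by (auto simp: E_def)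
          then have "K \<subseteq> \<gamma> x" using fine unfolding fine_def by blast
          then have "K \<subseteq> O'" using xD by (simp add: \<gamma>_def)
          moreover have "K = {u..v}" using tagged_division_intervals(1)[OF D xD(1)] xK by simp
          ultimately show ?thesis by auto
        qed
      qed (use fE O' in auto)
      then show "(\<Sum>(u, v)\<in>?\<iota> ` E. v - u) < d" using O' by linarith
    qed
    then have E_small: "(\<Sum>(x, K)\<in>E. \<bar>g (Sup K) - g (Inf K)\<bar>) < e / 2"
      using sum_tagged_reindex[OF D ED, of "\<lambda>u v. \<bar>g v - g u\<bar>"] by simp
    have "(\<Sum>(x, K)\<in>D - E. Sup K - Inf K) \<le> (\<Sum>(x, K)\<in>D. Sup K - Inf K)"
      using fD TI by (intro sum_mono2) (auto split: prod.splits)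
    also have "\<dots> = t - s" using additive_tagged_division_1[OF st(2) D, of "\<lambda>x. x"] by simp
    finally have len': "(\<Sum>(x, K)\<in>D - E. Sup K - Inf K) \<le> 1" using st by simp
    have G_small: "(\<Sum>(x, K)\<in>D - E. \<bar>measure lborel K * f x - (g (Sup K) - g (Inf K))\<bar>) \<le> e / 4"
    proof -
      have "(\<Sum>(x, K)\<in>D - E. \<bar>measure lborel K * f x - (g (Sup K) - g (Inf K))\<bar>) \<le> (\<Sum>(x, K)\<in>D - E. (e / 4) * (Sup K - Inf K))"
      proof (rule sum_mono, clarify)
        fix x K assume xK: "(x, K) \<in> D" "(x, K) \<notin> E"
        have xN: "x \<notin> N" using xK by (auto simp: E_def)
        note K = tagged_division_intervals[OF D xK(1)]
        have x01: "x \<in> {0..1}" using K st by auto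
        have "K \<subseteq> \<gamma> x" using fine xK(1) unfolding fine_def by blast
        then have "K \<subseteq> ball x (r x)" using xN x01 by (simp add: \<gamma>_def)
        then have "{Inf K..Sup K} \<subseteq> ball x (r x)" using K(1) by simp
        moreover have "Inf K \<in> {Inf K..Sup K}" "Sup K \<in> {Inf K..Sup K}" using TI[OF xK(1)] by auto
        ultimately have "dist x (Inf K) < r x" "dist x (Sup K) < r x" by auto
        then have "\<bar>g (Sup K) - g (Inf K) - f x * (Sup K - Inf K)\<bar> \<le> (e / 4) * (Sup K - Inf K)"
          using K xN x01 by (intro r(2)) (auto simp: dist_real_def)
        then show "\<bar>measure lborel K * f x - (g (Sup K) - g (Inf K))\<bar> \<le> (e / 4) * (Sup K - Inf K)"
          unfolding K(6) by (simp add: abs_minus_commute mult.commute)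
      qed
      also have "\<dots> = (e / 4) * (\<Sum>(x, K)\<in>D - E. Sup K - Inf K)" by (simp add: sum_distrib_left split_beta)
      also have "\<dots> \<le> (e / 4) * 1" using len' e by (intro mult_left_mono) auto
      finally show ?thesis by simp
    qed
    have "(\<Sum>(x, K)\<in>D. measure lborel K *\<^sub>R f x) - (g t - g s) = (\<Sum>(x, K)\<in>D. measure lborel K * f x - (g (Sup K) - g (Inf K)))"
      using additive_tagged_division_1[OF st(2) D, of g] by (simp add: sum_subtractf split_beta)
    then have "norm ((\<Sum>(x, K)\<in>D. measure lborel K *\<^sub>R f x) - (g t - g s)) \<le> (\<Sum>(x, K)\<in>D. \<bar>measure lborel K * f x - (g (Sup K) - g (Inf K))\<bar>)"
      by (simp add: split_beta)
    also have "\<dots> = (\<Sum>(x, K)\<in>D - E. \<bar>measure lborel K * f x - (g (Sup K) - g (Inf K))\<bar>) + (\<Sum>(x, K)\<in>E. \<bar>measure lborel K * f x - (g (Sup K) - g (Inf K))\<bar>)"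
      by (rule sum.subset_diff[OF ED fD])
    also have "(\<Sum>(x, K)\<in>E. \<bar>measure lborel K * f x - (g (Sup K) - g (Inf K))\<bar>) = (\<Sum>(x, K)\<in>E. \<bar>g (Sup K) - g (Inf K)\<bar>)"
      using f0 by (intro sum.cong) (auto simp: E_def)
    also have "(\<Sum>(x, K)\<in>D - E. \<bar>measure lborel K * f x - (g (Sup K) - g (Inf K))\<bar>) + (\<Sum>(x, K)\<in>E. \<bar>g (Sup K) - g (Inf K)\<bar>) < e"
      using G_small E_small e by linarith
    finally show ?thesis .
  qed
  then show "\<exists>\<gamma>. gauge \<gamma> \<and> (\<forall>\<D>. \<D> tagged_division_of {s..t} \<and> \<gamma> fine \<D> \<longrightarrow>
      norm ((\<Sum>(x, k)\<in>\<D>. measure lborel k *\<^sub>R f x) - (g t - g s)) < e)"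
    by (intro exI[of _ \<gamma>] conjI gg) simp
qed


section \<open>Discrete energy of the functions in the Strassen set\<close>

text \<open>
  If \<open>g\<close> has a square integrable derivative, then \<open>H t\<close> is the integral of \<open>(g')\<^sup>2\<close> over \<open>[0, t]\<close>, and the
  inequality is that of Cauchy and Schwarz.  The definition keeps exactly what survives without
  derivatives.
\<close>

definition energy_majorant :: "(real \<Rightarrow> real) \<Rightarrow> (real \<Rightarrow> real) \<Rightarrow> bool" where
  "energy_majorant g H \<longleftrightarrow> mono_on {0..1} H \<and> H 1 - H 0 \<le> 1 \<and>
     (\<forall>s t. 0 \<le> s \<and> s \<le> t \<and> t \<le> 1 \<longrightarrow> (g t - g s)\<^sup>2 \<le> (t - s) * (H t - H s))"

lemma energy_majorant_of_AC:
  assumes g: "abs_continuous_on 0 1 g"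
    and E: "(\<integral>\<^sup>+t\<in>{0..1}. ennreal ((deriv g t)\<^sup>2) \<partial>lebesgue) \<le> 1"
  obtains H where "energy_majorant g H"
proof -
  define N where "N = {x \<in> {0<..<1}. \<not> g differentiable (at x)} \<union> {0, 1}"
  have N: "negligible N" unfolding N_def
    by (intro negligible_Un abs_continuous_on_imp_differentiable_ae g) auto
  (* deriv is an arbitrary value at the exceptional points, so it is reset to 0 there *)
  define f where "f = (\<lambda>x. if x \<in> {0..1} - N then deriv g x else 0)"
  have der: "(g has_real_derivative f x) (at x)" if "x \<in> {0..1} - N" for x
  proof -
    have "g differentiable (at x)" using that by (auto simp: N_def)
    then show ?thesis using that
      by (simp add: f_def DERIV_deriv_iff_real_differentiable)
  qed
  have f0: "f x = 0" if "x \<in> N" for x using that by (simp add: f_def)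
  have FTC: "(f has_integral (g t - g s)) {s..t}" if "0 \<le> s" "s \<le> t" "t \<le> 1" for s t
    by (rule abs_continuous_on_FTC[OF g that N der f0])
  have fz: "f x * indicator {0..1} x = f x" for x by (auto simp: f_def)
  have fm: "f \<in> borel_measurable lebesgue"
    using has_integral_implies_lebesgue_measurable_real[OF FTC[of 0 1]] unfolding fz by simp
  have Nn: "N \<in> null_sets lebesgue" using N by (simp add: negligible_iff_null_sets)
  have "(\<integral>\<^sup>+x. ennreal ((f x)\<^sup>2) \<partial>lebesgue) = (\<integral>\<^sup>+t\<in>{0..1}. ennreal ((deriv g t)\<^sup>2) \<partial>lebesgue)"
  proof (rule nn_integral_cong_AE)
    show "AE x in lebesgue. ennreal ((f x)\<^sup>2) = ennreal ((deriv g x)\<^sup>2) * indicator {0..1} x"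
      using AE_not_in[OF Nn] by eventually_elim (auto simp: f_def indicator_def)
  qed
  then have nn: "(\<integral>\<^sup>+x. ennreal ((f x)\<^sup>2) \<partial>lebesgue) \<le> 1" using E by simp
  have int: "integrable lebesgue (\<lambda>x. (f x)\<^sup>2)"
  proof (rule integrableI_nonneg)
    show "(\<integral>\<^sup>+x. ennreal ((f x)\<^sup>2) \<partial>lebesgue) < \<infinity>"
      using nn by (auto intro: le_less_trans)
  qed (use fm in auto)
  have le1: "integral\<^sup>L lebesgue (\<lambda>x. (f x)\<^sup>2) \<le> 1"
    using nn nn_integral_eq_integral[OF int] by (simp add: ennreal_le_1)
  have FU: "((\<lambda>x. (f x)\<^sup>2) has_integral (integral\<^sup>L lebesgue (\<lambda>x. (f x)\<^sup>2))) UNIV"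
    by (rule has_integral_integral_lebesgue[OF int])
  have feq: "(\<lambda>x. (f x)\<^sup>2) = (\<lambda>x. if x \<in> {0..1} then (f x)\<^sup>2 else 0)" by (auto simp: f_def)
  have "((\<lambda>x. if x \<in> {0..1} then (f x)\<^sup>2 else 0) has_integral (integral\<^sup>L lebesgue (\<lambda>x. (f x)\<^sup>2))) UNIV"
    by (subst feq[symmetric]) (rule FU)
  then have F: "((\<lambda>x. (f x)\<^sup>2) has_integral (integral\<^sup>L lebesgue (\<lambda>x. (f x)\<^sup>2))) {0..1}"
    by (simp only: has_integral_restrict_UNIV)
  define H where "H = (\<lambda>t. integral {0..t} (\<lambda>x. (f x)\<^sup>2))"
  have Fi: "(\<lambda>x. (f x)\<^sup>2) integrable_on {s..t}" if "0 \<le> s" "t \<le> 1" for s t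
    by (rule integrable_subinterval_real[OF has_integral_integrable[OF F]]) (use that in auto)
  have Hd: "((\<lambda>x. (f x)\<^sup>2) has_integral (H t - H s)) {s..t}" if "0 \<le> s" "s \<le> t" "t \<le> 1" for s t
  proof -
    have "integral {0..s} (\<lambda>x. (f x)\<^sup>2) + integral {s..t} (\<lambda>x. (f x)\<^sup>2) = integral {0..t} (\<lambda>x. (f x)\<^sup>2)"
      using that by (intro Henstock_Kurzweil_Integration.integral_combine Fi) auto
    then have "H t - H s = integral {s..t} (\<lambda>x. (f x)\<^sup>2)" by (simp add: H_def)
    then show ?thesis using integrable_integral[OF Fi[OF that(1,3)]] by simp
  qed
  have mono: "H s \<le> H t" if "0 \<le> s" "s \<le> t" "t \<le> 1" for s t
    using has_integral_nonneg[OF Hd[OF that]] by auto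
  have "energy_majorant g H" unfolding energy_majorant_def
  proof (intro conjI allI impI)
    show "mono_on {0..1} H" using mono by (auto simp: mono_on_def)
    show "H 1 - H 0 \<le> 1" using has_integral_unique[OF Hd[of 0 1] F] le1 by simp
    fix s t :: real assume st: "0 \<le> s \<and> s \<le> t \<and> t \<le> 1"
    show "(g t - g s)\<^sup>2 \<le> (t - s) * (H t - H s)"
    proof (cases "s = t")
      case False
      (* c minimises the integral of (f - c)^2 over [s, t] *)
      define c where "c = (g t - g s) / (t - s)"
      have ts: "t - s > 0" using st False by simp
      have "((\<lambda>x. (f x)\<^sup>2 - 2 * c * f x + c\<^sup>2) has_integral ((H t - H s) - 2 * c * (g t - g s) + (t - s) * c\<^sup>2)) {s..t}"
        using st has_integral_const_real[of "c\<^sup>2" s t]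
        by (intro has_integral_add has_integral_diff has_integral_mult_right Hd FTC) simp_all
      moreover have "0 \<le> (f x)\<^sup>2 - 2 * c * f x + c\<^sup>2" for x
        using zero_le_power2[of "f x - c"] by (simp add: power2_diff algebra_simps)
      ultimately have "0 \<le> (H t - H s) - 2 * c * (g t - g s) + (t - s) * c\<^sup>2"
        by (meson has_integral_nonneg)
      moreover have cd: "g t - g s = c * (t - s)" using ts by (simp add: c_def)
      ultimately have "0 \<le> (H t - H s) - c\<^sup>2 * (t - s)" unfolding cd by (simp add: power2_eq_square algebra_simps)
      then have "0 \<le> (t - s) * ((H t - H s) - c\<^sup>2 * (t - s))" using ts by (intro mult_nonneg_nonneg) auto
      then show ?thesis unfolding cd by (simp add: power2_eq_square algebra_simps)
    qed auto
  qed
  then show ?thesis by (rule that)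
qed

lemma strassen_set_majorant:
  assumes "g \<in> strassen_set"
  obtains H where "energy_majorant g H"
  using assms energy_majorant_of_AC unfolding strassen_set_def by blast

text \<open>
  This is the Cauchy-Schwarz inequality for sums; it gives absolute continuity with the modulus
  \<open>\<epsilon>\<^sup>2\<close>.
\<close>

lemma majorant_family:
  assumes H: "energy_majorant g H" and D: "finite D"
    "\<And>x y. (x, y) \<in> D \<Longrightarrow> 0 \<le> x \<and> x \<le> y \<and> y \<le> (1::real)" "disjoint_family_on (\<lambda>(x, y). {x<..<y}) D"
  shows "(\<Sum>(x, y)\<in>D. \<bar>g y - g x\<bar>) \<le> sqrt (\<Sum>(x, y)\<in>D. y - x)"
proof -
  note Hm = H[unfolded energy_majorant_def]
  have hp: "0 \<le> H y - H x" if "(x, y) \<in> D" for x y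
    using Hm D(2)[OF that] by (auto simp: mono_on_def)
  have "(\<Sum>(x, y)\<in>D. \<bar>g y - g x\<bar>) \<le> (\<Sum>(x, y)\<in>D. \<bar>sqrt (y - x)\<bar> * \<bar>sqrt (H y - H x)\<bar>)"
  proof (rule sum_mono, clarify)
    fix x y assume xy: "(x, y) \<in> D"
    have "(g y - g x)\<^sup>2 \<le> (y - x) * (H y - H x)" using Hm D(2)[OF xy] by auto
    then have "sqrt ((g y - g x)\<^sup>2) \<le> sqrt ((y - x) * (H y - H x))" by (rule real_sqrt_le_mono)
    then show "\<bar>g y - g x\<bar> \<le> \<bar>sqrt (y - x)\<bar> * \<bar>sqrt (H y - H x)\<bar>"
      using D(2)[OF xy] hp[OF xy] by (simp add: real_sqrt_mult)
  qed
  also have "\<dots> = (\<Sum>i\<in>D. \<bar>sqrt (snd i - fst i)\<bar> * \<bar>sqrt (H (snd i) - H (fst i))\<bar>)" by (simp add: split_beta)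
  also have "\<dots> \<le> L2_set (\<lambda>i. sqrt (snd i - fst i)) D * L2_set (\<lambda>i. sqrt (H (snd i) - H (fst i))) D"
    by (rule L2_set_mult_ineq)
  also have "L2_set (\<lambda>i. sqrt (snd i - fst i)) D = sqrt (\<Sum>(x, y)\<in>D. y - x)"
    unfolding L2_set_def split_beta using D(2) by (intro arg_cong[of _ _ sqrt] sum.cong) auto
  also have "L2_set (\<lambda>i. sqrt (H (snd i) - H (fst i))) D = sqrt (\<Sum>(x, y)\<in>D. H y - H x)"
    unfolding L2_set_def split_beta using hp by (intro arg_cong[of _ _ sqrt] sum.cong) auto
  also have "sqrt (\<Sum>(x, y)\<in>D. y - x) * sqrt (\<Sum>(x, y)\<in>D. H y - H x) \<le> sqrt (\<Sum>(x, y)\<in>D. y - x) * 1"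
  proof (rule mult_left_mono)
    have "(\<Sum>(x, y)\<in>D. H y - H x) \<le> H 1 - H 0"
      using Hm D by (intro sum_increments_le) auto
    then show "sqrt (\<Sum>(x, y)\<in>D. H y - H x) \<le> 1" using Hm by simp
    show "0 \<le> sqrt (\<Sum>(x, y)\<in>D. y - x)" using D(2) by (auto intro!: sum_nonneg)
  qed
  finally show ?thesis by simp
qed

lemma majorant_grid:
  assumes H: "energy_majorant g H" and "N > 0"
  shows "(\<Sum>i<N. real N * (g (real (Suc i) / N) - g (real i / N))\<^sup>2) \<le> 1"
proof -
  note Hm = H[unfolded energy_majorant_def]
  have "real N * (g (real (Suc i) / N) - g (real i / N))\<^sup>2 \<le> H (real (Suc i) / N) - H (real i / N)" if "i < N" for i
  proof -
    have "0 \<le> real i / N" "real i / N \<le> real (Suc i) / N" "real (Suc i) / N \<le> 1"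
      using that by (auto simp: divide_right_mono)
    then have "(g (real (Suc i) / N) - g (real i / N))\<^sup>2 \<le> (real (Suc i) / N - real i / N) * (H (real (Suc i) / N) - H (real i / N))"
      using Hm by blast
    also have "real (Suc i) / N - real i / N = 1 / N" by (simp add: diff_divide_distrib[symmetric])
    finally show ?thesis using \<open>N > 0\<close> by (simp add: field_simps)
  qed
  then have "(\<Sum>i<N. real N * (g (real (Suc i) / N) - g (real i / N))\<^sup>2) \<le> (\<Sum>i<N. H (real (Suc i) / N) - H (real i / N))"
    by (intro sum_mono) auto
  also have "\<dots> = H 1 - H 0" using \<open>N > 0\<close> by (subst sum_lessThan_telescope) auto
  finally show ?thesis using Hm by simp
qed

lemma majorant_holder:
  assumes H: "energy_majorant g H" and "s \<in> {0..1}" "t \<in> {0..1}"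
  shows "\<bar>g t - g s\<bar> \<le> sqrt \<bar>t - s\<bar>"
proof -
  have *: "\<bar>g t - g s\<bar> \<le> sqrt (t - s)" if "0 \<le> s" "s \<le> t" "t \<le> 1" for s t
    using majorant_family[OF H, of "{(s, t)}"] that by (auto simp: disjoint_family_on_def)
  show ?thesis using *[of s t] *[of t s] assms(2,3) by (cases "s \<le> t") (auto simp: abs_minus_commute)
qed


section \<open>Topology of the Strassen set and of \<open>C[0,1]\<close>\<close>

lemma C01_mspace: "f \<in> mspace C01 \<longleftrightarrow> f \<in> extensional {0..1} \<and> continuous_on {0..1} f"
  unfolding C01_def by (subst compactin_mspace_cfunspace) (auto simp: compactin_subtopology)

lemma restrict_C01: "continuous_on {0..1} f \<Longrightarrow> restrict f {0..1} \<in> mspace C01"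
proof -
  assume f: "continuous_on {0..1} f"
  have "continuous_on {0..1} (restrict f {0..1})"
    by (rule continuous_on_eq[OF f]) simp
  then show ?thesis unfolding C01_mspace by simp
qed

lemma C01_mdist_le:
  "f \<in> mspace C01 \<Longrightarrow> g \<in> mspace C01 \<Longrightarrow> mdist C01 f g \<le> c \<longleftrightarrow> (\<forall>x\<in>{0..1}. \<bar>f x - g x\<bar> \<le> c)"
  unfolding C01_def by (subst cfunspace_mdist_le) (auto simp: dist_real_def)

lemma abs_continuous_onI_sqrt:
  assumes "\<And>D. finite D \<Longrightarrow> (\<And>x y. (x, y) \<in> D \<Longrightarrow> 0 \<le> x \<and> x \<le> y \<and> y \<le> (1::real)) \<Longrightarrow>
      disjoint_family_on (\<lambda>(x, y). {x<..<y}) D \<Longrightarrow> (\<Sum>(x, y)\<in>D. \<bar>g y - g x\<bar>) \<le> sqrt (\<Sum>(x, y)\<in>D. y - x)"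
  shows "abs_continuous_on 0 1 g"
  unfolding abs_continuous_on_def
proof (intro allI impI)
  fix e :: real assume e: "e > 0"
  show "\<exists>\<delta>>0. \<forall>D :: (real \<times> real) set.
        finite D \<and> (\<forall>(x, y)\<in>D. 0 \<le> x \<and> x \<le> y \<and> y \<le> 1) \<and>
        disjoint_family_on (\<lambda>(x, y). {x<..<y}) D \<and> (\<Sum>(x, y)\<in>D. y - x) < \<delta>
        \<longrightarrow> (\<Sum>(x, y)\<in>D. \<bar>g y - g x\<bar>) < e"
  proof (intro exI[of _ "e\<^sup>2"] conjI allI impI)
    fix D :: "(real \<times> real) set"
    assume D: "finite D \<and> (\<forall>(x, y)\<in>D. 0 \<le> x \<and> x \<le> y \<and> y \<le> 1) \<and>
        disjoint_family_on (\<lambda>(x, y). {x<..<y}) D \<and> (\<Sum>(x, y)\<in>D. y - x) < e\<^sup>2"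
    have "(\<Sum>(x, y)\<in>D. \<bar>g y - g x\<bar>) \<le> sqrt (\<Sum>(x, y)\<in>D. y - x)" using D by (intro assms) auto
    also have "\<dots> < sqrt (e\<^sup>2)" using D by (intro real_sqrt_less_mono) auto
    finally show "(\<Sum>(x, y)\<in>D. \<bar>g y - g x\<bar>) < e" using e by simp
  qed (use e in auto)
qed

text \<open>
  The cell of mesh \<open>1 / (n + 1)\<close> that contains \<open>x\<close> shrinks to \<open>x\<close>.
\<close>

lemma grid_slope_tendsto:
  assumes g: "(g has_real_derivative L) (at x)" and x: "0 \<le> x"
  shows "(\<lambda>n. real (Suc n) * (g (real (Suc (nat \<lfloor>x * Suc n\<rfloor>)) / Suc n) - g (real (nat \<lfloor>x * Suc n\<rfloor>) / Suc n))) \<longlonglongrightarrow> L"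
proof (rule LIMSEQ_I)
  fix e :: real assume e: "e > 0"
  obtain d where d: "d > 0" "\<And>u v. u \<le> x \<Longrightarrow> x \<le> v \<Longrightarrow> x - u < d \<Longrightarrow> v - x < d \<Longrightarrow> \<bar>g v - g u - L * (v - u)\<bar> \<le> (e / 2) * (v - u)"
    using straddle[OF g, of "e / 2"] e by (metis half_gt_zero)
  obtain n0 where n0: "inverse (real (Suc n0)) < d" using reals_Archimedean[OF d(1)] by auto
  show "\<exists>no. \<forall>n\<ge>no. norm (real (Suc n) * (g (real (Suc (nat \<lfloor>x * Suc n\<rfloor>)) / Suc n) - g (real (nat \<lfloor>x * Suc n\<rfloor>) / Suc n)) - L) < e"
  proof (intro exI[of _ n0] allI impI)
    fix n assume n: "n \<ge> n0"
    define N where "N = Suc n"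
    define k where "k = nat \<lfloor>x * N\<rfloor>"
    have N: "real N > 0" by (simp add: N_def)
    have k: "real k \<le> x * N" "x * N < real k + 1" using x by (auto simp: k_def)
    define u v where "u = real k / N" and "v = real (Suc k) / N"
    have uv: "u \<le> x" "x \<le> v" "v - u = 1 / N"
      using k N by (auto simp: u_def v_def field_simps)
    have "1 / real N \<le> inverse (real (Suc n0))" using n by (simp add: N_def field_simps)
    then have "1 / real N < d" using n0 by linarith
    then have "\<bar>g v - g u - L * (v - u)\<bar> \<le> (e / 2) * (v - u)" using uv by (intro d(2)) auto
    then have "\<bar>g v - g u - L / N\<bar> \<le> (e / 2) / N" using uv by simp
    then have "real N * \<bar>g v - g u - L / N\<bar> \<le> e / 2" using N by (simp add: field_simps)
    moreover have "real N * \<bar>g v - g u - L / N\<bar> = \<bar>real N * (g v - g u) - L\<bar>"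
    proof -
      have "real N * (g v - g u - L / N) = real N * (g v - g u) - L" using N by (simp add: field_simps)
      then show ?thesis using abs_mult[of "real N" "g v - g u - L / N"] by simp
    qed
    ultimately show "norm (real (Suc n) * (g (real (Suc (nat \<lfloor>x * Suc n\<rfloor>)) / Suc n) - g (real (nat \<lfloor>x * Suc n\<rfloor>) / Suc n)) - L) < e"
      using e unfolding u_def v_def k_def N_def by simp
  qed
qed

lemma grid_slopes_nn_integral:
  fixes c :: "nat \<Rightarrow> real"
  assumes "N > 0" "(\<Sum>i<N. (c i)\<^sup>2 / N) \<le> 1"
  shows "(\<integral>\<^sup>+x. (\<Sum>i<N. ennreal ((c i)\<^sup>2) * indicator {real i / N..<real (Suc i) / N} x) \<partial>lebesgue) \<le> 1"
proof -
  have "emeasure lebesgue {real i / N..<real (Suc i) / N} = ennreal (1 / N)" for i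
    using assms(1) by (simp add: divide_right_mono diff_divide_distrib[symmetric])
  note em = this
  have mi: "indicator {real i / N..<real (Suc i) / N} \<in> borel_measurable lebesgue" for i
    by (intro borel_measurable_indicator) auto
  have "(\<integral>\<^sup>+x. (\<Sum>i<N. ennreal ((c i)\<^sup>2) * indicator {real i / N..<real (Suc i) / N} x) \<partial>lebesgue)
    = (\<Sum>i<N. \<integral>\<^sup>+x. ennreal ((c i)\<^sup>2) * indicator {real i / N..<real (Suc i) / N} x \<partial>lebesgue)"
    by (rule nn_integral_sum) (intro borel_measurable_times_ennreal mi borel_measurable_const)
  also have "\<dots> = (\<Sum>i<N. ennreal ((c i)\<^sup>2) * ennreal (1 / N))"
  proof (rule sum.cong[OF refl])
    fix i
    have "(\<integral>\<^sup>+x. ennreal ((c i)\<^sup>2) * indicator {real i / N..<real (Suc i) / N} x \<partial>lebesgue)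
      = ennreal ((c i)\<^sup>2) * emeasure lebesgue {real i / N..<real (Suc i) / N}"
      by (rule nn_integral_cmult_indicator) auto
    then show "(\<integral>\<^sup>+x. ennreal ((c i)\<^sup>2) * indicator {real i / N..<real (Suc i) / N} x \<partial>lebesgue)
      = ennreal ((c i)\<^sup>2) * ennreal (1 / N)" by (simp only: em)
  qed
  also have "\<dots> = (\<Sum>i<N. ennreal ((c i)\<^sup>2 / N))" by (simp add: ennreal_mult'[symmetric])
  also have "\<dots> = ennreal (\<Sum>i<N. (c i)\<^sup>2 / N)" by (rule sum_ennreal) auto
  also have "\<dots> \<le> 1" using assms(2) by (simp add: ennreal_le_1)
  finally show ?thesis .
qed

text \<open>
  The step functions formed from the slopes of \<open>g\<close> over finer and finer grids converge to the derivative
  almost everywhere, and the integrals of their squares are at most one by \<open>grid\<close>; Fatou's lemma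
  gives the energy bound.  Both hypotheses \<open>fam\<close> and \<open>grid\<close> involve finitely many values of \<open>g\<close> only,
  so they pass to pointwise limits.
\<close>

lemma strassen_setI_grid:
  assumes g: "g \<in> mspace C01" "g 0 = 0"
    and fam: "\<And>D. finite D \<Longrightarrow> (\<And>x y. (x, y) \<in> D \<Longrightarrow> 0 \<le> x \<and> x \<le> y \<and> y \<le> (1::real)) \<Longrightarrow>
      disjoint_family_on (\<lambda>(x, y). {x<..<y}) D \<Longrightarrow> (\<Sum>(x, y)\<in>D. \<bar>g y - g x\<bar>) \<le> sqrt (\<Sum>(x, y)\<in>D. y - x)"
    and grid: "\<And>N. N > 0 \<Longrightarrow> (\<Sum>i<N. real N * (g (real (Suc i) / N) - g (real i / N))\<^sup>2) \<le> 1"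
  shows "g \<in> strassen_set"
proof -
  have AC: "abs_continuous_on 0 1 g" by (rule abs_continuous_onI_sqrt[OF fam])
  define c where "c = (\<lambda>n i. real (Suc n) * (g (real (Suc i) / Suc n) - g (real i / Suc n)))"
  define D where "D = (\<lambda>n x. \<Sum>i<Suc n. ennreal ((c n i)\<^sup>2) * indicator {real i / Suc n..<real (Suc i) / Suc n} x)"
  have D1: "(\<integral>\<^sup>+x. D n x \<partial>lebesgue) \<le> 1" for n
    unfolding D_def
  proof (rule grid_slopes_nn_integral)
    have "(\<Sum>i<Suc n. (c n i)\<^sup>2 / real (Suc n)) = (\<Sum>i<Suc n. real (Suc n) * (g (real (Suc i) / Suc n) - g (real i / Suc n))\<^sup>2)"
      by (intro sum.cong refl) (simp add: c_def power2_eq_square)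
    then show "(\<Sum>i<Suc n. (c n i)\<^sup>2 / real (Suc n)) \<le> 1" using grid[of "Suc n"] by simp
  qed simp
  have Dm: "D n \<in> borel_measurable lebesgue" for n unfolding D_def
    by (intro borel_measurable_sum borel_measurable_times_ennreal borel_measurable_const borel_measurable_indicator) auto
  (* at each point exactly one cell contributes *)
  have Dv: "D n x = ennreal ((c n (nat \<lfloor>x * Suc n\<rfloor>))\<^sup>2)" if x: "0 < x" "x < 1" for n x
  proof -
    define N where "N = Suc n"
    define k where "k = nat \<lfloor>x * N\<rfloor>"
    have N: "real N > 0" by (simp add: N_def)
    have k: "real k \<le> x * N" "x * N < real k + 1" using x by (auto simp: k_def)
    have "x * N < N" using x N by simp
    then have "k < N" using k by linarith
    have ind: "indicator {real i / N..<real (Suc i) / N} x = (if i = k then 1 else 0 :: ennreal)" for i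
    proof -
      have "real i / N \<le> x \<and> x < real (Suc i) / N \<longleftrightarrow> real i \<le> x * N \<and> x * N < real i + 1"
        using N by (simp add: field_simps)
      also have "\<dots> \<longleftrightarrow> i = k" using k by linarith
      finally show ?thesis by (auto simp: indicator_def)
    qed
    have "D n x = (\<Sum>i<N. ennreal ((c n i)\<^sup>2) * (if i = k then 1 else 0))"
      unfolding D_def N_def[symmetric] ind ..
    also have "\<dots> = (\<Sum>i<N. if i = k then ennreal ((c n i)\<^sup>2) else 0)" by (intro sum.cong) auto
    also have "\<dots> = ennreal ((c n k)\<^sup>2)" using \<open>k < N\<close> by simp
    finally show ?thesis by (simp add: k_def N_def)
  qed
  have Null: "{x \<in> {0<..<1}. \<not> g differentiable (at x)} \<union> {0, 1} \<in> null_sets lebesgue"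
    unfolding negligible_iff_null_sets[symmetric]
    by (intro negligible_Un abs_continuous_on_imp_differentiable_ae AC) auto
  have "(\<integral>\<^sup>+t\<in>{0..1}. ennreal ((deriv g t)\<^sup>2) \<partial>lebesgue) \<le> (\<integral>\<^sup>+x. liminf (\<lambda>n. D n x) \<partial>lebesgue)"
  proof (rule nn_integral_mono_AE)
    show "AE x in lebesgue. ennreal ((deriv g x)\<^sup>2) * indicator {0..1} x \<le> liminf (\<lambda>n. D n x)"
      using AE_not_in[OF Null]
    proof eventually_elim
      case (elim x)
      show ?case
      proof (cases "x \<in> {0..1}")
        case True
        then have x: "0 < x" "x < 1" "g differentiable (at x)" using elim by force+
        then have "(g has_real_derivative deriv g x) (at x)" by (simp add: DERIV_deriv_iff_real_differentiable)
        then have "(\<lambda>n. c n (nat \<lfloor>x * Suc n\<rfloor>)) \<longlonglongrightarrow> deriv g x"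
          unfolding c_def using x by (intro grid_slope_tendsto) auto
        then have "(\<lambda>n. ennreal ((c n (nat \<lfloor>x * Suc n\<rfloor>))\<^sup>2)) \<longlonglongrightarrow> ennreal ((deriv g x)\<^sup>2)"
          by (intro tendsto_ennrealI tendsto_power)
        then have "(\<lambda>n. D n x) \<longlonglongrightarrow> ennreal ((deriv g x)\<^sup>2)" using Dv x by simp
        then have "liminf (\<lambda>n. D n x) = ennreal ((deriv g x)\<^sup>2)" by (intro lim_imp_Liminf) auto
        then show ?thesis using True by simp
      qed auto
    qed
  qed
  also have "\<dots> \<le> liminf (\<lambda>n. \<integral>\<^sup>+x. D n x \<partial>lebesgue)" by (rule nn_integral_liminf[OF Dm])
  also have "\<dots> \<le> 1"
  proof -
    have "liminf (\<lambda>n. \<integral>\<^sup>+x. D n x \<partial>lebesgue) \<le> liminf (\<lambda>n. 1::ennreal)"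
      by (rule Liminf_mono) (use D1 in auto)
    then show ?thesis by (simp add: Liminf_const)
  qed
  finally show ?thesis using AC g unfolding strassen_set_def by auto
qed

text \<open>
  This removes derivatives from the definition of the Strassen set, which makes membership easy to check
  for polygons and for rescaled functions.
\<close>

theorem strassen_set_iff_majorant:
  "g \<in> strassen_set \<longleftrightarrow> g \<in> mspace C01 \<and> g 0 = 0 \<and> (\<exists>H. energy_majorant g H)"
proof
  assume "g \<in> strassen_set"
  then show "g \<in> mspace C01 \<and> g 0 = 0 \<and> (\<exists>H. energy_majorant g H)"
    using strassen_set_majorant by (auto simp: strassen_set_def)
next
  assume "g \<in> mspace C01 \<and> g 0 = 0 \<and> (\<exists>H. energy_majorant g H)"
  then obtain H where g: "g \<in> mspace C01" "g 0 = 0" and H: "energy_majorant g H" by blast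
  show "g \<in> strassen_set"
    by (rule strassen_setI_grid[OF g majorant_family[OF H] majorant_grid[OF H]])
qed

lemma strassen_family:
  assumes "g \<in> strassen_set" "finite D" "\<And>x y. (x, y) \<in> D \<Longrightarrow> 0 \<le> x \<and> x \<le> y \<and> y \<le> (1::real)"
    "disjoint_family_on (\<lambda>(x, y). {x<..<y}) D"
  shows "(\<Sum>(x, y)\<in>D. \<bar>g y - g x\<bar>) \<le> sqrt (\<Sum>(x, y)\<in>D. y - x)"
proof -
  obtain H where "energy_majorant g H" using assms(1) strassen_set_majorant by blast
  from majorant_family[OF this assms(2-4)] show ?thesis .
qed

lemma strassen_grid:
  assumes "g \<in> strassen_set" "N > 0"
  shows "(\<Sum>i<N. real N * (g (real (Suc i) / N) - g (real i / N))\<^sup>2) \<le> 1"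
proof -
  obtain H where "energy_majorant g H" using assms(1) strassen_set_majorant by blast
  from majorant_grid[OF this assms(2)] show ?thesis .
qed

lemma strassen_set_holder:
  assumes "g \<in> strassen_set" "s \<in> {0..1}" "t \<in> {0..1}"
  shows "\<bar>g t - g s\<bar> \<le> sqrt \<bar>t - s\<bar>"

proof -
  obtain H where "energy_majorant g H" using assms(1) strassen_set_majorant by blast
  from majorant_holder[OF this assms(2,3)] show ?thesis .
qed

lemma strassen_set_bound: "g \<in> strassen_set \<Longrightarrow> t \<in> {0..1} \<Longrightarrow> \<bar>g t\<bar> \<le> 1"
proof -
  assume g: "g \<in> strassen_set" "t \<in> {0..1}"
  have "\<bar>g t - g 0\<bar> \<le> sqrt \<bar>t - 0\<bar>" by (rule strassen_set_holder) (use g in auto)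
  also have "\<dots> \<le> 1" using g by simp
  finally show "\<bar>g t\<bar> \<le> 1" using g by (simp add: strassen_set_def)
qed

text \<open>
  Arzela-Ascoli with the common Hoelder modulus gives convergent subsequences; the limit stays in the set
  because the criterion \<open>strassen_setI_grid\<close> is closed under pointwise convergence.
\<close>

theorem compactin_strassen_set: "compactin (mtopology_of C01) strassen_set"
proof -
  interpret C: Metric_space "mspace C01" "mdist C01" by (rule Metric_space_mspace_mdist)
  have "compactin C.mtopology strassen_set"
    unfolding C.compactin_sequentially
  proof (intro conjI allI impI)
    show "strassen_set \<subseteq> mspace C01" by (auto simp: strassen_set_def)
    fix \<sigma> :: "nat \<Rightarrow> real \<Rightarrow> real" assume "range \<sigma> \<subseteq> strassen_set"
    then have \<sigma>: "\<sigma> n \<in> strassen_set" for n by auto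
    have equi: "\<exists>d>0. \<forall>n y. y \<in> {0..1} \<and> norm (x - y) < d \<longrightarrow> norm (\<sigma> n x - \<sigma> n y) < e"
      if "x \<in> {0..1}" "0 < e" for x e
    proof (intro exI[of _ "e\<^sup>2"] conjI allI impI)
      fix n y assume y: "y \<in> {0..1} \<and> norm (x - y) < e\<^sup>2"
      have "\<bar>\<sigma> n x - \<sigma> n y\<bar> \<le> sqrt \<bar>x - y\<bar>" using strassen_set_holder[OF \<sigma>, of y x n] that y by simp
      also have "\<dots> < sqrt (e\<^sup>2)" using y by (intro real_sqrt_less_mono) auto
      finally show "norm (\<sigma> n x - \<sigma> n y) < e" using that by simp
    qed (use that in auto)
    have bnd: "norm (\<sigma> n x) \<le> 1" if "x \<in> {0..1}" for n x
      using strassen_set_bound[OF \<sigma> that] by simp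
    obtain g k where g: "continuous_on {0..1} g" and k: "strict_mono (k :: nat \<Rightarrow> nat)"
      and conv: "\<And>e. 0 < e \<Longrightarrow> \<exists>N. \<forall>n x. n \<ge> N \<and> x \<in> {0..1} \<longrightarrow> norm (\<sigma> (k n) x - g x) < e"
      using Arzela_Ascoli[of "{0..1::real}" \<sigma> 1, OF compact_Icc bnd equi] by blast
    define l where "l = restrict g {0..1}"
    have lm: "l \<in> mspace C01" unfolding l_def by (rule restrict_C01[OF g])
    have pt: "(\<lambda>n. \<sigma> (k n) x) \<longlonglongrightarrow> l x" if "x \<in> {0..1}" for x
    proof (rule LIMSEQ_I)
      fix e :: real assume "e > 0"
      then obtain N where "\<And>n x. n \<ge> N \<Longrightarrow> x \<in> {0..1} \<Longrightarrow> norm (\<sigma> (k n) x - g x) < e" using conv by blast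
      then show "\<exists>no. \<forall>n\<ge>no. norm (\<sigma> (k n) x - l x) < e"
        using that by (intro exI[of _ N]) (simp add: l_def)
    qed
    have "l \<in> strassen_set"
    proof (rule strassen_setI_grid[OF lm])
      have "(\<lambda>n. \<sigma> (k n) 0) \<longlonglongrightarrow> l 0" by (rule pt) auto
      moreover have "\<sigma> (k n) 0 = 0" for n using \<sigma> by (auto simp: strassen_set_def)
      ultimately show "l 0 = 0" by (simp add: LIMSEQ_const_iff)
    next
      fix D :: "(real \<times> real) set"
      assume D: "finite D" "\<And>x y. (x, y) \<in> D \<Longrightarrow> 0 \<le> x \<and> x \<le> y \<and> y \<le> (1::real)"
        "disjoint_family_on (\<lambda>(x, y). {x<..<y}) D"
      have "(\<lambda>n. \<Sum>p\<in>D. \<bar>\<sigma> (k n) (snd p) - \<sigma> (k n) (fst p)\<bar>) \<longlonglongrightarrow> (\<Sum>p\<in>D. \<bar>l (snd p) - l (fst p)\<bar>)"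
        using D(2) by (intro tendsto_sum tendsto_rabs tendsto_diff pt) force+
      moreover have "(\<Sum>p\<in>D. \<bar>\<sigma> (k n) (snd p) - \<sigma> (k n) (fst p)\<bar>) \<le> sqrt (\<Sum>(x, y)\<in>D. y - x)" for n
        using strassen_family[OF \<sigma>[of "k n"] D] by (simp add: split_beta)
      ultimately have "(\<Sum>p\<in>D. \<bar>l (snd p) - l (fst p)\<bar>) \<le> sqrt (\<Sum>(x, y)\<in>D. y - x)"
        by (intro LIMSEQ_le_const2) auto
      then show "(\<Sum>(x, y)\<in>D. \<bar>l y - l x\<bar>) \<le> sqrt (\<Sum>(x, y)\<in>D. y - x)" by (simp add: split_beta)
    next
      fix N :: nat assume N: "N > 0"
      have "(\<lambda>n. \<Sum>i<N. real N * (\<sigma> (k n) (real (Suc i) / N) - \<sigma> (k n) (real i / N))\<^sup>2)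
        \<longlonglongrightarrow> (\<Sum>i<N. real N * (l (real (Suc i) / N) - l (real i / N))\<^sup>2)"
        by (intro tendsto_sum tendsto_mult tendsto_const tendsto_power tendsto_diff pt) auto
      moreover have "(\<Sum>i<N. real N * (\<sigma> (k n) (real (Suc i) / N) - \<sigma> (k n) (real i / N))\<^sup>2) \<le> 1" for n
        by (rule strassen_grid[OF \<sigma>[of "k n"] N])
      ultimately show "(\<Sum>i<N. real N * (l (real (Suc i) / N) - l (real i / N))\<^sup>2) \<le> 1"
        by (intro LIMSEQ_le_const2) auto
    qed
    moreover have "limitin C.mtopology (\<sigma> \<circ> k) l sequentially"
      unfolding C.limit_metric_sequentially
    proof (intro conjI lm allI impI)
      fix e :: real assume e: "e > 0"
      obtain N where N: "\<And>n x. n \<ge> N \<Longrightarrow> x \<in> {0..1} \<Longrightarrow> norm (\<sigma> (k n) x - g x) < e / 2"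
        using conv[of "e / 2"] e by auto
      show "\<exists>N. \<forall>n\<ge>N. (\<sigma> \<circ> k) n \<in> mspace C01 \<and> mdist C01 ((\<sigma> \<circ> k) n) l < e"
      proof (intro exI[of _ N] allI impI conjI)
        fix n assume n: "n \<ge> N"
        show sm: "(\<sigma> \<circ> k) n \<in> mspace C01" using \<sigma> by (auto simp: strassen_set_def)
        have "mdist C01 ((\<sigma> \<circ> k) n) l \<le> e / 2"
          unfolding C01_mdist_le[OF sm lm] using N[OF n] by (auto simp: l_def less_imp_le)
        then show "mdist C01 ((\<sigma> \<circ> k) n) l < e" using e by simp
      qed
    qed
    ultimately show "\<exists>l r. l \<in> strassen_set \<and> strict_mono r \<and> limitin C.mtopology (\<sigma> \<circ> r) l sequentially"
      using k by blast
  qed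
  then show ?thesis by (simp add: mtopology_of_def)
qed

text \<open>
  The piecewise linear interpolation of the values \<open>z k\<close> at \<open>k / N\<close>, as a sum of clipped ramps: in this
  form continuity is immediate.
\<close>

definition interp :: "nat \<Rightarrow> (nat \<Rightarrow> real) \<Rightarrow> real \<Rightarrow> real" where
  "interp N z t = z 0 + (\<Sum>i<N. (z (Suc i) - z i) * (real N * (min t (real (Suc i) / N) - min t (real i / N))))"

lemma interp_on_cell:
  assumes "N > 0" "k < N" "real k / N \<le> t" "t \<le> real (Suc k) / N"
  shows "interp N z t = z k + (z (Suc k) - z k) * (real N * (t - real k / N))"
proof -
  have m: "min t (real (Suc i) / N) - min t (real i / N) = (if i < k then 1 / N else if i = k then t - real k / N else 0)" for i
  proof (cases i k rule: linorder_cases)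
    case less
    then have "real (Suc i) / N \<le> real k / N" by (intro divide_right_mono) auto
    moreover have "real i / N \<le> real (Suc i) / N" by (intro divide_right_mono) auto
    ultimately show ?thesis using less assms(3) by (simp add: diff_divide_distrib[symmetric])
  next
    case greater
    then have "real (Suc k) / N \<le> real i / N" by (intro divide_right_mono) auto
    moreover have "real i / N \<le> real (Suc i) / N" by (intro divide_right_mono) auto
    ultimately show ?thesis using greater assms(4) by simp
  qed (use assms in auto)
  have "(\<Sum>i<N. (z (Suc i) - z i) * (real N * (min t (real (Suc i) / N) - min t (real i / N))))
    = (\<Sum>i<N. (if i < k then z (Suc i) - z i else 0) + (if i = k then (z (Suc k) - z k) * (real N * (t - real k / N)) else 0))"
    unfolding m using assms(1) by (intro sum.cong) auto
  also have "\<dots> = (\<Sum>i<N. if i < k then z (Suc i) - z i else 0) + (z (Suc k) - z k) * (real N * (t - real k / N))"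
    using assms(2) by (simp add: sum.distrib)
  also have "(\<Sum>i<N. if i < k then z (Suc i) - z i else 0) = (\<Sum>i<k. z (Suc i) - z i)"
    using assms(2) by (intro sum.mono_neutral_cong_right) auto
  also have "\<dots> = z k - z 0" by (rule sum_lessThan_telescope)
  finally show ?thesis by (simp add: interp_def)
qed

lemma interp_node: "N > 0 \<Longrightarrow> k \<le> N \<Longrightarrow> interp N z (real k / N) = z k"
proof (cases "k < N")
  case True
  assume "N > 0"
  then show ?thesis using interp_on_cell[of N k "real k / N" z] True by (simp add: divide_right_mono)
next
  case False
  assume N: "N > 0" "k \<le> N"
  then obtain j where j: "k = Suc j" "j < N" using False by (cases k) auto
  show ?thesis using interp_on_cell[of N j "real k / N" z] N j by (simp add: divide_right_mono add_divide_distrib)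
qed

lemma continuous_on_interp [continuous_intros]: "continuous_on S (interp N z)"
  unfolding interp_def[abs_def] by (intro continuous_intros)

lemma grid_cell:
  assumes "N > 0" "t \<in> {0..1::real}"
  obtains k where "k < N" "real k / N \<le> t" "t \<le> real (Suc k) / N"
proof (cases "t = 1")
  case True
  then show ?thesis using assms that[of "N - 1"] by (auto simp: of_nat_diff field_simps)
next
  case False
  define k where "k = nat \<lfloor>t * N\<rfloor>"
  have k: "real k \<le> t * N" "t * N < real k + 1" using assms by (auto simp: k_def)
  have "t * N < N" using False assms by simp
  then have "k < N" using k by linarith
  then show ?thesis using that[of k] k assms(1) by (auto simp: field_simps)
qed

text \<open>
  The energy of the polygon, accumulated linearly over each cell, is a majorant; it is itself an
  interpolation.
\<close>

lemma interp_in_strassen_set: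
  assumes N: "N > 0" and z0: "z 0 = 0" and E: "(\<Sum>i<N. real N * (z (Suc i) - z i)\<^sup>2) \<le> 1"
  shows "restrict (interp N z) {0..1} \<in> strassen_set"
proof -
  define m where "m = (\<lambda>i t. min t (real (Suc i) / N) - min t (real i / N))"
  define f where "f = (\<lambda>i. real N * (z (Suc i) - z i))"
  define H where "H = (\<lambda>t. \<Sum>i<N. (f i)\<^sup>2 * m i t)"
  have mm: "m i s \<le> m i t" if "s \<le> t" for i s t
  proof -
    have "real i / N \<le> real (Suc i) / N" by (intro divide_right_mono) auto
    then show ?thesis using that by (auto simp: m_def min_def)
  qed
  have ms: "(\<Sum>i<N. m i t) = t" if "0 \<le> t" "t \<le> 1" for t
    unfolding m_def using sum_lessThan_telescope[of "\<lambda>i. min t (real i / N)" N] that N by simp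
  have gi: "interp N z t = (\<Sum>i<N. f i * m i t)" for t
    by (simp add: interp_def z0 f_def m_def mult.assoc mult.left_commute)
  have "energy_majorant (restrict (interp N z) {0..1}) H"
    unfolding energy_majorant_def
  proof (intro conjI allI impI)
    show "mono_on {0..1} H" unfolding H_def
      by (intro mono_onI sum_mono mult_left_mono mm) auto
    have "m i 1 = 1 / N" "m i 0 = 0" if "i < N" for i
    proof -
      have "real (Suc i) / N \<le> 1" "real i / N \<le> 1" using that by auto
      then show "m i 1 = 1 / N" "m i 0 = 0" by (auto simp: m_def diff_divide_distrib[symmetric])
    qed
    then have "H 1 - H 0 = (\<Sum>i<N. (f i)\<^sup>2 * (1 / N))"
      unfolding H_def by (simp add: sum_subtractf[symmetric])
    also have "\<dots> = (\<Sum>i<N. real N * (z (Suc i) - z i)\<^sup>2)"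
      using N by (intro sum.cong) (auto simp: f_def power2_eq_square)
    finally show "H 1 - H 0 \<le> 1" using E by simp
    fix s t :: real assume st: "0 \<le> s \<and> s \<le> t \<and> t \<le> 1"
    define c where "c = (\<lambda>i. m i t - m i s)"
    have c0: "c i \<ge> 0" for i using mm[of s t i] st by (simp add: c_def)
    have cs: "(\<Sum>i<N. c i) = t - s" using ms[of t] ms[of s] st by (simp add: c_def sum_subtractf)
    have Hc: "H t - H s = (\<Sum>i<N. (f i)\<^sup>2 * c i)" by (simp add: H_def c_def sum_subtractf right_diff_distrib)
    have "interp N z t - interp N z s = (\<Sum>i<N. f i * c i)" by (simp add: gi c_def sum_subtractf right_diff_distrib)
    also have "\<dots> = (\<Sum>i<N. sqrt (c i) * (f i * sqrt (c i)))" using c0 by (intro sum.cong) auto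
    finally have "(interp N z t - interp N z s)\<^sup>2 \<le> (\<Sum>i<N. (sqrt (c i))\<^sup>2) * (\<Sum>i<N. (f i * sqrt (c i))\<^sup>2)"
      using Cauchy_Schwarz_ineq_sum[of "\<lambda>i. sqrt (c i)" "\<lambda>i. f i * sqrt (c i)" "{..<N}"] by simp
    also have "\<dots> = (t - s) * (H t - H s)" using c0 by (simp add: power_mult_distrib Hc cs)
    finally show "(restrict (interp N z) {0..1} t - restrict (interp N z) {0..1} s)\<^sup>2 \<le> (t - s) * (H t - H s)"
      using st by simp
  qed
  moreover have "restrict (interp N z) {0..1} 0 = 0" using interp_node[OF N, of 0 z] z0 by simp
  ultimately show ?thesis
    unfolding strassen_set_iff_majorant using restrict_C01[OF continuous_on_interp] by blast
qed

text \<open>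
  Brownian scaling preserves the energy bound: if \<open>H\<close> is a majorant of \<open>g\<close>, then \<open>H (s * t)\<close> is one of the
  rescaled function.
\<close>

lemma strassen_set_scale:
  assumes g: "g \<in> strassen_set" and s: "0 < s" "s \<le> 1"
  shows "(\<lambda>t\<in>{0..1}. g (s * t) / sqrt s) \<in> strassen_set" (is "?g \<in> _")
proof -
  obtain H where H: "energy_majorant g H" using strassen_set_majorant[OF g] .
  note Hm = H[unfolded energy_majorant_def]
  have gc: "continuous_on {0..1} g" "g 0 = 0" using g by (auto simp: strassen_set_def C01_mspace)
  have le: "0 \<le> s * t" "s * t \<le> 1" if "0 \<le> t" "t \<le> 1" for t
    using that s by (auto intro: mult_le_one)
  have "continuous_on {0..1} (\<lambda>t. g (s * t) / sqrt s)"
    by (intro continuous_intros continuous_on_compose2[OF gc(1)]) (use le s in auto)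
  then have 1: "?g \<in> mspace C01" by (rule restrict_C01)
  have "energy_majorant ?g (\<lambda>t. H (s * t))"
    unfolding energy_majorant_def
  proof (intro conjI allI impI)
    show "mono_on {0..1} (\<lambda>t. H (s * t))"
      using Hm le s by (auto simp: mono_on_def intro: mult_left_mono)
    have "H (s * 1) \<le> H 1" using Hm s by (auto simp: mono_on_def)
    then show "H (s * 1) - H (s * 0) \<le> 1" using Hm by simp
    fix u t :: real assume ut: "0 \<le> u \<and> u \<le> t \<and> t \<le> 1"
    then have "s * u \<le> s * t" using s by (intro mult_left_mono) auto
    then have "(g (s * t) - g (s * u))\<^sup>2 \<le> (s * t - s * u) * (H (s * t) - H (s * u))"
      using Hm le[of t] le[of u] ut by auto
    moreover have "?g t - ?g u = (g (s * t) - g (s * u)) / sqrt s" using ut by (simp add: diff_divide_distrib)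
    ultimately show "(?g t - ?g u)\<^sup>2 \<le> (t - u) * (H (s * t) - H (s * u))"
      using s by (simp add: power_divide pos_divide_le_eq right_diff_distrib[symmetric] mult_ac)
  qed
  moreover have "?g 0 = 0" using gc by simp
  ultimately show ?thesis unfolding strassen_set_iff_majorant using 1 by blast
qed

lemma zero_in_strassen_set: "(\<lambda>t\<in>{0..1}. 0) \<in> strassen_set"
  using interp_in_strassen_set[of 1 "\<lambda>_. 0"] by (simp add: interp_def[abs_def])

text \<open>
  Polygons with rational values at equidistant nodes are dense.
\<close>

theorem separable_C01: "separable_space (mtopology_of C01)"
proof -
  interpret C: Metric_space "mspace C01" "mdist C01" by (rule Metric_space_mspace_mdist)
  define \<phi> where "\<phi> = (\<lambda>(N :: nat, xs :: rat list). restrict (interp N (\<lambda>i. real_of_rat (xs ! i))) {0..1})"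
  have \<phi>m: "\<phi> p \<in> mspace C01" for p
    by (cases p) (auto simp: \<phi>_def intro!: restrict_C01 continuous_on_interp)
  have dense: "\<exists>p. mdist C01 f (\<phi> p) < e" if f: "f \<in> mspace C01" and e: "e > 0" for f e
  proof -
    have fc: "continuous_on {0..1} f" using f by (simp add: C01_mspace)
    then have "uniformly_continuous_on {0..1} f" by (intro compact_uniformly_continuous) auto
    then obtain d where d: "d > 0" "\<And>x y. x \<in> {0..1} \<Longrightarrow> y \<in> {0..1} \<Longrightarrow> dist y x < d \<Longrightarrow> dist (f y) (f x) < e / 4"
      unfolding uniformly_continuous_on_def using e by (metis zero_less_divide_iff zero_less_numeral)
    obtain n where n: "inverse (real (Suc n)) < d" using reals_Archimedean[OF d(1)] by auto
    define N where "N = Suc n"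
    have N: "N > 0" "1 / real N < d" using n by (auto simp: N_def field_simps)
    have "\<exists>q. \<bar>f (real i / N) - real_of_rat q\<bar> < e / 4" for i
    proof -
      obtain q where "f (real i / N) - e / 4 < real_of_rat q" "real_of_rat q < f (real i / N) + e / 4"
        using of_rat_dense[of "f (real i / N) - e / 4" "f (real i / N) + e / 4"] e by auto
      then have "f (real i / N) - real_of_rat q < e / 4" "- (f (real i / N) - real_of_rat q) < e / 4" by linarith+
      then show ?thesis by (intro exI[of _ q]) (simp only: abs_less_iff)
    qed
    then obtain q where q: "\<And>i. \<bar>f (real i / N) - real_of_rat (q i)\<bar> < e / 4" by metis
    define xs where "xs = map q [0..<Suc N]"
    have xs: "xs ! i = q i" if "i \<le> N" for i using that unfolding xs_def by (subst nth_map) (auto simp del: upt_Suc)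
    have "mdist C01 f (\<phi> (N, xs)) \<le> e / 2"
      unfolding C01_mdist_le[OF f \<phi>m]
    proof
      fix t :: real assume t: "t \<in> {0..1}"
      obtain k where k: "k < N" "real k / N \<le> t" "t \<le> real (Suc k) / N" using grid_cell[OF N(1) t] .
      define w where "w = real N * (t - real k / N)"
      have "t - real k / N \<le> 1 / N" using k(3) by (simp add: add_divide_distrib)
      then have "real N * (t - real k / N) \<le> real N * (1 / N)" by (intro mult_left_mono) auto
      then have w: "0 \<le> w" "w \<le> 1" using k N by (auto simp: w_def)
      have "real k / N + 1 / N \<le> 1" using k(1) by (simp add: add_divide_distrib[symmetric])
      moreover have "real (Suc k) / N = real k / N + 1 / N" by (simp add: add_divide_distrib)
      ultimately have "\<bar>f t - f (real k / N)\<bar> < e / 4" "\<bar>f t - f (real (Suc k) / N)\<bar> < e / 4"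
        using d(2)[of "real k / N" t] d(2)[of "real (Suc k) / N" t] t k N
        by (auto simp: dist_real_def)
      then have A: "\<bar>f t - real_of_rat (q k)\<bar> \<le> e / 2" "\<bar>f t - real_of_rat (q (Suc k))\<bar> \<le> e / 2"
        using q[of k] q[of "Suc k"] by linarith+
      have "interp N (\<lambda>i. real_of_rat (xs ! i)) t = real_of_rat (q k) + (real_of_rat (q (Suc k)) - real_of_rat (q k)) * w"
        using interp_on_cell[OF N(1) k] k xs by (simp add: w_def)
      then have "f t - \<phi> (N, xs) t = (1 - w) * (f t - real_of_rat (q k)) + w * (f t - real_of_rat (q (Suc k)))"
        using t by (simp add: \<phi>_def algebra_simps)
      also have "\<bar>\<dots>\<bar> \<le> \<bar>(1 - w) * (f t - real_of_rat (q k))\<bar> + \<bar>w * (f t - real_of_rat (q (Suc k)))\<bar>" by (rule abs_triangle_ineq)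
      also have "\<dots> \<le> (1 - w) * (e / 2) + w * (e / 2)"
        unfolding abs_mult using w A by (intro add_mono mult_mono) auto
      also have "\<dots> = e / 2" by (subst distrib_right[symmetric]) simp
      finally show "\<bar>f t - \<phi> (N, xs) t\<bar> \<le> e / 2" .
    qed
    then show ?thesis using e by (intro exI[of _ "(N, xs)"]) linarith
  qed
  have "C.mtopology closure_of (range \<phi>) = topspace C.mtopology"
  proof (rule antisym)
    show "topspace C.mtopology \<subseteq> C.mtopology closure_of (range \<phi>)"
    proof
      fix f assume "f \<in> topspace C.mtopology"
      then have f: "f \<in> mspace C01" by simp
      show "f \<in> C.mtopology closure_of (range \<phi>)"
        unfolding C.metric_closure_of
        using f dense[OF f] \<phi>m by (auto simp: C.in_mball)
    qed
  qed (rule closure_of_subset_topspace)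
  then have "separable_space C.mtopology"
    unfolding separable_space_def using \<phi>m by (intro exI[of _ "range \<phi>"]) auto
  then show ?thesis by (simp add: mtopology_of_def)
qed


section \<open>Polygonal lines close to functions of the Strassen set\<close>

lemma polyline_head:
  "successively (\<lambda>p q. fst p < fst q) ((x, y) # ps) \<Longrightarrow> polyline ((x, y) # ps) x = y"
  by (cases ps) auto

lemma continuous_on_polyline:
  "successively (\<lambda>p q. fst p < fst q) ps \<Longrightarrow> continuous_on UNIV (polyline ps)"
proof (induction ps rule: induct_list012)
  case (3 p q ps)
  obtain x y x' y' where pq: "p = (x, y)" "q = (x', y')" by (metis surj_pair)
  have IH: "continuous_on UNIV (polyline (q # ps))" using 3 by simp
  have "continuous_on ({..x'} \<union> {x'..}) (\<lambda>t. if t \<le> x' then y + (t - x) / (x' - x) * (y' - y) else polyline (q # ps) t)"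
  proof (rule continuous_on_If)
    show "continuous_on {..x'} (\<lambda>t. y + (t - x) / (x' - x) * (y' - y))"
      using 3(3) pq by (intro continuous_intros) auto
    show "continuous_on {x'..} (polyline (q # ps))" using IH continuous_on_subset by blast
    show "y + (t - x) / (x' - x) * (y' - y) = polyline (q # ps) t" if "t \<in> {..x'}" "\<not> t \<le> x'" for t
      using that by auto
    show "y + (t - x) / (x' - x) * (y' - y) = polyline (q # ps) t" if "t \<in> {x'..}" "t \<le> x'" for t
      using that 3(3) pq polyline_head[of x' y' ps] by auto
  qed auto
  moreover have "({..x'} \<union> {x'..}) = (UNIV :: real set)" by auto
  moreover have "polyline (p # q # ps) = (\<lambda>t. if t \<le> x' then y + (t - x) / (x' - x) * (y' - y) else polyline (q # ps) t)"
    using pq by auto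
  ultimately show ?case by simp
qed (auto simp: split_beta)

text \<open>
  On each edge the value of the polygon is a convex combination of the values at its two ends, which
  are within \<open>\<epsilon>\<close> of \<open>G\<close>, and \<open>G\<close> varies by at most \<open>\<delta>\<close> along the edge.
\<close>

lemma polyline_approx:
  fixes G :: "real \<Rightarrow> real"
  assumes "successively (\<lambda>p q. fst p < fst q \<and> fst q \<le> fst p + \<kappa>) ps" "ps \<noteq> []"
    and "\<And>p. p \<in> set ps \<Longrightarrow> \<bar>snd p - G (fst p)\<bar> \<le> \<epsilon> \<and> fst p \<in> I"
    and G: "\<And>s t. s \<in> I \<Longrightarrow> t \<in> I \<Longrightarrow> \<bar>s - t\<bar> \<le> \<kappa> \<Longrightarrow> \<bar>G s - G t\<bar> \<le> \<delta>"
    and "\<delta> \<ge> 0" "t \<in> I" "fst (hd ps) \<le> t" "t \<le> fst (last ps)"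
  shows "\<bar>polyline ps t - G t\<bar> \<le> \<epsilon> + \<delta>"
  using assms(1-3,7,8)
proof (induction ps rule: induct_list012)
  case (2 p)
  obtain x y where p: "p = (x, y)" by force
  have "t = x" using 2 p by simp
  then show ?case using 2(3)[of p] p \<open>\<delta> \<ge> 0\<close> by auto
next
  case (3 p q ps)
  obtain x y x' y' where pq: "p = (x, y)" "q = (x', y')" by (metis surj_pair)
  have gap: "x < x'" "x' \<le> x + \<kappa>" using 3(3) pq by auto
  show ?case
  proof (cases "t \<le> x'")
    case True
    define w where "w = (t - x) / (x' - x)"
    have xt: "x \<le> t" using 3 pq by simp
    have w: "0 \<le> w" "w \<le> 1" using True gap xt by (auto simp: w_def)
    have P: "\<bar>y - G x\<bar> \<le> \<epsilon>" "x \<in> I" "\<bar>y' - G x'\<bar> \<le> \<epsilon>" "x' \<in> I" using 3(5)[of p] 3(5)[of q] pq by auto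
    have "\<bar>G x - G t\<bar> \<le> \<delta>" by (rule G) (use P \<open>t \<in> I\<close> True gap xt in auto)
    moreover have "\<bar>G x' - G t\<bar> \<le> \<delta>" by (rule G) (use P \<open>t \<in> I\<close> True gap xt in auto)
    ultimately have A: "\<bar>y - G t\<bar> \<le> \<epsilon> + \<delta>" "\<bar>y' - G t\<bar> \<le> \<epsilon> + \<delta>" using P by linarith+
    have "polyline (p # q # ps) t - G t = (1 - w) * (y - G t) + w * (y' - G t)"
      using True pq by (simp add: w_def[symmetric] algebra_simps)
    also have "\<bar>\<dots>\<bar> \<le> \<bar>(1 - w) * (y - G t)\<bar> + \<bar>w * (y' - G t)\<bar>" by (rule abs_triangle_ineq)
    also have "\<dots> \<le> (1 - w) * (\<epsilon> + \<delta>) + w * (\<epsilon> + \<delta>)"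
      unfolding abs_mult using w A by (intro add_mono mult_mono) auto
    also have "\<dots> = \<epsilon> + \<delta>" by (subst distrib_right[symmetric]) simp
    finally show ?thesis .
  next
    case False
    have "\<bar>polyline (q # ps) t - G t\<bar> \<le> \<epsilon> + \<delta>"
      using 3 False pq by (intro 3(2)) auto
    then show ?thesis using False pq by simp
  qed
qed auto

text \<open>
  The vertex list of \<open>u_line\<close> with arbitrary ordinates \<open>s\<close>, so that the approximation lemmas apply to a
  path before and after it is replaced by a simpler one.
\<close>

definition vertices :: "(nat \<Rightarrow> real) \<Rightarrow> (nat \<Rightarrow> real) \<Rightarrow> (nat \<Rightarrow> real) \<Rightarrow> nat \<Rightarrow> (real \<times> real) list" where
  "vertices a lam s m = (0, 0) # map (\<lambda>i. (Bsq a lam i, s i)) (filter (\<lambda>i. a i \<noteq> 0) [1..<Suc m])"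

lemma u_line_vertices:
  "u_line h lam m \<sigma> = polyline (vertices (\<lambda>j. h j 1) lam (\<lambda>i. hsum h \<sigma> i - Acen (\<lambda>j. h j 1) lam i) m)"
  by (simp add: u_line_def vertices_def Let_def)

definition bvar :: "(nat \<Rightarrow> real) \<Rightarrow> (nat \<Rightarrow> real) \<Rightarrow> nat \<Rightarrow> real" where
  "bvar a lam j = (a j)\<^sup>2 * exp (- lam j) * (1 - exp (- lam j))"

lemma Bsq_0 [simp]: "Bsq a lam 0 = 0" by (simp add: Bsq_def)

lemma Bsq_Suc: "Bsq a lam (Suc m) = Bsq a lam m + bvar a lam (Suc m)"
  by (simp add: Bsq_def bvar_def)

context
  fixes a lam :: "nat \<Rightarrow> real"
  assumes lam: "\<And>j. j \<ge> 1 \<Longrightarrow> 0 < lam j"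
begin

lemma bvar_nonneg: "j \<ge> 1 \<Longrightarrow> 0 \<le> bvar a lam j"
  using lam[of j] by (simp add: bvar_def)

lemma bvar_pos: "j \<ge> 1 \<Longrightarrow> a j \<noteq> 0 \<Longrightarrow> 0 < bvar a lam j"
  using lam[of j] by (simp add: bvar_def)

lemma Bsq_mono: "i \<le> j \<Longrightarrow> Bsq a lam i \<le> Bsq a lam j"
  by (induction j rule: dec_induct) (auto simp: Bsq_Suc intro: order_trans[OF _ add_increasing2[OF bvar_nonneg]])

lemma Bsq_nonneg: "0 \<le> Bsq a lam i" using Bsq_mono[of 0 i] by simp

text \<open>
  Vertices are placed only where \<open>a\<close> does not vanish, so consecutive abscissas differ by exactly one
  \<open>bvar\<close>.
\<close>

lemma vertices_props:
  assumes "\<And>j. 1 \<le> j \<Longrightarrow> j \<le> m \<Longrightarrow> bvar a lam j \<le> \<kappa>"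
  shows "successively (\<lambda>p q. fst p < fst q \<and> fst q \<le> fst p + \<kappa>) (vertices a lam s m)
    \<and> fst (last (vertices a lam s m)) = Bsq a lam m"
  using assms
proof (induction m)
  case 0
  show ?case by (simp add: vertices_def)
next
  case (Suc m)
  have IH: "successively (\<lambda>p q. fst p < fst q \<and> fst q \<le> fst p + \<kappa>) (vertices a lam s m)"
    "fst (last (vertices a lam s m)) = Bsq a lam m"
    using Suc by auto
  have nz: "vertices a lam s m \<noteq> []" by (simp add: vertices_def)
  show ?case
  proof (cases "a (Suc m) = 0")
    case True
    then have "vertices a lam s (Suc m) = vertices a lam s m" by (simp add: vertices_def)
    moreover have "Bsq a lam (Suc m) = Bsq a lam m" using True by (simp add: Bsq_Suc bvar_def)
    ultimately show ?thesis using IH by simp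
  next
    case False
    then have V: "vertices a lam s (Suc m) = vertices a lam s m @ [(Bsq a lam (Suc m), s (Suc m))]"
      by (simp add: vertices_def)
    have "Bsq a lam m < Bsq a lam (Suc m)" using bvar_pos[of "Suc m"] False by (simp add: Bsq_Suc)
    moreover have "Bsq a lam (Suc m) \<le> Bsq a lam m + \<kappa>" using Suc(2)[of "Suc m"] by (simp add: Bsq_Suc)
    ultimately show ?thesis using IH nz unfolding V by (simp add: successively_append_iff)
  qed
qed

lemma vertices_increasing: "successively (\<lambda>p q. fst p < fst q) (vertices a lam s m)"
proof -
  have "bvar a lam j \<le> Max (insert 0 (bvar a lam ` {1..m}))" if "1 \<le> j" "j \<le> m" for j
    using that by (intro Max_ge) auto
  from conjunct1[OF vertices_props[OF this]] show ?thesis by (rule successively_mono) auto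
qed

lemma vertices_set: "p \<in> set (vertices a lam s m) \<Longrightarrow> p = (0, 0) \<or> (\<exists>i\<in>{1..m}. p = (Bsq a lam i, s i))"
  by (auto simp: vertices_def)

text \<open>
  Closeness at the vertices extends to the whole polygon because edges are short in time and \<open>g\<close> has
  the Hoelder modulus \<open>sqrt\<close>; this is where \<open>sqrt \<kappa>\<close> comes from.
\<close>

lemma polyline_vertices_near:
  assumes g: "g \<in> strassen_set" and T: "Bsq a lam m > 0" and \<beta>0: "b > 0"
    and near: "\<And>i. 1 \<le> i \<Longrightarrow> i \<le> m \<Longrightarrow> \<bar>s i / b - g (Bsq a lam i / Bsq a lam m)\<bar> \<le> \<epsilon>"
    and gap: "\<And>j. 1 \<le> j \<Longrightarrow> j \<le> m \<Longrightarrow> bvar a lam j \<le> \<kappa> * Bsq a lam m"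
    and t: "t \<in> {0..1}" and e: "\<epsilon> \<ge> 0" "\<kappa> \<ge> 0"
  shows "\<bar>polyline (vertices a lam s m) (Bsq a lam m * t) / b - g t\<bar> \<le> \<epsilon> + sqrt \<kappa>"
proof -
  define V where "V = Bsq a lam m"
  define G where "G = (\<lambda>x. b * g (x / V))"
  have V: "V > 0" using T by (simp add: V_def)
  have g0: "g 0 = 0" using g by (simp add: strassen_set_def)
  have "\<bar>polyline (vertices a lam s m) (V * t) - G (V * t)\<bar> \<le> b * \<epsilon> + b * sqrt \<kappa>"
  proof (rule polyline_approx[where I = "{0..V}" and \<kappa> = "\<kappa> * V"])
    note vp = vertices_props[of m "\<kappa> * V" s, unfolded V_def, OF gap]
    show "successively (\<lambda>p q. fst p < fst q \<and> fst q \<le> fst p + \<kappa> * V) (vertices a lam s m)"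
      using vp unfolding V_def by blast
    show "vertices a lam s m \<noteq> []" "fst (hd (vertices a lam s m)) \<le> V * t" using V t by (auto simp: vertices_def)
    have "fst (last (vertices a lam s m)) = V" using vp unfolding V_def by blast
    then show "V * t \<le> fst (last (vertices a lam s m))" using t V by (simp add: mult_left_le)
    show "\<bar>snd p - G (fst p)\<bar> \<le> b * \<epsilon> \<and> fst p \<in> {0..V}" if p: "p \<in> set (vertices a lam s m)" for p
    proof (cases "p = (0, 0)")
      case True
      then show ?thesis using g0 e \<beta>0 V by (simp add: G_def)
    next
      case False
      then obtain i where i: "i \<in> {1..m}" "p = (Bsq a lam i, s i)" using vertices_set[OF p] by blast
      have "\<bar>s i / b - g (Bsq a lam i / V)\<bar> \<le> \<epsilon>" using near i by (auto simp: V_def)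
      then have "b * \<bar>s i / b - g (Bsq a lam i / V)\<bar> \<le> b * \<epsilon>" using \<beta>0 by simp
      moreover have "b * \<bar>s i / b - g (Bsq a lam i / V)\<bar> = \<bar>s i - G (Bsq a lam i)\<bar>"
      proof -
        have "b * (s i / b - g (Bsq a lam i / V)) = s i - G (Bsq a lam i)"
          using \<beta>0 by (simp add: G_def right_diff_distrib)
        then show ?thesis using abs_mult[of b "s i / b - g (Bsq a lam i / V)"] \<beta>0 by simp
      qed
      ultimately show ?thesis using i Bsq_nonneg[of i] Bsq_mono[of i m] by (simp add: V_def)
    qed
    show "\<bar>G u - G v\<bar> \<le> b * sqrt \<kappa>" if uv: "u \<in> {0..V}" "v \<in> {0..V}" "\<bar>u - v\<bar> \<le> \<kappa> * V" for u v
    proof -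
      have "\<bar>g (u / V) - g (v / V)\<bar> \<le> sqrt \<bar>u / V - v / V\<bar>"
        using uv V by (intro strassen_set_holder[OF g]) auto
      also have "\<bar>u / V - v / V\<bar> = \<bar>u - v\<bar> / V" using V by (simp add: diff_divide_distrib[symmetric])
      also have "sqrt (\<bar>u - v\<bar> / V) \<le> sqrt \<kappa>" using uv V by (intro real_sqrt_le_mono) (simp add: field_simps)
      finally have "b * \<bar>g (u / V) - g (v / V)\<bar> \<le> b * sqrt \<kappa>" using \<beta>0 by simp
      then show ?thesis using \<beta>0 by (simp add: G_def right_diff_distrib[symmetric] abs_mult)
    qed
  qed (use \<beta>0 e t V in \<open>auto simp: mult_left_le\<close>)
  moreover have "G (V * t) = b * g t" using V by (simp add: G_def)
  moreover have "\<bar>x / b - y\<bar> = \<bar>x - b * y\<bar> / b" for x y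
  proof -
    have "x / b - y = (x - b * y) / b" using \<beta>0 by (simp add: diff_divide_distrib)
    then show ?thesis using \<beta>0 by simp
  qed
  ultimately show ?thesis using \<beta>0 by (simp add: V_def[symmetric] field_simps)
qed

lemma polyline_vertices_C01:
  "(\<lambda>t\<in>{0..1}. polyline (vertices a lam s m) (Bsq a lam m * t) / b) \<in> mspace C01"
proof (rule restrict_C01)
  have "continuous_on {0..1} (\<lambda>t. polyline (vertices a lam s m) (Bsq a lam m * t) * inverse b)"
    by (intro continuous_intros continuous_on_compose2[OF continuous_on_polyline[OF vertices_increasing]]) auto
  then show "continuous_on {0..1} (\<lambda>t. polyline (vertices a lam s m) (Bsq a lam m * t) / b)"
    by (simp add: divide_inverse)
qed

end


section \<open>Exponential moments of sums of bounded independent variables\<close>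

lemma exp_quadratic_bounds:
  fixes z :: real
  assumes "\<bar>z\<bar> \<le> \<kappa>" "\<kappa> \<le> 1"
  shows "exp z \<le> 1 + z + (1 + \<kappa>) * z\<^sup>2 / 2" "1 + z + (1 - \<kappa>) * z\<^sup>2 / 2 \<le> exp z"
proof -
  obtain t where t: "\<bar>t\<bar> \<le> \<bar>z\<bar>" "exp z = (\<Sum>m<3. z ^ m / fact m) + exp t / fact 3 * z ^ 3"
    using Maclaurin_exp_le[of z 3] by auto
  have "exp t \<le> exp 1" using t assms by simp
  then have "exp t \<le> 3" using exp_le by linarith
  have "\<bar>exp t / fact 3 * z ^ 3\<bar> = exp t / 6 * (\<bar>z\<bar> * z\<^sup>2)"
    by (simp add: abs_mult fact_numeral power3_eq_cube power2_eq_square)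
  also have "\<dots> \<le> 3 / 6 * (\<kappa> * z\<^sup>2)"
    using \<open>exp t \<le> 3\<close> assms by (intro mult_mono) auto
  finally have 1: "\<bar>exp t / fact 3 * z ^ 3\<bar> \<le> \<kappa> * z\<^sup>2 / 2" by simp
  have 2: "exp z = 1 + z + z\<^sup>2 / 2 + exp t / fact 3 * z ^ 3"
    unfolding t(2) by (simp add: numeral_3_eq_3 power2_eq_square)
  define R P Q where "R = exp t / fact 3 * z ^ 3" and "P = z\<^sup>2 / 2" and "Q = \<kappa> * z\<^sup>2 / 2"
  have R: "\<bar>R\<bar> \<le> Q" "exp z = 1 + z + P + R" unfolding R_def P_def Q_def by (fact 1, fact 2)
  have PQ: "(1 + \<kappa>) * z\<^sup>2 / 2 = P + Q" "(1 - \<kappa>) * z\<^sup>2 / 2 = P - Q"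
    by (simp_all add: P_def Q_def algebra_simps add_divide_distrib diff_divide_distrib)
  show "exp z \<le> 1 + z + (1 + \<kappa>) * z\<^sup>2 / 2" "1 + z + (1 - \<kappa>) * z\<^sup>2 / 2 \<le> exp z"
    unfolding PQ R(2) using R(1) by (auto simp: abs_le_iff)
qed

text \<open>
  \<open>E\<close> is measurable with respect to the coordinates in \<open>A\<close>.  With this notion events of a product measure
  over a large index set need not be pulled back to a smaller one.
\<close>

definition depends_on :: "'i set \<Rightarrow> ('i \<Rightarrow> 'a) set \<Rightarrow> bool" where
  "depends_on A E \<longleftrightarrow> (\<forall>f g. (\<forall>i\<in>A. f i = g i) \<longrightarrow> (f \<in> E \<longleftrightarrow> g \<in> E))"

lemma depends_onD: "depends_on A E \<Longrightarrow> (\<And>i. i \<in> A \<Longrightarrow> f i = g i) \<Longrightarrow> f \<in> E \<longleftrightarrow> g \<in> E"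
  unfolding depends_on_def by blast

lemma depends_on_mono: "depends_on A E \<Longrightarrow> A \<subseteq> B \<Longrightarrow> depends_on B E"
  unfolding depends_on_def by blast

lemma prob_pair_pmf_Times:
  "measure_pmf.prob (pair_pmf p r) (A \<times> B) = measure_pmf.prob p A * measure_pmf.prob r B"
proof -
  have "measure_pmf.prob (pair_pmf p r) (A \<times> B) = measure_pmf.prob (pair_pmf p r) ((A \<inter> set_pmf p) \<times> (B \<inter> set_pmf r))"
    by (intro measure_pmf.finite_measure_eq_AE) (auto simp: AE_measure_pmf_iff)
  also have "\<dots> = measure_pmf.prob p (A \<inter> set_pmf p) * measure_pmf.prob r (B \<inter> set_pmf r)"
    by (intro measure_pmf_prob_product countable_Int2 countable_set_pmf)
  finally show ?thesis by (simp add: measure_Int_set_pmf)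
qed

lemma prob_Pi_pmf_Int:
  assumes "finite A" "finite B" "A \<inter> B = {}" "depends_on A E" "depends_on B F"
  shows "measure_pmf.prob (Pi_pmf (A \<union> B) d q) (E \<inter> F) =
    measure_pmf.prob (Pi_pmf A d q) E * measure_pmf.prob (Pi_pmf B d q) F"
proof -
  have "(\<lambda>(f, g) x. if x \<in> A then f x else g x) -` (E \<inter> F) = E \<times> F"
  proof -
    have "(\<lambda>x. if x \<in> A then f x else g x) \<in> E \<longleftrightarrow> f \<in> E" for f g
      by (rule depends_onD[OF assms(4)]) auto
    moreover have "(\<lambda>x. if x \<in> A then f x else g x) \<in> F \<longleftrightarrow> g \<in> F" for f g
      by (rule depends_onD[OF assms(5)]) (use assms(3) in auto)
    ultimately show ?thesis by auto
  qed
  then show ?thesis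
    unfolding Pi_pmf_union[OF assms(1-3)] by (simp add: prob_pair_pmf_Times)
qed

lemma prob_Pi_pmf_marginal:
  assumes "finite C" "A \<subseteq> C" "depends_on A E"
  shows "measure_pmf.prob (Pi_pmf C d q) E = measure_pmf.prob (Pi_pmf A d q) E"
proof -
  have "A \<union> (C - A) = C" using assms by auto
  then show ?thesis
    using prob_Pi_pmf_Int[where A = A and B = "C - A" and E = E and F = UNIV and d = d and q = q] assms by (auto simp: depends_on_def finite_subset)
qed

lemma prob_Pi_pmf_INT:
  fixes J :: "'k \<Rightarrow> 'i set" and E :: "'k \<Rightarrow> ('i \<Rightarrow> 'a) set"
  assumes "finite I" "\<And>i. i \<in> I \<Longrightarrow> finite (J i)" "disjoint_family_on J I" "\<And>i. i \<in> I \<Longrightarrow> depends_on (J i) (E i)"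
  shows "measure_pmf.prob (Pi_pmf (\<Union>i\<in>I. J i) d q) (\<Inter>i\<in>I. E i) = (\<Prod>i\<in>I. measure_pmf.prob (Pi_pmf (J i) d q) (E i))"
  using assms
proof (induction I rule: finite_induct)
  case (insert i I)
  have dj: "J i \<inter> (\<Union>i\<in>I. J i) = {}" using insert(2,5) by (auto simp: disjoint_family_on_def)
  have dp: "depends_on (\<Union>i\<in>I. J i) (\<Inter>i\<in>I. E i)"
    unfolding depends_on_def
  proof (intro allI impI)
    fix f g :: "'i \<Rightarrow> 'a" assume fg: "\<forall>j\<in>\<Union>i\<in>I. J i. f j = g j"
    have "f \<in> E k \<longleftrightarrow> g \<in> E k" if "k \<in> I" for k
      by (rule depends_onD[OF insert(6)[of k]]) (use that fg in auto)
    then show "f \<in> (\<Inter>i\<in>I. E i) \<longleftrightarrow> g \<in> (\<Inter>i\<in>I. E i)" by auto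
  qed
  have "measure_pmf.prob (Pi_pmf (J i \<union> (\<Union>i\<in>I. J i)) d q) (E i \<inter> (\<Inter>i\<in>I. E i)) =
    measure_pmf.prob (Pi_pmf (J i) d q) (E i) * measure_pmf.prob (Pi_pmf (\<Union>i\<in>I. J i) d q) (\<Inter>i\<in>I. E i)"
    using insert by (intro prob_Pi_pmf_Int dj dp) auto
  moreover have "disjoint_family_on J I" using insert(5) by (auto simp: disjoint_family_on_def)
  ultimately show ?case using insert by simp
qed auto

text \<open>
  The variable \<open>Y j\<close> is a function of the \<open>j\<close>-th coordinate of a product measure with factors \<open>q j\<close>; \<open>dflt\<close>
  is the value of the coordinates outside the index set of the product.
\<close>

locale bounded_array =
  fixes q :: "nat \<Rightarrow> 'a pmf" and Y :: "nat \<Rightarrow> 'a \<Rightarrow> real" and c b :: "nat \<Rightarrow> real" and dflt :: 'a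
  assumes Y_bound: "\<And>j x. j \<ge> 1 \<Longrightarrow> \<bar>Y j x\<bar> \<le> c j"
    and Y_mean: "\<And>j. j \<ge> 1 \<Longrightarrow> measure_pmf.expectation (q j) (Y j) = 0"
    and Y_var: "\<And>j. j \<ge> 1 \<Longrightarrow> measure_pmf.expectation (q j) (\<lambda>x. (Y j x)\<^sup>2) = b j"
begin

lemma c_nonneg: "j \<ge> 1 \<Longrightarrow> 0 \<le> c j"
  using Y_bound[of j undefined] by linarith

lemma int_Y [simp]: "j \<ge> 1 \<Longrightarrow> integrable (measure_pmf (q j)) (Y j)"
  by (rule measure_pmf.integrable_const_bound[of _ "c j"]) (auto simp: Y_bound)

lemma int_Y2 [simp]: "j \<ge> 1 \<Longrightarrow> integrable (measure_pmf (q j)) (\<lambda>x. (Y j x)\<^sup>2)"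
  by (rule measure_pmf.integrable_const_bound[of _ "(c j)\<^sup>2"]) (auto intro!: abs_le_square_iff[THEN iffD1] simp: Y_bound c_nonneg)

lemma int_expY [simp]: "j \<ge> 1 \<Longrightarrow> integrable (measure_pmf (q j)) (\<lambda>x. exp (\<theta> * Y j x))"
proof (rule measure_pmf.integrable_const_bound[of _ "exp (\<bar>\<theta>\<bar> * c j)"])
  assume j: "j \<ge> 1"
  have "\<theta> * Y j x \<le> \<bar>\<theta>\<bar> * c j" for x
  proof -
    have "\<theta> * Y j x \<le> \<bar>\<theta>\<bar> * \<bar>Y j x\<bar>" by (metis abs_ge_self abs_mult)
    also have "\<dots> \<le> \<bar>\<theta>\<bar> * c j" using Y_bound[OF j] by (intro mult_left_mono) auto
    finally show ?thesis .
  qed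
  then show "AE x in measure_pmf (q j). norm (exp (\<theta> * Y j x)) \<le> exp (\<bar>\<theta>\<bar> * c j)" by simp
qed simp

lemma b_nonneg: "j \<ge> 1 \<Longrightarrow> 0 \<le> b j"
  unfolding Y_var[symmetric] by (rule integral_nonneg_AE) auto

lemma b_le: "j \<ge> 1 \<Longrightarrow> b j \<le> (c j)\<^sup>2"
proof -
  assume j: "j \<ge> 1"
  have "measure_pmf.expectation (q j) (\<lambda>x. (Y j x)\<^sup>2) \<le> measure_pmf.expectation (q j) (\<lambda>x. (c j)\<^sup>2)"
    using j by (intro integral_mono) (auto intro!: abs_le_square_iff[THEN iffD1] simp: Y_bound c_nonneg)
  then show ?thesis using Y_var[OF j] by simp
qed

text \<open>
  As long as the argument of the exponential is small, the second-order Taylor expansion has a relative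
  error \<open>\<kappa>\<close>, and \<open>1 + u \<le> exp u\<close> turns it into a Gaussian upper bound.  The second \<open>\<kappa>\<close> in the lower
  bound pays for the reverse inequality \<open>exp (v - v\<^sup>2) \<le> 1 + v\<close>.
\<close>

lemma mgf_bounds:
  assumes j: "j \<ge> 1" and \<kappa>: "\<bar>\<theta>\<bar> * c j \<le> \<kappa>" "\<kappa> \<le> 1"
  shows "measure_pmf.expectation (q j) (\<lambda>x. exp (\<theta> * Y j x)) \<le> exp ((1 + \<kappa>) * \<theta>\<^sup>2 * b j / 2)"
    and "1 \<le> measure_pmf.expectation (q j) (\<lambda>x. exp (\<theta> * Y j x))"
    and "exp ((1 - 2 * \<kappa>) * \<theta>\<^sup>2 * b j / 2) \<le> measure_pmf.expectation (q j) (\<lambda>x. exp (\<theta> * Y j x))"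
proof -
  let ?E = "measure_pmf.expectation (q j)"
  have z: "\<bar>\<theta> * Y j x\<bar> \<le> \<kappa>" for x
    using \<kappa>(1) mult_left_mono[OF Y_bound[OF j, of x], of "\<bar>\<theta>\<bar>"] by (simp add: abs_mult)
  have \<kappa>0: "0 \<le> \<kappa>" using z[of undefined] by linarith
  have lin: "?E (\<lambda>x. 1 + \<theta> * Y j x + K * (\<theta> * Y j x)\<^sup>2 / 2) = 1 + K * \<theta>\<^sup>2 * b j / 2" for K
    using j Y_mean[OF j] Y_var[OF j] by (simp add: power_mult_distrib mult.assoc)
  have intK: "integrable (measure_pmf (q j)) (\<lambda>x. 1 + \<theta> * Y j x + K * (\<theta> * Y j x)\<^sup>2 / 2)" for K
    using j by (simp add: power_mult_distrib mult.assoc)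
  have "?E (\<lambda>x. exp (\<theta> * Y j x)) \<le> ?E (\<lambda>x. 1 + \<theta> * Y j x + (1 + \<kappa>) * (\<theta> * Y j x)\<^sup>2 / 2)"
    using j intK z \<kappa> by (intro integral_mono exp_quadratic_bounds) auto
  also have "\<dots> \<le> exp ((1 + \<kappa>) * \<theta>\<^sup>2 * b j / 2)" unfolding lin by (rule exp_ge_add_one_self)
  finally show "?E (\<lambda>x. exp (\<theta> * Y j x)) \<le> exp ((1 + \<kappa>) * \<theta>\<^sup>2 * b j / 2)" .
  define v where "v = (1 - \<kappa>) * \<theta>\<^sup>2 * b j / 2"
  have v0: "0 \<le> v" using \<kappa> b_nonneg[OF j] by (simp add: v_def)
  have low: "1 + v \<le> ?E (\<lambda>x. exp (\<theta> * Y j x))"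
  proof -
    have "?E (\<lambda>x. 1 + \<theta> * Y j x + (1 - \<kappa>) * (\<theta> * Y j x)\<^sup>2 / 2) \<le> ?E (\<lambda>x. exp (\<theta> * Y j x))"
      using j intK z \<kappa> by (intro integral_mono exp_quadratic_bounds) auto
    then show ?thesis unfolding lin v_def .
  qed
  then show "1 \<le> ?E (\<lambda>x. exp (\<theta> * Y j x))" using v0 by simp
  have "\<theta>\<^sup>2 * b j \<le> \<theta>\<^sup>2 * (c j)\<^sup>2" using b_le[OF j] by (intro mult_left_mono) auto
  also have "\<dots> = (\<bar>\<theta>\<bar> * c j)\<^sup>2" by (simp add: power_mult_distrib)
  also have "\<dots> \<le> \<kappa>\<^sup>2" using \<kappa> c_nonneg[OF j] by (intro power_mono) auto
  also have "\<dots> \<le> \<kappa>" using \<kappa> \<kappa>0 by (simp add: power2_eq_square mult_left_le)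
  finally have tb: "\<theta>\<^sup>2 * b j \<le> \<kappa>" .
  have "v \<le> 1 * \<kappa> / 2" unfolding v_def mult.assoc using tb \<kappa> \<kappa>0 b_nonneg[OF j]
    by (intro divide_right_mono mult_mono) auto
  then have vk: "v \<le> \<kappa> / 2" by simp
  have "exp (v - v\<^sup>2) \<le> 1 + v"
  proof -
    have "v - v\<^sup>2 \<le> ln (1 + v)" using v0 vk \<kappa> by (intro ln_one_plus_pos_lower_bound) auto
    then have "exp (v - v\<^sup>2) \<le> exp (ln (1 + v))" by simp
    then show ?thesis using v0 by simp
  qed
  moreover have "(1 - 2 * \<kappa>) * \<theta>\<^sup>2 * b j / 2 \<le> v - v\<^sup>2"
  proof -
    have "v\<^sup>2 \<le> (\<kappa> / 2) * v" unfolding power2_eq_square by (rule mult_right_mono[OF vk v0])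
    also have "\<dots> \<le> (\<kappa> / 2) * (\<theta>\<^sup>2 * b j / 2)"
    proof (rule mult_left_mono)
      have "(1 - \<kappa>) * (\<theta>\<^sup>2 * b j) \<le> 1 * (\<theta>\<^sup>2 * b j)" using \<kappa>0 b_nonneg[OF j] by (intro mult_right_mono) auto
      then show "v \<le> \<theta>\<^sup>2 * b j / 2" by (simp add: v_def mult.assoc)
    qed (use \<kappa>0 in auto)
    also have "\<dots> \<le> \<kappa> * (\<theta>\<^sup>2 * b j / 2)" using \<kappa>0 b_nonneg[OF j] by (intro mult_right_mono) auto
    finally have "v\<^sup>2 \<le> \<kappa> * (\<theta>\<^sup>2 * b j / 2)" .
    moreover have "v = \<theta>\<^sup>2 * b j / 2 - \<kappa> * (\<theta>\<^sup>2 * b j / 2)" by (simp add: v_def algebra_simps diff_divide_distrib)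
    moreover have "(1 - 2 * \<kappa>) * \<theta>\<^sup>2 * b j / 2 = \<theta>\<^sup>2 * b j / 2 - 2 * (\<kappa> * (\<theta>\<^sup>2 * b j / 2))" by (simp add: algebra_simps diff_divide_distrib)
    ultimately show ?thesis by linarith
  qed
  ultimately have "exp ((1 - 2 * \<kappa>) * \<theta>\<^sup>2 * b j / 2) \<le> 1 + v" by (meson exp_le_cancel_iff order_trans)
  then show "exp ((1 - 2 * \<kappa>) * \<theta>\<^sup>2 * b j / 2) \<le> ?E (\<lambda>x. exp (\<theta> * Y j x))" using low by linarith
qed

lemma block_mgf:
  assumes J: "finite J" "\<And>j. j \<in> J \<Longrightarrow> j \<ge> 1" and \<kappa>: "\<And>j. j \<in> J \<Longrightarrow> \<bar>\<theta>\<bar> * c j \<le> \<kappa>" "\<kappa> \<le> 1"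
  defines "M \<equiv> measure_pmf.expectation (Pi_pmf J dflt q) (\<lambda>x. exp (\<theta> * (\<Sum>j\<in>J. Y j (x j))))"
  shows "M \<le> exp ((1 + \<kappa>) * \<theta>\<^sup>2 * (\<Sum>j\<in>J. b j) / 2)"
    and "exp ((1 - 2 * \<kappa>) * \<theta>\<^sup>2 * (\<Sum>j\<in>J. b j) / 2) \<le> M"
proof -
  have "M = measure_pmf.expectation (Pi_pmf J dflt q) (\<lambda>x. \<Prod>j\<in>J. exp (\<theta> * Y j (x j)))"
    unfolding M_def using J by (simp add: exp_sum sum_distrib_left)
  also have "\<dots> = (\<Prod>j\<in>J. measure_pmf.expectation (q j) (\<lambda>x. exp (\<theta> * Y j x)))"
    using J by (intro expectation_prod_Pi_pmf) auto
  finally have M: "M = (\<Prod>j\<in>J. measure_pmf.expectation (q j) (\<lambda>x. exp (\<theta> * Y j x)))" .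
  have "M \<le> (\<Prod>j\<in>J. exp ((1 + \<kappa>) * \<theta>\<^sup>2 * b j / 2))"
    unfolding M using J \<kappa> by (intro prod_mono conjI mgf_bounds) (auto intro: integral_nonneg_AE)
  also have "\<dots> = exp ((1 + \<kappa>) * \<theta>\<^sup>2 * (\<Sum>j\<in>J. b j) / 2)"
    using J by (simp add: exp_sum[symmetric] sum_distrib_left sum_divide_distrib)
  finally show "M \<le> exp ((1 + \<kappa>) * \<theta>\<^sup>2 * (\<Sum>j\<in>J. b j) / 2)" .
  have "exp ((1 - 2 * \<kappa>) * \<theta>\<^sup>2 * (\<Sum>j\<in>J. b j) / 2) = (\<Prod>j\<in>J. exp ((1 - 2 * \<kappa>) * \<theta>\<^sup>2 * b j / 2))"
    using J by (simp add: exp_sum[symmetric] sum_distrib_left sum_divide_distrib)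
  also have "\<dots> \<le> M" unfolding M using J \<kappa> by (intro prod_mono conjI mgf_bounds) auto
  finally show "exp ((1 - 2 * \<kappa>) * \<theta>\<^sup>2 * (\<Sum>j\<in>J. b j) / 2) \<le> M" .
qed

text \<open>
  Downward induction on the starting index, in place of the submartingale inequality.  For \<open>t \<le> 0\<close> the
  bound is at least one.  Otherwise condition on the first increment: the remaining path has to climb
  the rest of the level.
\<close>

lemma maximal_exponential_aux:
  assumes "r \<le> n" "\<theta> \<ge> 0" "\<kappa> \<le> 1" "\<And>j. r < j \<Longrightarrow> j \<le> n \<Longrightarrow> \<bar>\<theta> * d j\<bar> * c j \<le> \<kappa>"
  shows "emeasure (Pi_pmf {r<..n} dflt q) {x. \<exists>m\<in>{r..n}. t \<le> (\<Sum>j\<in>{r<..m}. d j * Y j (x j))}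
    \<le> ennreal (exp (- \<theta> * t + (1 + \<kappa>) * \<theta>\<^sup>2 * (\<Sum>j\<in>{r<..n}. (d j)\<^sup>2 * b j) / 2))"
  using assms(1,4)
proof (induction r arbitrary: t rule: inc_induct)
  case base
  show ?case
  proof (cases "t \<le> 0")
    case True
    then have "1 \<le> exp (- \<theta> * t)" using assms(2) by (simp add: mult_nonneg_nonpos)
    then show ?thesis by (auto intro!: order_trans[OF measure_pmf.emeasure_le_1])
  qed simp
next
  case (step r)
  define A where "A = {Suc r<..n}"
  have I: "{r<..n} = insert (Suc r) A" "Suc r \<notin> A" "finite A" using step(1,2) by (auto simp: A_def)
  define X where "X = {x :: nat \<Rightarrow> 'a. \<exists>m\<in>{r..n}. t \<le> (\<Sum>j\<in>{r<..m}. d j * Y j (x j))}"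
  define X' where "X' = (\<lambda>t. {x :: nat \<Rightarrow> 'a. \<exists>m\<in>{Suc r..n}. t \<le> (\<Sum>j\<in>A \<inter> {..m}. d j * Y j (x j))})"
  have Am: "A \<inter> {..m} = {Suc r<..m}" if "m \<le> n" for m using that by (auto simp: A_def)
  have C0: "0 \<le> (1 + \<kappa>) * \<theta>\<^sup>2 * (\<Sum>j\<in>{s<..n}. (d j)\<^sup>2 * b j) / 2" for s
  proof -
    have "0 \<le> \<bar>\<theta> * d (Suc r)\<bar> * c (Suc r)" using c_nonneg[of "Suc r"] by simp
    also have "\<dots> \<le> \<kappa>" using step(2) by (intro step(4)) auto
    finally have "0 \<le> \<kappa>" .
    then show ?thesis by (intro divide_nonneg_pos mult_nonneg_nonneg sum_nonneg b_nonneg) auto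
  qed
  show ?case
  proof (cases "t \<le> 0")
    case True
    then have "0 \<le> - \<theta> * t" using assms(2) by (simp add: mult_nonneg_nonpos)
    then have "1 \<le> exp (- \<theta> * t + (1 + \<kappa>) * \<theta>\<^sup>2 * (\<Sum>j\<in>{r<..n}. (d j)\<^sup>2 * b j) / 2)"
      using C0[of r] by simp
    then have "1 \<le> ennreal (exp (- \<theta> * t + (1 + \<kappa>) * \<theta>\<^sup>2 * (\<Sum>j\<in>{r<..n}. (d j)\<^sup>2 * b j) / 2))"
      by (metis ennreal_1 ennreal_leI)
    then show ?thesis by (rule order_trans[OF measure_pmf.emeasure_le_1])
  next
    case False
    have sub: "emeasure (Pi_pmf A dflt q) {f. f(Suc r := y) \<in> X} \<le> emeasure (Pi_pmf A dflt q) (X' (t - d (Suc r) * Y (Suc r) y))" for y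
    proof (rule emeasure_mono)
      show "{f. f(Suc r := y) \<in> X} \<subseteq> X' (t - d (Suc r) * Y (Suc r) y)"
      proof safe
        fix f assume "f(Suc r := y) \<in> X"
        then obtain m where m: "r \<le> m" "m \<le> n" "t \<le> (\<Sum>j\<in>{r<..m}. d j * Y j ((f(Suc r := y)) j))"
          by (auto simp: X_def)
        then have "m \<noteq> r" using False by auto
        then have m': "Suc r \<le> m" using m by simp
        have "{r<..m} = insert (Suc r) {Suc r<..m}" using m' by auto
        then have "(\<Sum>j\<in>{r<..m}. d j * Y j ((f(Suc r := y)) j)) = d (Suc r) * Y (Suc r) y + (\<Sum>j\<in>{Suc r<..m}. d j * Y j ((f(Suc r := y)) j))"
          by simp
        also have "(\<Sum>j\<in>{Suc r<..m}. d j * Y j ((f(Suc r := y)) j)) = (\<Sum>j\<in>{Suc r<..m}. d j * Y j (f j))"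
          by (intro sum.cong) auto
        finally show "f \<in> X' (t - d (Suc r) * Y (Suc r) y)"
          using m m' unfolding X'_def by (auto simp: Am intro!: bexI[of _ m])
      qed
    qed simp
    let ?C = "(1 + \<kappa>) * \<theta>\<^sup>2 * (\<Sum>j\<in>A. (d j)\<^sup>2 * b j) / 2"
    have "emeasure (Pi_pmf {r<..n} dflt q) X = (\<integral>\<^sup>+y. emeasure (Pi_pmf A dflt q) {f. f(Suc r := y) \<in> X} \<partial>q (Suc r))"
      unfolding I(1) Pi_pmf_insert'[OF I(3,2)]
      by (simp add: emeasure_bind_pmf map_pmf_def[symmetric] vimage_def)
    also have "\<dots> \<le> (\<integral>\<^sup>+y. ennreal (exp (- \<theta> * (t - d (Suc r) * Y (Suc r) y) + ?C)) \<partial>q (Suc r))"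
    proof (rule nn_integral_mono)
      fix y
      have "X' s = {x. \<exists>m\<in>{Suc r..n}. s \<le> (\<Sum>j\<in>{Suc r<..m}. d j * Y j (x j))}" for s
        unfolding X'_def by (auto simp: Am)
      then have "emeasure (Pi_pmf A dflt q) (X' s) \<le> ennreal (exp (- \<theta> * s + ?C))" for s
        using step(3)[of s] step(4) unfolding A_def by auto
      then show "emeasure (Pi_pmf A dflt q) {f. f(Suc r := y) \<in> X} \<le> ennreal (exp (- \<theta> * (t - d (Suc r) * Y (Suc r) y) + ?C))"
        using sub[of y] order_trans by blast
    qed
    also have "\<dots> = (\<integral>\<^sup>+y. ennreal (exp (- \<theta> * t + ?C) * exp (\<theta> * d (Suc r) * Y (Suc r) y)) \<partial>q (Suc r))"
      by (simp add: mult_exp_exp algebra_simps)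
    also have "\<dots> = ennreal (measure_pmf.expectation (q (Suc r)) (\<lambda>y. exp (- \<theta> * t + ?C) * exp (\<theta> * d (Suc r) * Y (Suc r) y)))"
      by (rule nn_integral_eq_integral) auto
    also have "\<dots> \<le> ennreal (exp (- \<theta> * t + ?C) * exp ((1 + \<kappa>) * (\<theta> * d (Suc r))\<^sup>2 * b (Suc r) / 2))"
      using step(2) assms(3) step(4)[of "Suc r"] by (auto intro!: ennreal_leI mult_left_mono mgf_bounds)
    also have "exp (- \<theta> * t + ?C) * exp ((1 + \<kappa>) * (\<theta> * d (Suc r))\<^sup>2 * b (Suc r) / 2)
      = exp (- \<theta> * t + (1 + \<kappa>) * \<theta>\<^sup>2 * (\<Sum>j\<in>{r<..n}. (d j)\<^sup>2 * b j) / 2)"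
    proof -
      have "(\<Sum>j\<in>{r<..n}. (d j)\<^sup>2 * b j) = (d (Suc r))\<^sup>2 * b (Suc r) + (\<Sum>j\<in>A. (d j)\<^sup>2 * b j)"
        unfolding I(1) using I by simp
      then show ?thesis by (simp add: mult_exp_exp power_mult_distrib algebra_simps add_divide_distrib)
    qed
    finally show ?thesis unfolding X_def .
  qed
qed

lemma maximal_exponential:
  assumes "\<theta> \<ge> 0" "\<kappa> \<le> 1" "\<And>j. 1 \<le> j \<Longrightarrow> j \<le> n \<Longrightarrow> \<theta> * \<bar>d j\<bar> * c j \<le> \<kappa>"
    and V: "(\<Sum>j=1..n. (d j)\<^sup>2 * b j) \<le> Q" and "0 \<le> \<kappa>"
  shows "measure_pmf.prob (Pi_pmf {1..n} dflt q) {x. \<exists>m\<le>n. t \<le> (\<Sum>j=1..m. d j * Y j (x j))}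
    \<le> exp (- \<theta> * t + (1 + \<kappa>) * \<theta>\<^sup>2 * Q / 2)"
proof -
  have I: "{1..m} = {0<..m}" for m :: nat by auto
  have "emeasure (Pi_pmf {0<..n} dflt q) {x. \<exists>m\<in>{0..n}. t \<le> (\<Sum>j\<in>{0<..m}. d j * Y j (x j))}
    \<le> ennreal (exp (- \<theta> * t + (1 + \<kappa>) * \<theta>\<^sup>2 * (\<Sum>j\<in>{0<..n}. (d j)\<^sup>2 * b j) / 2))"
    using assms(1-3) by (intro maximal_exponential_aux) (auto simp: abs_mult)
  then have "measure_pmf.prob (Pi_pmf {1..n} dflt q) {x. \<exists>m\<le>n. t \<le> (\<Sum>j=1..m. d j * Y j (x j))}
    \<le> exp (- \<theta> * t + (1 + \<kappa>) * \<theta>\<^sup>2 * (\<Sum>j=1..n. (d j)\<^sup>2 * b j) / 2)"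
    unfolding I by (auto simp: measure_pmf.emeasure_eq_measure Bex_def)
  also have "\<dots> \<le> exp (- \<theta> * t + (1 + \<kappa>) * \<theta>\<^sup>2 * Q / 2)"
    using V assms by (auto intro!: divide_right_mono mult_left_mono)
  finally show ?thesis .
qed

end

text \<open>
  Tilting by \<open>\<theta> = x / W\<close> centres \<open>S\<close> at \<open>x\<close>.  The part of the tilted mass outside the window of radius \<open>\<eta>\<close>
  is bounded by moving the tilt by \<open>\<plusminus> \<eta> / W\<close>, and by \<open>big\<close> each of the two sides carries at most a
  quarter of it.  So half of the tilted mass lies in the window, where the density of the tilt is known up to
  \<open>exp (\<bar>\<theta>\<bar> * \<eta>)\<close>.
\<close>

lemma mgf_lower_bound:
  fixes S :: "'b \<Rightarrow> real" and D :: "'b pmf"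
  assumes S: "\<And>x. \<bar>S x\<bar> \<le> K" and W: "W > 0" and \<eta>: "\<eta> > 0" and \<kappa>: "0 \<le> \<kappa>"
    and up: "\<And>\<theta>. \<bar>\<theta>\<bar> \<le> (\<bar>x\<bar> + \<eta>) / W \<Longrightarrow> measure_pmf.expectation D (\<lambda>x. exp (\<theta> * S x)) \<le> exp ((1 + \<kappa>) * \<theta>\<^sup>2 * W / 2)"
    and lo: "\<And>\<theta>. \<bar>\<theta>\<bar> \<le> (\<bar>x\<bar> + \<eta>) / W \<Longrightarrow> exp ((1 - 2 * \<kappa>) * \<theta>\<^sup>2 * W / 2) \<le> measure_pmf.expectation D (\<lambda>x. exp (\<theta> * S x))"
    and big: "2 * W \<le> \<eta>\<^sup>2 / 2 - 2 * \<kappa> * (\<bar>x\<bar> + \<eta>)\<^sup>2"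
  shows "exp (- (1 + 2 * \<kappa>) * x\<^sup>2 / (2 * W) - \<bar>x\<bar> * \<eta> / W) / 2 \<le> measure_pmf.prob D {w. \<bar>S w - x\<bar> \<le> \<eta>}"
proof -
  define \<theta> where "\<theta> = x / W"
  define t where "t = \<eta> / W"
  define E :: "('b \<Rightarrow> real) \<Rightarrow> real" where "E = measure_pmf.expectation D"
  define M where "M = (\<lambda>\<theta>. E (\<lambda>w. exp (\<theta> * S w)))"
  have t: "t > 0" using \<eta> W by (simp add: t_def)
  have int: "integrable (measure_pmf D) (\<lambda>w. exp (\<theta> * S w))" for \<theta>
  proof (rule measure_pmf.integrable_const_bound[of _ "exp (\<bar>\<theta>\<bar> * K)"])
    have "\<theta> * S w \<le> \<bar>\<theta>\<bar> * K" for w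
    proof -
      have "\<theta> * S w \<le> \<bar>\<theta>\<bar> * \<bar>S w\<bar>" by (metis abs_ge_self abs_mult)
      also have "\<dots> \<le> \<bar>\<theta>\<bar> * K" using S by (intro mult_left_mono) auto
      finally show ?thesis .
    qed
    then show "AE w in measure_pmf D. norm (exp (\<theta> * S w)) \<le> exp (\<bar>\<theta>\<bar> * K)" by simp
  qed simp
  define G where "G = {w. \<bar>S w - x\<bar> \<le> \<eta>}"
  (* a pointwise bound according to whether S w lies in the window, above or below it *)
  have pw: "exp (\<theta> * S w) \<le> exp (\<theta> * x + \<bar>\<theta>\<bar> * \<eta>) * indicator G w + exp (- t * (x + \<eta>)) * exp ((\<theta> + t) * S w) + exp (t * (x - \<eta>)) * exp ((\<theta> - t) * S w)" for w
  proof -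
    consider "w \<in> G" | "S w > x + \<eta>" | "S w < x - \<eta>" unfolding G_def by fastforce
    then show ?thesis
    proof cases
      case 1
      have "\<theta> * (S w - x) \<le> \<bar>\<theta>\<bar> * \<bar>S w - x\<bar>" by (metis abs_ge_self abs_mult)
      also have "\<dots> \<le> \<bar>\<theta>\<bar> * \<eta>" using 1 by (intro mult_left_mono) (auto simp: G_def)
      finally have "exp (\<theta> * S w) \<le> exp (\<theta> * x + \<bar>\<theta>\<bar> * \<eta>)" by (simp add: algebra_simps)
      then show ?thesis using 1 by (simp add: add_increasing2)
    next
      case 2
      have "exp (\<theta> * S w) \<le> exp (- t * (x + \<eta>)) * exp ((\<theta> + t) * S w)"
      proof -
        have "0 \<le> t * (S w - x - \<eta>)" using 2 t by (intro mult_nonneg_nonneg) auto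
        then show ?thesis by (simp add: mult_exp_exp algebra_simps)
      qed
      then show ?thesis by (simp add: add_increasing add_increasing2)
    next
      case 3
      have "exp (\<theta> * S w) \<le> exp (t * (x - \<eta>)) * exp ((\<theta> - t) * S w)"
      proof -
        have "0 \<le> t * (x - \<eta> - S w)" using 3 t by (intro mult_nonneg_nonneg) auto
        then show ?thesis by (simp add: mult_exp_exp algebra_simps)
      qed
      then show ?thesis by (simp add: add_increasing)
    qed
  qed
  have "M \<theta> \<le> E (\<lambda>w. exp (\<theta> * x + \<bar>\<theta>\<bar> * \<eta>) * indicator G w + exp (- t * (x + \<eta>)) * exp ((\<theta> + t) * S w) + exp (t * (x - \<eta>)) * exp ((\<theta> - t) * S w))"
    unfolding M_def E_def using int
    by (intro integral_mono pw Bochner_Integration.integrable_add Bochner_Integration.integrable_mult_right) (auto simp: measure_pmf.integrable_const_bound[of _ 1])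
  also have "\<dots> = exp (\<theta> * x + \<bar>\<theta>\<bar> * \<eta>) * measure_pmf.prob D G + exp (- t * (x + \<eta>)) * M (\<theta> + t) + exp (t * (x - \<eta>)) * M (\<theta> - t)"
    unfolding M_def E_def using int by (simp add: measure_pmf.integrable_const_bound[of _ 1])
  finally have main: "M \<theta> \<le> exp (\<theta> * x + \<bar>\<theta>\<bar> * \<eta>) * measure_pmf.prob D G + exp (- t * (x + \<eta>)) * M (\<theta> + t) + exp (t * (x - \<eta>)) * M (\<theta> - t)" .
  have rng: "\<bar>\<theta>\<bar> \<le> (\<bar>x\<bar> + \<eta>) / W" "\<bar>\<theta> + s * t\<bar> \<le> (\<bar>x\<bar> + \<eta>) / W" if "\<bar>s\<bar> = 1" for s
  proof -
    have "\<bar>\<theta>\<bar> = \<bar>x\<bar> / W" "\<bar>s * t\<bar> = \<eta> / W" using W \<eta> that by (auto simp: \<theta>_def t_def abs_mult)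
    then show "\<bar>\<theta>\<bar> \<le> (\<bar>x\<bar> + \<eta>) / W" "\<bar>\<theta> + s * t\<bar> \<le> (\<bar>x\<bar> + \<eta>) / W"
      using W \<eta> by (auto simp: add_divide_distrib intro: order_trans[OF abs_triangle_ineq])
  qed
  have tail: "exp (- s * t * x - t * \<eta>) * M (\<theta> + s * t) \<le> M \<theta> / 4" if s: "\<bar>s\<bar> = 1" for s
  proof -
    define y where "y = \<theta> + s * t"
    have s2: "s * s = 1" using s by (metis abs_mult_self_eq mult_1)
    have y2: "y\<^sup>2 * W \<le> (\<bar>x\<bar> + \<eta>)\<^sup>2 / W"
    proof -
      have "y\<^sup>2 \<le> ((\<bar>x\<bar> + \<eta>) / W)\<^sup>2" using rng(2)[OF s] unfolding y_def by (metis abs_ge_zero power2_abs power_mono)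
      then have "y\<^sup>2 * W \<le> ((\<bar>x\<bar> + \<eta>) / W)\<^sup>2 * W" using W by simp
      then show ?thesis using W by (simp add: power2_eq_square)
    qed
    have th2: "\<theta>\<^sup>2 * W \<le> (\<bar>x\<bar> + \<eta>)\<^sup>2 / W"
    proof -
      have "\<theta>\<^sup>2 \<le> ((\<bar>x\<bar> + \<eta>) / W)\<^sup>2" using rng(1)[OF s] by (metis abs_ge_zero power2_abs power_mono)
      then have "\<theta>\<^sup>2 * W \<le> ((\<bar>x\<bar> + \<eta>) / W)\<^sup>2 * W" using W by simp
      then show ?thesis using W by (simp add: power2_eq_square)
    qed
    (* completing the square *)
    have id: "- s * t * x - t * \<eta> + y\<^sup>2 * W / 2 = \<theta>\<^sup>2 * W / 2 - \<eta>\<^sup>2 / (2 * W)"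
    proof -
      have e1: "x = \<theta> * W" "\<eta> = t * W" using W by (auto simp: \<theta>_def t_def)
      have "y\<^sup>2 = \<theta>\<^sup>2 + 2 * s * t * \<theta> + t\<^sup>2" using s2 by (simp add: y_def power2_eq_square algebra_simps)
      moreover have "\<eta>\<^sup>2 / (2 * W) = t\<^sup>2 * W / 2" using W by (simp add: t_def power2_eq_square)
      ultimately show ?thesis unfolding e1 using W by (simp add: power2_eq_square algebra_simps add_divide_distrib)
    qed
    have "exp (- s * t * x - t * \<eta>) * M y \<le> exp (- s * t * x - t * \<eta>) * exp ((1 + \<kappa>) * y\<^sup>2 * W / 2)"
      unfolding M_def E_def y_def by (intro mult_left_mono up rng s) auto
    also have "\<dots> = exp (- s * t * x - t * \<eta> + y\<^sup>2 * W / 2 + \<kappa> * (y\<^sup>2 * W) / 2)"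
      by (simp add: mult_exp_exp algebra_simps add_divide_distrib)
    also have "\<dots> \<le> exp (- 2 + (1 - 2 * \<kappa>) * \<theta>\<^sup>2 * W / 2)"
    proof -
      have "\<kappa> * (y\<^sup>2 * W) \<le> \<kappa> * ((\<bar>x\<bar> + \<eta>)\<^sup>2 / W)" "\<kappa> * (\<theta>\<^sup>2 * W) \<le> \<kappa> * ((\<bar>x\<bar> + \<eta>)\<^sup>2 / W)" "0 \<le> \<kappa> * ((\<bar>x\<bar> + \<eta>)\<^sup>2 / W)"
        using mult_left_mono[OF y2 \<kappa>] mult_left_mono[OF th2 \<kappa>] \<kappa> W by auto
      moreover have "2 \<le> \<eta>\<^sup>2 / (2 * W) - 2 * (\<kappa> * ((\<bar>x\<bar> + \<eta>)\<^sup>2 / W))"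
        using big W by (simp add: field_simps)
      moreover have "(1 - 2 * \<kappa>) * \<theta>\<^sup>2 * W / 2 = \<theta>\<^sup>2 * W / 2 - \<kappa> * (\<theta>\<^sup>2 * W)" by (simp add: algebra_simps diff_divide_distrib)
      ultimately show ?thesis unfolding id exp_le_cancel_iff by linarith
    qed
    also have "\<dots> = exp (- 2) * exp ((1 - 2 * \<kappa>) * \<theta>\<^sup>2 * W / 2)" by (rule exp_add)
    also have "\<dots> \<le> (1 / 4) * M \<theta>"
    proof (rule mult_mono)
      have "(2::real) \<le> exp 1" using exp_ge_add_one_self[of 1] by simp
      then have "2 * 2 \<le> exp 1 * exp (1::real)" by (intro mult_mono) auto
      then have "4 \<le> exp (2::real)" by (simp add: mult_exp_exp)
      then show "exp (- 2) \<le> 1 / (4::real)" by (simp add: exp_minus field_simps)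
      show "exp ((1 - 2 * \<kappa>) * \<theta>\<^sup>2 * W / 2) \<le> M \<theta>" unfolding M_def E_def by (rule lo[OF rng(1)[OF s]])
    qed auto
    finally show ?thesis by (simp add: y_def)
  qed
  have "exp (- t * (x + \<eta>)) * M (\<theta> + t) \<le> M \<theta> / 4"
  proof -
    have "- t * (x + \<eta>) = - 1 * t * x - t * \<eta>" by (simp add: algebra_simps)
    then show ?thesis using tail[of 1] by simp
  qed
  moreover have "exp (t * (x - \<eta>)) * M (\<theta> - t) \<le> M \<theta> / 4"
  proof -
    have "t * (x - \<eta>) = - (- 1) * t * x - t * \<eta>" by (simp add: algebra_simps)
    then show ?thesis using tail[of "- 1"] by simp
  qed
  ultimately have "M \<theta> / 2 \<le> exp (\<theta> * x + \<bar>\<theta>\<bar> * \<eta>) * measure_pmf.prob D G" using main by linarith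
  then have "exp (- (\<theta> * x + \<bar>\<theta>\<bar> * \<eta>)) * (M \<theta> / 2) \<le> exp (- (\<theta> * x + \<bar>\<theta>\<bar> * \<eta>)) * (exp (\<theta> * x + \<bar>\<theta>\<bar> * \<eta>) * measure_pmf.prob D G)"
    by (intro mult_left_mono) auto
  also have "\<dots> = measure_pmf.prob D G" by (simp only: mult.assoc[symmetric] exp_add[symmetric]) simp
  finally have P: "exp (- (\<theta> * x + \<bar>\<theta>\<bar> * \<eta>)) * (M \<theta> / 2) \<le> measure_pmf.prob D G" .
  have "exp (- (1 + 2 * \<kappa>) * x\<^sup>2 / (2 * W) - \<bar>x\<bar> * \<eta> / W) / 2 = exp (- (\<theta> * x + \<bar>\<theta>\<bar> * \<eta>)) * (exp ((1 - 2 * \<kappa>) * \<theta>\<^sup>2 * W / 2) / 2)"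
  proof -
    define X where "X = x\<^sup>2 / (2 * W)"
    have e1: "\<theta> * x = 2 * X" "(1 - 2 * \<kappa>) * \<theta>\<^sup>2 * W / 2 = (1 - 2 * \<kappa>) * X" "\<bar>\<theta>\<bar> * \<eta> = \<bar>x\<bar> * \<eta> / W"
      "- (1 + 2 * \<kappa>) * x\<^sup>2 / (2 * W) = - (1 + 2 * \<kappa>) * X"
      using W by (auto simp: \<theta>_def power2_eq_square X_def)
    have "- (\<theta> * x + \<bar>\<theta>\<bar> * \<eta>) + (1 - 2 * \<kappa>) * \<theta>\<^sup>2 * W / 2 = - (1 + 2 * \<kappa>) * x\<^sup>2 / (2 * W) - \<bar>x\<bar> * \<eta> / W"
      unfolding e1 by (simp add: algebra_simps)
    then show ?thesis by (simp add: exp_add[symmetric])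
  qed
  also have "\<dots> \<le> exp (- (\<theta> * x + \<bar>\<theta>\<bar> * \<eta>)) * (M \<theta> / 2)"
    using lo[OF rng(1)[of 1]] unfolding M_def E_def by (intro mult_left_mono divide_right_mono) auto
  finally show ?thesis using P unfolding G_def by linarith
qed


section \<open>Iterated logarithms, finite nets and blocks of equal variance\<close>

lemma Lg_ge_1: "1 \<le> Lg x"
  unfolding Lg_def using ln_mono[of "exp 1" "max x (exp 1)"] by simp

lemma Lg_mono: "x \<le> y \<Longrightarrow> Lg x \<le> Lg y"
  unfolding Lg_def by (intro ln_mono) (auto simp: less_max_iff_disj)

lemma Lg_ge_ln: "0 < x \<Longrightarrow> ln x \<le> Lg x"
  unfolding Lg_def by (intro ln_mono) auto

lemma Lg_le_add: "0 < x \<Longrightarrow> x \<le> y \<Longrightarrow> Lg y \<le> Lg x + ln (y / x)"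
proof -
  assume x: "0 < x" "x \<le> y"
  have r: "1 \<le> y / x" using x by simp
  have "y \<le> max x (exp 1) * (y / x)" using x mult_right_mono[of x "max x (exp 1)" "y / x"] by simp
  moreover have "exp 1 \<le> max x (exp 1) * (y / x)"
    using mult_mono[of "exp 1" "max x (exp 1)" 1 "y / x"] r by (simp add: le_max_iff_disj)
  ultimately have "max y (exp 1) \<le> max x (exp 1) * (y / x)" by simp
  then have "ln (max y (exp 1)) \<le> ln (max x (exp 1) * (y / x))"
    by (intro ln_mono) (auto simp: less_max_iff_disj)
  also have "\<dots> = ln (max x (exp 1)) + ln (y / x)"
    using x by (intro ln_mult_pos) (auto simp: less_max_iff_disj)
  finally show ?thesis by (simp add: Lg_def)
qed

lemma Lg_ratio: "0 < x \<Longrightarrow> x \<le> y \<Longrightarrow> Lg y \<le> (y / x) * Lg x"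
proof -
  assume x: "0 < x" "x \<le> y"
  have "Lg y \<le> Lg x + ln (y / x)" by (rule Lg_le_add[OF x])
  also have "ln (y / x) \<le> y / x - 1" using x by (intro ln_le_minus_one) auto
  also have "\<dots> \<le> (y / x - 1) * Lg x" using x Lg_ge_1[of x] mult_left_mono[of 1 "Lg x" "y / x - 1"] by simp
  finally show ?thesis by (simp add: algebra_simps)
qed

lemma LLg_ge_1: "1 \<le> LLg x" by (simp add: LLg_def Lg_ge_1)

lemma LLg_mono: "x \<le> y \<Longrightarrow> LLg x \<le> LLg y" by (simp add: LLg_def Lg_mono)

lemma LLg_ratio: "0 < x \<Longrightarrow> x \<le> y \<Longrightarrow> LLg y \<le> (y / x) * LLg x"
proof -
  assume x: "0 < x" "x \<le> y"
  have p: "0 < Lg x" using Lg_ge_1[of x] by simp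
  have "LLg y \<le> (Lg y / Lg x) * LLg x" unfolding LLg_def by (rule Lg_ratio[OF p Lg_mono[OF x(2)]])
  also have "\<dots> \<le> (y / x) * LLg x"
    using Lg_ratio[OF x] p LLg_ge_1[of x] by (intro mult_right_mono) (auto simp: pos_divide_le_eq)
  finally show ?thesis .
qed

text \<open>
  The iterated logarithm varies slowly: multiplying the argument by a constant changes it by a
  quantity that tends to zero.
\<close>

lemma LLg_le_add: "0 < x \<Longrightarrow> x \<le> y \<Longrightarrow> LLg y \<le> LLg x + ln (y / x) / Lg x"
proof -
  assume x: "0 < x" "x \<le> y"
  have p: "0 < Lg x" using Lg_ge_1[of x] by simp
  have q: "0 < Lg y" using Lg_ge_1[of y] by simp
  have "LLg y \<le> LLg x + ln (Lg y / Lg x)" unfolding LLg_def by (rule Lg_le_add[OF p Lg_mono[OF x(2)]])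
  also have "ln (Lg y / Lg x) \<le> Lg y / Lg x - 1" using p q by (intro ln_le_minus_one) auto
  also have "\<dots> = (Lg y - Lg x) / Lg x" using p by (simp add: diff_divide_distrib)
  also have "\<dots> \<le> ln (y / x) / Lg x" using Lg_le_add[OF x] p by (intro divide_right_mono) auto
  finally show ?thesis by simp
qed

lemma LLg_le_self: "1 \<le> x \<Longrightarrow> LLg x \<le> x"
proof -
  assume x: "1 \<le> x"
  have "Lg 1 = 1" unfolding Lg_def by (simp add: max_absorb2)
  then show ?thesis using LLg_ratio[of 1 x] x by (simp add: LLg_def)
qed

lemma filterlim_Lg: "filterlim Lg at_top at_top"
  by (rule filterlim_at_top_mono[OF ln_at_top]) (auto intro!: eventually_mono[OF eventually_gt_at_top[of 0]] Lg_ge_ln)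

lemma filterlim_LLg: "filterlim LLg at_top at_top"
  unfolding LLg_def[abs_def] by (rule filterlim_compose[OF filterlim_Lg filterlim_Lg])

text \<open>
  Normalise the nonzero points of a fine cubic grid.  A vector of norm \<open>1 + 2 * \<delta>\<close> or more, shortened
  to this norm, is close to a grid point, whose direction detects it.
\<close>

lemma sphere_net:
  fixes \<delta> :: real
  assumes \<delta>: "0 < \<delta>" "\<delta> \<le> 1"
  obtains Vn :: "(nat \<Rightarrow> real) set" where "finite Vn" "\<And>v. v \<in> Vn \<Longrightarrow> (\<Sum>i<N. (v i)\<^sup>2) = 1"
    "\<And>x. (1 + 2 * \<delta>)\<^sup>2 \<le> (\<Sum>i<N. (x i)\<^sup>2) \<Longrightarrow> \<exists>v\<in>Vn. 1 + \<delta> \<le> (\<Sum>i<N. v i * x i)"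
proof -
  define \<rho> where "\<rho> = \<delta> / (2 * (real N + 1))"
  define A where "A = 1 + 2 * \<delta>"
  have \<rho>: "0 < \<rho>" "real N * \<rho> \<le> \<delta> / 2" using \<delta> by (auto simp: \<rho>_def field_simps)
  define K where "K = \<lceil>4 / \<rho>\<rceil>"
  define Z where "Z = PiE {..<N} (\<lambda>_. (\<lambda>k::int. \<rho> * real_of_int k) ` {-K..K})"
  define nrm where "nrm = (\<lambda>z :: nat \<Rightarrow> real. L2_set z {..<N})"
  define Vn where "Vn = (\<lambda>z i. z i / nrm z) ` {z \<in> Z. nrm z \<noteq> 0}"
  have nrm2: "(\<Sum>i<N. (z i)\<^sup>2) = (nrm z)\<^sup>2" for z
    by (simp add: nrm_def L2_set_def sum_nonneg)
  have "finite Z" unfolding Z_def by (intro finite_PiE) auto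
  then have 1: "finite Vn" by (simp add: Vn_def)
  have 2: "(\<Sum>i<N. (v i)\<^sup>2) = 1" if vV: "v \<in> Vn" for v
  proof -
    obtain z where z: "v = (\<lambda>i. z i / nrm z)" "nrm z \<noteq> 0" using vV by (auto simp: Vn_def)
    have "(\<Sum>i<N. (v i)\<^sup>2) = (\<Sum>i<N. (z i)\<^sup>2) / (nrm z)\<^sup>2"
      unfolding z(1) by (simp only: power_divide sum_divide_distrib)
    then show ?thesis unfolding nrm2[of z] using z(2) by simp
  qed
  have 3: "\<exists>v\<in>Vn. 1 + \<delta> \<le> (\<Sum>i<N. v i * x i)" if x: "(1 + 2 * \<delta>)\<^sup>2 \<le> (\<Sum>i<N. (x i)\<^sup>2)" for x
  proof -
    define R where "R = nrm x"
    have A: "1 \<le> A" "A \<le> 3" using \<delta> by (auto simp: A_def)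
    have R0: "0 \<le> R" by (simp add: R_def nrm_def)
    have "A\<^sup>2 \<le> R\<^sup>2" using x by (simp add: nrm2 R_def A_def)
    then have RA: "A \<le> R" using R0 by (rule power2_le_imp_le)
    have Rp: "0 < R" using RA A by simp
    define y where "y = (\<lambda>i. x i * (A / R))"
    have ny: "nrm y = A"
    proof -
      have "(\<Sum>i<N. (y i)\<^sup>2) = (\<Sum>i<N. (x i)\<^sup>2) * (A / R)\<^sup>2"
        unfolding y_def by (simp only: power_mult_distrib sum_distrib_right)
      then have "(nrm y)\<^sup>2 = R\<^sup>2 * (A / R)\<^sup>2" unfolding nrm2 R_def .
      also have "\<dots> = A\<^sup>2" using Rp by (simp add: power_divide)
      finally show ?thesis using A by (simp add: nrm_def)
    qed
    have yi: "\<bar>y i\<bar> \<le> 3" if "i < N" for i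
    proof -
      have "\<bar>y i\<bar> = sqrt ((y i)\<^sup>2)" by simp
      also have "\<dots> \<le> nrm y" unfolding nrm_def L2_set_def
        using that by (intro real_sqrt_le_mono member_le_sum) auto
      finally show ?thesis using ny A by simp
    qed
    define z where "z = (\<lambda>i\<in>{..<N}. \<rho> * real_of_int \<lfloor>y i / \<rho>\<rfloor>)"
    have zy: "\<bar>y i - z i\<bar> \<le> \<rho>" if "i < N" for i
    proof -
      have "real_of_int \<lfloor>y i / \<rho>\<rfloor> \<le> y i / \<rho>" "y i / \<rho> \<le> real_of_int \<lfloor>y i / \<rho>\<rfloor> + 1" by linarith+
      then have "real_of_int \<lfloor>y i / \<rho>\<rfloor> * \<rho> \<le> y i" "y i \<le> (real_of_int \<lfloor>y i / \<rho>\<rfloor> + 1) * \<rho>"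
        by (simp_all only: pos_le_divide_eq[OF \<rho>(1)] pos_divide_le_eq[OF \<rho>(1)])
      then have "\<rho> * real_of_int \<lfloor>y i / \<rho>\<rfloor> \<le> y i" "y i \<le> \<rho> * real_of_int \<lfloor>y i / \<rho>\<rfloor> + \<rho>"
        by (simp_all add: algebra_simps)
      then show ?thesis using that by (simp add: z_def)
    qed
    have "z \<in> Z" unfolding Z_def z_def
    proof (intro restrict_PiE_iff[THEN iffD2] ballI imageI)
      fix i assume "i \<in> {..<N}"
      then have "\<bar>y i\<bar> \<le> 3" using yi by simp
      then have "\<bar>y i / \<rho>\<bar> \<le> 3 / \<rho>" using \<rho>(1) by (simp add: divide_right_mono)
      moreover have "3 / \<rho> + 1 \<le> 4 / \<rho>"
      proof -
        have "\<rho> \<le> \<delta> / 2" unfolding \<rho>_def using \<delta> by (intro divide_left_mono) auto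
        then have "\<rho> \<le> 1" using \<delta> by simp
        then show ?thesis using \<rho>(1) by (simp add: field_simps)
      qed
      ultimately have "\<bar>y i / \<rho>\<bar> + 1 \<le> of_int K" unfolding K_def by linarith
      then have "- of_int K \<le> y i / \<rho>" "y i / \<rho> < of_int K + 1" by linarith+
      then show "\<lfloor>y i / \<rho>\<rfloor> \<in> {-K..K}" by (auto simp: le_floor_iff floor_le_iff)
    qed
    define \<tau> where "\<tau> = \<delta> / 2"
    have nyz: "nrm (\<lambda>i. y i - z i) \<le> \<tau>"
    proof -
      have "nrm (\<lambda>i. y i - z i) \<le> (\<Sum>i<N. \<bar>y i - z i\<bar>)" unfolding nrm_def by (rule L2_set_le_sum_abs)
      also have "\<dots> \<le> (\<Sum>i<N. \<rho>)" using zy by (intro sum_mono) auto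
      finally show ?thesis using \<rho>(2) by (simp add: \<tau>_def)
    qed
    have "(\<Sum>i<N. (y i - z i) * y i) \<le> (\<Sum>i<N. \<bar>y i - z i\<bar> * \<bar>y i\<bar>)" by (intro sum_mono) (metis abs_ge_self abs_mult)
    also have "\<dots> \<le> nrm (\<lambda>i. y i - z i) * nrm y" unfolding nrm_def by (rule L2_set_mult_ineq)
    also have "\<dots> \<le> \<tau> * A" using nyz ny A by (simp add: mult_right_mono)
    finally have "(\<Sum>i<N. (y i - z i) * y i) \<le> \<tau> * A" .
    moreover have "(\<Sum>i<N. z i * y i) = (\<Sum>i<N. (y i)\<^sup>2) - (\<Sum>i<N. (y i - z i) * y i)"
      by (simp add: sum_subtractf[symmetric] power2_eq_square algebra_simps)
    moreover have "(\<Sum>i<N. (y i)\<^sup>2) = A\<^sup>2" by (simp add: nrm2 ny)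
    moreover have "A * (A - \<tau>) = A\<^sup>2 - \<tau> * A" by (simp add: power2_eq_square algebra_simps)
    ultimately have zy': "A * (A - \<tau>) \<le> (\<Sum>i<N. z i * y i)" by linarith
    have nz: "nrm z \<le> A + \<tau>"
    proof -
      have "nrm z = nrm (\<lambda>i. y i + - (y i - z i))" by simp
      also have "\<dots> \<le> nrm y + nrm (\<lambda>i. - (y i - z i))" unfolding nrm_def by (rule L2_set_triangle_ineq)
      also have "nrm (\<lambda>i. - (y i - z i)) = nrm (\<lambda>i. y i - z i)" by (simp add: nrm_def L2_set_def power2_commute)
      finally show ?thesis using ny nyz by simp
    qed
    have \<tau>: "0 < \<tau>" "\<tau> < A" using \<delta> A by (auto simp: \<tau>_def)
    have nz0: "0 < nrm z"
    proof -
      have "nrm z \<noteq> 0"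
      proof
        assume "nrm z = 0"
        then have "(\<Sum>i<N. (z i)\<^sup>2) = 0" by (simp add: nrm2)
        then have "z i = 0" if "i < N" for i using that by (simp add: sum_nonneg_eq_0_iff)
        then have "(\<Sum>i<N. z i * y i) = 0" by simp
        moreover have "0 < A * (A - \<tau>)" using \<tau> A by simp
        ultimately show False using zy' by simp
      qed
      then show ?thesis by (simp add: nrm_def less_le)
    qed
    have "(\<lambda>i. z i / nrm z) \<in> Vn" unfolding Vn_def using \<open>z \<in> Z\<close> nz0 by (intro imageI) auto
    moreover have "1 + \<delta> \<le> (\<Sum>i<N. z i / nrm z * x i)"
    proof -
      have "(A - 2 * \<tau>) * nrm z \<le> (A - 2 * \<tau>) * (A + \<tau>)" using nz \<delta> by (intro mult_left_mono) (auto simp: \<tau>_def A_def)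
      also have "\<dots> \<le> A * (A - \<tau>)" using \<tau> by (simp add: algebra_simps)
      also have "\<dots> \<le> (\<Sum>i<N. z i * y i)" by (rule zy')
      finally have "A - 2 * \<tau> \<le> (\<Sum>i<N. z i * y i) / nrm z" using nz0 by (simp add: pos_le_divide_eq)
      also have "\<dots> = (A / R) * (\<Sum>i<N. z i / nrm z * x i)"
        by (simp add: y_def sum_distrib_left sum_divide_distrib algebra_simps)
      finally have B: "A - 2 * \<tau> \<le> (A / R) * (\<Sum>i<N. z i / nrm z * x i)" .
      have pos: "0 \<le> (\<Sum>i<N. z i / nrm z * x i)"
      proof (rule ccontr)
        assume "\<not> ?thesis"
        then have "(A / R) * (\<Sum>i<N. z i / nrm z * x i) < 0" using A Rp by (intro mult_pos_neg) auto
        moreover have "0 < A - 2 * \<tau>" using \<delta> by (simp add: A_def \<tau>_def)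
        ultimately show False using B by linarith
      qed
      have "(A / R) * (\<Sum>i<N. z i / nrm z * x i) \<le> 1 * (\<Sum>i<N. z i / nrm z * x i)"
        using RA Rp pos by (intro mult_right_mono) auto
      then show ?thesis using B by (simp add: A_def \<tau>_def)
    qed
    ultimately show ?thesis by (intro bexI[of _ "\<lambda>i. z i / nrm z"])
  qed
  show ?thesis using that[OF 1 2 3] .
qed

text \<open>
  For \<open>i < N\<close> the witness \<open>r i\<close> is the first index at which \<open>V\<close> reaches the fraction \<open>i / N\<close> of \<open>V m\<close>; it
  overshoots by at most one term.  The last conclusion is what makes the blocks from \<open>r 1\<close> on
  independent of an initial segment.
\<close>

lemma grid_indices:
  fixes V :: "nat \<Rightarrow> real"
  assumes V: "mono V" "V 0 = 0" and Vm: "V m > 0" and N: "N > 0" and \<kappa>: "0 \<le> \<kappa>"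
    and gap: "\<And>j. j < m \<Longrightarrow> V (Suc j) - V j \<le> \<kappa> * V m"
  obtains r :: "nat \<Rightarrow> nat" where "r 0 = 0" "r N = m" "\<And>i. i \<le> N \<Longrightarrow> r i \<le> m" "\<And>i j. i \<le> j \<Longrightarrow> r i \<le> r j"
    "\<And>i. i \<le> N \<Longrightarrow> V m * (i / N) \<le> V (r i) \<and> V (r i) \<le> V m * (i / N) + \<kappa> * V m"
    "\<And>i l. V l < V m * (i / N) \<Longrightarrow> i \<le> N \<Longrightarrow> l < r i"
proof -
  define s where "s = (\<lambda>i. LEAST r. V m * (i / N) \<le> V r)"
  define r where "r = (\<lambda>i. if i \<ge> N then m else s i)"
  have ex: "V m * (i / N) \<le> V m" if "i \<le> N" for i :: nat
  proof -
    have "real i / N \<le> 1" using that N by simp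
    then have "V m * (i / N) \<le> V m * 1" using Vm by (intro mult_left_mono) auto
    then show ?thesis by simp
  qed
  have sV: "V m * (i / N) \<le> V (s i)" if "i \<le> N" for i unfolding s_def by (rule LeastI[of _ m]) (rule ex[OF that])
  have sle: "s i \<le> l" if "V m * (i / N) \<le> V l" for i l unfolding s_def by (rule Least_le) (rule that)
  have sm: "s i \<le> m" if "i \<le> N" for i by (rule sle[OF ex[OF that]])
  have smono: "s i \<le> s j" if "i \<le> j" "j \<le> N" for i j
  proof (rule sle)
    have "V m * (i / N) \<le> V m * (j / N)" using that Vm by (intro mult_left_mono divide_right_mono) auto
    then show "V m * (i / N) \<le> V (s j)" using sV[OF that(2)] by linarith
  qed
  have s0: "s 0 = 0" using sle[of 0 0] V by simp
  have sup: "V (s i) \<le> V m * (i / N) + \<kappa> * V m" if "i \<le> N" for i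
  proof (cases "s i")
    case 0
    then show ?thesis using V(2) Vm \<kappa> by simp
  next
    case (Suc l)
    have "\<not> V m * (i / N) \<le> V l" using sle[of i l] Suc by auto
    moreover have "l < m" using sm[OF that] Suc by simp
    ultimately show ?thesis using gap[of l] Suc by simp
  qed
  show ?thesis
  proof (rule that[of r])
    show "r 0 = 0" using N s0 by (simp add: r_def)
    show "r N = m" by (simp add: r_def)
    show "r i \<le> m" if "i \<le> N" for i using sm[OF that] by (simp add: r_def)
    show "r i \<le> r j" if "i \<le> j" for i j using that smono[of i j] sm[of i] by (auto simp: r_def)
    show "V m * (i / N) \<le> V (r i) \<and> V (r i) \<le> V m * (i / N) + \<kappa> * V m" if "i \<le> N" for i
    proof (cases "i = N")
      case True
      then show ?thesis using N Vm \<kappa> by (simp add: r_def)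
    qed (use sV[OF that] sup[OF that] that in \<open>auto simp: r_def\<close>)
    show "l < r i" if l: "V l < V m * (i / N)" "i \<le> N" for i l
    proof -
      have "\<not> s i \<le> l" using sV[OF l(2)] l(1) monoD[OF V(1), of "s i" l] by linarith
      moreover have "\<not> m \<le> l" using ex[OF l(2)] l(1) monoD[OF V(1), of m l] by linarith
      ultimately show ?thesis by (simp add: r_def)
    qed
  qed
qed

lemma sum_blocks:
  fixes r :: "nat \<Rightarrow> nat"
  assumes "\<And>i j. i \<le> j \<Longrightarrow> r i \<le> r j"
  shows "(\<Sum>j\<in>{r 0<..r N}. f j) = (\<Sum>i<N. \<Sum>j\<in>{r i<..r (Suc i)}. (f j :: real))"
proof (induction N)
  case (Suc N)
  have "{r 0<..r (Suc N)} = {r 0<..r N} \<union> {r N<..r (Suc N)}" using assms[of 0 N] assms[of N "Suc N"] by auto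
  then have "(\<Sum>j\<in>{r 0<..r (Suc N)}. f j) = (\<Sum>j\<in>{r 0<..r N}. f j) + (\<Sum>j\<in>{r N<..r (Suc N)}. f j)"
    by (simp add: sum.union_disjoint disjoint_iff)
  then show ?case using Suc by simp
qed simp

text \<open>
  The condition \<open>c_small\<close> is Kolmogorov's condition for the law of the iterated logarithm.
\<close>

locale kolmogorov_array = bounded_array q Y c b dflt
  for q :: "nat \<Rightarrow> 'a pmf" and Y :: "nat \<Rightarrow> 'a \<Rightarrow> real" and c b :: "nat \<Rightarrow> real" and dflt :: 'a +
  assumes V_top: "filterlim (\<lambda>m. \<Sum>j=1..m. b j) at_top sequentially"
    and c_small: "(\<lambda>j. c j * sqrt (LLg (sqrt (\<Sum>i=1..j. b i))) / sqrt (\<Sum>i=1..j. b i)) \<longlonglongrightarrow> 0"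
begin

definition V :: "nat \<Rightarrow> real" where "V m = (\<Sum>j=1..m. b j)"
definition L :: "nat \<Rightarrow> real" where "L m = LLg (sqrt (V m))"
definition bet :: "nat \<Rightarrow> real" where "bet m = sqrt (V m) * sqrt (2 * L m)"
definition S :: "(nat \<Rightarrow> 'a) \<Rightarrow> nat \<Rightarrow> real" where "S x m = (\<Sum>j=1..m. Y j (x j))"
definition near :: "nat \<Rightarrow> (nat \<Rightarrow> 'a) \<Rightarrow> real \<Rightarrow> bool" where
  "near m x \<epsilon> \<longleftrightarrow> (\<exists>g\<in>strassen_set. \<forall>i\<le>m. \<bar>S x i / bet m - g (V i / V m)\<bar> \<le> \<epsilon>)"

abbreviation P :: "nat \<Rightarrow> (nat \<Rightarrow> 'a) pmf" where "P n \<equiv> Pi_pmf {1..n} dflt q"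

lemma V_0: "V 0 = 0" by (simp add: V_def)
lemma V_Suc: "V (Suc m) = V m + b (Suc m)" by (simp add: V_def)
lemma V_mono: "mono V" by (rule incseq_SucI) (simp add: V_Suc b_nonneg)
lemma V_le: "i \<le> j \<Longrightarrow> V i \<le> V j" using V_mono by (simp add: mono_def)
lemma V_nonneg: "0 \<le> V m" using V_le[of 0 m] by (simp add: V_0)
lemma V_filterlim: "filterlim V at_top sequentially" using V_top by (simp add: V_def[abs_def])
lemma V_large: "\<exists>m0. \<forall>m\<ge>m0. C \<le> V m"
  using V_filterlim by (auto simp: filterlim_at_top eventually_sequentially)
lemma L_ge_1: "1 \<le> L m" by (simp add: L_def LLg_ge_1)
lemma L_mono: "i \<le> j \<Longrightarrow> L i \<le> L j" by (simp add: L_def LLg_mono V_le)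
lemma bet_sq: "(bet m)\<^sup>2 = 2 * V m * L m"
  using V_nonneg[of m] L_ge_1[of m] by (simp add: bet_def power_mult_distrib)
lemma bet_nonneg: "0 \<le> bet m" using V_nonneg[of m] L_ge_1[of m] by (simp add: bet_def)
lemma bet_pos: "0 < V m \<Longrightarrow> 0 < bet m" using L_ge_1[of m] by (simp add: bet_def)
lemma bet_mono: "i \<le> j \<Longrightarrow> bet i \<le> bet j"
  using V_le[of i j] L_mono[of i j] V_nonneg[of i] L_ge_1[of i] by (auto simp: bet_def intro!: mult_mono)
lemma S_0: "S x 0 = 0" by (simp add: S_def)
lemma S_diff: "i \<le> j \<Longrightarrow> S x j - S x i = (\<Sum>l\<in>{i<..j}. Y l (x l))"
proof -
  assume "i \<le> j"
  then have "{1..j} = {1..i} \<union> {i<..j}" by auto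
  then show ?thesis by (simp add: S_def sum.union_disjoint disjoint_iff)
qed

lemma near_mono: "near m x \<epsilon> \<Longrightarrow> \<epsilon> \<le> \<epsilon>' \<Longrightarrow> near m x \<epsilon>'"
  unfolding near_def by (meson order_trans)

lemma near_depends: "m \<le> n \<Longrightarrow> depends_on {1..n} {x. near m x \<epsilon>}"
proof -
  assume mn: "m \<le> n"
  have eq: "S x i = S y i" if "\<forall>j\<in>{1..n}. x j = y j" "i \<le> m" for x y :: "nat \<Rightarrow> 'a" and i
    unfolding S_def using that mn by (intro sum.cong) auto
  show ?thesis unfolding depends_on_def near_def
  proof (intro allI impI)
    fix f g :: "nat \<Rightarrow> 'a" assume fg: "\<forall>i\<in>{1..n}. f i = g i"
    show "f \<in> {x. \<exists>g\<in>strassen_set. \<forall>i\<le>m. \<bar>S x i / bet m - g (V i / V m)\<bar> \<le> \<epsilon>} \<longleftrightarrow>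
      g \<in> {x. \<exists>g\<in>strassen_set. \<forall>i\<le>m. \<bar>S x i / bet m - g (V i / V m)\<bar> \<le> \<epsilon>}"
      using eq[OF fg] by simp
  qed
qed

text \<open>
  Kolmogorov's condition for the index \<open>j\<close> at its own time \<open>j\<close> persists at all later times, as the variance
  grows faster than its iterated logarithm.  The finitely many early indices are absorbed by the
  growth of \<open>V\<close>.
\<close>

lemma c_uniform:
  assumes "\<kappa> > 0"
  shows "\<exists>m0. \<forall>m\<ge>m0. 1 \<le> V m \<and> (\<forall>j. 1 \<le> j \<and> j \<le> m \<longrightarrow> c j * sqrt (L m) \<le> \<kappa> * sqrt (V m))"
proof -
  have "eventually (\<lambda>j. c j * sqrt (L j) / sqrt (V j) < \<kappa>) sequentially"
    using order_tendstoD(2)[OF c_small assms] by (simp add: L_def V_def)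
  then obtain j1 where j1: "\<And>j. j \<ge> j1 \<Longrightarrow> c j * sqrt (L j) / sqrt (V j) < \<kappa>" by (auto simp: eventually_sequentially)
  obtain j2 where j2: "\<And>j. j \<ge> j2 \<Longrightarrow> 1 \<le> V j" using V_large[of 1] by auto
  define j0 where "j0 = Suc (max j1 j2)"
  define C where "C = (\<Sum>j=1..j0. c j)"
  have C: "0 \<le> C" unfolding C_def by (intro sum_nonneg c_nonneg) auto
  (* both sqrt (L m) and C / \<kappa> are at most the fourth root of V m, so their product is
     at most sqrt (V m) *)
  obtain j3 where j3: "\<And>j. j \<ge> j3 \<Longrightarrow> (C / \<kappa>) ^ 4 \<le> V j" using V_large by auto
  show ?thesis
  proof (intro exI[of _ "max j0 j3"] allI impI conjI)
    fix m assume m: "max j0 j3 \<le> m"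
    show Vm: "1 \<le> V m" using m by (intro j2) (auto simp: j0_def)
    fix j assume j: "1 \<le> j \<and> j \<le> m"
    show "c j * sqrt (L m) \<le> \<kappa> * sqrt (V m)"
    proof (cases "j \<le> j0")
      case True
      have "c j \<le> C" unfolding C_def using True j c_nonneg by (intro member_le_sum) auto
      have "L m \<le> sqrt (V m)" unfolding L_def using Vm by (intro LLg_le_self) auto
      then have Ls: "sqrt (L m) \<le> sqrt (sqrt (V m))" by simp
      have "C / \<kappa> \<le> sqrt (sqrt (V m))"
      proof -
        have "sqrt (sqrt ((C / \<kappa>) ^ 4)) \<le> sqrt (sqrt (V m))" using j3 m by simp
        moreover have "(C / \<kappa>) ^ 4 = ((C / \<kappa>)\<^sup>2)\<^sup>2" by (simp flip: power_mult)
        moreover have "sqrt (((C / \<kappa>)\<^sup>2)\<^sup>2) = (C / \<kappa>)\<^sup>2" by (rule real_sqrt_unique[OF refl]) simp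
        moreover have "sqrt ((C / \<kappa>)\<^sup>2) = C / \<kappa>" by (rule real_sqrt_unique[OF refl]) (use C assms in simp)
        ultimately show ?thesis by metis
      qed
      then have "C \<le> \<kappa> * sqrt (sqrt (V m))" using assms by (simp add: pos_divide_le_eq mult.commute)
      then have "c j \<le> \<kappa> * sqrt (sqrt (V m))" using \<open>c j \<le> C\<close> by simp
      then have "c j * sqrt (L m) \<le> \<kappa> * sqrt (sqrt (V m)) * sqrt (sqrt (V m))"
        using Ls c_nonneg[of j] j L_ge_1[of m] assms Vm by (intro mult_mono) auto
      also have "\<dots> = \<kappa> * sqrt (V m)" using Vm by (simp add: mult.assoc)
      finally show ?thesis .
    next
      case False
      then have Vj: "1 \<le> V j" by (intro j2) (auto simp: j0_def)
      have "c j * sqrt (L j) / sqrt (V j) < \<kappa>" using False by (intro j1) (auto simp: j0_def)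
      then have cj: "c j * sqrt (L j) \<le> \<kappa> * sqrt (V j)" using Vj by (simp add: pos_divide_less_eq less_imp_le)
      have Vjm: "V j \<le> V m" using j by (simp add: V_le)
      have "L m \<le> (sqrt (V m) / sqrt (V j)) * L j" unfolding L_def using Vj Vjm by (intro LLg_ratio) auto
      also have "\<dots> \<le> (V m / V j) * L j"
      proof (rule mult_right_mono)
        have r: "1 \<le> V m / V j" using Vj Vjm by simp
        have "sqrt (V m) / sqrt (V j) = sqrt (V m / V j)" by (simp add: real_sqrt_divide)
        also have "\<dots> \<le> sqrt ((V m / V j)\<^sup>2)" using r by (intro real_sqrt_le_mono self_le_power) auto
        also have "\<dots> = V m / V j" by (rule real_sqrt_unique[OF refl]) (use r in linarith)
        finally show "sqrt (V m) / sqrt (V j) \<le> V m / V j" .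
      qed (use L_ge_1[of j] in auto)
      finally have "sqrt (L m) \<le> sqrt ((V m / V j) * L j)" by (rule real_sqrt_le_mono)
      then have "sqrt (L m) \<le> sqrt (V m / V j) * sqrt (L j)" unfolding real_sqrt_mult .
      then have "c j * sqrt (L m) \<le> c j * (sqrt (V m / V j) * sqrt (L j))"
        using c_nonneg[of j] j by (intro mult_left_mono) auto
      also have "\<dots> = sqrt (V m / V j) * (c j * sqrt (L j))" by simp
      also have "\<dots> \<le> sqrt (V m / V j) * (\<kappa> * sqrt (V j))" using cj V_nonneg by (intro mult_left_mono) auto
      also have "\<dots> = \<kappa> * sqrt (V m)" using Vj by (simp add: real_sqrt_divide)
      finally show ?thesis .
    qed
  qed
qed

lemma b_uniform:
  assumes "0 < \<kappa>" "\<kappa> \<le> 1" "\<And>j. 1 \<le> j \<Longrightarrow> j \<le> m \<Longrightarrow> c j * sqrt (L m) \<le> \<kappa> * sqrt (V m)" "1 \<le> j" "j \<le> m"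
  shows "b j \<le> \<kappa> * V m"
proof -
  have "c j * 1 \<le> c j * sqrt (L m)" using c_nonneg assms L_ge_1[of m] by (intro mult_left_mono) auto
  then have "c j \<le> \<kappa> * sqrt (V m)" using assms(3)[OF assms(4,5)] by simp
  then have "(c j)\<^sup>2 \<le> (\<kappa> * sqrt (V m))\<^sup>2" using c_nonneg assms by (intro power_mono) auto
  also have "\<dots> = \<kappa> * (\<kappa> * V m)" using V_nonneg[of m] by (simp add: power_mult_distrib power2_eq_square)
  also have "\<dots> \<le> 1 * (\<kappa> * V m)" using assms V_nonneg[of m] by (intro mult_right_mono) auto
  finally show ?thesis using b_le[of j] assms by simp
qed

text \<open>
  Restrict the approximating function to \<open>[0, V m / V m']\<close> and rescale.  Brownian scaling accounts for the
  factor \<open>sqrt (V m' / V m)\<close> between the two normalisations, and \<open>\<iota>\<close> for the change of the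
  iterated logarithm.
\<close>

lemma near_descend:
  assumes n: "near m' x \<epsilon>" and mm: "m \<le> m'" and Vm: "0 < V m" and V4: "V m' \<le> 4 * V m"
    and L': "L m' \<le> (1 + \<iota>) * L m" and \<iota>: "0 \<le> \<iota>" "\<iota> \<le> 1" and \<epsilon>: "0 \<le> \<epsilon>"
  shows "near m x (4 * \<epsilon> + \<iota>)"
proof -
  obtain g where g: "g \<in> strassen_set" "\<And>i. i \<le> m' \<Longrightarrow> \<bar>S x i / bet m' - g (V i / V m')\<bar> \<le> \<epsilon>"
    using n by (auto simp: near_def)
  define s where "s = V m / V m'"
  have Vm': "0 < V m'" "V m \<le> V m'" using Vm V_le[OF mm] by auto
  have s: "0 < s" "s \<le> 1" using Vm Vm' by (auto simp: s_def)
  define g' where "g' = (\<lambda>t\<in>{0..1}. g (s * t) / sqrt s)"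
  have g': "g' \<in> strassen_set" unfolding g'_def by (rule strassen_set_scale[OF g(1) s])
  define \<rho> where "\<rho> = bet m' / bet m"
  define l where "l = sqrt (L m' / L m)"
  have bp: "0 < bet m" "0 < bet m'" using Vm Vm' by (auto intro: bet_pos)
  have \<rho>eq: "\<rho> = sqrt (V m' / V m) * l"
    using bp by (simp add: \<rho>_def l_def bet_def real_sqrt_mult real_sqrt_divide)
  have "L m' / L m \<le> 1 + \<iota>" using L' L_ge_1[of m] by (simp add: pos_divide_le_eq)
  moreover have "1 \<le> L m' / L m" using L_mono[OF mm] L_ge_1[of m] by simp
  ultimately have l: "1 \<le> l" "l \<le> 1 + \<iota>"
  proof -
    assume a: "L m' / L m \<le> 1 + \<iota>" "1 \<le> L m' / L m"
    show "1 \<le> l" unfolding l_def using a(2) by simp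
    have "l \<le> sqrt (1 + \<iota>)" unfolding l_def using a(1) by simp
    also have "\<dots> \<le> sqrt ((1 + \<iota>)\<^sup>2)" using \<iota> by (intro real_sqrt_le_mono) (simp add: power2_eq_square algebra_simps)
    finally show "l \<le> 1 + \<iota>" using \<iota> by simp
  qed
  have "sqrt (V m' / V m) \<le> sqrt 4" using V4 Vm by (intro real_sqrt_le_mono) (simp add: pos_divide_le_eq)
  then have sq2: "sqrt (V m' / V m) \<le> 2" by simp
  have \<rho>: "0 < \<rho>" "\<rho> \<le> 4"
  proof -
    show "0 < \<rho>" using bp by (simp add: \<rho>_def)
    have "\<rho> \<le> 2 * 2" unfolding \<rho>eq using sq2 l \<iota> Vm Vm' by (intro mult_mono) auto
    then show "\<rho> \<le> 4" by simp
  qed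
  have "\<bar>S x i / bet m - g' (V i / V m)\<bar> \<le> 4 * \<epsilon> + \<iota>" if i: "i \<le> m" for i
  proof -
    have t: "V i / V m \<in> {0..1}" using V_nonneg[of i] V_le[OF i] Vm by simp
    have st: "s * (V i / V m) = V i / V m'" using Vm by (simp add: s_def)
    have gg: "g (V i / V m') = sqrt s * g' (V i / V m)"
    proof -
      have "g' (V i / V m) = g (s * (V i / V m)) / sqrt s" unfolding g'_def using t by (rule restrict_apply')
      then show ?thesis unfolding st using s by simp
    qed
    have rs: "\<rho> * sqrt s = l" unfolding \<rho>eq s_def using Vm Vm' by (simp add: real_sqrt_divide)
    have "S x i / bet m = \<rho> * (S x i / bet m')" using bp by (simp add: \<rho>_def)
    then have "S x i / bet m - g' (V i / V m) = \<rho> * (S x i / bet m' - g (V i / V m')) + (l - 1) * g' (V i / V m)"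
      unfolding gg rs[symmetric] by (simp add: algebra_simps)
    also have "\<bar>\<dots>\<bar> \<le> \<bar>\<rho> * (S x i / bet m' - g (V i / V m'))\<bar> + \<bar>(l - 1) * g' (V i / V m)\<bar>" by (rule abs_triangle_ineq)
    also have "\<dots> \<le> 4 * \<epsilon> + \<iota> * 1"
      unfolding abs_mult using \<rho> l g(2)[of i] i mm strassen_set_bound[OF g' t] \<epsilon> \<iota>
      by (intro add_mono mult_mono) auto
    finally show ?thesis by simp
  qed
  then show ?thesis unfolding near_def using g' by blast
qed

text \<open>
  The polygon through the path at the block ends, divided by \<open>1 + \<delta>\<close>, has energy at most one.
\<close>

lemma near_from_grid:
  assumes N: "N > 0" and Vm: "0 < V m" and r: "r 0 = 0" "r N = m" "\<And>i. i \<le> N \<Longrightarrow> r i \<le> m" "\<And>i j. i \<le> j \<Longrightarrow> r i \<le> r j"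
    and Vr: "\<And>i. i \<le> N \<Longrightarrow> V m * (real i / real N) \<le> V (r i) \<and> V (r i) \<le> V m * (real i / real N) + \<kappa> * V m"
    and osc: "\<And>i j. i < N \<Longrightarrow> r i \<le> j \<Longrightarrow> j \<le> r (Suc i) \<Longrightarrow> \<bar>S x j - S x (r i)\<bar> \<le> \<epsilon> * bet m"
    and en: "(\<Sum>i<N. (sqrt N * ((S x (r (Suc i)) - S x (r i)) / bet m))\<^sup>2) \<le> (1 + \<delta>)\<^sup>2"
    and pos: "0 \<le> \<epsilon>" "0 \<le> \<delta>" "0 \<le> \<kappa>"
  shows "near m x (\<epsilon> + \<delta> + sqrt (1 / N + \<kappa>))"
proof -
  define z where "z = (\<lambda>i. S x (r i) / bet m / (1 + \<delta>))"
  have bp: "0 < bet m" by (rule bet_pos[OF Vm])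
  have "(\<Sum>i<N. real N * (z (Suc i) - z i)\<^sup>2) = (\<Sum>i<N. (sqrt N * ((S x (r (Suc i)) - S x (r i)) / bet m))\<^sup>2) / (1 + \<delta>)\<^sup>2"
    unfolding sum_divide_distrib by (intro sum.cong refl) (simp add: z_def diff_divide_distrib[symmetric] power_mult_distrib power_divide)
  also have "\<dots> \<le> 1" using en pos by (simp add: divide_le_eq_1)
  finally have E: "(\<Sum>i<N. real N * (z (Suc i) - z i)\<^sup>2) \<le> 1" .
  define g where "g = restrict (interp N z) {0..1}"
  have g: "g \<in> strassen_set" unfolding g_def
    by (rule interp_in_strassen_set[OF N _ E]) (simp add: z_def r(1) S_0)
  have gn: "g (real i / N) = z i" if "i \<le> N" for i
    using that N interp_node[OF N that, of z] by (simp add: g_def)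
  have "\<bar>S x j / bet m - g (V j / V m)\<bar> \<le> \<epsilon> + \<delta> + sqrt (1 / N + \<kappa>)" if j: "j \<le> m" for j
  proof -
    have "\<exists>i<N. r i \<le> j \<and> j \<le> r (Suc i)"
    proof -
      define i where "i = (LEAST i. j \<le> r (Suc i))"
      have ex: "j \<le> r (Suc (N - 1))" using j r(2) N by simp
      have i: "j \<le> r (Suc i)" unfolding i_def by (rule LeastI) (rule ex)
      have "i \<le> N - 1" unfolding i_def by (rule Least_le) (rule ex)
      moreover have "r i \<le> j"
      proof (cases i)
        case (Suc i')
        then have "\<not> j \<le> r (Suc i')" using not_less_Least[of i' "\<lambda>i. j \<le> r (Suc i)"] by (simp add: i_def)
        then show ?thesis using Suc by simp
      qed (simp add: r(1))
      ultimately show ?thesis using i N by (intro exI[of _ i]) auto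
    qed
    then obtain i where i: "i < N" "r i \<le> j" "j \<le> r (Suc i)" by auto
    have "\<bar>(S x j - S x (r i)) / bet m\<bar> \<le> \<epsilon>" using osc[OF i] bp by (simp add: pos_divide_le_eq)
    then have A: "\<bar>S x j / bet m - S x (r i) / bet m\<bar> \<le> \<epsilon>" by (simp add: diff_divide_distrib)
    have iN: "real i / N \<in> {0..1}" using i by simp
    have "S x (r i) / bet m = (1 + \<delta>) * g (real i / N)" using gn[of i] i pos by (simp add: z_def)
    then have "\<bar>S x (r i) / bet m - g (real i / N)\<bar> = \<delta> * \<bar>g (real i / N)\<bar>" using pos by (simp add: algebra_simps abs_mult)
    also have "\<dots> \<le> \<delta> * 1" using strassen_set_bound[OF g iN] pos by (intro mult_left_mono) auto
    finally have B: "\<bar>S x (r i) / bet m - g (real i / N)\<bar> \<le> \<delta>" by simp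
    have t: "V j / V m \<in> {0..1}" using V_nonneg[of j] V_le[OF j] Vm by simp
    have "V m * (real i / N) \<le> V j" using Vr[of i] i V_le[OF i(2)] by auto
    then have lo: "real i / N \<le> V j / V m" using Vm by (simp add: pos_le_divide_eq mult.commute)
    have "V j \<le> V m * (real (Suc i) / N) + \<kappa> * V m" using Vr[of "Suc i"] i V_le[OF i(3)] by auto
    also have "\<dots> = (real (Suc i) / N + \<kappa>) * V m" by (simp add: algebra_simps)
    finally have "V j / V m \<le> real (Suc i) / N + \<kappa>" unfolding pos_divide_le_eq[OF Vm] .
    then have hi: "V j / V m - real i / N \<le> 1 / N + \<kappa>" by (simp add: add_divide_distrib)
    have "\<bar>g (real i / N) - g (V j / V m)\<bar> \<le> sqrt \<bar>real i / N - V j / V m\<bar>" by (rule strassen_set_holder[OF g t iN])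
    also have "\<dots> \<le> sqrt (1 / N + \<kappa>)" using lo hi by (intro real_sqrt_le_mono) auto
    finally show ?thesis using A B by linarith
  qed
  then show ?thesis unfolding near_def using g by blast
qed

end


section \<open>The law of the iterated logarithm: all paths stay near the Strassen set\<close>

context kolmogorov_array
begin

lemma bet_c:
  assumes "c j * sqrt (L m) \<le> \<kappa> * sqrt (V m)" "0 \<le> \<kappa>"
  shows "bet m * c j \<le> 2 * \<kappa> * V m"
proof -
  have "bet m * c j = sqrt 2 * sqrt (V m) * (c j * sqrt (L m))"
    by (simp add: bet_def real_sqrt_mult)
  also have "\<dots> \<le> sqrt 2 * sqrt (V m) * (\<kappa> * sqrt (V m))"
    using assms V_nonneg by (intro mult_left_mono) auto
  also have "\<dots> = sqrt 2 * (\<kappa> * V m)" using V_nonneg[of m] by simp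
  also have "\<dots> \<le> 2 * (\<kappa> * V m)"
    using assms V_nonneg[of m] by (intro mult_right_mono) (auto simp: real_le_lsqrt intro: real_le_lsqrt)
  finally show ?thesis by simp
qed

text \<open>
  For coefficients \<open>d\<close> of unit energy, the exponential bound with the optimal \<open>\<theta> = (1 + \<delta>) * bet m / V m\<close>
  would give the exponent \<open>(1 + \<delta>)\<^sup>2 * L m\<close>.  The slack against \<open>(1 + \<delta>) * L m\<close> absorbs the relative errors
  \<open>\<delta> / 8\<close> of the exponential moments and of the variance.
\<close>

lemma net_bad_event:
  assumes Vm: "0 < V m" and cu: "\<And>j. 1 \<le> j \<Longrightarrow> j \<le> m \<Longrightarrow> c j * sqrt (L m) \<le> \<kappa> * sqrt (V m)"
    and \<delta>: "0 < \<delta>" "\<delta> \<le> 1" and D: "0 \<le> D" "\<And>j. 1 \<le> j \<Longrightarrow> j \<le> m \<Longrightarrow> \<bar>d j\<bar> \<le> D" and \<kappa>: "0 \<le> \<kappa>" "4 * \<kappa> * D \<le> \<delta> / 8"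
    and Q: "(\<Sum>j=1..m. (d j)\<^sup>2 * b j) \<le> (1 + \<delta> / 8) * V m"
  shows "measure_pmf.prob (P m) {x. \<exists>m'\<le>m. (1 + \<delta>) * bet m \<le> (\<Sum>j=1..m'. d j * Y j (x j))} \<le> exp (- (1 + \<delta>) * L m)"
proof -
  define \<theta> where "\<theta> = (1 + \<delta>) * bet m / V m"
  have \<theta>0: "0 \<le> \<theta>" using \<delta> Vm bet_nonneg[of m] by (simp add: \<theta>_def)
  have "measure_pmf.prob (P m) {x. \<exists>m'\<le>m. (1 + \<delta>) * bet m \<le> (\<Sum>j=1..m'. d j * Y j (x j))}
    \<le> exp (- \<theta> * ((1 + \<delta>) * bet m) + (1 + \<delta> / 8) * \<theta>\<^sup>2 * ((1 + \<delta> / 8) * V m) / 2)"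
  proof (rule maximal_exponential[OF \<theta>0 _ _ Q])
    fix j assume j: "1 \<le> j" "j \<le> m"
    have "\<theta> * c j = (1 + \<delta>) * (bet m * c j) / V m" by (simp add: \<theta>_def)
    also have "\<dots> \<le> 2 * (2 * \<kappa> * V m) / V m"
    proof (rule divide_right_mono)
      show "(1 + \<delta>) * (bet m * c j) \<le> 2 * (2 * \<kappa> * V m)"
        by (rule mult_mono) (use bet_c[OF cu[OF j] \<kappa>(1)] \<delta> bet_nonneg[of m] c_nonneg[OF j(1)] in auto)
    qed (use Vm in simp)
    also have "\<dots> = 4 * \<kappa>" using Vm by simp
    finally have tc: "\<theta> * c j \<le> 4 * \<kappa>" .
    have "\<theta> * \<bar>d j\<bar> * c j = (\<theta> * c j) * \<bar>d j\<bar>" by simp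
    also have "\<dots> \<le> 4 * \<kappa> * D" by (rule mult_mono) (use tc D(2)[OF j] \<kappa>(1) in auto)
    finally show "\<theta> * \<bar>d j\<bar> * c j \<le> \<delta> / 8" using \<kappa>(2) by linarith
  qed (use \<delta> in auto)
  also have "\<dots> \<le> exp (- (1 + \<delta>) * L m)"
  proof -
    define G where "G = (1 + \<delta>) * L m"
    define h where "h = (1 + \<delta> / 8)\<^sup>2"
    have bb: "bet m * bet m = 2 * V m * L m" using bet_sq[of m] by (simp add: power2_eq_square)
    have "\<theta> * ((1 + \<delta>) * bet m) = (1 + \<delta>) * (1 + \<delta>) * (bet m * bet m) / V m" by (simp add: \<theta>_def)
    also have red: "(1 + \<delta>) * (1 + \<delta>) * (bet m * bet m) / V m = (1 + \<delta>) * (1 + \<delta>) * (2 * L m)" unfolding bb using Vm by simp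
    finally have e1: "\<theta> * ((1 + \<delta>) * bet m) = 2 * ((1 + \<delta>) * G)" unfolding G_def by (simp only: mult_ac)
    have "\<theta>\<^sup>2 * V m = (1 + \<delta>) * (1 + \<delta>) * (bet m * bet m) / V m" using Vm by (simp add: \<theta>_def power2_eq_square)
    then have e2: "\<theta>\<^sup>2 * V m = 2 * ((1 + \<delta>) * G)" unfolding red G_def by (simp only: mult_ac)
    have "(1 + \<delta> / 8) * \<theta>\<^sup>2 * ((1 + \<delta> / 8) * V m) / 2 = h * (\<theta>\<^sup>2 * V m) / 2"
      by (simp add: h_def power2_eq_square)
    also have "\<dots> = h * ((1 + \<delta>) * G)" unfolding e2 by simp
    finally have e3: "(1 + \<delta> / 8) * \<theta>\<^sup>2 * ((1 + \<delta> / 8) * V m) / 2 = h * ((1 + \<delta>) * G)" .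
    have "- \<theta> * ((1 + \<delta>) * bet m) = - (2 * ((1 + \<delta>) * G))" using e1 by simp
    then have eq: "- \<theta> * ((1 + \<delta>) * bet m) + (1 + \<delta> / 8) * \<theta>\<^sup>2 * ((1 + \<delta> / 8) * V m) / 2 = - (G * ((1 + \<delta>) * (2 - h)))"
      unfolding e3 by (simp add: algebra_simps)
    have dd: "\<delta> * \<delta> \<le> \<delta>" using \<delta> mult_left_le[of \<delta> \<delta>] by simp
    have "h = 1 + \<delta> / 4 + \<delta> * \<delta> / 64" by (simp add: h_def power2_eq_square algebra_simps)
    then have a: "h \<le> 1 + \<delta> / 2" using dd \<delta> by linarith
    have "1 \<le> (1 + \<delta>) * (1 - \<delta> / 2)" using dd by (simp add: algebra_simps)
    also have "\<dots> \<le> (1 + \<delta>) * (2 - h)" using a \<delta> by (intro mult_left_mono) auto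
    finally have "G * 1 \<le> G * ((1 + \<delta>) * (2 - h))"
      using \<delta> L_ge_1[of m] by (intro mult_left_mono) (auto simp: G_def)
    moreover have "- (1 + \<delta>) * L m = - G" by (simp add: G_def algebra_simps)
    ultimately show ?thesis unfolding eq by simp
  qed
  finally show ?thesis .
qed

text \<open>
  Inside one of \<open>N\<close> blocks the variance is of order \<open>V m / N\<close>, so for large \<open>N\<close> an oscillation of
  \<open>\<epsilon> * bet m\<close> is much rarer than the main deviations.
\<close>

lemma osc_bad_event:
  assumes Vm: "0 < V m" and cu: "\<And>j. 1 \<le> j \<Longrightarrow> j \<le> m \<Longrightarrow> c j * sqrt (L m) \<le> \<kappa> * sqrt (V m)"
    and \<epsilon>: "0 < \<epsilon>" "\<epsilon> \<le> 1" and D: "\<And>j. \<bar>d j\<bar> \<le> 1" and N: "8 \<le> \<epsilon>\<^sup>2 * real N" and \<kappa>: "0 \<le> \<kappa>" "real N * \<kappa> \<le> 1"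
    and Q: "(\<Sum>j=1..m. (d j)\<^sup>2 * b j) \<le> 2 * V m / N"
  shows "measure_pmf.prob (P m) {x. \<exists>m'\<le>m. \<epsilon> * bet m \<le> (\<Sum>j=1..m'. d j * Y j (x j))} \<le> exp (- 2 * L m)"
proof -
  have N0: "0 < real N" using N \<epsilon> by (metis less_le_trans mult_zero_right not_gr_zero of_nat_0 of_nat_0_less_iff zero_less_numeral less_irrefl)
  define \<theta> where "\<theta> = \<epsilon> * bet m * N / (4 * V m)"
  have \<theta>0: "0 \<le> \<theta>" using \<epsilon> Vm bet_nonneg[of m] by (simp add: \<theta>_def)
  have "measure_pmf.prob (P m) {x. \<exists>m'\<le>m. \<epsilon> * bet m \<le> (\<Sum>j=1..m'. d j * Y j (x j))}
    \<le> exp (- \<theta> * (\<epsilon> * bet m) + (1 + 1) * \<theta>\<^sup>2 * (2 * V m / N) / 2)"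
  proof (rule maximal_exponential[OF \<theta>0 _ _ Q])
    fix j assume j: "1 \<le> j" "j \<le> m"
    have "\<theta> * c j = \<epsilon> * N * (bet m * c j) / (4 * V m)" by (simp add: \<theta>_def)
    also have "\<dots> \<le> 1 * real N * (2 * \<kappa> * V m) / (4 * V m)"
    proof (rule divide_right_mono)
      have "\<epsilon> * real N \<le> 1 * real N" using \<epsilon> by (intro mult_right_mono) auto
      then show "\<epsilon> * N * (bet m * c j) \<le> 1 * real N * (2 * \<kappa> * V m)"
        by (rule mult_mono) (use bet_c[OF cu[OF j] \<kappa>(1)] bet_nonneg[of m] c_nonneg[OF j(1)] in auto)
    qed (use Vm in simp)
    also have "\<dots> = real N * \<kappa> / 2" using Vm by simp
    also have "\<dots> \<le> 1" using \<kappa> by simp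
    finally have tc: "\<theta> * c j \<le> 1" .
    have "\<theta> * \<bar>d j\<bar> * c j = (\<theta> * c j) * \<bar>d j\<bar>" by simp
    also have "\<dots> \<le> 1 * 1" using tc D by (intro mult_mono) auto
    finally show "\<theta> * \<bar>d j\<bar> * c j \<le> 1" by simp
  qed auto
  also have "- \<theta> * (\<epsilon> * bet m) + (1 + 1) * \<theta>\<^sup>2 * (2 * V m / N) / 2 = - (\<epsilon>\<^sup>2 * N * ((bet m)\<^sup>2 / (8 * V m)))"
    using Vm N0 by (simp add: \<theta>_def power2_eq_square field_simps)
  also have "(bet m)\<^sup>2 / (8 * V m) = L m / 4" using Vm by (simp add: bet_sq)
  also have "exp (- (\<epsilon>\<^sup>2 * N * (L m / 4))) \<le> exp (- 2 * L m)"
  proof -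
    have "8 * (L m / 4) \<le> \<epsilon>\<^sup>2 * N * (L m / 4)" using N L_ge_1[of m] by (intro mult_right_mono) auto
    then show ?thesis by simp
  qed
  finally show ?thesis .
qed

text \<open>
  Two kinds of bad events are excluded: some direction of the net sees a projection of the vector
  of block increments that exceeds one, or the path oscillates inside a block.  Each is a
  statement about partial sums with coefficients that are constant on blocks.
\<close>

lemma upper_single:
  assumes \<epsilon>: "0 < \<epsilon>" "\<epsilon> \<le> 1"
  shows "\<exists>\<delta>>0. \<exists>K\<ge>0. \<exists>m0. \<forall>m\<ge>m0. measure_pmf.prob (P m) {x. \<not> near m x \<epsilon>} \<le> K * exp (- (1 + \<delta>) * L m)"
proof -
  define \<delta> where "\<delta> = \<epsilon> / 8"
  have \<delta>: "0 < \<delta>" "\<delta> \<le> 1" using \<epsilon> by (auto simp: \<delta>_def)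
  (* N makes the modulus sqrt (2 / N) of the Strassen set at most \<epsilon> / 8 *)
  obtain N :: nat where N: "128 / \<epsilon>\<^sup>2 \<le> real N" using real_arch_simple by blast
  have N0: "0 < real N" using N \<epsilon> by (meson divide_pos_pos less_le_trans zero_less_numeral zero_less_power)
  then have N1: "1 \<le> real N" "N > 0" by auto
  have N2: "128 \<le> \<epsilon>\<^sup>2 * real N" using N \<epsilon> by (simp add: pos_divide_le_eq mult.commute)
  define \<kappa> where "\<kappa> = \<epsilon> / (256 * N)"
  have \<kappa>: "0 < \<kappa>" "N * \<kappa> = \<epsilon> / 256" using \<epsilon> N0 by (auto simp: \<kappa>_def)
  have \<kappa>1: "\<kappa> \<le> 1" "\<kappa> \<le> 1 / N"
  proof -
    have "\<kappa> * 1 \<le> \<kappa> * N" using \<kappa> N1 by (intro mult_left_mono) auto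
    moreover have "\<kappa> * N = \<epsilon> / 256" using \<kappa>(2) by (simp only: mult.commute)
    ultimately show "\<kappa> \<le> 1" using \<epsilon> by linarith
    show "\<kappa> \<le> 1 / N" using \<kappa> \<epsilon> N0 by (simp add: pos_le_divide_eq mult.commute)
  qed
  obtain Vn :: "(nat \<Rightarrow> real) set" where Vn: "finite Vn" "\<And>v. v \<in> Vn \<Longrightarrow> (\<Sum>i<N. (v i)\<^sup>2) = 1"
    "\<And>x. (1 + 2 * \<delta>)\<^sup>2 \<le> (\<Sum>i<N. (x i)\<^sup>2) \<Longrightarrow> \<exists>v\<in>Vn. 1 + \<delta> \<le> (\<Sum>i<N. v i * x i)"
    using sphere_net[OF \<delta>, of N] by blast
  obtain m0 where m0: "\<And>m. m0 \<le> m \<Longrightarrow> 1 \<le> V m" "\<And>m j. m0 \<le> m \<Longrightarrow> 1 \<le> j \<Longrightarrow> j \<le> m \<Longrightarrow> c j * sqrt (L m) \<le> \<kappa> * sqrt (V m)"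
    using c_uniform[OF \<kappa>(1)] by blast
  define K where "K = real (card Vn) + 2 * real N"
  have "measure_pmf.prob (P m) {x. \<not> near m x \<epsilon>} \<le> K * exp (- (1 + \<delta>) * L m)" if m: "m0 \<le> m" for m
  proof -
    have Vm: "0 < V m" using m0(1)[OF m] by simp
    have bp: "0 < bet m" by (rule bet_pos[OF Vm])
    note cu = m0(2)[OF m]
    have gap: "V (Suc j) - V j \<le> \<kappa> * V m" if "j < m" for j
      using b_uniform[OF \<kappa>(1) \<kappa>1(1) cu, of "Suc j"] that by (simp add: V_Suc)
    obtain r :: "nat \<Rightarrow> nat" where r: "r 0 = 0" "r N = m" "\<And>i. i \<le> N \<Longrightarrow> r i \<le> m" "\<And>i j. i \<le> j \<Longrightarrow> r i \<le> r j"
      and Vr: "\<And>i. i \<le> N \<Longrightarrow> V m * (i / N) \<le> V (r i) \<and> V (r i) \<le> V m * (i / N) + \<kappa> * V m"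
      using grid_indices[OF V_mono V_0 Vm N1(2) less_imp_le[OF \<kappa>(1)] gap] by metis
    have W: "V (r (Suc i)) - V (r i) \<le> V m / N + \<kappa> * V m" if "i < N" for i
    proof -
      have "V m * (real (Suc i) / N) = V m * (real i / N) + V m / N" by (simp add: add_divide_distrib algebra_simps)
      then show ?thesis using Vr[of i] Vr[of "Suc i"] that by auto
    qed
    have blockV: "(\<Sum>j\<in>{r i<..r (Suc i)}. b j) = V (r (Suc i)) - V (r i)" for i
    proof -
      have "{1..r (Suc i)} = {1..r i} \<union> {r i<..r (Suc i)}" using r(4)[of i "Suc i"] by auto
      then show ?thesis by (simp add: V_def sum.union_disjoint disjoint_iff)
    qed
    have Im: "{1..m} = {r 0<..r N}" using r by auto
    (* the number of the block that contains the index j *)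
    define blk where "blk = (\<lambda>j. LEAST i. j \<le> r (Suc i))"
    have blk: "blk j = i" if "r i < j" "j \<le> r (Suc i)" for i j
      unfolding blk_def
    proof (rule Least_equality)
      fix y assume "j \<le> r (Suc y)"
      then show "i \<le> y" using that r(4)[of "Suc y" i] by (meson leD le_trans not_less_eq_eq)
    qed (rule that(2))
    have blkN: "blk j < N" if "j \<le> m" for j
    proof -
      have "blk j \<le> N - 1" unfolding blk_def by (rule Least_le) (use that r(2) N1 in simp)
      then show ?thesis using N1 by simp
    qed
    (* the projection of the normalised increments on v, written as a sum over single indices *)
    define d where "d = (\<lambda>v j. sqrt N * v (blk j) :: real)"
    define B1 where "B1 = (\<lambda>v. {x. \<exists>m'\<le>m. (1 + \<delta>) * bet m \<le> (\<Sum>j=1..m'. d v j * Y j (x j))})"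
    have dsum: "(\<Sum>j=1..m. d v j * f j) = (\<Sum>i<N. sqrt N * v i * (\<Sum>j\<in>{r i<..r (Suc i)}. f j))" for v f
    proof -
      have "(\<Sum>j=1..m. d v j * f j) = (\<Sum>j\<in>{r 0<..r N}. d v j * f j)" by (simp only: Im)
      also have "\<dots> = (\<Sum>i<N. \<Sum>j\<in>{r i<..r (Suc i)}. d v j * f j)" by (rule sum_blocks[OF r(4)])
      also have "\<dots> = (\<Sum>i<N. sqrt N * v i * (\<Sum>j\<in>{r i<..r (Suc i)}. f j))"
        unfolding sum_distrib_left by (intro sum.cong refl) (auto simp: d_def blk)
      finally show ?thesis .
    qed
    have PB1: "measure_pmf.prob (P m) (B1 v) \<le> exp (- (1 + \<delta>) * L m)" if v: "v \<in> Vn" for v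
      unfolding B1_def
    proof (rule net_bad_event[OF Vm cu \<delta>, where D = "sqrt N"])
      fix j assume j: "1 \<le> j" "j \<le> m"
      have "(v (blk j))\<^sup>2 \<le> (\<Sum>i<N. (v i)\<^sup>2)" using blkN[OF j(2)] by (intro member_le_sum) auto
      then have "\<bar>v (blk j)\<bar> \<le> 1" using Vn(2)[OF v] by (simp add: abs_square_le_1)
      then have "sqrt N * \<bar>v (blk j)\<bar> \<le> sqrt N * 1" by (intro mult_left_mono) auto
      then show "\<bar>d v j\<bar> \<le> sqrt N" by (simp add: d_def abs_mult)
    next
      have "real N * 1 \<le> real N * N" using N1 by (intro mult_left_mono) auto
      then have "sqrt N \<le> sqrt (real N * N)" by (intro real_sqrt_le_mono) simp
      also have "\<dots> = N" by simp
      finally have "\<kappa> * sqrt N \<le> \<kappa> * N" using \<kappa>(1) by (intro mult_left_mono) auto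
      then show "4 * \<kappa> * sqrt N \<le> \<delta> / 8" using \<kappa>(2) \<epsilon> by (simp add: \<delta>_def mult.commute)
    next
      have "(d v j)\<^sup>2 = d (\<lambda>i. sqrt N * (v i)\<^sup>2) j" for j by (simp add: d_def power_mult_distrib)
      then have "(\<Sum>j=1..m. (d v j)\<^sup>2 * b j) = (\<Sum>j=1..m. d (\<lambda>i. sqrt N * (v i)\<^sup>2) j * b j)" by (simp only:)
      also have "\<dots> = (\<Sum>i<N. sqrt N * (sqrt N * (v i)\<^sup>2) * (\<Sum>j\<in>{r i<..r (Suc i)}. b j))" by (rule dsum)
      also have "\<dots> = (\<Sum>i<N. real N * (v i)\<^sup>2 * (V (r (Suc i)) - V (r i)))"
        by (simp add: blockV mult.assoc[symmetric])
      also have "\<dots> \<le> (\<Sum>i<N. real N * (v i)\<^sup>2 * (V m / N + \<kappa> * V m))"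
        using W by (intro sum_mono mult_left_mono) auto
      also have "\<dots> = (\<Sum>i<N. (v i)\<^sup>2) * (real N * (V m / N + \<kappa> * V m))" by (simp add: sum_distrib_right sum_distrib_left mult_ac)
      also have "\<dots> = V m + (N * \<kappa>) * V m" using Vn(2)[OF v] N0 by (simp add: distrib_left)
      also have "\<dots> \<le> (1 + \<delta> / 8) * V m"
        unfolding \<kappa>(2) using \<epsilon> Vm by (simp add: \<delta>_def distrib_right)
      finally show "(\<Sum>j=1..m. (d v j)\<^sup>2 * b j) \<le> (1 + \<delta> / 8) * V m" .
    qed (use \<kappa> in auto)
    (* the increments inside block i with the sign s; both signs together bound the
       oscillation *)
    define e where "e = (\<lambda>i (s::real) j. if r i < j \<and> j \<le> r (Suc i) then s else 0)"
    define B2 where "B2 = (\<lambda>i s. {x. \<exists>m'\<le>m. \<epsilon> / 4 * bet m \<le> (\<Sum>j=1..m'. e i s j * Y j (x j))})"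
    have PB2: "measure_pmf.prob (P m) (B2 i s) \<le> exp (- (1 + \<delta>) * L m)" if i: "i < N" and s: "\<bar>s\<bar> = 1" for i s
    proof -
      have "measure_pmf.prob (P m) (B2 i s) \<le> exp (- 2 * L m)"
        unfolding B2_def
      proof (rule osc_bad_event[OF Vm cu])
        have "(e i s j)\<^sup>2 * b j = (if r i < j \<and> j \<le> r (Suc i) then b j else 0)" for j
          using s by (auto simp: e_def) (metis abs_1 abs_square_eq_1 mult_1 power2_abs power_one)
        then have "(\<Sum>j=1..m. (e i s j)\<^sup>2 * b j) = (\<Sum>j=1..m. if r i < j \<and> j \<le> r (Suc i) then b j else 0)" by simp
        also have "\<dots> = (\<Sum>j\<in>{r i<..r (Suc i)}. b j)"
          using r(3)[of "Suc i"] i by (intro sum.mono_neutral_cong_right) auto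
        also have "\<dots> \<le> V m / N + \<kappa> * V m" unfolding blockV by (rule W[OF i])
        also have "\<kappa> * V m \<le> 1 / N * V m" using \<kappa>1 Vm by (intro mult_right_mono) auto
        finally show "(\<Sum>j=1..m. (e i s j)\<^sup>2 * b j) \<le> 2 * V m / N" by simp
        show "8 \<le> (\<epsilon> / 4)\<^sup>2 * real N" using N2 by (simp add: power_divide)
        show "\<bar>e i s j\<bar> \<le> 1" for j using s by (simp add: e_def)
        show "real N * \<kappa> \<le> 1" using \<kappa> \<epsilon> by simp
      qed (use \<epsilon> \<kappa> in auto)
      also have "\<dots> \<le> exp (- (1 + \<delta>) * L m)"
      proof -
        have "(1 + \<delta>) * L m \<le> 2 * L m" using \<delta> L_ge_1[of m] by (intro mult_right_mono) auto
        then show ?thesis unfolding exp_le_cancel_iff by linarith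
      qed
      finally show ?thesis .
    qed
    define Bad where "Bad = (\<Union>v\<in>Vn. B1 v) \<union> ((\<Union>i<N. B2 i 1) \<union> (\<Union>i<N. B2 i (- 1)))"
    have "{x. \<not> near m x \<epsilon>} \<subseteq> Bad"
    proof (rule subsetI, rule ccontr)
      fix x assume x: "x \<in> {x. \<not> near m x \<epsilon>}" "x \<notin> Bad"
      have "near m x (\<epsilon> / 4 + 2 * \<delta> + sqrt (1 / N + \<kappa>))"
      proof (rule near_from_grid[OF N1(2) Vm r Vr])
        fix i j assume i: "i < N" "r i \<le> j" "j \<le> r (Suc i)"
        have jm: "j \<le> m" using i r(3)[of "Suc i"] by simp
        have es: "(\<Sum>l=1..j. e i s l * Y l (x l)) = s * (S x j - S x (r i))" for s
        proof -
          have "(\<Sum>l=1..j. e i s l * Y l (x l)) = (\<Sum>l\<in>{r i<..j}. s * Y l (x l))"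
            using i by (intro sum.mono_neutral_cong_right) (auto simp: e_def)
          then show ?thesis using S_diff[OF i(2), of x] by (simp add: sum_distrib_left)
        qed
        have "x \<notin> B2 i 1" "x \<notin> B2 i (- 1)" using x(2) i(1) by (auto simp: Bad_def)
        then have "\<not> \<epsilon> / 4 * bet m \<le> 1 * (S x j - S x (r i))" "\<not> \<epsilon> / 4 * bet m \<le> - 1 * (S x j - S x (r i))"
          unfolding B2_def mem_Collect_eq using jm es by metis+
        then have "S x j - S x (r i) < \<epsilon> / 4 * bet m" "- (S x j - S x (r i)) < \<epsilon> / 4 * bet m" by auto
        then show "\<bar>S x j - S x (r i)\<bar> \<le> \<epsilon> / 4 * bet m" by (intro abs_leI less_imp_le)
      next
        show "(\<Sum>i<N. (sqrt N * ((S x (r (Suc i)) - S x (r i)) / bet m))\<^sup>2) \<le> (1 + 2 * \<delta>)\<^sup>2"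
        proof (rule ccontr)
          assume "\<not> ?thesis"
          then obtain v where v: "v \<in> Vn" "1 + \<delta> \<le> (\<Sum>i<N. v i * (sqrt N * ((S x (r (Suc i)) - S x (r i)) / bet m)))"
            using Vn(3)[of "\<lambda>i. sqrt N * ((S x (r (Suc i)) - S x (r i)) / bet m)"] by auto
          have "(\<Sum>i<N. v i * (sqrt N * ((S x (r (Suc i)) - S x (r i)) / bet m))) = (\<Sum>i<N. sqrt N * v i * (S x (r (Suc i)) - S x (r i))) / bet m"
            by (simp add: sum_divide_distrib mult_ac)
          also have "(\<Sum>i<N. sqrt N * v i * (S x (r (Suc i)) - S x (r i))) = (\<Sum>j=1..m. d v j * Y j (x j))"
            unfolding dsum using S_diff[OF r(4)] by simp
          finally have "(1 + \<delta>) * bet m \<le> (\<Sum>j=1..m. d v j * Y j (x j))" using v(2) bp by (simp add: pos_le_divide_eq)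
          then have "x \<in> B1 v" unfolding B1_def by blast
          then show False using x(2) v(1) by (auto simp: Bad_def)
        qed
      qed (use \<epsilon> \<delta> \<kappa> in auto)
      moreover have "sqrt (1 / N + \<kappa>) \<le> \<epsilon> / 8"
      proof (rule real_le_lsqrt)
        have "1 / N + \<kappa> \<le> 2 / N" using \<kappa>1(2) by simp
        also have "\<dots> \<le> (\<epsilon> / 8)\<^sup>2" using N2 N0 by (simp add: power_divide pos_divide_le_eq)
        finally show "1 / N + \<kappa> \<le> (\<epsilon> / 8)\<^sup>2" .
      qed (use \<epsilon> \<kappa> in auto)
      ultimately have "near m x \<epsilon>" using \<epsilon> by (elim near_mono) (simp add: \<delta>_def)
      then show False using x(1) by simp
    qed
    then have "measure_pmf.prob (P m) {x. \<not> near m x \<epsilon>} \<le> measure_pmf.prob (P m) Bad"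
      by (intro measure_pmf.finite_measure_mono) auto
    also have "\<dots> \<le> measure_pmf.prob (P m) (\<Union>v\<in>Vn. B1 v) + (measure_pmf.prob (P m) (\<Union>i<N. B2 i 1) + measure_pmf.prob (P m) (\<Union>i<N. B2 i (- 1)))"
      unfolding Bad_def by (intro order_trans[OF measure_Un_le] add_left_mono measure_Un_le) auto
    also have "\<dots> \<le> real (card Vn) * exp (- (1 + \<delta>) * L m) + (real N * exp (- (1 + \<delta>) * L m) + real N * exp (- (1 + \<delta>) * L m))"
    proof (intro add_mono)
      have "measure_pmf.prob (P m) (\<Union>v\<in>Vn. B1 v) \<le> (\<Sum>v\<in>Vn. measure_pmf.prob (P m) (B1 v))"
        using Vn(1) by (intro measure_pmf.finite_measure_subadditive_finite) auto
      also have "\<dots> \<le> (\<Sum>v\<in>Vn. exp (- (1 + \<delta>) * L m))" by (intro sum_mono PB1)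
      finally show "measure_pmf.prob (P m) (\<Union>v\<in>Vn. B1 v) \<le> real (card Vn) * exp (- (1 + \<delta>) * L m)" by simp
      have *: "measure_pmf.prob (P m) (\<Union>i<N. B2 i s) \<le> real N * exp (- (1 + \<delta>) * L m)" if "\<bar>s\<bar> = 1" for s
      proof -
        have "measure_pmf.prob (P m) (\<Union>i<N. B2 i s) \<le> (\<Sum>i<N. measure_pmf.prob (P m) (B2 i s))"
          by (intro measure_pmf.finite_measure_subadditive_finite) auto
        also have "\<dots> \<le> (\<Sum>i<N. exp (- (1 + \<delta>) * L m))" using that by (intro sum_mono PB2) auto
        finally show ?thesis by simp
      qed
      show "measure_pmf.prob (P m) (\<Union>i<N. B2 i 1) \<le> real N * exp (- (1 + \<delta>) * L m)"
        "measure_pmf.prob (P m) (\<Union>i<N. B2 i (- 1)) \<le> real N * exp (- (1 + \<delta>) * L m)"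
        using *[of 1] *[of "- 1"] by auto
    qed
    also have "\<dots> = K * exp (- (1 + \<delta>) * L m)" by (simp add: K_def algebra_simps)
    finally show ?thesis .
  qed
  moreover have "0 \<le> K" by (simp add: K_def)
  ultimately show ?thesis using \<delta>(1) by blast
qed

lemma V_overshoot:
  assumes cu: "\<And>j. 1 \<le> j \<Longrightarrow> j \<le> m \<Longrightarrow> c j * sqrt (L m) \<le> 1 / 2 * sqrt (V m)"
    and m: "m = (LEAST m. C \<le> V m)" and ex: "C \<le> V l" and C: "0 < C"
  shows "C \<le> V m" "V m \<le> 2 * C" "\<And>i. V i < C \<Longrightarrow> i < m"
proof -
  show CV: "C \<le> V m" unfolding m by (rule LeastI) (rule ex)
  show "i < m" if "V i < C" for i using that CV V_le[of m i] by (meson leI le_less_trans less_irrefl)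
  show "V m \<le> 2 * C"
  proof (cases m)
    case 0
    then show ?thesis using C V_0 by simp
  next
    case (Suc k)
    have "\<not> C \<le> V k" using not_less_Least[of k "\<lambda>m. C \<le> V m"] Suc m by simp
    moreover have "b m \<le> 1 / 2 * V m" using b_uniform[OF _ _ cu, of m] Suc by simp
    ultimately show ?thesis using Suc V_Suc[of k] by simp
  qed
qed

text \<open>
  When \<open>V m\<close> is at least \<open>2 ^ k\<close>, the iterated logarithm is about \<open>ln k\<close>; therefore \<open>exp (- (1 + \<delta>) * L m)\<close>
  is bounded by a convergent series in \<open>k\<close>.
\<close>

lemma L_lower:
  assumes "2 ^ k \<le> V m" "1 \<le> k"
  shows "ln (real k * (ln 2 / 2)) \<le> L m"
proof -
  have p: "0 < (2::real) ^ k" by simp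
  have "real k * (ln 2 / 2) = ln (sqrt (2 ^ k))" by (simp add: ln_sqrt ln_realpow)
  also have "\<dots> \<le> Lg (sqrt (2 ^ k))" using p by (intro Lg_ge_ln) simp
  also have "\<dots> \<le> Lg (sqrt (V m))" using assms by (intro Lg_mono) simp
  finally have "real k * (ln 2 / 2) \<le> Lg (sqrt (V m))" .
  then have "ln (real k * (ln 2 / 2)) \<le> ln (Lg (sqrt (V m)))" using assms(2) by (intro ln_mono) auto
  also have "\<dots> \<le> L m" unfolding L_def LLg_def using Lg_ge_1[of "sqrt (V m)"] by (intro Lg_ge_ln) simp
  finally show ?thesis .
qed

text \<open>
  The failures at the indices \<open>M k\<close> where \<open>V\<close> reaches \<open>2 ^ k\<close> have summable probabilities.  An
  index \<open>m\<close> with \<open>2 ^ (k - 1) \<le> V m < 2 ^ k\<close> inherits nearness from \<open>M k\<close>, where the variance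
  is at most four times as large.
\<close>

theorem upper_LIL:
  assumes \<epsilon>: "0 < \<epsilon>" and \<eta>: "0 < \<eta>"
  shows "\<exists>n1. \<forall>n. measure_pmf.prob (P n) {x. \<exists>m\<in>{n1..n}. \<not> near m x \<epsilon>} \<le> \<eta>"
proof -
  define \<epsilon>1 where "\<epsilon>1 = min 1 \<epsilon>"
  define \<epsilon>' where "\<epsilon>' = \<epsilon>1 / 8"
  have \<epsilon>1: "0 < \<epsilon>1" "\<epsilon>1 \<le> 1" "\<epsilon>1 \<le> \<epsilon>" using \<epsilon> by (auto simp: \<epsilon>1_def)
  obtain \<delta> K m0 where \<delta>: "\<delta> > 0" and K: "K \<ge> 0" and
    single: "\<And>m. m0 \<le> m \<Longrightarrow> measure_pmf.prob (P m) {x. \<not> near m x \<epsilon>'} \<le> K * exp (- (1 + \<delta>) * L m)"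
    using upper_single[of \<epsilon>'] \<epsilon>1 by (auto simp: \<epsilon>'_def)
  obtain m1 where m1: "\<And>m. m1 \<le> m \<Longrightarrow> 1 \<le> V m"
    "\<And>m j. m1 \<le> m \<Longrightarrow> 1 \<le> j \<Longrightarrow> j \<le> m \<Longrightarrow> c j * sqrt (L m) \<le> 1 / 2 * sqrt (V m)"
    using c_uniform[of "1 / 2"] by auto
  (* beyond C1 a change of V by a factor of 4 changes L by a factor of at most 1 + \<epsilon>1
     / 2 *)
  obtain C1 where C1: "\<And>x. C1 \<le> x \<Longrightarrow> 2 * ln 2 / \<epsilon>1 \<le> Lg x"
    using filterlim_Lg by (auto simp: filterlim_at_top eventually_at_top_linorder)
  define M where "M = (\<lambda>k. LEAST m. (2::real) ^ k \<le> V m)"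
  have exM: "\<exists>l. (2::real) ^ k \<le> V l" for k using V_large[of "2 ^ k"] by blast
  have MV: "(2::real) ^ k \<le> V (M k)" for k unfolding M_def using exM[of k] by (rule LeastI_ex)
  have Mless: "i < M k" if "V i < 2 ^ k" for i k
    using that MV[of k] V_le[of "M k" i] by (meson leI le_less_trans less_irrefl order_trans)
  define c0 where "c0 = ln 2 / (2::real)"
  have c0: "0 < c0" by (simp add: c0_def)
  define a where "a = (\<lambda>k. K * c0 powr (- (1 + \<delta>)) * real k powr (- (1 + \<delta>)))"
  have "summable (\<lambda>k. real k powr (- (1 + \<delta>)))" using \<delta> by (subst summable_real_powr_iff) simp
  then have "summable a" unfolding a_def by (rule summable_mult)
  then obtain k0 where k0: "\<And>i j. k0 \<le> i \<Longrightarrow> norm (sum a {i..<j}) < \<eta>"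
    using \<eta> unfolding summable_Cauchy by blast
  have bound: "measure_pmf.prob (P (M k)) {x. \<not> near (M k) x \<epsilon>'} \<le> a k" if "m0 \<le> M k" "1 \<le> k" for k
  proof -
    have "exp (- (1 + \<delta>) * L (M k)) \<le> exp (- (1 + \<delta>) * ln (real k * c0))"
      using L_lower[OF MV that(2)] \<delta> unfolding c0_def by (simp add: mult_left_mono)
    also have "\<dots> = (real k * c0) powr (- (1 + \<delta>))" using that(2) c0 by (simp add: powr_def)
    also have "\<dots> = real k powr (- (1 + \<delta>)) * c0 powr (- (1 + \<delta>))" by (rule powr_mult)
    finally have "K * exp (- (1 + \<delta>) * L (M k)) \<le> K * (real k powr (- (1 + \<delta>)) * c0 powr (- (1 + \<delta>)))"
      using K by (intro mult_left_mono)
    then show ?thesis using single[OF that(1)] by (simp add: a_def mult_ac)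
  qed
  obtain k1 where k1: "k0 \<le> k1" "1 \<le> k1" "V m0 < 2 ^ k1" "V m1 < 2 ^ k1" "max 1 (C1\<^sup>2) \<le> 2 ^ k1"
  proof -
    define X where "X = max (max (V m0) (V m1)) (max 1 (C1\<^sup>2))"
    obtain k where k: "X < (2::real) ^ k" using real_arch_pow[of "2::real" X] by auto
    have X: "V m0 \<le> X" "V m1 \<le> X" "max 1 (C1\<^sup>2) \<le> X" unfolding X_def by linarith+
    have "(2::real) ^ k \<le> 2 ^ max k (max k0 1)" by (intro power_increasing) auto
    then have "X < 2 ^ max k (max k0 1)" using k by linarith
    then show ?thesis using X by (intro that[of "max k (max k0 1)"]; linarith)
  qed
  have Mlarge: "m0 \<le> M k" "m1 \<le> M k" if "k1 \<le> k" for k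
  proof -
    have "(2::real) ^ k1 \<le> 2 ^ k" using that by (intro power_increasing) auto
    then have "V m0 < 2 ^ k" "V m1 < 2 ^ k" using k1(3,4) by linarith+
    then show "m0 \<le> M k" "m1 \<le> M k" using Mless[of m0 k] Mless[of m1 k] by auto
  qed
  obtain n1 where n1: "\<And>m. n1 \<le> m \<Longrightarrow> 2 ^ k1 \<le> V m" using V_large[of "2 ^ k1"] by auto
  have "measure_pmf.prob (P n) {x. \<exists>m\<in>{n1..n}. \<not> near m x \<epsilon>} \<le> \<eta>" for n
  proof -
    obtain kn where kn: "V n < (2::real) ^ kn" using real_arch_pow[of 2 "V n"] by auto
    define R where "R = Max (insert n (M ` {..kn}))"
    have R: "n \<le> R" "M k \<le> R" if "k \<le> kn" for k
      unfolding R_def by (rule Max_ge; use that in simp)+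
    have sub: "{x. \<exists>m\<in>{n1..n}. \<not> near m x \<epsilon>} \<subseteq> (\<Union>k\<in>{k1..<Suc kn}. {x. \<not> near (M k) x \<epsilon>'})"
    proof
      fix x assume "x \<in> {x. \<exists>m\<in>{n1..n}. \<not> near m x \<epsilon>}"
      then obtain m where m: "n1 \<le> m" "m \<le> n" "\<not> near m x \<epsilon>" by auto
      define k where "k = (LEAST k. V m < (2::real) ^ k)"
      have Vmn: "V m < 2 ^ kn" using V_le[OF m(2)] kn by linarith
      have k: "V m < 2 ^ k" unfolding k_def by (rule LeastI) (rule Vmn)
      have kkn: "k \<le> kn" unfolding k_def by (rule Least_le) (rule Vmn)
      have kk1: "k1 < k"
      proof (rule ccontr)
        assume "\<not> k1 < k"
        then have "(2::real) ^ k \<le> 2 ^ k1" by (intro power_increasing) auto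
        then show False using k n1[OF m(1)] by linarith
      qed
      then obtain k' where k': "k = Suc k'" by (cases k) auto
      have "\<not> V m < 2 ^ k'" using not_less_Least[of k' "\<lambda>k. V m < (2::real) ^ k"] k' by (simp add: k_def)
      then have lo: "2 ^ k' \<le> V m" by simp
      have V2: "V (M k) \<le> 2 * 2 ^ k"
        using V_overshoot(2)[OF m1(2)[OF Mlarge(2)], of k "2 ^ k" "M k"] MV[of k] kk1 by (simp add: M_def)
      have V4: "V (M k) \<le> 4 * V m" using V2 lo k' by simp
      have mM: "m \<le> M k" using Mless[OF k] by simp
      have Vm1: "1 \<le> V m" and VC: "C1\<^sup>2 \<le> V m" using n1[OF m(1)] k1(5) by linarith+
      have "C1 \<le> sqrt (V m)" using VC by (simp add: real_le_rsqrt)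
      then have Lgm: "2 * ln 2 / \<epsilon>1 \<le> Lg (sqrt (V m))" by (rule C1)
      have Lg0: "0 < Lg (sqrt (V m))" using Lg_ge_1[of "sqrt (V m)"] by simp
      have A: "L (M k) \<le> L m + ln (sqrt (V (M k)) / sqrt (V m)) / Lg (sqrt (V m))"
        unfolding L_def using Vm1 V_le[OF mM] by (intro LLg_le_add) auto
      have "sqrt (V (M k)) \<le> sqrt (2\<^sup>2 * V m)" using V4 by simp
      also have "\<dots> = 2 * sqrt (V m)" by (simp add: real_sqrt_mult)
      finally have "sqrt (V (M k)) / sqrt (V m) \<le> 2" using Vm1 by (simp add: pos_divide_le_eq)
      then have "ln (sqrt (V (M k)) / sqrt (V m)) \<le> ln 2"
        using Vm1 V_le[OF mM] by (intro ln_mono) auto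
      then have B: "ln (sqrt (V (M k)) / sqrt (V m)) / Lg (sqrt (V m)) \<le> ln 2 / Lg (sqrt (V m))"
        using Lg0 by (intro divide_right_mono) auto
      have "2 * ln 2 \<le> Lg (sqrt (V m)) * \<epsilon>1" using Lgm \<epsilon>1 by (simp add: pos_divide_le_eq)
      then have C: "ln 2 / Lg (sqrt (V m)) \<le> \<epsilon>1 / 2" using Lg0 by (simp add: pos_divide_le_eq mult.commute)
      have D: "\<epsilon>1 / 2 * 1 \<le> \<epsilon>1 / 2 * L m" using \<epsilon>1 L_ge_1[of m] by (intro mult_left_mono) auto
      have "(1 + \<epsilon>1 / 2) * L m = L m + \<epsilon>1 / 2 * L m" by (simp add: algebra_simps)
      then have LM: "L (M k) \<le> (1 + \<epsilon>1 / 2) * L m" using A B C D by linarith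
      have "\<not> near (M k) x \<epsilon>'"
      proof
        assume "near (M k) x \<epsilon>'"
        then have "near m x (4 * \<epsilon>' + \<epsilon>1 / 2)"
          using \<epsilon>1 Vm1 by (intro near_descend[OF _ mM _ V4 LM]) (auto simp: \<epsilon>'_def)
        then have "near m x \<epsilon>" using \<epsilon>1 by (elim near_mono) (simp add: \<epsilon>'_def)
        then show False using m(3) by simp
      qed
      then show "x \<in> (\<Union>k\<in>{k1..<Suc kn}. {x. \<not> near (M k) x \<epsilon>'})" using kk1 kkn by auto
    qed
    have dep: "depends_on {1..n} {x. \<exists>m\<in>{n1..n}. \<not> near m x \<epsilon>}"
    proof -
      have *: "near m f \<epsilon> \<longleftrightarrow> near m g \<epsilon>" if "\<forall>i\<in>{1..n}. f i = g i" "m \<le> n" for f g m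
        using depends_onD[OF near_depends[OF that(2), of \<epsilon>], of f g] that(1) by simp
      show ?thesis unfolding depends_on_def
      proof (intro allI impI)
        fix f g :: "nat \<Rightarrow> 'a" assume "\<forall>i\<in>{1..n}. f i = g i"
        from *[OF this] show "f \<in> {x. \<exists>m\<in>{n1..n}. \<not> near m x \<epsilon>} \<longleftrightarrow> g \<in> {x. \<exists>m\<in>{n1..n}. \<not> near m x \<epsilon>}"
          by auto
      qed
    qed
    (* the index M k may exceed n, so all events are viewed in a larger product *)
    have "measure_pmf.prob (P n) {x. \<exists>m\<in>{n1..n}. \<not> near m x \<epsilon>} = measure_pmf.prob (P R) {x. \<exists>m\<in>{n1..n}. \<not> near m x \<epsilon>}"
      using R(1)[of 0] by (intro prob_Pi_pmf_marginal[symmetric] dep) auto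
    also have "\<dots> \<le> measure_pmf.prob (P R) (\<Union>k\<in>{k1..<Suc kn}. {x. \<not> near (M k) x \<epsilon>'})"
      by (intro measure_pmf.finite_measure_mono sub) auto
    also have "\<dots> \<le> (\<Sum>k\<in>{k1..<Suc kn}. measure_pmf.prob (P R) {x. \<not> near (M k) x \<epsilon>'})"
      by (intro measure_pmf.finite_measure_subadditive_finite) auto
    also have "\<dots> \<le> (\<Sum>k\<in>{k1..<Suc kn}. a k)"
    proof (rule sum_mono)
      fix k assume k: "k \<in> {k1..<Suc kn}"
      have "depends_on {1..M k} {x. \<not> near (M k) x \<epsilon>'}"
        using near_depends[of "M k" "M k" \<epsilon>'] unfolding depends_on_def by blast
      then have "measure_pmf.prob (P R) {x. \<not> near (M k) x \<epsilon>'} = measure_pmf.prob (P (M k)) {x. \<not> near (M k) x \<epsilon>'}"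
        using R(2)[of k] k by (intro prob_Pi_pmf_marginal) auto
      then show "measure_pmf.prob (P R) {x. \<not> near (M k) x \<epsilon>'} \<le> a k" using bound[of k] Mlarge[of k] k k1 by auto
    qed
    also have "\<dots> \<le> \<eta>" using k0[of k1 "Suc kn"] k1(1) by (simp add: abs_less_iff less_imp_le)
    finally show ?thesis .
  qed
  then show ?thesis by blast
qed

end


section \<open>The law of the iterated logarithm: every function of the Strassen set is approached\<close>

context kolmogorov_array
begin

definition close :: "(real \<Rightarrow> real) \<Rightarrow> nat \<Rightarrow> (nat \<Rightarrow> 'a) \<Rightarrow> real \<Rightarrow> bool" where
  "close g m x \<epsilon> \<longleftrightarrow> (\<forall>i\<le>m. \<bar>S x i / bet m - g (V i / V m)\<bar> \<le> \<epsilon>)"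

text \<open>
  The lower bound \<open>mgf_lower_bound\<close> for a single block, whose variance is about \<open>V m / N\<close>.  The Gaussian cost of the
  increment \<open>bet m * y\<close> is \<open>(bet m * y)\<^sup>2 / (2 * V m / N) = L m * (N * y\<^sup>2)\<close>, so over all blocks the
  costs sum to \<open>L m\<close> times the discrete energy.
\<close>

lemma block_lower:
  assumes T: "0 < V m" and cu: "\<And>j. 1 \<le> j \<Longrightarrow> j \<le> m \<Longrightarrow> c j * sqrt (L m) \<le> \<kappa> * sqrt (V m)"
    and N: "1 \<le> N" and \<rho>: "0 < \<rho>" "\<rho> \<le> 1" and \<kappa>: "0 < \<kappa>" "\<kappa> = \<rho>\<^sup>2 / (256 * N)"
    and uv: "u \<le> v" "v \<le> m" and W: "V m / N - \<kappa> * V m \<le> V v - V u" "V v - V u \<le> V m / N + \<kappa> * V m"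
    and y: "\<bar>y\<bar> \<le> 1" and Lb: "8 / \<rho>\<^sup>2 \<le> L m"
  shows "1 / 2 * exp (- (L m * (((1 + \<rho>\<^sup>2 / 16) / (1 - N * \<kappa>)) * (N * y\<^sup>2) + 4 * \<rho> * N))) \<le>
    measure_pmf.prob (Pi_pmf {u<..v} dflt q) {x. \<bar>(S x v - S x u) - bet m * y\<bar> \<le> \<rho> * bet m}"
proof -
  define T where "T = V m"
  define W where "W = V v - V u"
  have T0: "0 < T" using T by (simp add: T_def)
  have N0: "0 < N" using N by simp
  have bp: "0 < bet m" by (rule bet_pos[OF T])
  have bb: "bet m * bet m = 2 * T * L m" using bet_sq[of m] by (simp add: power2_eq_square T_def)
  have r2: "0 < \<rho>\<^sup>2" "\<rho>\<^sup>2 \<le> 1" using \<rho> by (auto simp: power_le_one)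
  have Nk: "N * \<kappa> = \<rho>\<^sup>2 / 256" using N0 \<kappa> by simp
  have k1: "\<kappa> \<le> 1 / (2 * N)"
  proof -
    have "\<kappa> * (2 * N) \<le> 1" using Nk r2 by (simp add: mult_ac)
    then show ?thesis using N0 by (simp add: pos_le_divide_eq)
  qed
  have kT: "\<kappa> * T \<le> 1 / (2 * N) * T" using k1 T0 by (intro mult_right_mono) auto
  have W1: "T / (2 * N) \<le> W" using assms(10) kT N0 unfolding W_def T_def by simp
  have W2: "W \<le> 2 * T"
  proof -
    have "T / N \<le> T" "1 / (2 * N) * T \<le> T" using N T0 by (auto simp: divide_le_eq mult_left_le)
    then show ?thesis using assms(11) kT unfolding W_def T_def by linarith
  qed
  have Wp: "0 < W" using W1 T0 N0 by (meson divide_pos_pos less_le_trans mult_pos_pos zero_less_numeral)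
  define J where "J = {u<..v}"
  have J: "finite J" "\<And>j. j \<in> J \<Longrightarrow> 1 \<le> j \<and> j \<le> m" using uv by (auto simp: J_def)
  have sumb: "(\<Sum>j\<in>J. b j) = W"
  proof -
    have "{1..v} = {1..u} \<union> {u<..v}" using uv by auto
    then show ?thesis by (simp add: V_def W_def J_def sum.union_disjoint disjoint_iff)
  qed
  define Sj where "Sj = (\<lambda>x. \<Sum>j\<in>J. Y j (x j))"
  define z where "z = bet m * y"
  define \<eta> where "\<eta> = \<rho> * bet m"
  define \<kappa>2 where "\<kappa>2 = \<rho>\<^sup>2 / 32"
  have z: "\<bar>z\<bar> \<le> bet m" using y bp by (simp add: z_def abs_mult mult_left_le)
  have \<eta>: "0 < \<eta>" "\<eta> \<le> bet m" using \<rho> bp by (auto simp: \<eta>_def mult_left_le_one_le)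
  have k2: "0 \<le> \<kappa>2" "\<kappa>2 \<le> 1" using r2 by (auto simp: \<kappa>2_def)
  have thc: "\<bar>\<theta>\<bar> * c j \<le> \<kappa>2" if \<theta>: "\<bar>\<theta>\<bar> \<le> (\<bar>z\<bar> + \<eta>) / W" and j: "j \<in> J" for \<theta> j
  proof -
    have cj: "0 \<le> c j" using J(2)[OF j] c_nonneg by simp
    have "(\<bar>z\<bar> + \<eta>) / W \<le> (2 * bet m) / (T / (2 * N))"
      using z \<eta> W1 T0 N0 bp by (intro frac_le) auto
    then have "\<bar>\<theta>\<bar> \<le> 4 * N * bet m / T" using \<theta> by (simp add: mult_ac)
    then have "\<bar>\<theta>\<bar> * c j \<le> 4 * N * bet m / T * c j" using cj by (rule mult_right_mono)
    also have "\<dots> = 4 * N * (bet m * c j) / T" by simp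
    also have "\<dots> \<le> 4 * N * (2 * \<kappa> * T) / T"
      using bet_c[OF cu, of j] J(2)[OF j] \<kappa> T0 N0 by (intro divide_right_mono mult_left_mono) (auto simp: T_def)
    also have "\<dots> = 8 * (N * \<kappa>)" using T0 by simp
    also have "\<dots> = \<kappa>2" unfolding Nk \<kappa>2_def by simp
    finally show ?thesis .
  qed
  have "exp (- (1 + 2 * \<kappa>2) * z\<^sup>2 / (2 * W) - \<bar>z\<bar> * \<eta> / W) / 2 \<le> measure_pmf.prob (Pi_pmf J dflt q) {x. \<bar>Sj x - z\<bar> \<le> \<eta>}"
  proof (rule mgf_lower_bound[where K = "\<Sum>j\<in>J. c j", OF _ Wp \<eta>(1) k2(1)])
    show "\<bar>Sj x\<bar> \<le> (\<Sum>j\<in>J. c j)" for x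
      unfolding Sj_def using J(2) by (intro order_trans[OF sum_abs] sum_mono Y_bound) auto
    show "measure_pmf.expectation (Pi_pmf J dflt q) (\<lambda>x. exp (\<theta> * Sj x)) \<le> exp ((1 + \<kappa>2) * \<theta>\<^sup>2 * W / 2)"
      if "\<bar>\<theta>\<bar> \<le> (\<bar>z\<bar> + \<eta>) / W" for \<theta>
      using block_mgf(1)[OF J(1) _ thc[OF that] k2(2)] J(2) unfolding Sj_def sumb by simp
    show "exp ((1 - 2 * \<kappa>2) * \<theta>\<^sup>2 * W / 2) \<le> measure_pmf.expectation (Pi_pmf J dflt q) (\<lambda>x. exp (\<theta> * Sj x))"
      if "\<bar>\<theta>\<bar> \<le> (\<bar>z\<bar> + \<eta>) / W" for \<theta>
      using block_mgf(2)[OF J(1) _ thc[OF that] k2(2)] J(2) unfolding Sj_def sumb by simp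
    have "(\<bar>z\<bar> + \<eta>)\<^sup>2 \<le> (2 * bet m)\<^sup>2" using z \<eta> by (intro power_mono) auto
    also have "\<dots> = 8 * T * L m" using bb by (simp add: power2_eq_square)
    finally have "2 * \<kappa>2 * (\<bar>z\<bar> + \<eta>)\<^sup>2 \<le> 2 * \<kappa>2 * (8 * T * L m)" using k2 by (intro mult_left_mono) auto
    also have "\<dots> = \<rho>\<^sup>2 * (T * L m) / 2" by (simp add: \<kappa>2_def)
    finally have a: "2 * \<kappa>2 * (\<bar>z\<bar> + \<eta>)\<^sup>2 \<le> \<rho>\<^sup>2 * (T * L m) / 2" .
    have "\<eta>\<^sup>2 = \<rho>\<^sup>2 * (bet m * bet m)" by (simp add: \<eta>_def power2_eq_square)
    then have b: "\<eta>\<^sup>2 / 2 = \<rho>\<^sup>2 * (T * L m)" unfolding bb by simp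
    have "8 \<le> \<rho>\<^sup>2 * L m" using Lb r2 by (simp add: pos_divide_le_eq mult.commute)
    then have "8 * T \<le> \<rho>\<^sup>2 * L m * T" using T0 by (intro mult_right_mono) auto
    then have "8 * T \<le> \<rho>\<^sup>2 * (T * L m)" by (simp add: mult_ac)
    then show "2 * W \<le> \<eta>\<^sup>2 / 2 - 2 * \<kappa>2 * (\<bar>z\<bar> + \<eta>)\<^sup>2" using a b W2 by linarith
  qed
  also have "{x. \<bar>Sj x - z\<bar> \<le> \<eta>} = {x. \<bar>(S x v - S x u) - bet m * y\<bar> \<le> \<rho> * bet m}"
    using S_diff[OF uv(1)] by (simp add: Sj_def J_def z_def \<eta>_def)
  finally have main: "exp (- (1 + 2 * \<kappa>2) * z\<^sup>2 / (2 * W) - \<bar>z\<bar> * \<eta> / W) / 2 \<le>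
    measure_pmf.prob (Pi_pmf {u<..v} dflt q) {x. \<bar>(S x v - S x u) - bet m * y\<bar> \<le> \<rho> * bet m}" unfolding J_def .
  have Nk1: "0 < 1 - N * \<kappa>" unfolding Nk using r2 by simp
  have W1': "T * (1 - N * \<kappa>) / N \<le> W"
    using assms(10) N0 unfolding W_def T_def by (simp add: diff_divide_distrib right_diff_distrib mult_ac)
  have "z\<^sup>2 = (bet m * bet m) * y\<^sup>2" by (simp add: z_def power2_eq_square)
  then have "z\<^sup>2 / (2 * W) = T * L m * y\<^sup>2 / W" unfolding bb by simp
  also have "\<dots> \<le> T * L m * y\<^sup>2 / (T * (1 - N * \<kappa>) / N)"
    using W1' T0 N0 Nk1 L_ge_1[of m] Wp by (intro divide_left_mono mult_pos_pos) auto
  also have "\<dots> = L m * (N * y\<^sup>2) / (1 - N * \<kappa>)" using T0 by simp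
  finally have A: "(1 + 2 * \<kappa>2) * (z\<^sup>2 / (2 * W)) \<le> (1 + 2 * \<kappa>2) * (L m * (N * y\<^sup>2) / (1 - N * \<kappa>))"
    using k2 by (intro mult_left_mono) auto
  have "\<bar>z\<bar> * \<eta> / W \<le> bet m * (\<rho> * bet m) / (T / (2 * N))"
    using z \<eta> W1 T0 N0 bp by (intro frac_le mult_mono) (auto simp: \<eta>_def)
  also have "\<dots> = \<rho> * (bet m * bet m) * (2 * N) / T" by simp
  also have "\<dots> = L m * (4 * \<rho> * N)" unfolding bb using T0 by simp
  finally have B: "\<bar>z\<bar> * \<eta> / W \<le> L m * (4 * \<rho> * N)" .
  have "(1 + \<rho>\<^sup>2 / 16) = 1 + 2 * \<kappa>2" by (simp add: \<kappa>2_def)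
  then have C: "L m * (((1 + \<rho>\<^sup>2 / 16) / (1 - N * \<kappa>)) * (N * y\<^sup>2) + 4 * \<rho> * N) = (1 + 2 * \<kappa>2) * (L m * (N * y\<^sup>2) / (1 - N * \<kappa>)) + L m * (4 * \<rho> * N)"
    by (simp add: distrib_left mult_ac)
  have D: "- (1 + 2 * \<kappa>2) * z\<^sup>2 / (2 * W) = - ((1 + 2 * \<kappa>2) * (z\<^sup>2 / (2 * W)))"
    by (simp only: minus_mult_left[symmetric] minus_divide_left[symmetric] times_divide_eq_right)
  have "exp (- (L m * (((1 + \<rho>\<^sup>2 / 16) / (1 - N * \<kappa>)) * (N * y\<^sup>2) + 4 * \<rho> * N))) \<le> exp (- (1 + 2 * \<kappa>2) * z\<^sup>2 / (2 * W) - \<bar>z\<bar> * \<eta> / W)"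
    unfolding C D exp_le_cancel_iff using A B by linarith
  then show ?thesis using main by linarith
qed

text \<open>
  The increments over all blocks but the first agree with those of \<open>g\<close>.  On the first block nearness to
  some function \<open>f\<close> of the Strassen set suffices, since both \<open>f\<close> and \<open>g\<close> move by at most \<open>sqrt (1 / N)\<close>
  up to errors there; inside the blocks \<open>f\<close> again controls the path.
\<close>

lemma close_from_increments:
  assumes g: "g \<in> strassen_set" and N: "N > 0" and Vm: "0 < V m"
    and r: "r N = m" "\<And>i. i \<le> N \<Longrightarrow> r i \<le> m"
    and Vr: "\<And>i. i \<le> N \<Longrightarrow> V m * (real i / real N) \<le> V (r i) \<and> V (r i) \<le> V m * (real i / real N) + \<kappa> * V m"
    and near: "near m x \<epsilon>" and \<delta>: "0 \<le> \<delta>" "\<delta> \<le> 1" and \<kappa>: "0 \<le> \<kappa>"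
    and inc: "\<And>i. 1 \<le> i \<Longrightarrow> i < N \<Longrightarrow> \<bar>(S x (r (Suc i)) - S x (r i)) - bet m * ((1 - \<delta>) * (g (real (Suc i) / N) - g (real i / N)))\<bar> \<le> \<rho> * bet m"
    and \<rho>: "real N * \<rho> \<le> \<epsilon>" "0 \<le> \<rho>"
  shows "close g m x (4 * \<epsilon> + \<delta> + 4 * sqrt (1 / N + \<kappa>))"
proof -
  have bp: "0 < bet m" by (rule bet_pos[OF Vm])
  obtain f where f: "f \<in> strassen_set" "\<And>i. i \<le> m \<Longrightarrow> \<bar>S x i / bet m - f (V i / V m)\<bar> \<le> \<epsilon>"
    using near by (auto simp: near_def)
  define \<tau> where "\<tau> = sqrt (1 / N + \<kappa>)"
  have \<tau>1: "sqrt (1 / N) \<le> \<tau>" unfolding \<tau>_def using \<kappa> by simp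
  have t01: "V j / V m \<in> {0..1}" if "j \<le> m" for j using V_nonneg[of j] V_le[OF that] Vm by simp
  have rt: "real i / N \<le> V (r i) / V m \<and> V (r i) / V m \<le> real i / N + \<kappa>" if "i \<le> N" for i
  proof -
    have "V m * (real i / N) + \<kappa> * V m = (real i / N + \<kappa>) * V m" by (simp add: algebra_simps)
    then show ?thesis using Vr[OF that] unfolding pos_le_divide_eq[OF Vm] pos_divide_le_eq[OF Vm] by (simp add: mult.commute)
  qed
  have iN: "real i / N \<in> {0..1}" if "i \<le> N" for i using that N by (simp add: divide_le_eq_1)
  define s where "s = (\<lambda>i. S x (r i) / bet m)"
  have inc': "\<bar>(s (Suc i) - s i) - (1 - \<delta>) * (g (real (Suc i) / N) - g (real i / N))\<bar> \<le> \<rho>" if "1 \<le> i" "i < N" for i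
  proof -
    have "(s (Suc i) - s i) - (1 - \<delta>) * (g (real (Suc i) / N) - g (real i / N)) =
      ((S x (r (Suc i)) - S x (r i)) - bet m * ((1 - \<delta>) * (g (real (Suc i) / N) - g (real i / N)))) / bet m"
      using bp by (simp add: s_def diff_divide_distrib)
    then show ?thesis using inc[OF that] bp by (simp add: pos_divide_le_eq)
  qed
  have cum: "\<bar>(s i - s 1) - (1 - \<delta>) * (g (real i / N) - g (real 1 / N))\<bar> \<le> real (i - 1) * \<rho>" if "1 \<le> i" "i \<le> N" for i
    using that
  proof (induction i rule: dec_induct)
    case (step i)
    have "\<bar>(s i - s 1) - (1 - \<delta>) * (g (real i / N) - g (real 1 / N))\<bar> \<le> real (i - 1) * \<rho>" using step by simp
    moreover have "\<bar>(s (Suc i) - s i) - (1 - \<delta>) * (g (real (Suc i) / N) - g (real i / N))\<bar> \<le> \<rho>" using step by (intro inc') auto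
    moreover have "real (Suc i - 1) * \<rho> = real (i - 1) * \<rho> + \<rho>" using step(1) by (simp add: of_nat_diff algebra_simps)
    moreover have "(s (Suc i) - s 1) - (1 - \<delta>) * (g (real (Suc i) / N) - g (real 1 / N)) =
      ((s i - s 1) - (1 - \<delta>) * (g (real i / N) - g (real 1 / N))) + ((s (Suc i) - s i) - (1 - \<delta>) * (g (real (Suc i) / N) - g (real i / N)))"
      by (simp add: algebra_simps)
    ultimately show ?case by linarith
  qed simp
  have grid: "\<bar>s i - g (real i / N)\<bar> \<le> 2 * \<epsilon> + \<delta> + 2 * \<tau>" if i: "1 \<le> i" "i \<le> N" for i
  proof -
    have "real (i - 1) * \<rho> \<le> real N * \<rho>" using i \<rho> by (intro mult_right_mono) auto
    then have A: "\<bar>(s i - s 1) - (1 - \<delta>) * (g (real i / N) - g (real 1 / N))\<bar> \<le> \<epsilon>" using cum[OF i] \<rho> by linarith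
    have r1: "r 1 \<le> m" using r(2)[of 1] N by simp
    have f0: "f 0 = 0" "g 0 = 0" using f(1) g by (auto simp: strassen_set_def)
    have "\<bar>f (V (r 1) / V m) - f 0\<bar> \<le> sqrt \<bar>V (r 1) / V m - 0\<bar>"
      by (rule strassen_set_holder[OF f(1) _ t01[OF r1]]) simp
    also have "\<dots> \<le> \<tau>" unfolding \<tau>_def using rt[of 1] N V_nonneg[of "r 1"] Vm by (intro real_sqrt_le_mono) auto
    finally have B: "\<bar>s 1\<bar> \<le> \<epsilon> + \<tau>" using f(2)[OF r1] f0 unfolding s_def by linarith
    have "\<bar>g (real 1 / N) - g 0\<bar> \<le> sqrt \<bar>real 1 / N - 0\<bar>" by (rule strassen_set_holder[OF g _ iN]) (use N in auto)
    then have C: "\<bar>g (real 1 / N)\<bar> \<le> \<tau>" using \<tau>1 f0 by simp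
    have "\<bar>g (real i / N) - g (real 1 / N)\<bar> \<le> sqrt \<bar>real i / N - real 1 / N\<bar>"
      by (rule strassen_set_holder[OF g iN iN]) (use N i in auto)
    also have "\<bar>real i / N - real 1 / N\<bar> \<le> 1"
      using iN[OF i(2)] iN[OF order_trans[OF i]] unfolding atLeastAtMost_iff by linarith
    finally have "\<bar>g (real i / N) - g (real 1 / N)\<bar> \<le> 1" by simp
    then have D: "\<bar>\<delta> * (g (real i / N) - g (real 1 / N))\<bar> \<le> \<delta>" using \<delta> by (simp add: abs_mult mult_left_le)
    have "s i - g (real i / N) = ((s i - s 1) - (1 - \<delta>) * (g (real i / N) - g (real 1 / N))) + s 1 - g (real 1 / N) - \<delta> * (g (real i / N) - g (real 1 / N))"
      by (simp add: algebra_simps)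
    then show ?thesis using A B C D by linarith
  qed
  show ?thesis unfolding close_def
  proof (intro allI impI)
    fix j assume j: "j \<le> m"
    obtain k where k: "k < N" "real k / N \<le> V j / V m" "V j / V m \<le> real (Suc k) / N" using grid_cell[OF N t01[OF j]] .
    define i where "i = Suc k"
    have i: "1 \<le> i" "i \<le> N" using k by (auto simp: i_def)
    have ik: "real i / N = real k / N + 1 / N" by (simp add: i_def add_divide_distrib)
    have "\<bar>g (real i / N) - g (V j / V m)\<bar> \<le> sqrt \<bar>real i / N - V j / V m\<bar>" by (rule strassen_set_holder[OF g t01[OF j] iN[OF i(2)]])
    also have "\<dots> \<le> sqrt (1 / N)" using k ik by (intro real_sqrt_le_mono) (auto simp: i_def)
    finally have A: "\<bar>g (real i / N) - g (V j / V m)\<bar> \<le> \<tau>" using \<tau>1 by linarith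
    have "\<bar>f (V j / V m) - f (V (r i) / V m)\<bar> \<le> sqrt \<bar>V j / V m - V (r i) / V m\<bar>"
      by (rule strassen_set_holder[OF f(1) t01[OF r(2)[OF i(2)]] t01[OF j]])
    also have "\<dots> \<le> \<tau>" unfolding \<tau>_def
    proof (rule real_sqrt_le_mono)
      have "V j / V m \<le> real i / N" using k by (simp add: i_def)
      then show "\<bar>V j / V m - V (r i) / V m\<bar> \<le> 1 / N + \<kappa>" using k(2) ik rt[OF i(2)] by linarith
    qed
    finally have B: "\<bar>f (V j / V m) - f (V (r i) / V m)\<bar> \<le> \<tau>" .
    show "\<bar>S x j / bet m - g (V j / V m)\<bar> \<le> 4 * \<epsilon> + \<delta> + 4 * sqrt (1 / N + \<kappa>)"
      using A B grid[OF i] f(2)[OF j] f(2)[OF r(2)[OF i(2)]] unfolding \<tau>_def[symmetric] s_def by linarith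
  qed
qed

text \<open>
  The event \<open>G\<close> prescribes the increments over all blocks except the first, which is why it is independent
  of the variables up to any \<open>l\<close> with \<open>V l < V m / N\<close>.  Shrinking \<open>g\<close> by \<open>1 - \<delta>\<close> brings its energy
  strictly below one; this pays for all multiplicative errors in the exponent, and the cost
  stays below \<open>L m\<close>.
\<close>

lemma lower_single:
  assumes g: "g \<in> strassen_set" and \<epsilon>: "0 < \<epsilon>" "\<epsilon> \<le> 1"
  shows "\<exists>N \<epsilon>' m0. N > 0 \<and> 0 < \<epsilon>' \<and> (\<forall>m\<ge>m0. \<forall>l. V l < V m * (1 / real N) \<longrightarrow>
    (\<exists>G. depends_on {l<..m} G \<and> (\<forall>x\<in>G. near m x \<epsilon>' \<longrightarrow> close g m x \<epsilon>) \<and>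
      (1 / 2) ^ N * exp (- L m) \<le> measure_pmf.prob (Pi_pmf {l<..m} dflt q) G))"
proof -
  obtain N :: nat where N: "512 / \<epsilon>\<^sup>2 \<le> real N" using real_arch_simple by blast
  have N0: "0 < real N" using N \<epsilon> by (meson divide_pos_pos less_le_trans zero_less_numeral zero_less_power)
  then have N1: "1 \<le> real N" "N > 0" by auto
  have N2: "512 \<le> \<epsilon>\<^sup>2 * real N" using N \<epsilon> by (simp add: pos_divide_le_eq mult.commute)
  define \<delta> where "\<delta> = \<epsilon> / 8"
  define \<epsilon>' where "\<epsilon>' = \<epsilon> / 16"
  (* the precision of the increments: the N errors add up to at most \<epsilon>', and the N
     error terms 4 * \<rho> * N in the exponent stay below \<delta> *)
  define \<rho> where "\<rho> = \<delta> / (16 * N * N)"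
  define \<kappa> where "\<kappa> = \<rho>\<^sup>2 / (256 * real N)"
  have \<delta>: "0 < \<delta>" "\<delta> \<le> 1" using \<epsilon> by (auto simp: \<delta>_def)
  have NN: "1 \<le> real N * real N" using N1 mult_mono[of 1 "real N" 1 "real N"] by simp
  have \<rho>: "0 < \<rho>" "real N * real N * \<rho> = \<delta> / 16"
    using \<delta> N0 by (auto simp: \<rho>_def)
  have \<rho>1: "\<rho> \<le> \<delta> / 16"
    using \<rho>(2) mult_right_mono[OF NN less_imp_le[OF \<rho>(1)]] by linarith
  then have \<rho>2: "\<rho> \<le> 1" "\<rho>\<^sup>2 \<le> \<delta> / 16"
    using \<delta> \<rho>(1) mult_mono[of \<rho> 1 \<rho> "\<delta> / 16"] by (auto simp: power2_eq_square)
  have N\<rho>: "real N * \<rho> \<le> \<epsilon>'"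
  proof -
    have "real N * \<rho> \<le> real N * (real N * \<rho>)" using N1 \<rho> mult_right_mono[of 1 "real N" "real N * \<rho>"] by simp
    then show ?thesis using \<rho>(2) \<epsilon> by (simp add: \<delta>_def \<epsilon>'_def mult.assoc)
  qed
  have \<kappa>: "0 < \<kappa>" "real N * \<kappa> = \<rho>\<^sup>2 / 256" using \<rho> N0 by (auto simp: \<kappa>_def)
  have \<kappa>1: "\<kappa> \<le> 1" "\<kappa> \<le> 1 / N"
  proof -
    have "real N * \<kappa> \<le> 1" using \<kappa>(2) \<rho>2 \<delta> by simp
    moreover have "\<kappa> \<le> real N * \<kappa>" using mult_right_mono[OF N1(1) less_imp_le[OF \<kappa>(1)]] by simp
    ultimately show "\<kappa> \<le> 1" "\<kappa> \<le> 1 / N" using N0 by (auto simp: pos_le_divide_eq mult.commute)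
  qed
  obtain m1 where m1: "\<And>m. m1 \<le> m \<Longrightarrow> 1 \<le> V m" "\<And>m j. m1 \<le> m \<Longrightarrow> 1 \<le> j \<Longrightarrow> j \<le> m \<Longrightarrow> c j * sqrt (L m) \<le> \<kappa> * sqrt (V m)"
    using c_uniform[OF \<kappa>(1)] by blast
  obtain C1 where C1: "\<And>x. C1 \<le> x \<Longrightarrow> 8 / \<rho>\<^sup>2 \<le> LLg x"
    using filterlim_LLg by (auto simp: filterlim_at_top eventually_at_top_linorder)
  obtain m2 where m2: "\<And>m. m2 \<le> m \<Longrightarrow> C1\<^sup>2 \<le> V m" using V_large by blast
  define y where "y = (\<lambda>i. (1 - \<delta>) * (g (real (Suc i) / N) - g (real i / N)))"
  have yb: "\<bar>y i\<bar> \<le> 1" if "i < N" for i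
  proof -
    have "\<bar>g (real (Suc i) / N) - g (real i / N)\<bar> \<le> sqrt \<bar>real (Suc i) / N - real i / N\<bar>"
      by (rule strassen_set_holder[OF g]) (use that in auto)
    also have "\<bar>real (Suc i) / N - real i / N\<bar> \<le> 1" using N1 by (simp add: diff_divide_distrib[symmetric])
    finally have "\<bar>g (real (Suc i) / N) - g (real i / N)\<bar> \<le> 1" by simp
    then have "(1 - \<delta>) * \<bar>g (real (Suc i) / N) - g (real i / N)\<bar> \<le> 1 * 1" using \<delta> by (intro mult_mono) auto
    then show ?thesis using \<delta> by (simp add: y_def abs_mult)
  qed
  have yE: "(\<Sum>i=1..<N. real N * (y i)\<^sup>2) \<le> 1 - \<delta>"
  proof -
    have "(\<Sum>i=1..<N. real N * (y i)\<^sup>2) \<le> (\<Sum>i<N. real N * (y i)\<^sup>2)" by (intro sum_mono2) auto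
    also have "\<dots> = (1 - \<delta>)\<^sup>2 * (\<Sum>i<N. real N * (g (real (Suc i) / N) - g (real i / N))\<^sup>2)"
      by (simp add: y_def power_mult_distrib sum_distrib_left mult_ac)
    also have "\<dots> \<le> (1 - \<delta>)\<^sup>2 * 1" using strassen_grid[OF g N1(2)] by (intro mult_left_mono) auto
    also have "\<dots> \<le> 1 - \<delta>" using \<delta> by (simp add: power2_eq_square mult_left_le)
    finally show ?thesis .
  qed
  have "\<exists>G. depends_on {l<..m} G \<and> (\<forall>x\<in>G. near m x \<epsilon>' \<longrightarrow> close g m x \<epsilon>) \<and>
      (1 / 2) ^ N * exp (- L m) \<le> measure_pmf.prob (Pi_pmf {l<..m} dflt q) G"
    if m: "max m1 m2 \<le> m" and l: "V l < V m * (1 / real N)" for m l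
  proof -
    have Vm: "0 < V m" using m1(1)[of m] m by simp
    have cu: "\<And>j. 1 \<le> j \<Longrightarrow> j \<le> m \<Longrightarrow> c j * sqrt (L m) \<le> \<kappa> * sqrt (V m)" using m1(2) m by simp
    have Lb: "8 / \<rho>\<^sup>2 \<le> L m" unfolding L_def using m2[of m] m by (intro C1 real_le_rsqrt) auto
    have gap: "V (Suc j) - V j \<le> \<kappa> * V m" if "j < m" for j
      using b_uniform[OF \<kappa>(1) \<kappa>1(1) cu, of "Suc j"] that by (simp add: V_Suc)
    obtain r :: "nat \<Rightarrow> nat" where r: "r 0 = 0" "r N = m" "\<And>i. i \<le> N \<Longrightarrow> r i \<le> m" "\<And>i j. i \<le> j \<Longrightarrow> r i \<le> r j"
      and Vr: "\<And>i. i \<le> N \<Longrightarrow> V m * (i / N) \<le> V (r i) \<and> V (r i) \<le> V m * (i / N) + \<kappa> * V m"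
      and rl: "\<And>i l. V l < V m * (i / N) \<Longrightarrow> i \<le> N \<Longrightarrow> l < r i"
      using grid_indices[OF V_mono V_0 Vm N1(2) less_imp_le[OF \<kappa>(1)] gap] by metis
    have l1: "l < r 1" using rl[of l 1] l N1 by simp
    define E where "E = (\<lambda>i. {x. \<bar>(S x (r (Suc i)) - S x (r i)) - bet m * y i\<bar> \<le> \<rho> * bet m})"
    define G where "G = (\<Inter>i\<in>{1..<N}. E i)"
    define J where "J = (\<lambda>i. {r i<..r (Suc i)})"
    have dE: "depends_on (J i) (E i)" for i
    proof -
      have *: "S f (r (Suc i)) - S f (r i) = S h (r (Suc i)) - S h (r i)" if "\<forall>j\<in>J i. f j = h j" for f h
        using that unfolding S_diff[OF r(4)[of i "Suc i", simplified]] by (intro sum.cong) (auto simp: J_def)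
      show ?thesis unfolding depends_on_def
      proof (intro allI impI)
        fix f h :: "nat \<Rightarrow> 'a" assume "\<forall>j\<in>J i. f j = h j"
        from *[OF this] show "f \<in> E i \<longleftrightarrow> h \<in> E i" by (simp add: E_def)
      qed
    qed
    have Jsub: "(\<Union>i\<in>{1..<N}. J i) \<subseteq> {l<..m}"
    proof
      fix j assume "j \<in> (\<Union>i\<in>{1..<N}. J i)"
      then obtain i where i: "1 \<le> i" "i < N" "r i < j" "j \<le> r (Suc i)" by (auto simp: J_def)
      then show "j \<in> {l<..m}" using l1 r(4)[OF i(1)] r(3)[of "Suc i"] by auto
    qed
    have dG': "depends_on (\<Union>i\<in>{1..<N}. J i) G"
      unfolding depends_on_def G_def
    proof (intro allI impI)
      fix f h :: "nat \<Rightarrow> 'a" assume fh: "\<forall>j\<in>\<Union>i\<in>{1..<N}. J i. f j = h j"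
      have "f \<in> E i \<longleftrightarrow> h \<in> E i" if "i \<in> {1..<N}" for i
        by (rule depends_onD[OF dE[of i]]) (use that fh in blast)
      then show "f \<in> (\<Inter>i\<in>{1..<N}. E i) \<longleftrightarrow> h \<in> (\<Inter>i\<in>{1..<N}. E i)" by auto
    qed
    have dG: "depends_on {l<..m} G" by (rule depends_on_mono[OF dG' Jsub])
    have cl: "close g m x \<epsilon>" if x: "x \<in> G" "near m x \<epsilon>'" for x
    proof -
      have inc: "\<bar>(S x (r (Suc i)) - S x (r i)) - bet m * ((1 - \<delta>) * (g (real (Suc i) / N) - g (real i / N)))\<bar> \<le> \<rho> * bet m"
        if "1 \<le> i" "i < N" for i
        using x(1) that by (auto simp: G_def E_def y_def)
      have c: "close g m x (4 * \<epsilon>' + \<delta> + 4 * sqrt (1 / N + \<kappa>))"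
        by (rule close_from_increments[OF g N1(2) Vm r(2,3) Vr x(2) _ _ _ inc N\<rho>]) (use \<delta> \<kappa> \<rho> in auto)
      have "sqrt (1 / N + \<kappa>) \<le> \<epsilon> / 16"
      proof (rule real_le_lsqrt)
        have "1 / N + \<kappa> \<le> 2 / N" using \<kappa>1(2) by simp
        also have "\<dots> \<le> (\<epsilon> / 16)\<^sup>2" using N2 N0 by (simp add: power_divide pos_divide_le_eq)
        finally show "1 / N + \<kappa> \<le> (\<epsilon> / 16)\<^sup>2" .
      qed (use \<epsilon> \<kappa> in auto)
      then have "4 * \<epsilon>' + \<delta> + 4 * sqrt (1 / N + \<kappa>) \<le> \<epsilon>" using \<epsilon> by (simp add: \<epsilon>'_def \<delta>_def)
      then show ?thesis using c unfolding close_def by (meson order_trans)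
    qed
    define A where "A = (1 + \<rho>\<^sup>2 / 16) / (1 - real N * \<kappa>)"
    have PE: "1 / 2 * exp (- (L m * (A * (real N * (y i)\<^sup>2) + 4 * \<rho> * real N))) \<le> measure_pmf.prob (Pi_pmf (J i) dflt q) (E i)"
      if i: "i \<in> {1..<N}" for i
      unfolding A_def J_def E_def
    proof (rule block_lower[OF Vm cu N1(1) \<rho>(1) \<rho>2(1) \<kappa>(1) \<kappa>_def])
      have "V m * (real (Suc i) / N) = V m * (real i / N) + V m / N" by (simp add: add_divide_distrib algebra_simps)
      then show "V m / real N - \<kappa> * V m \<le> V (r (Suc i)) - V (r i)" "V (r (Suc i)) - V (r i) \<le> V m / real N + \<kappa> * V m"
        using Vr[of i] Vr[of "Suc i"] i by auto
    qed (use r i yb Lb in auto)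
    have "(1 / 2) ^ N * exp (- L m) \<le> (\<Prod>i\<in>{1..<N}. 1 / 2 * exp (- (L m * (A * (real N * (y i)\<^sup>2) + 4 * \<rho> * real N))))"
    proof -
      have "(\<Prod>i\<in>{1..<N}. 1 / 2 * exp (- (L m * (A * (real N * (y i)\<^sup>2) + 4 * \<rho> * real N)))) =
        (1 / 2) ^ (N - 1) * exp (- (\<Sum>i\<in>{1..<N}. L m * (A * (real N * (y i)\<^sup>2) + 4 * \<rho> * real N)))"
        unfolding prod.distrib by (simp add: exp_sum[symmetric] sum_negf)
      moreover have "(\<Sum>i\<in>{1..<N}. L m * (A * (real N * (y i)\<^sup>2) + 4 * \<rho> * real N)) \<le> L m"
      proof -
        have "(\<Sum>i\<in>{1..<N}. L m * (A * (real N * (y i)\<^sup>2) + 4 * \<rho> * real N)) =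
          L m * (A * (\<Sum>i\<in>{1..<N}. real N * (y i)\<^sup>2) + real (N - 1) * (4 * \<rho> * real N))"
          by (simp add: sum_distrib_left[symmetric] sum.distrib)
        also have "\<dots> \<le> L m * 1"
        proof (rule mult_left_mono)
          have "real (N - 1) * (4 * \<rho> * real N) \<le> real N * (4 * \<rho> * real N)" using \<rho> by (intro mult_right_mono) auto
          also have "\<dots> = \<delta> / 4" using \<rho>(2) by (simp add: mult_ac)
          finally have a: "real (N - 1) * (4 * \<rho> * real N) \<le> \<delta> / 4" .
          have d1: "0 < 1 - real N * \<kappa>" unfolding \<kappa>(2) using \<rho>2 \<delta> by simp
          have "real N * \<kappa> \<le> \<delta> / 4096" "\<rho>\<^sup>2 / 16 \<le> \<delta> / 256" using \<kappa>(2) \<rho>2(2) by auto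
          moreover have "(1 + \<delta> / 4) * (1 - \<delta> / 4096) = 1 + \<delta> / 4 - \<delta> / 4096 - \<delta> * \<delta> / 16384"
            by (simp add: algebra_simps add_divide_distrib)
          moreover have "\<delta> * \<delta> \<le> \<delta>" using \<delta> mult_left_le[of \<delta> \<delta>] by simp
          moreover have "(1 + \<delta> / 4) * (1 - \<delta> / 4096) \<le> (1 + \<delta> / 4) * (1 - real N * \<kappa>)"
            using calculation(1) \<delta> by (intro mult_left_mono) auto
          ultimately have "1 + \<rho>\<^sup>2 / 16 \<le> (1 + \<delta> / 4) * (1 - real N * \<kappa>)" using \<delta> by linarith
          then have A1: "A \<le> 1 + \<delta> / 4" unfolding A_def using d1 by (simp add: pos_divide_le_eq)
          have A0: "0 \<le> A" unfolding A_def using d1 by (intro divide_nonneg_pos) auto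
          have "A * (\<Sum>i\<in>{1..<N}. real N * (y i)\<^sup>2) \<le> (1 + \<delta> / 4) * (1 - \<delta>)"
            using A1 A0 yE \<delta> by (intro mult_mono) (auto intro: sum_nonneg)
          also have "\<dots> = 1 - 3 / 4 * \<delta> - \<delta> * \<delta> / 4"
            by (simp add: algebra_simps diff_divide_distrib)
          also have "\<dots> \<le> 1 - 3 / 4 * \<delta>" by simp
          finally show "A * (\<Sum>i\<in>{1..<N}. real N * (y i)\<^sup>2) + real (N - 1) * (4 * \<rho> * real N) \<le> 1" using a \<delta> by linarith
        qed (use L_ge_1[of m] in auto)
        finally show ?thesis by simp
      qed
      moreover have "(1 / 2 :: real) ^ N \<le> (1 / 2) ^ (N - 1)" by (intro power_decreasing) auto
      ultimately show ?thesis by (auto intro!: mult_mono)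
    qed
    also have "\<dots> \<le> (\<Prod>i\<in>{1..<N}. measure_pmf.prob (Pi_pmf (J i) dflt q) (E i))"
      using PE by (intro prod_mono) auto
    also have "\<dots> = measure_pmf.prob (Pi_pmf (\<Union>i\<in>{1..<N}. J i) dflt q) G"
      unfolding G_def
    proof (rule prob_Pi_pmf_INT[symmetric])
      show "disjoint_family_on J {1..<N}" unfolding disjoint_family_on_def
      proof (intro ballI impI)
        fix i k :: nat assume "i \<noteq> k"
        then consider "Suc i \<le> k" | "Suc k \<le> i" by linarith
        then show "J i \<inter> J k = {}"
        proof cases
          case 1 then show ?thesis using r(4)[OF 1] by (auto simp: J_def)
        next
          case 2 then show ?thesis using r(4)[OF 2] by (auto simp: J_def)
        qed
      qed
    qed (auto simp: J_def intro: dE[unfolded J_def])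
    also have "\<dots> = measure_pmf.prob (Pi_pmf {l<..m} dflt q) G"
      by (rule prob_Pi_pmf_marginal[symmetric, OF _ Jsub dG']) simp
    finally show ?thesis using dG cl by blast
  qed
  moreover have "0 < \<epsilon>'" using \<epsilon> by (simp add: \<epsilon>'_def)
  ultimately show ?thesis using N1(2) by blast
qed

text \<open>
  When \<open>V m\<close> is at most a power of \<open>B\<close> with exponent \<open>k + 1\<close>, the iterated logarithm is at most
  \<open>ln k\<close> up to a constant, so \<open>exp (- L m)\<close> is at least of the order \<open>1 / k\<close>.
\<close>

lemma exp_L_lower:
  assumes "1 \<le> V m" "V m \<le> B ^ (k + 1)" "exp 1 \<le> B"
  shows "1 / ((ln B + 3) * (real k + 1)) \<le> exp (- L m)"
proof -
  have B: "1 \<le> B" using assms(3) one_le_exp_iff[of 1] by linarith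
  have "sqrt (V m) \<le> V m" using assms(1) real_sqrt_le_mono[of "V m" "(V m)\<^sup>2"] self_le_power[of "V m" 2] by simp
  then have s: "sqrt (V m) \<le> B ^ (k + 1)" using assms(2) by simp
  have "B ^ 1 \<le> B ^ (k + 1)" using B by (intro power_increasing) auto
  then have e: "exp 1 \<le> B ^ (k + 1)" using assms(3) by simp
  have "Lg (sqrt (V m)) \<le> Lg (B ^ (k + 1))" by (rule Lg_mono[OF s])
  also have "\<dots> = real (k + 1) * ln B" unfolding Lg_def using e B by (simp add: max_absorb1 ln_realpow del: power_Suc power_add add_Suc_right)
  finally have a: "Lg (sqrt (V m)) \<le> real (k + 1) * ln B" .
  have "exp 1 \<le> (3::real)" by (rule exp_le)
  moreover have "(3::real) * 1 \<le> 3 * (real k + 1)" by (intro mult_left_mono) auto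
  moreover have "0 \<le> real (k + 1) * ln B" using B by simp
  moreover have "(ln B + 3) * (real k + 1) = real (k + 1) * ln B + 3 * (real k + 1)" by (simp add: algebra_simps)
  ultimately have "max (Lg (sqrt (V m))) (exp 1) \<le> (ln B + 3) * (real k + 1)" using a by (intro max.boundedI) linarith+
  then have "ln (max (Lg (sqrt (V m))) (exp 1)) \<le> ln ((ln B + 3) * (real k + 1))"
    by (intro ln_mono) (auto simp: less_max_iff_disj)
  then have "L m \<le> ln ((ln B + 3) * (real k + 1))" by (simp add: L_def LLg_def Lg_def[of "Lg _"])
  then have "exp (- ln ((ln B + 3) * (real k + 1))) \<le> exp (- L m)" by simp
  moreover have "0 < (ln B + 3) * (real k + 1)" using B by (intro mult_pos_pos) (auto intro: add_nonneg_pos)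
  ultimately show ?thesis by (simp add: exp_minus inverse_eq_divide)
qed

lemma harmonic_product_small:
  assumes "0 < a" "0 < \<eta>"
  shows "\<exists>k2\<ge>k1. exp (- (\<Sum>k\<in>{k1..<k2}. a / (real k + 1))) \<le> \<eta>"
proof (rule ccontr)
  assume H: "\<not> ?thesis"
  have bd: "(\<Sum>k\<in>{k1..<k2}. a / (real k + 1)) \<le> - ln \<eta>" for k2
  proof (cases "k1 \<le> k2")
    case True
    then have "\<eta> < exp (- (\<Sum>k\<in>{k1..<k2}. a / (real k + 1)))" using H by force
    then have "ln \<eta> < ln (exp (- (\<Sum>k\<in>{k1..<k2}. a / (real k + 1))))" using assms by (intro ln_less_cancel_iff[THEN iffD2]) auto
    then show ?thesis by simp
  next
    case False
    have "\<eta> < exp (- (\<Sum>k\<in>{k1..<k1}. a / (real k + 1)))" using H by force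
    then have "ln \<eta> < 0" using assms by simp
    then show ?thesis using False by simp
  qed
  have "summable (\<lambda>k. a / (real (k + k1) + 1))"
  proof (rule summableI_nonneg_bounded)
    fix n
    have "(\<Sum>k<n. a / (real (k + k1) + 1)) = (\<Sum>k\<in>{k1..<n + k1}. a / (real k + 1))"
      using sum.shift_bounds_nat_ivl[of "\<lambda>k. a / (real k + 1)" 0 k1 n] by (simp add: atLeast0LessThan)
    then show "(\<Sum>k<n. a / (real (k + k1) + 1)) \<le> - ln \<eta>" using bd[of "n + k1"] by simp
  qed (use assms in auto)
  then have "summable (\<lambda>k. a / (real k + 1))" using summable_iff_shift[of "\<lambda>k. a / (real k + 1)" k1] by simp
  then have "summable (\<lambda>k. (1 / a) * (a / (real k + 1)))" by (rule summable_mult)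
  then have "summable (\<lambda>k. 1 / (real k + 1))" using assms by simp
  then have "summable (\<lambda>k. real (Suc k) powr (- 1))" by (simp add: powr_minus_divide add.commute)
  then have "summable (\<lambda>k. real k powr (- 1))" using summable_Suc_iff[of "\<lambda>k. real k powr (- 1)"] by simp
  then show False unfolding summable_real_powr_iff by simp
qed

text \<open>
  Second Borel-Cantelli lemma in finite form: along the indices \<open>M k\<close> where \<open>V\<close> reaches \<open>(4 * N) ^ k\<close>, the
  events of \<open>lower_single\<close> live on disjoint blocks and have probabilities of order \<open>1 / k\<close>, so with
  probability close to one one of them occurs.  There \<open>upper_LIL\<close> supplies the nearness that turns it
  into closeness to \<open>g\<close>.
\<close>

theorem lower_LIL:
  assumes g: "g \<in> strassen_set" and \<epsilon>: "0 < \<epsilon>" and \<eta>: "0 < \<eta>"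
  shows "\<exists>n0. \<forall>n\<ge>n0. measure_pmf.prob (P n) {x. \<forall>m\<in>{n1..n}. \<not> close g m x \<epsilon>} \<le> \<eta>"
proof -
  define \<epsilon>1 where "\<epsilon>1 = min 1 \<epsilon>"
  have \<epsilon>1: "0 < \<epsilon>1" "\<epsilon>1 \<le> 1" "\<epsilon>1 \<le> \<epsilon>" using \<epsilon> by (auto simp: \<epsilon>1_def)
  obtain N \<epsilon>' m0 where N: "N > 0" and \<epsilon>': "0 < \<epsilon>'" and single: "\<And>m l. m0 \<le> m \<Longrightarrow> V l < V m * (1 / real N) \<Longrightarrow>
    \<exists>G. depends_on {l<..m} G \<and> (\<forall>x\<in>G. near m x \<epsilon>' \<longrightarrow> close g m x \<epsilon>1) \<and>
      (1 / 2) ^ N * exp (- L m) \<le> measure_pmf.prob (Pi_pmf {l<..m} dflt q) G"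
    using lower_single[OF g \<epsilon>1(1,2)] by blast
  obtain n2 where n2: "\<And>n. measure_pmf.prob (P n) {x. \<exists>m\<in>{n2..n}. \<not> near m x \<epsilon>'} \<le> \<eta> / 2"
    using upper_LIL[OF \<epsilon>', of "\<eta> / 2"] \<eta> by auto
  obtain m1 where m1: "\<And>m. m1 \<le> m \<Longrightarrow> 1 \<le> V m"
    "\<And>m j. m1 \<le> m \<Longrightarrow> 1 \<le> j \<Longrightarrow> j \<le> m \<Longrightarrow> c j * sqrt (L m) \<le> 1 / 2 * sqrt (V m)"
    using c_uniform[of "1 / 2"] by auto
  (* the factor 4 * N exceeds N by enough to make all variables up to M k part of the first
     block at M (Suc k), even after an overshoot by the factor 2 *)
  define B where "B = 4 * real N"
  have B4: "4 \<le> B" using N by (simp add: B_def)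
  have Be: "exp 1 \<le> B" using exp_le B4 by linarith
  define M where "M = (\<lambda>k. LEAST m. B ^ k \<le> V m)"
  have exM: "\<exists>l. B ^ k \<le> V l" for k using V_large[of "B ^ k"] by blast
  have MV: "B ^ k \<le> V (M k)" for k unfolding M_def using exM[of k] by (rule LeastI_ex)
  have Mless: "i < M k" if "V i < B ^ k" for i k
    using that MV[of k] V_le[of "M k" i] by (meson leI le_less_trans less_irrefl order_trans)
  have Mmono: "M i \<le> M j" if "i \<le> j" for i j
  proof -
    have "B ^ i \<le> B ^ j" using that B4 by (intro power_increasing) auto
    then have "B ^ i \<le> V (M j)" using MV[of j] by linarith
    then show ?thesis using Least_le[of "\<lambda>m. B ^ i \<le> V m" "M j"] by (simp add: M_def)
  qed
  define nn where "nn = max (max n1 n2) (max m0 m1)"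
  obtain k1 where k1: "V nn < B ^ k1" using real_arch_pow[of B "V nn"] B4 by auto
  have Mlarge: "nn < M k" if "k1 \<le> k" for k
    using Mless[OF k1] Mmono[OF that] by simp
  have MV2: "V (M k) \<le> 2 * B ^ k" if "k1 \<le> k" for k
  proof -
    have "m1 \<le> M k" using Mlarge[OF that] by (simp add: nn_def)
    moreover have "0 < B ^ k" using B4 by simp
    ultimately show ?thesis using V_overshoot(2)[OF m1(2), of "M k" "B ^ k" "M k"] MV[of k] by (simp add: M_def)
  qed
  define J where "J = (\<lambda>k. {M k<..M (Suc k)})"
  define p0 where "p0 = (1 / 2) ^ N / ((ln B + 3) * 2)"
  have lnB: "0 \<le> ln B" using B4 by simp
  have p0: "0 < p0" using lnB by (simp add: p0_def)
  have "\<exists>G. depends_on (J k) G \<and> (\<forall>x\<in>G. near (M (Suc k)) x \<epsilon>' \<longrightarrow> close g (M (Suc k)) x \<epsilon>1) \<and>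
      p0 / (real k + 1) \<le> measure_pmf.prob (Pi_pmf (J k) dflt q) G" if k: "k1 \<le> k" for k
  proof -
    have mm: "nn < M (Suc k)" using Mlarge[of "Suc k"] k by simp
    have eq: "B ^ Suc k = 4 * real N * B ^ k" by (simp add: B_def)
    have "4 * real N * B ^ k \<le> V (M (Suc k))" using MV[of "Suc k"] unfolding eq .
    then have "4 * B ^ k \<le> V (M (Suc k)) * (1 / real N)" using N by (simp add: pos_le_divide_eq mult_ac)
    moreover have "2 * B ^ k < 4 * B ^ k" using B4 by simp
    ultimately have lt: "V (M k) < V (M (Suc k)) * (1 / real N)" using MV2[OF k] by linarith
    obtain G where G: "depends_on {M k<..M (Suc k)} G" "\<forall>x\<in>G. near (M (Suc k)) x \<epsilon>' \<longrightarrow> close g (M (Suc k)) x \<epsilon>1"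
      "(1 / 2) ^ N * exp (- L (M (Suc k))) \<le> measure_pmf.prob (Pi_pmf {M k<..M (Suc k)} dflt q) G"
      using single[OF _ lt] mm by (auto simp: nn_def)
    have "1 \<le> V (M (Suc k))" using mm by (intro m1(1)) (simp add: nn_def)
    moreover have "V (M (Suc k)) \<le> B ^ (Suc k + 1)"
    proof -
      have "2 * B ^ Suc k \<le> B * B ^ Suc k" using B4 by (intro mult_right_mono) auto
      then show ?thesis using MV2[of "Suc k"] k by simp
    qed
    ultimately have e: "1 / ((ln B + 3) * (real (Suc k) + 1)) \<le> exp (- L (M (Suc k)))" by (rule exp_L_lower[OF _ _ Be])
    have "1 / ((ln B + 3) * (2 * (real k + 1))) \<le> 1 / ((ln B + 3) * (real (Suc k) + 1))"
      using lnB by (intro divide_left_mono mult_left_mono mult_pos_pos) auto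
    then have "1 / ((ln B + 3) * (2 * (real k + 1))) \<le> exp (- L (M (Suc k)))" using e by linarith
    then have "(1 / 2) ^ N * (1 / ((ln B + 3) * (2 * (real k + 1)))) \<le> (1 / 2) ^ N * exp (- L (M (Suc k)))"
      by (intro mult_left_mono) auto
    moreover have "p0 / (real k + 1) = (1 / 2) ^ N * (1 / ((ln B + 3) * (2 * (real k + 1))))"
      by (simp only: p0_def divide_divide_eq_left mult.assoc times_divide_eq_right mult_1_right)
    ultimately show ?thesis using G unfolding J_def by (intro exI[of _ G]) auto
  qed
  then obtain G where G: "\<And>k. k1 \<le> k \<Longrightarrow> depends_on (J k) (G k)"
    "\<And>k x. k1 \<le> k \<Longrightarrow> x \<in> G k \<Longrightarrow> near (M (Suc k)) x \<epsilon>' \<Longrightarrow> close g (M (Suc k)) x \<epsilon>1"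
    "\<And>k. k1 \<le> k \<Longrightarrow> p0 / (real k + 1) \<le> measure_pmf.prob (Pi_pmf (J k) dflt q) (G k)"
    by metis
  obtain k2 where k2: "k1 \<le> k2" "exp (- (\<Sum>k\<in>{k1..<k2}. p0 / (real k + 1))) \<le> \<eta> / 2"
    using harmonic_product_small[OF p0, of "\<eta> / 2" k1] \<eta> by auto
  let ?K = "{k1..<k2}"
  have dJ: "disjoint_family_on J ?K" unfolding disjoint_family_on_def
  proof (intro ballI impI)
    fix i k :: nat assume "i \<noteq> k"
    then consider "Suc i \<le> k" | "Suc k \<le> i" by linarith
    then show "J i \<inter> J k = {}"
    proof cases
      case 1 then show ?thesis using Mmono[OF 1] by (auto simp: J_def)
    next
      case 2 then show ?thesis using Mmono[OF 2] by (auto simp: J_def)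
    qed
  qed
  have dGc: "depends_on (J k) (- G k)" if "k1 \<le> k" for k
    using G(1)[OF that] unfolding depends_on_def by simp
  have miss: "measure_pmf.prob (Pi_pmf (\<Union>k\<in>?K. J k) dflt q) (\<Inter>k\<in>?K. - G k) \<le> \<eta> / 2"
  proof -
    have "measure_pmf.prob (Pi_pmf (\<Union>k\<in>?K. J k) dflt q) (\<Inter>k\<in>?K. - G k) = (\<Prod>k\<in>?K. measure_pmf.prob (Pi_pmf (J k) dflt q) (- G k))"
      by (rule prob_Pi_pmf_INT[OF _ _ dJ dGc]) (auto simp: J_def)
    also have "\<dots> \<le> (\<Prod>k\<in>?K. exp (- (p0 / (real k + 1))))"
    proof (intro prod_mono conjI)
      fix k assume k: "k \<in> ?K"
      have "measure_pmf.prob (Pi_pmf (J k) dflt q) (- G k) = 1 - measure_pmf.prob (Pi_pmf (J k) dflt q) (G k)"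
        using measure_pmf.prob_compl[of "G k" "Pi_pmf (J k) dflt q"] by (simp add: Compl_eq_Diff_UNIV)
      also have "\<dots> \<le> 1 + - (p0 / (real k + 1))" using G(3)[of k] k by simp
      also have "\<dots> \<le> exp (- (p0 / (real k + 1)))" by (rule exp_ge_add_one_self)
      finally show "measure_pmf.prob (Pi_pmf (J k) dflt q) (- G k) \<le> exp (- (p0 / (real k + 1)))" .
    qed simp
    also have "\<dots> = exp (- (\<Sum>k\<in>?K. p0 / (real k + 1)))" by (simp add: exp_sum[symmetric] sum_negf)
    also have "\<dots> \<le> \<eta> / 2" by (rule k2(2))
    finally show ?thesis .
  qed
  have "measure_pmf.prob (P n) {x. \<forall>m\<in>{n1..n}. \<not> close g m x \<epsilon>} \<le> \<eta>" if n: "M k2 \<le> n" for n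
  proof -
    have Jn: "(\<Union>k\<in>?K. J k) \<subseteq> {1..n}"
    proof
      fix j assume "j \<in> (\<Union>k\<in>?K. J k)"
      then obtain k where "k1 \<le> k" "k < k2" "M k < j" "j \<le> M (Suc k)" by (auto simp: J_def)
      then show "j \<in> {1..n}" using Mmono[of "Suc k" k2] n by auto
    qed
    have dI: "depends_on (\<Union>k\<in>?K. J k) (\<Inter>k\<in>?K. - G k)"
      unfolding depends_on_def
    proof (intro allI impI)
      fix f h :: "nat \<Rightarrow> 'a" assume fh: "\<forall>j\<in>\<Union>k\<in>?K. J k. f j = h j"
      have "f \<in> - G k \<longleftrightarrow> h \<in> - G k" if "k \<in> ?K" for k
        by (rule depends_onD[OF dGc[of k]]) (use that fh in auto)
      then show "f \<in> (\<Inter>k\<in>?K. - G k) \<longleftrightarrow> h \<in> (\<Inter>k\<in>?K. - G k)" by auto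
    qed
    have "{x. \<forall>m\<in>{n1..n}. \<not> close g m x \<epsilon>} \<subseteq> {x. \<exists>m\<in>{n2..n}. \<not> near m x \<epsilon>'} \<union> (\<Inter>k\<in>?K. - G k)"
    proof
      fix x assume x: "x \<in> {x. \<forall>m\<in>{n1..n}. \<not> close g m x \<epsilon>}"
      show "x \<in> {x. \<exists>m\<in>{n2..n}. \<not> near m x \<epsilon>'} \<union> (\<Inter>k\<in>?K. - G k)"
      proof (rule ccontr)
        assume H: "\<not> ?thesis"
        then obtain k where k: "k1 \<le> k" "k < k2" "x \<in> G k" by auto
        have Mk: "nn < M (Suc k)" "M (Suc k) \<le> n" using Mlarge[of "Suc k"] k Mmono[of "Suc k" k2] n by auto
        have "near (M (Suc k)) x \<epsilon>'" using H Mk by (auto simp: nn_def)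
        then have "close g (M (Suc k)) x \<epsilon>1" using G(2)[OF k(1) k(3)] by simp
        then have "close g (M (Suc k)) x \<epsilon>" using \<epsilon>1(3) unfolding close_def by (meson order_trans)
        then show False using x Mk by (auto simp: nn_def)
      qed
    qed
    then have "measure_pmf.prob (P n) {x. \<forall>m\<in>{n1..n}. \<not> close g m x \<epsilon>} \<le> measure_pmf.prob (P n) ({x. \<exists>m\<in>{n2..n}. \<not> near m x \<epsilon>'} \<union> (\<Inter>k\<in>?K. - G k))"
      by (intro measure_pmf.finite_measure_mono) auto
    also have "\<dots> \<le> measure_pmf.prob (P n) {x. \<exists>m\<in>{n2..n}. \<not> near m x \<epsilon>'} + measure_pmf.prob (P n) (\<Inter>k\<in>?K. - G k)"
      by (rule measure_Un_le) auto
    also have "measure_pmf.prob (P n) (\<Inter>k\<in>?K. - G k) = measure_pmf.prob (Pi_pmf (\<Union>k\<in>?K. J k) dflt q) (\<Inter>k\<in>?K. - G k)"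
      by (rule prob_Pi_pmf_marginal[OF _ Jn dI]) simp
    finally show ?thesis using n2[of n] miss by linarith
  qed
  then show ?thesis by blast
qed

end


section \<open>Poisson variables conditioned on their weighted sum\<close>

text \<open>
  The weights satisfy \<open>y * P y = \<mu> * P (y - 1)\<close>.
\<close>

lemma poisson_size_bias:
  fixes G :: "nat \<Rightarrow> ennreal"
  assumes "0 < \<mu>"
  shows "(\<integral>\<^sup>+y. of_nat y * G y \<partial>poisson_pmf \<mu>) = ennreal \<mu> * (\<integral>\<^sup>+y. G (Suc y) \<partial>poisson_pmf \<mu>)"
proof -
  define f where "f = (\<lambda>y. ennreal (pmf (poisson_pmf \<mu>) y) * (of_nat y * G y))"
  have "(\<integral>\<^sup>+y. of_nat y * G y \<partial>poisson_pmf \<mu>) = (\<integral>\<^sup>+y. f y \<partial>count_space UNIV)"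
    unfolding f_def by (rule nn_integral_measure_pmf)
  also have "\<dots> = (\<integral>\<^sup>+y. f y \<partial>count_space (range Suc))"
  proof (rule nn_integral_count_space_eq)
    fix y :: nat assume "y \<in> UNIV - range Suc"
    then have "y = 0" by (cases y) auto
    then show "f y = 0" by (simp add: f_def)
  qed auto
  also have "\<dots> = (\<integral>\<^sup>+y. f (Suc y) \<partial>count_space UNIV)"
    by (rule nn_integral_bij_count_space[symmetric]) (simp add: bij_betw_def)
  also have "\<dots> = (\<integral>\<^sup>+y. ennreal \<mu> * (ennreal (pmf (poisson_pmf \<mu>) y) * G (Suc y)) \<partial>count_space UNIV)"
  proof (rule nn_integral_cong)
    fix y :: nat
    have "pmf (poisson_pmf \<mu>) (Suc y) * real (Suc y) = \<mu> * pmf (poisson_pmf \<mu>) y"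
      unfolding pmf_poisson[OF assms] by (simp add: field_simps del: of_nat_Suc)
    then have "ennreal (pmf (poisson_pmf \<mu>) (Suc y)) * of_nat (Suc y) = ennreal \<mu> * ennreal (pmf (poisson_pmf \<mu>) y)"
      using assms by (simp add: ennreal_mult'[symmetric] ennreal_of_nat_eq_real_of_nat del: of_nat_Suc pmf_poisson)
    then show "f (Suc y) = ennreal \<mu> * (ennreal (pmf (poisson_pmf \<mu>) y) * G (Suc y))"
      unfolding f_def by (simp only: mult.assoc[symmetric])
  qed
  also have "\<dots> = ennreal \<mu> * (\<integral>\<^sup>+y. G (Suc y) \<partial>poisson_pmf \<mu>)"
    by (subst nn_integral_cmult) (auto simp: nn_integral_measure_pmf)
  finally show ?thesis .
qed

definition ell :: "nat set \<Rightarrow> (nat \<Rightarrow> nat) \<Rightarrow> nat" where "ell A x = (\<Sum>j\<in>A. j * x j)"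

lemma ell_incr: "finite A \<Longrightarrow> j \<in> A \<Longrightarrow> ell A (x(j := Suc (x j))) = ell A x + j"
  unfolding ell_def by (subst (1 2) sum.remove[of A j]) auto

lemma ell_cong: "(\<And>j. j \<in> A \<Longrightarrow> x j = y j) \<Longrightarrow> ell A x = ell A y"
  unfolding ell_def by (intro sum.cong) auto

lemma measure_cond_pmf:
  assumes "measure_pmf.prob p S \<noteq> 0"
  shows "measure_pmf.prob (cond_pmf p S) E = measure_pmf.prob p (S \<inter> E) / measure_pmf.prob p S"
proof -
  have "set_pmf p \<inter> S \<noteq> {}"
  proof
    assume "set_pmf p \<inter> S = {}"
    then have "measure_pmf.prob p S = 0" by (simp add: measure_pmf_zero_iff)
    then show False using assms by simp
  qed
  then have "measure_pmf (cond_pmf p S) = uniform_measure (measure_pmf p) S" by (rule cond_pmf.rep_eq)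
  moreover have "emeasure (measure_pmf p) S \<noteq> 0" using assms by (simp add: measure_pmf.emeasure_eq_measure)
  ultimately show ?thesis by (simp add: measure_uniform_measure)
qed

text \<open>
  The parameters are those of a weakly logarithmic class; from here on \<open>x j\<close> is the number of components
  of size \<open>j\<close>.
\<close>

locale log_poisson =
  fixes lam :: "nat \<Rightarrow> real" and \<theta>1 \<theta>2 :: real
  assumes \<theta>: "0 < \<theta>1" "\<theta>1 \<le> \<theta>2"
    and lam_lower: "\<And>j. 1 \<le> j \<Longrightarrow> \<theta>1 / real j \<le> lam j"
    and lam_upper: "\<And>j. 1 \<le> j \<Longrightarrow> lam j \<le> \<theta>2 / real j"
begin

abbreviation PP :: "nat set \<Rightarrow> (nat \<Rightarrow> nat) pmf" where "PP A \<equiv> Pi_pmf A 0 (\<lambda>j. poisson_pmf (lam j))"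

lemma lam_pos: "1 \<le> j \<Longrightarrow> 0 < lam j"
proof -
  assume j: "1 \<le> j"
  then have "0 < \<theta>1 / real j" using \<theta> by simp
  then show ?thesis using lam_lower[OF j] by linarith
qed

lemma j_lam: "1 \<le> j \<Longrightarrow> \<theta>1 \<le> real j * lam j" "1 \<le> j \<Longrightarrow> real j * lam j \<le> \<theta>2"
  using lam_lower[of j] lam_upper[of j] by (auto simp: field_simps)

lemma mecke:
  fixes F :: "(nat \<Rightarrow> nat) \<Rightarrow> ennreal"
  assumes A: "finite A" "j \<in> A" "1 \<le> j"
  shows "(\<integral>\<^sup>+x. of_nat (x j) * F x \<partial>PP A) = ennreal (lam j) * (\<integral>\<^sup>+x. F (x(j := Suc (x j))) \<partial>PP A)"
proof -
  define B where "B = A - {j}"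
  have B: "A = insert j B" "finite B" "j \<notin> B" using A by (auto simp: B_def)
  have split: "(\<integral>\<^sup>+x. H x \<partial>PP A) = (\<integral>\<^sup>+f. \<integral>\<^sup>+y. H (f(j := y)) \<partial>poisson_pmf (lam j) \<partial>PP B)" for H :: "(nat \<Rightarrow> nat) \<Rightarrow> ennreal"
  proof -
    have "PP A = map_pmf (\<lambda>(y, f). f(j := y)) (pair_pmf (poisson_pmf (lam j)) (PP B))"
      unfolding B(1) by (rule Pi_pmf_insert[OF B(2,3)])
    also have "pair_pmf (poisson_pmf (lam j)) (PP B) = map_pmf (\<lambda>(f, y). (y, f)) (pair_pmf (PP B) (poisson_pmf (lam j)))"
      by (rule pair_commute_pmf)
    finally have "PP A = map_pmf (\<lambda>(f, y). f(j := y)) (pair_pmf (PP B) (poisson_pmf (lam j)))"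
      by (simp only: pmf.map_comp o_def case_prod_unfold fst_conv snd_conv)
    then show ?thesis by (simp add: nn_integral_pair_pmf' case_prod_unfold)
  qed
  have "(\<integral>\<^sup>+x. of_nat (x j) * F x \<partial>PP A) = (\<integral>\<^sup>+f. \<integral>\<^sup>+y. of_nat y * F (f(j := y)) \<partial>poisson_pmf (lam j) \<partial>PP B)"
    unfolding split by simp
  also have "\<dots> = (\<integral>\<^sup>+f. ennreal (lam j) * (\<integral>\<^sup>+y. F (f(j := Suc y)) \<partial>poisson_pmf (lam j)) \<partial>PP B)"
    using lam_pos[OF A(3)] by (subst poisson_size_bias) auto
  also have "\<dots> = ennreal (lam j) * (\<integral>\<^sup>+f. \<integral>\<^sup>+y. F (f(j := Suc y)) \<partial>poisson_pmf (lam j) \<partial>PP B)"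
    by (rule nn_integral_cmult) auto
  also have "(\<integral>\<^sup>+f. \<integral>\<^sup>+y. F (f(j := Suc y)) \<partial>poisson_pmf (lam j) \<partial>PP B) = (\<integral>\<^sup>+x. F (x(j := Suc (x j))) \<partial>PP A)"
    unfolding split by simp
  finally show ?thesis .
qed

lemma mecke_ell:
  assumes A: "finite A" "\<And>j. j \<in> A \<Longrightarrow> 1 \<le> j" and B: "B \<subseteq> A"
  shows "(\<integral>\<^sup>+x. of_nat (ell B x) * indicator E x \<partial>PP A) =
    ennreal (\<Sum>j\<in>B. real j * lam j * measure_pmf.prob (PP A) {x. x(j := Suc (x j)) \<in> E})"
proof -
  have fB: "finite B" using A B finite_subset by blast
  have "(\<integral>\<^sup>+x. of_nat (ell B x) * indicator E x \<partial>PP A) = (\<integral>\<^sup>+x. (\<Sum>j\<in>B. of_nat j * (of_nat (x j) * indicator E x)) \<partial>PP A)"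
    by (intro nn_integral_cong) (simp add: ell_def sum_distrib_right mult.assoc)
  also have "\<dots> = (\<Sum>j\<in>B. \<integral>\<^sup>+x. of_nat j * (of_nat (x j) * indicator E x) \<partial>PP A)"
    by (rule nn_integral_sum) auto
  also have "\<dots> = (\<Sum>j\<in>B. ennreal (real j * lam j * measure_pmf.prob (PP A) {x. x(j := Suc (x j)) \<in> E}))"
  proof (rule sum.cong[OF refl])
    fix j assume "j \<in> B"
    then have j: "j \<in> A" "1 \<le> j" using A B by auto
    have "(\<integral>\<^sup>+x. of_nat j * (of_nat (x j) * indicator E x) \<partial>PP A) = of_nat j * (\<integral>\<^sup>+x. of_nat (x j) * indicator E x \<partial>PP A)"
      by (rule nn_integral_cmult) auto
    also have "(\<integral>\<^sup>+x. of_nat (x j) * indicator E x \<partial>PP A) = ennreal (lam j) * (\<integral>\<^sup>+x. indicator E (x(j := Suc (x j))) \<partial>PP A)"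
      by (rule mecke[OF A(1) j])
    also have "(\<integral>\<^sup>+x. indicator E (x(j := Suc (x j))) \<partial>PP A) = (\<integral>\<^sup>+x. indicator {x. x(j := Suc (x j)) \<in> E} x \<partial>PP A)"
      by (intro nn_integral_cong) (auto simp: indicator_def)
    also have "\<dots> = ennreal (measure_pmf.prob (PP A) {x. x(j := Suc (x j)) \<in> E})"
      by (simp add: measure_pmf.emeasure_eq_measure)
    finally show "(\<integral>\<^sup>+x. of_nat j * (of_nat (x j) * indicator E x) \<partial>PP A) = ennreal (real j * lam j * measure_pmf.prob (PP A) {x. x(j := Suc (x j)) \<in> E})"
      using lam_pos[OF j(2)] by (simp add: ennreal_mult ennreal_of_nat_eq_real_of_nat mult.assoc)
  qed
  also have "\<dots> = ennreal (\<Sum>j\<in>B. real j * lam j * measure_pmf.prob (PP A) {x. x(j := Suc (x j)) \<in> E})"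
  proof (rule sum_ennreal)
    fix j assume "j \<in> B"
    then have "1 \<le> j" using A B by auto
    then show "0 \<le> real j * lam j * measure_pmf.prob (PP A) {x. x(j := Suc (x j)) \<in> E}" using lam_pos[of j] by simp
  qed
  finally show ?thesis .
qed

lemma size_bias_le:
  assumes A: "finite A" "\<And>j. j \<in> A \<Longrightarrow> 1 \<le> j" and B: "B \<subseteq> A" and E: "\<And>x. x \<in> E \<Longrightarrow> t \<le> ell B x"
  shows "real t * measure_pmf.prob (PP A) E \<le> (\<Sum>j\<in>B. real j * lam j * measure_pmf.prob (PP A) {x. x(j := Suc (x j)) \<in> E})" (is "_ \<le> ?S")
proof -
  have "ennreal (real t * measure_pmf.prob (PP A) E) = (\<integral>\<^sup>+x. of_nat t * indicator E x \<partial>PP A)"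
    by (subst nn_integral_cmult) (auto simp: measure_pmf.emeasure_eq_measure ennreal_mult ennreal_of_nat_eq_real_of_nat)
  also have "\<dots> \<le> (\<integral>\<^sup>+x. of_nat (ell B x) * indicator E x \<partial>PP A)"
    using E by (intro nn_integral_mono) (auto simp: indicator_def)
  also have "\<dots> = ennreal ?S" by (rule mecke_ell[OF A B])
  finally show ?thesis
  proof (rule ennreal_le_iff[THEN iffD1, rotated])
    show "0 \<le> ?S"
    proof (rule sum_nonneg)
      fix j assume "j \<in> B"
      then have "1 \<le> j" using A B by auto
      then show "0 \<le> real j * lam j * measure_pmf.prob (PP A) {x. x(j := Suc (x j)) \<in> E}" using lam_pos[of j] by simp
    qed
  qed
qed

text \<open>
  Since \<open>t * P (ell = t) = E (ell; ell = t)\<close>, the size-bias identity gives a recursion for the point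
  probabilities of \<open>ell\<close>.
\<close>

lemma size_bias_eq:
  assumes A: "finite A" "\<And>j. j \<in> A \<Longrightarrow> 1 \<le> j"
  shows "real t * measure_pmf.prob (PP A) {x. ell A x = t} = (\<Sum>j\<in>A. real j * lam j * measure_pmf.prob (PP A) {x. ell A x + j = t})" (is "_ = ?S")
proof -
  have "ennreal (real t * measure_pmf.prob (PP A) {x. ell A x = t}) = (\<integral>\<^sup>+x. of_nat t * indicator {x. ell A x = t} x \<partial>PP A)"
    by (subst nn_integral_cmult) (auto simp: measure_pmf.emeasure_eq_measure ennreal_mult ennreal_of_nat_eq_real_of_nat)
  also have "\<dots> = (\<integral>\<^sup>+x. of_nat (ell A x) * indicator {x. ell A x = t} x \<partial>PP A)"
    by (intro nn_integral_cong) (auto simp: indicator_def)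
  also have "\<dots> = ennreal (\<Sum>j\<in>A. real j * lam j * measure_pmf.prob (PP A) {x. x(j := Suc (x j)) \<in> {x. ell A x = t}})"
    by (rule mecke_ell[OF A order_refl])
  also have "(\<Sum>j\<in>A. real j * lam j * measure_pmf.prob (PP A) {x. x(j := Suc (x j)) \<in> {x. ell A x = t}}) = ?S"
    using ell_incr[OF A(1)] by (intro sum.cong refl) simp
  finally have eq: "ennreal (real t * measure_pmf.prob (PP A) {x. ell A x = t}) = ennreal ?S" .
  have "0 \<le> ?S"
  proof (rule sum_nonneg)
    fix j assume "j \<in> A"
    then have "1 \<le> j" using A by auto
    then show "0 \<le> real j * lam j * measure_pmf.prob (PP A) {x. ell A x + j = t}" using lam_pos[of j] by simp
  qed
  then show ?thesis using eq by (subst (asm) ennreal_inj) auto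
qed

lemma sum_disjoint_prob_le_1:
  assumes "finite A" "inj_on k A"
  shows "(\<Sum>j\<in>A. measure_pmf.prob p {x. f x + k j = (t::nat)}) \<le> 1"
proof -
  have "(\<Sum>j\<in>A. measure_pmf.prob p {x. f x + k j = t}) = measure_pmf.prob p (\<Union>j\<in>A. {x. f x + k j = t})"
    using assms by (intro measure_pmf.finite_measure_finite_Union[symmetric])
      (auto simp: disjoint_family_on_def inj_on_def)
  then show ?thesis by simp
qed

text \<open>
  In the recursion \<open>size_bias_eq\<close> the coefficients \<open>j * lam j\<close> are at most \<open>\<theta>2\<close>, and the remaining events
  are disjoint.
\<close>

lemma local_upper:
  assumes A: "finite A" "\<And>j. j \<in> A \<Longrightarrow> 1 \<le> j"
  shows "real t * measure_pmf.prob (PP A) {x. ell A x = t} \<le> \<theta>2"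
proof -
  have "real t * measure_pmf.prob (PP A) {x. ell A x = t} = (\<Sum>j\<in>A. real j * lam j * measure_pmf.prob (PP A) {x. ell A x + j = t})"
    by (rule size_bias_eq[OF A])
  also have "\<dots> \<le> (\<Sum>j\<in>A. \<theta>2 * measure_pmf.prob (PP A) {x. ell A x + j = t})"
    using A j_lam by (intro sum_mono mult_right_mono) auto
  also have "\<dots> = \<theta>2 * (\<Sum>j\<in>A. measure_pmf.prob (PP A) {x. ell A x + j = t})" by (simp add: sum_distrib_left)
  also have "\<dots> \<le> \<theta>2 * 1" using \<theta> sum_disjoint_prob_le_1[OF A(1), of "\<lambda>j. j"] by (intro mult_left_mono) auto
  finally show ?thesis by simp
qed

text \<open>
  The counts beyond \<open>r\<close>, a fixed fraction of \<open>n\<close>, all vanish with a probability bounded below; by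
  Markov's inequality those up to \<open>r\<close> contribute less than \<open>n\<close> with probability at least one half.
\<close>

lemma ell_lt_lower:
  assumes n: "1 \<le> n"
  shows "exp (- (2 * \<theta>2 * max 1 \<theta>2)) / 2 \<le> measure_pmf.prob (PP {1..n}) {x. ell {1..n} x < n}"
proof -
  define \<theta> where "\<theta> = max 1 \<theta>2"
  have th: "1 \<le> \<theta>" "\<theta>2 \<le> \<theta>" "0 < \<theta>" by (auto simp: \<theta>_def)
  (* r makes the mean of ell over {1..r} at most n / 2 *)
  define r where "r = nat \<lfloor>n / (2 * \<theta>)\<rfloor>"
  have r1: "real r \<le> n / (2 * \<theta>)" "n / (2 * \<theta>) < real r + 1" using th by (auto simp: r_def)
  have "n / (2 * \<theta>) \<le> n / 1" using th by (intro divide_left_mono) auto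
  then have rn: "r \<le> n" using r1 by linarith
  have I: "{1..n} = {1..r} \<union> {r<..n}" using rn by auto
  define E where "E = {x :: nat \<Rightarrow> nat. ell {1..r} x < n}"
  define F where "F = {x :: nat \<Rightarrow> nat. \<forall>j\<in>{r<..n}. x j = 0}"
  have dE: "depends_on {1..r} E" unfolding depends_on_def E_def using ell_cong by (metis mem_Collect_eq)
  have dF: "depends_on {r<..n} F" unfolding depends_on_def F_def by auto
  have "E \<inter> F \<subseteq> {x. ell {1..n} x < n}"
  proof
    fix x assume x: "x \<in> E \<inter> F"
    have "ell {1..n} x = ell {1..r} x + ell {r<..n} x" unfolding ell_def I by (rule sum.union_disjoint) auto
    also have "ell {r<..n} x = 0" using x by (auto simp: ell_def F_def)
    finally show "x \<in> {x. ell {1..n} x < n}" using x by (simp add: E_def)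
  qed
  then have "measure_pmf.prob (PP {1..n}) (E \<inter> F) \<le> measure_pmf.prob (PP {1..n}) {x. ell {1..n} x < n}"
    by (intro measure_pmf.finite_measure_mono) auto
  moreover have "measure_pmf.prob (PP {1..n}) (E \<inter> F) = measure_pmf.prob (PP {1..r}) E * measure_pmf.prob (PP {r<..n}) F"
    unfolding I by (rule prob_Pi_pmf_Int[OF _ _ _ dE dF]) auto
  moreover have "1 / 2 \<le> measure_pmf.prob (PP {1..r}) E"
  proof -
    have "real n * measure_pmf.prob (PP {1..r}) {x. n \<le> ell {1..r} x} \<le>
      (\<Sum>j\<in>{1..r}. real j * lam j * measure_pmf.prob (PP {1..r}) {x. x(j := Suc (x j)) \<in> {x. n \<le> ell {1..r} x}})"
      by (rule size_bias_le) auto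
    also have "\<dots> \<le> (\<Sum>j\<in>{1..r}. \<theta>2 * 1)"
      using j_lam \<theta> lam_pos by (intro sum_mono mult_mono) auto
    also have "\<dots> = real r * \<theta>2" by simp
    also have "\<dots> \<le> n / (2 * \<theta>) * \<theta>" using r1 th \<theta> by (intro mult_mono) auto
    also have "\<dots> = n / 2" using th by simp
    finally have "measure_pmf.prob (PP {1..r}) {x. n \<le> ell {1..r} x} \<le> 1 / 2" using n by (simp add: field_simps)
    moreover have "measure_pmf.prob (PP {1..r}) E = 1 - measure_pmf.prob (PP {1..r}) {x. n \<le> ell {1..r} x}"
      using measure_pmf.prob_compl[of "{x. n \<le> ell {1..r} x}" "PP {1..r}"]
      by (simp add: E_def Collect_neg_eq[symmetric] Compl_eq_Diff_UNIV[symmetric] not_le)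
    ultimately show ?thesis by simp
  qed
  moreover have "exp (- (2 * \<theta>2 * \<theta>)) \<le> measure_pmf.prob (PP {r<..n}) F"
  proof -
    have "measure_pmf.prob (PP {r<..n}) F = measure_pmf.prob (PP {r<..n}) (PiE_dflt {r<..n} 0 (\<lambda>_. {0}))"
      by (intro measure_pmf.finite_measure_eq_AE)
         (auto simp: AE_measure_pmf_iff F_def PiE_dflt_def set_Pi_pmf)
    also have "\<dots> = (\<Prod>j\<in>{r<..n}. exp (- lam j))"
      by (subst measure_Pi_pmf_PiE_dflt) (auto simp: measure_pmf_single pmf_poisson lam_pos less_imp_le intro!: prod.cong)
    also have "\<dots> = exp (- (\<Sum>j\<in>{r<..n}. lam j))" by (simp add: exp_sum[symmetric] sum_negf)
    finally have eq: "measure_pmf.prob (PP {r<..n}) F = exp (- (\<Sum>j\<in>{r<..n}. lam j))" .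
    have "(\<Sum>j\<in>{r<..n}. lam j) \<le> (\<Sum>j\<in>{r<..n}. \<theta>2 / (real r + 1))"
    proof (rule sum_mono)
      fix j assume j: "j \<in> {r<..n}"
      then have "lam j \<le> \<theta>2 / real j" by (intro lam_upper) auto
      also have "\<dots> \<le> \<theta>2 / (real r + 1)" using j \<theta> by (intro divide_left_mono) auto
      finally show "lam j \<le> \<theta>2 / (real r + 1)" .
    qed
    also have "\<dots> = real (n - r) * (\<theta>2 / (real r + 1))" by simp
    also have "\<dots> \<le> real n * (\<theta>2 / (n / (2 * \<theta>)))"
      using r1 \<theta> n th by (intro mult_mono divide_left_mono) auto
    also have "\<dots> = 2 * \<theta>2 * \<theta>" using n by simp
    finally show ?thesis unfolding eq by simp
  qed
  moreover have "1 / 2 * exp (- (2 * \<theta>2 * \<theta>)) \<le> measure_pmf.prob (PP {1..r}) E * measure_pmf.prob (PP {r<..n}) F"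
    using calculation(3,4) by (intro mult_mono) auto
  ultimately show ?thesis unfolding \<theta>_def by linarith
qed

text \<open>
  A lower bound for \<open>n\<close> times the probability of \<open>ell = n\<close>, uniform in \<open>n\<close>.
\<close>

definition c1 :: real where "c1 = \<theta>1 * (exp (- (2 * \<theta>2 * max 1 \<theta>2)) / 2)"

lemma c1_pos: "0 < c1" using \<theta> by (simp add: c1_def)

text \<open>
  In the recursion \<open>size_bias_eq\<close> the coefficients are at least \<open>\<theta>1\<close>, and for the full index set
  \<open>{1..n}\<close> the events on the right are a partition of \<open>ell < n\<close>.
\<close>

lemma local_lower: "1 \<le> n \<Longrightarrow> c1 \<le> real n * measure_pmf.prob (PP {1..n}) {x. ell {1..n} x = n}"
proof -
  assume n: "1 \<le> n"
  have "{x. ell {1..n} x < n} = (\<Union>j\<in>{1..n}. {x. ell {1..n} x + j = n})"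
  proof (intro set_eqI iffI)
    fix x assume "x \<in> {x. ell {1..n} x < n}"
    then show "x \<in> (\<Union>j\<in>{1..n}. {x. ell {1..n} x + j = n})" by (intro UN_I[of "n - ell {1..n} x"]) auto
  qed auto
  then have "measure_pmf.prob (PP {1..n}) {x. ell {1..n} x < n} = (\<Sum>j=1..n. measure_pmf.prob (PP {1..n}) {x. ell {1..n} x + j = n})"
    by (simp add: measure_pmf.finite_measure_finite_Union disjoint_family_on_def disjoint_iff)
  moreover have "(\<Sum>j=1..n. \<theta>1 * measure_pmf.prob (PP {1..n}) {x. ell {1..n} x + j = n}) \<le>
    (\<Sum>j=1..n. real j * lam j * measure_pmf.prob (PP {1..n}) {x. ell {1..n} x + j = n})"
    using j_lam by (intro sum_mono mult_right_mono) auto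
  moreover have "real n * measure_pmf.prob (PP {1..n}) {x. ell {1..n} x = n} = (\<Sum>j=1..n. real j * lam j * measure_pmf.prob (PP {1..n}) {x. ell {1..n} x + j = n})"
    by (rule size_bias_eq) auto
  moreover have "c1 \<le> \<theta>1 * measure_pmf.prob (PP {1..n}) {x. ell {1..n} x < n}"
    unfolding c1_def using ell_lt_lower[OF n] \<theta> by (intro mult_left_mono) auto
  ultimately show ?thesis by (simp add: sum_distrib_left)
qed

definition \<nu> :: "nat \<Rightarrow> (nat \<Rightarrow> nat) pmf" where "\<nu> n = cond_pmf (PP {1..n}) {x. ell {1..n} x = n}"

lemma \<nu>_le:
  assumes n: "1 \<le> n" and E: "measure_pmf.prob (PP {1..n}) ({x. ell {1..n} x = n} \<inter> E) \<le> K / real n"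
  shows "measure_pmf.prob (\<nu> n) E \<le> K / c1"
proof -
  define p where "p = measure_pmf.prob (PP {1..n}) {x. ell {1..n} x = n}"
  have "c1 / n \<le> p" using local_lower[OF n] n unfolding p_def by (simp add: pos_divide_le_eq mult.commute)
  moreover have cn: "0 < c1 / n" using c1_pos n by simp
  ultimately have p: "0 < p" by linarith
  have K: "0 \<le> K / real n" using E measure_nonneg[of "PP {1..n}" "{x. ell {1..n} x = n} \<inter> E"] by linarith
  have "measure_pmf.prob (\<nu> n) E = measure_pmf.prob (PP {1..n}) ({x. ell {1..n} x = n} \<inter> E) / p"
    unfolding \<nu>_def p_def by (rule measure_cond_pmf) (use p in \<open>simp add: p_def\<close>)
  also have "\<dots> \<le> (K / real n) / (c1 / n)" using E K cn \<open>c1 / n \<le> p\<close> by (intro frac_le) auto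
  also have "\<dots> = K / c1" using n by simp
  finally show ?thesis .
qed

text \<open>
  Given that the small indices contribute \<open>s \<le> n / 2\<close>, the large ones have to contribute \<open>n - s\<close>, which
  has a probability of order \<open>1 / n\<close> at most, just as the condition itself.
\<close>

lemma \<nu>_contiguous:
  assumes n: "1 \<le> n" "r \<le> n" and dE: "depends_on {1..r} E"
  shows "measure_pmf.prob (\<nu> n) (E \<inter> {x. 2 * ell {1..r} x \<le> n}) \<le> 2 * \<theta>2 * measure_pmf.prob (PP {1..r}) E / c1"
proof (rule \<nu>_le[OF n(1)])
  have I: "{1..n} = {1..r} \<union> {r<..n}" using n by auto
  let ?S = "{s. 2 * s \<le> n}"
  have fS: "finite ?S" by (rule finite_subset[of _ "{..n}"]) auto
  define E' where "E' = (\<lambda>s. E \<inter> {x. ell {1..r} x = s})"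
  define F where "F = (\<lambda>s. {x. ell {r<..n} x + s = n})"
  have dE': "depends_on {1..r} (E' s)" for s
    unfolding depends_on_def E'_def
  proof (intro allI impI)
    fix f g :: "nat \<Rightarrow> nat" assume fg: "\<forall>i\<in>{1..r}. f i = g i"
    then have "ell {1..r} f = ell {1..r} g" by (intro ell_cong) auto
    moreover have "f \<in> E \<longleftrightarrow> g \<in> E" using depends_onD[OF dE, of f g] fg by auto
    ultimately show "f \<in> E \<inter> {x. ell {1..r} x = s} \<longleftrightarrow> g \<in> E \<inter> {x. ell {1..r} x = s}" by auto
  qed
  have dF: "depends_on {r<..n} (F s)" for s
    unfolding depends_on_def F_def using ell_cong[of "{r<..n}"] by (metis mem_Collect_eq)
  have split: "ell {1..n} x = ell {1..r} x + ell {r<..n} x" for x unfolding ell_def I by (rule sum.union_disjoint) auto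
  have "{x. ell {1..n} x = n} \<inter> (E \<inter> {x. 2 * ell {1..r} x \<le> n}) \<subseteq> (\<Union>s\<in>?S. E' s \<inter> F s)"
  proof
    fix x assume x: "x \<in> {x. ell {1..n} x = n} \<inter> (E \<inter> {x. 2 * ell {1..r} x \<le> n})"
    then have "x \<in> E' (ell {1..r} x) \<inter> F (ell {1..r} x)" using split[of x] by (simp add: E'_def F_def)
    moreover have "ell {1..r} x \<in> ?S" using x by simp
    ultimately show "x \<in> (\<Union>s\<in>?S. E' s \<inter> F s)" by (rule UN_I[rotated])
  qed
  then have "measure_pmf.prob (PP {1..n}) ({x. ell {1..n} x = n} \<inter> (E \<inter> {x. 2 * ell {1..r} x \<le> n})) \<le> measure_pmf.prob (PP {1..n}) (\<Union>s\<in>?S. E' s \<inter> F s)"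
    by (intro measure_pmf.finite_measure_mono) auto
  also have "\<dots> \<le> (\<Sum>s\<in>?S. measure_pmf.prob (PP {1..n}) (E' s \<inter> F s))"
    using fS by (intro measure_pmf.finite_measure_subadditive_finite) auto
  also have "\<dots> \<le> (\<Sum>s\<in>?S. measure_pmf.prob (PP {1..r}) (E' s) * (2 * \<theta>2 / n))"
  proof (rule sum_mono)
    fix s assume s: "s \<in> ?S"
    have "measure_pmf.prob (PP {1..n}) (E' s \<inter> F s) = measure_pmf.prob (PP {1..r}) (E' s) * measure_pmf.prob (PP {r<..n}) (F s)"
      unfolding I by (rule prob_Pi_pmf_Int[OF _ _ _ dE' dF]) auto
    also have "\<dots> \<le> measure_pmf.prob (PP {1..r}) (E' s) * (2 * \<theta>2 / n)"
    proof (rule mult_left_mono)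
      have "F s = {x. ell {r<..n} x = n - s}" using s by (auto simp: F_def)
      then have "real (n - s) * measure_pmf.prob (PP {r<..n}) (F s) \<le> \<theta>2" using local_upper[of "{r<..n}" "n - s"] by simp
      moreover have "real n / 2 * measure_pmf.prob (PP {r<..n}) (F s) \<le> real (n - s) * measure_pmf.prob (PP {r<..n}) (F s)"
        using s by (intro mult_right_mono) auto
      ultimately have "real n / 2 * measure_pmf.prob (PP {r<..n}) (F s) \<le> \<theta>2" by linarith
      then show "measure_pmf.prob (PP {r<..n}) (F s) \<le> 2 * \<theta>2 / n" using n by (simp add: field_simps)
    qed simp
    finally show "measure_pmf.prob (PP {1..n}) (E' s \<inter> F s) \<le> measure_pmf.prob (PP {1..r}) (E' s) * (2 * \<theta>2 / n)" .
  qed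
  also have "\<dots> = (\<Sum>s\<in>?S. measure_pmf.prob (PP {1..r}) (E' s)) * (2 * \<theta>2 / n)" by (rule sum_distrib_right[symmetric])
  also have "(\<Sum>s\<in>?S. measure_pmf.prob (PP {1..r}) (E' s)) = measure_pmf.prob (PP {1..r}) (\<Union>s\<in>?S. E' s)"
    using fS by (intro measure_pmf.finite_measure_finite_Union[symmetric]) (auto simp: E'_def disjoint_family_on_def)
  also have "measure_pmf.prob (PP {1..r}) (\<Union>s\<in>?S. E' s) * (2 * \<theta>2 / n) \<le> measure_pmf.prob (PP {1..r}) E * (2 * \<theta>2 / n)"
    using \<theta> by (intro mult_right_mono measure_pmf.finite_measure_mono) (auto simp: E'_def)
  also have "\<dots> = 2 * \<theta>2 * measure_pmf.prob (PP {1..r}) E / real n" by simp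
  finally show "measure_pmf.prob (PP {1..n}) ({x. ell {1..n} x = n} \<inter> (E \<inter> {x. 2 * ell {1..r} x \<le> n})) \<le> 2 * \<theta>2 * measure_pmf.prob (PP {1..r}) E / real n" .
qed

text \<open>
  Size-biasing the contribution of the indices up to \<open>r\<close> costs a factor \<open>n / 2\<close>, and each of the \<open>r\<close> resulting
  terms is a point probability of order \<open>1 / n\<close>.
\<close>

lemma \<nu>_small_parts:
  assumes n: "1 \<le> n" "2 * r \<le> n"
  shows "measure_pmf.prob (\<nu> n) {x. n < 2 * ell {1..r} x} \<le> 4 * \<theta>2\<^sup>2 * (real r / real n) / c1"
proof (rule \<nu>_le[OF n(1)])
  define E where "E = {x. ell {1..n} x = n} \<inter> {x. n < 2 * ell {1..r} x}"
  have nr: "real n / 2 \<le> real (n - r)" "0 < real n" using n by auto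
  have "real (n div 2 + 1) * measure_pmf.prob (PP {1..n}) E \<le> (\<Sum>j\<in>{1..r}. real j * lam j * measure_pmf.prob (PP {1..n}) {x. x(j := Suc (x j)) \<in> E})"
    using n by (intro size_bias_le) (auto simp: E_def)
  also have "\<dots> \<le> (\<Sum>j\<in>{1..r}. \<theta>2 * (2 * \<theta>2 / n))"
  proof (rule sum_mono)
    fix j assume j: "j \<in> {1..r}"
    have "{x. x(j := Suc (x j)) \<in> E} \<subseteq> {x. ell {1..n} x = n - j}"
      using j n ell_incr[of "{1..n}" j] by (auto simp: E_def)
    then have "measure_pmf.prob (PP {1..n}) {x. x(j := Suc (x j)) \<in> E} \<le> measure_pmf.prob (PP {1..n}) {x. ell {1..n} x = n - j}"
      by (intro measure_pmf.finite_measure_mono) auto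
    also have "\<dots> \<le> 2 * \<theta>2 / n"
    proof -
      have "real (n - j) * measure_pmf.prob (PP {1..n}) {x. ell {1..n} x = n - j} \<le> \<theta>2" by (rule local_upper) auto
      moreover have "real n / 2 * measure_pmf.prob (PP {1..n}) {x. ell {1..n} x = n - j} \<le> real (n - j) * measure_pmf.prob (PP {1..n}) {x. ell {1..n} x = n - j}"
        using j n by (intro mult_right_mono) auto
      ultimately have "real n / 2 * measure_pmf.prob (PP {1..n}) {x. ell {1..n} x = n - j} \<le> \<theta>2" by linarith
      then show ?thesis using n by (simp add: field_simps)
    qed
    finally have "measure_pmf.prob (PP {1..n}) {x. x(j := Suc (x j)) \<in> E} \<le> 2 * \<theta>2 / n" .
    then show "real j * lam j * measure_pmf.prob (PP {1..n}) {x. x(j := Suc (x j)) \<in> E} \<le> \<theta>2 * (2 * \<theta>2 / n)"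
      using j j_lam[of j] \<theta> by (intro mult_mono) auto
  qed
  also have "\<dots> = 2 * \<theta>2\<^sup>2 * (real r / real n)" by (simp add: power2_eq_square)
  finally have a: "real (n div 2 + 1) * measure_pmf.prob (PP {1..n}) E \<le> 2 * \<theta>2\<^sup>2 * (real r / real n)" .
  have "real n / 2 * measure_pmf.prob (PP {1..n}) E \<le> real (n div 2 + 1) * measure_pmf.prob (PP {1..n}) E"
    by (intro mult_right_mono measure_nonneg) linarith
  then have "real n / 2 * measure_pmf.prob (PP {1..n}) E \<le> 2 * \<theta>2\<^sup>2 * (real r / real n)" using a by linarith
  then have "measure_pmf.prob (PP {1..n}) E \<le> 2 * \<theta>2\<^sup>2 * (real r / real n) / (real n / 2)" using nr(2) by (simp add: pos_le_divide_eq mult.commute)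
  then show "measure_pmf.prob (PP {1..n}) ({x. ell {1..n} x = n} \<inter> {x. n < 2 * ell {1..r} x}) \<le> 4 * \<theta>2\<^sup>2 * (real r / real n) / real n"
    unfolding E_def by simp
qed

text \<open>
  Applying the size-bias identity twice to the same coordinate produces \<open>(lam j)\<^sup>2\<close>; the remaining events
  \<open>ell = n - 2 * j\<close> are disjoint for different \<open>j\<close>.
\<close>

lemma \<nu>_multiple_parts:
  assumes n: "1 \<le> n" and r: "1 \<le> r"
  shows "measure_pmf.prob (\<nu> n) {x. \<exists>j\<in>{r<..n}. 2 \<le> x j} \<le> (real n * (\<theta>2 / real r)\<^sup>2) / c1"
proof (rule \<nu>_le[OF n])
  have single: "measure_pmf.prob (PP {1..n}) {x. ell {1..n} x = n \<and> 2 \<le> x j} \<le> (lam j)\<^sup>2 * measure_pmf.prob (PP {1..n}) {x. ell {1..n} x + 2 * j = n}"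
    if j: "j \<in> {1..n}" for j
  proof -
    have lj: "0 < lam j" using j by (intro lam_pos) auto
    define A where "A = {1..n}"
    define w where "w = measure_pmf.prob (PP A) {x. ell A x + 2 * j = n}"
    have A: "finite A" "j \<in> A" "1 \<le> j" using j by (auto simp: A_def)
    have inc: "ell A (x(j := Suc (x j))) = ell A x + j" for x using A by (intro ell_incr)
    have "ennreal (measure_pmf.prob (PP A) {x. ell A x = n \<and> 2 \<le> x j}) = (\<integral>\<^sup>+x. indicator {x. ell A x = n \<and> 2 \<le> x j} x \<partial>PP A)"
      by (simp add: measure_pmf.emeasure_eq_measure)
    also have "\<dots> \<le> (\<integral>\<^sup>+x. of_nat (x j) * (of_nat (x j - 1) * indicator {x. ell A x = n} x) \<partial>PP A)"
    proof (rule nn_integral_mono)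
      fix x :: "nat \<Rightarrow> nat"
      have "(1::ennreal) \<le> of_nat (x j) * of_nat (x j - 1)" if "2 \<le> x j"
      proof -
        have "1 \<le> x j * (x j - 1)" using that by (cases "x j") auto
        then have "(of_nat 1 :: ennreal) \<le> of_nat (x j * (x j - 1))" using of_nat_mono by blast
        then show ?thesis by simp
      qed
      then show "indicator {x. ell A x = n \<and> 2 \<le> x j} x \<le> (of_nat (x j) * (of_nat (x j - 1) * indicator {x. ell A x = n} x) :: ennreal)"
        by (auto simp: indicator_def)
    qed
    also have "\<dots> = ennreal (lam j) * (\<integral>\<^sup>+x. of_nat ((x(j := Suc (x j))) j - 1) * indicator {x. ell A x = n} (x(j := Suc (x j))) \<partial>PP A)"
      by (rule mecke[OF A])
    also have "(\<integral>\<^sup>+x. of_nat ((x(j := Suc (x j))) j - 1) * indicator {x. ell A x = n} (x(j := Suc (x j))) \<partial>PP A)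
      = (\<integral>\<^sup>+x. of_nat (x j) * indicator {x. ell A x + j = n} x \<partial>PP A)"
      by (intro nn_integral_cong) (simp add: inc indicator_def)
    also have "\<dots> = ennreal (lam j) * (\<integral>\<^sup>+x. indicator {x. ell A x + j = n} (x(j := Suc (x j))) \<partial>PP A)"
      by (rule mecke[OF A])
    also have "(\<integral>\<^sup>+x. indicator {x. ell A x + j = n} (x(j := Suc (x j))) \<partial>PP A) = (\<integral>\<^sup>+x. indicator {x. ell A x + 2 * j = n} x \<partial>PP A)"
      by (intro nn_integral_cong) (simp add: inc indicator_def mult_2 add.assoc)
    also have "\<dots> = ennreal w" unfolding w_def by (simp add: measure_pmf.emeasure_eq_measure)
    also have "ennreal (lam j) * (ennreal (lam j) * ennreal w) = ennreal ((lam j)\<^sup>2 * w)"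
      using lj by (simp add: ennreal_mult' power2_eq_square mult.assoc w_def)
    finally have "ennreal (measure_pmf.prob (PP A) {x. ell A x = n \<and> 2 \<le> x j}) \<le> ennreal ((lam j)\<^sup>2 * w)" .
    then have "measure_pmf.prob (PP A) {x. ell A x = n \<and> 2 \<le> x j} \<le> (lam j)\<^sup>2 * w"
      by (subst (asm) ennreal_le_iff) (auto simp: w_def)
    then show ?thesis unfolding A_def w_def .
  qed
  have "{x. ell {1..n} x = n} \<inter> {x. \<exists>j\<in>{r<..n}. 2 \<le> x j} = (\<Union>j\<in>{r<..n}. {x. ell {1..n} x = n \<and> 2 \<le> x j})" by auto
  then have "measure_pmf.prob (PP {1..n}) ({x. ell {1..n} x = n} \<inter> {x. \<exists>j\<in>{r<..n}. 2 \<le> x j}) \<le> (\<Sum>j\<in>{r<..n}. measure_pmf.prob (PP {1..n}) {x. ell {1..n} x = n \<and> 2 \<le> x j})"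
    by (simp add: measure_pmf.finite_measure_subadditive_finite)
  also have "\<dots> \<le> (\<Sum>j\<in>{r<..n}. (\<theta>2 / real r)\<^sup>2 * measure_pmf.prob (PP {1..n}) {x. ell {1..n} x + 2 * j = n})"
  proof (rule sum_mono)
    fix j assume j: "j \<in> {r<..n}"
    have "lam j \<le> \<theta>2 / real j" using j by (intro lam_upper) auto
    also have "\<dots> \<le> \<theta>2 / real r" using j r \<theta> by (intro divide_left_mono) auto
    finally have "(lam j)\<^sup>2 \<le> (\<theta>2 / real r)\<^sup>2" using lam_pos[of j] j by (intro power_mono) auto
    then have "(lam j)\<^sup>2 * measure_pmf.prob (PP {1..n}) {x. ell {1..n} x + 2 * j = n} \<le> (\<theta>2 / real r)\<^sup>2 * measure_pmf.prob (PP {1..n}) {x. ell {1..n} x + 2 * j = n}"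
      by (intro mult_right_mono) auto
    then show "measure_pmf.prob (PP {1..n}) {x. ell {1..n} x = n \<and> 2 \<le> x j} \<le> (\<theta>2 / real r)\<^sup>2 * measure_pmf.prob (PP {1..n}) {x. ell {1..n} x + 2 * j = n}"
      using single[of j] j by auto
  qed
  also have "\<dots> = (\<theta>2 / real r)\<^sup>2 * (\<Sum>j\<in>{r<..n}. measure_pmf.prob (PP {1..n}) {x. ell {1..n} x + 2 * j = n})"
    by (simp add: sum_distrib_left)
  also have "\<dots> \<le> (\<theta>2 / real r)\<^sup>2 * 1"
    by (intro mult_left_mono sum_disjoint_prob_le_1) (auto simp: inj_on_def)
  also have "\<dots> = (real n * (\<theta>2 / real r)\<^sup>2) / real n" using n by simp
  finally show "measure_pmf.prob (PP {1..n}) ({x. ell {1..n} x = n} \<inter> {x. \<exists>j\<in>{r<..n}. 2 \<le> x j}) \<le> (real n * (\<theta>2 / real r)\<^sup>2) / real n" .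
qed

end


section \<open>Transfer from independent to conditioned variables\<close>

lemma pmf_tight:
  fixes f :: "'x \<Rightarrow> real"
  assumes "0 < \<eta>"
  shows "\<exists>K. measure_pmf.prob p {x. K < f x} \<le> \<eta>"
proof -
  have "(\<lambda>k. measure_pmf.prob p {x. real k < f x}) \<longlonglongrightarrow> measure_pmf.prob p (\<Inter>k. {x. real k < f x})"
    by (rule measure_pmf.finite_Lim_measure_decseq) (auto simp: decseq_def intro: le_less_trans[rotated])
  moreover have "(\<Inter>k. {x. real k < f x}) = {}"
  proof -
    have "\<exists>k. \<not> real k < f x" for x using real_arch_simple[of "f x"] by (auto simp: not_less)
    then show ?thesis by auto
  qed
  ultimately have "(\<lambda>k. measure_pmf.prob p {x. real k < f x}) \<longlonglongrightarrow> 0" by simp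
  then have "eventually (\<lambda>k. measure_pmf.prob p {x. real k < f x} < \<eta>) sequentially"
    using assms by (rule order_tendstoD(2))
  then show ?thesis by (auto simp: eventually_sequentially intro: less_imp_le)
qed

lemma prob_mono_on_support:
  assumes "\<And>x. x \<in> set_pmf p \<Longrightarrow> x \<in> A \<Longrightarrow> x \<in> B"
  shows "measure_pmf.prob p A \<le> measure_pmf.prob p B"
  by (rule measure_pmf.finite_measure_mono_AE) (use assms in \<open>auto simp: AE_measure_pmf_iff\<close>)

context kolmogorov_array
begin

text \<open>
  Stopping the path at time \<open>r\<close> changes little when \<open>r\<close> carries almost all the variance: the normalisation
  and the time scale change by factors within \<open>\<kappa>\<close> of one, and the approximating function moves by at
  most \<open>sqrt \<kappa>\<close> on the last piece.
\<close>

lemma near_extend: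
  assumes near: "near r x \<epsilon>" and rm: "r \<le> m" and \<kappa>: "0 \<le> \<kappa>" "\<kappa> < 1" and Vm: "0 < V m"
    and Vr: "(1 - \<kappa>) * V m \<le> V r" and \<epsilon>: "0 \<le> \<epsilon>" "\<epsilon> \<le> 1"
  shows "\<exists>g\<in>strassen_set. \<forall>i\<le>m. \<bar>S x (min i r) / bet m - g (V i / V m)\<bar> \<le> \<epsilon> + 2 * \<kappa> + 2 * sqrt \<kappa>"
proof -
  obtain g where g: "g \<in> strassen_set" "\<And>i. i \<le> r \<Longrightarrow> \<bar>S x i / bet r - g (V i / V r)\<bar> \<le> \<epsilon>"
    using near by (auto simp: near_def)
  have Vr0: "0 < V r"
  proof -
    have "0 < (1 - \<kappa>) * V m" using \<kappa> Vm by simp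
    then show ?thesis using Vr by linarith
  qed
  have Vle: "V r \<le> V m" by (rule V_le[OF rm])
  have bp: "0 < bet m" "0 < bet r" using Vm Vr0 by (auto intro: bet_pos)
  define u where "u = V r / V m"
  have u: "1 - \<kappa> \<le> u" "u \<le> 1" "0 < u" using Vr Vle Vm Vr0 by (auto simp: u_def pos_le_divide_eq)
  define l where "l = bet r / bet m"
  have l: "1 - \<kappa> \<le> l" "l \<le> 1"
  proof -
    show "l \<le> 1" using bet_mono[OF rm] bp by (simp add: l_def)
    have "L m \<le> (sqrt (V m) / sqrt (V r)) * L r" unfolding L_def using Vr0 Vle by (intro LLg_ratio) auto
    then have "sqrt (V r) * L m \<le> sqrt (V m) * L r" using Vr0 by (simp add: pos_le_divide_eq mult.commute)
    then have a: "sqrt u * L m \<le> L r" using Vm by (simp add: u_def real_sqrt_divide pos_divide_le_eq mult.commute)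
    have "u = sqrt u * sqrt u" using u by simp
    also have "\<dots> \<le> sqrt u * 1" using u by (intro mult_left_mono) auto
    finally have "u * L m \<le> sqrt u * L m" using L_ge_1[of m] by (intro mult_right_mono) auto
    then have "u * L m \<le> L r" using a by linarith
    then have "(2 * (u * V m)) * (u * L m) \<le> (2 * V r) * L r"
      using u Vm Vr0 L_ge_1[of m] by (intro mult_mono) (auto simp: u_def)
    then have "u\<^sup>2 * (bet m)\<^sup>2 \<le> (bet r)\<^sup>2" unfolding bet_sq by (simp add: power2_eq_square mult_ac)
    then have "(u * bet m)\<^sup>2 \<le> (bet r)\<^sup>2" by (simp add: power_mult_distrib)
    then have "u * bet m \<le> bet r" by (rule power2_le_imp_le) (use bp in auto)
    then have "u \<le> l" using bp by (simp add: l_def pos_le_divide_eq)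
    then show "1 - \<kappa> \<le> l" using u by linarith
  qed
  have t01: "V i / V m \<in> {0..1}" if "i \<le> m" for i using V_nonneg[of i] V_le[OF that] Vm by simp
  have r01: "V i / V r \<in> {0..1}" if "i \<le> r" for i using V_nonneg[of i] V_le[OF that] Vr0 by simp
  have small: "\<bar>S x i / bet m - g (V i / V m)\<bar> \<le> \<epsilon> + 2 * \<kappa> + sqrt \<kappa>" if i: "i \<le> r" for i
  proof -
    define s where "s = S x i / bet r"
    have "\<bar>s\<bar> \<le> 2" using g(2)[OF i] strassen_set_bound[OF g(1) r01[OF i]] \<epsilon> unfolding s_def by linarith
    then have "\<bar>(1 - l) * s\<bar> \<le> \<kappa> * 2" unfolding abs_mult using l by (intro mult_mono) auto
    moreover have "S x i / bet m = s - (1 - l) * s" using bp by (simp add: s_def l_def algebra_simps)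
    ultimately have A: "\<bar>S x i / bet m - s\<bar> \<le> 2 * \<kappa>" by simp
    have "\<bar>g (V i / V r) - g (V i / V m)\<bar> \<le> sqrt \<bar>V i / V r - V i / V m\<bar>"
      using t01[of i] i rm by (intro strassen_set_holder[OF g(1)] r01) auto
    also have "\<dots> \<le> sqrt \<kappa>"
    proof (rule real_sqrt_le_mono)
      have "V i / V m = (V i / V r) * u" using Vr0 by (simp add: u_def)
      then have "V i / V r - V i / V m = (V i / V r) * (1 - u)" by (simp only: right_diff_distrib mult_1_right)
      also have "\<bar>\<dots>\<bar> \<le> 1 * \<kappa>" unfolding abs_mult using r01[OF i] u by (intro mult_mono) auto
      finally show "\<bar>V i / V r - V i / V m\<bar> \<le> \<kappa>" by simp
    qed
    finally show ?thesis using A g(2)[OF i] unfolding s_def[symmetric] by linarith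
  qed
  have "\<bar>S x (min i r) / bet m - g (V i / V m)\<bar> \<le> \<epsilon> + 2 * \<kappa> + 2 * sqrt \<kappa>" if i: "i \<le> m" for i
  proof (cases "i \<le> r")
    case True
    have "0 \<le> sqrt \<kappa>" using \<kappa> by simp
    then have "\<epsilon> + 2 * \<kappa> + sqrt \<kappa> \<le> \<epsilon> + 2 * \<kappa> + 2 * sqrt \<kappa>" by linarith
    then show ?thesis using order_trans[OF small[OF True]] True by (simp add: min_def)
  next
    case False
    have "\<bar>g (V r / V m) - g (V i / V m)\<bar> \<le> sqrt \<bar>V r / V m - V i / V m\<bar>"
      by (rule strassen_set_holder[OF g(1) t01[OF i] t01[OF rm]])
    also have "\<dots> \<le> sqrt \<kappa>"
    proof (rule real_sqrt_le_mono)
      have "V r / V m \<le> V i / V m" using V_le[of r i] False Vm by (intro divide_right_mono) auto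
      then show "\<bar>V r / V m - V i / V m\<bar> \<le> \<kappa>" using t01[OF i] u(1) unfolding u_def[symmetric] by simp
    qed
    finally show ?thesis using small[of r] False by simp
  qed
  then show ?thesis using g(1) by blast
qed

end

context log_poisson
begin

text \<open>
  The event that the indices up to \<open>\<rho> n\<close> contribute more than \<open>n / 2\<close> accounts for \<open>\<eta>\<close>; off this event
  the conditional law is dominated by a multiple of the unconditional one.
\<close>

lemma transfer:
  assumes \<eta>: "0 < \<eta>"
  shows "\<exists>\<rho> C. 0 < \<rho> \<and> \<rho> \<le> 1 / 2 \<and> 0 < C \<and> (\<forall>n E. 1 \<le> n \<longrightarrow> depends_on {1..nat \<lfloor>\<rho> * real n\<rfloor>} E \<longrightarrow>
      measure_pmf.prob (\<nu> n) E \<le> \<eta> + C * measure_pmf.prob (PP {1..nat \<lfloor>\<rho> * real n\<rfloor>}) E)"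
proof -
  define \<rho> where "\<rho> = min (1 / 2) (\<eta> * c1 / (4 * \<theta>2\<^sup>2))"
  define C where "C = 2 * \<theta>2 / c1"
  have \<rho>: "0 < \<rho>" "\<rho> \<le> 1 / 2" "\<rho> \<le> \<eta> * c1 / (4 * \<theta>2\<^sup>2)" using \<eta> c1_pos \<theta> by (auto simp: \<rho>_def)
  have C: "0 < C" using \<theta> c1_pos by (simp add: C_def)
  have "measure_pmf.prob (\<nu> n) E \<le> \<eta> + C * measure_pmf.prob (PP {1..nat \<lfloor>\<rho> * real n\<rfloor>}) E"
    if n: "1 \<le> n" and dE: "depends_on {1..nat \<lfloor>\<rho> * real n\<rfloor>} E" for n E
  proof -
    define r where "r = nat \<lfloor>\<rho> * real n\<rfloor>"
    have r: "real r \<le> \<rho> * real n" using \<rho> by (simp add: r_def)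
    also have "\<dots> \<le> 1 / 2 * real n" using \<rho> by (intro mult_right_mono) auto
    finally have r2: "2 * r \<le> n" by linarith
    have "E \<subseteq> (E \<inter> {x. 2 * ell {1..r} x \<le> n}) \<union> {x. n < 2 * ell {1..r} x}" by auto
    then have "measure_pmf.prob (\<nu> n) E \<le> measure_pmf.prob (\<nu> n) ((E \<inter> {x. 2 * ell {1..r} x \<le> n}) \<union> {x. n < 2 * ell {1..r} x})"
      by (intro measure_pmf.finite_measure_mono) auto
    also have "\<dots> \<le> measure_pmf.prob (\<nu> n) (E \<inter> {x. 2 * ell {1..r} x \<le> n}) + measure_pmf.prob (\<nu> n) {x. n < 2 * ell {1..r} x}"
      by (rule measure_Un_le) auto
    also have "\<dots> \<le> C * measure_pmf.prob (PP {1..r}) E + \<eta>"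
    proof (rule add_mono)
      show "measure_pmf.prob (\<nu> n) (E \<inter> {x. 2 * ell {1..r} x \<le> n}) \<le> C * measure_pmf.prob (PP {1..r}) E"
        using \<nu>_contiguous[OF n _ dE[folded r_def]] r2 by (simp add: C_def)
      have "measure_pmf.prob (\<nu> n) {x. n < 2 * ell {1..r} x} \<le> 4 * \<theta>2\<^sup>2 * (real r / real n) / c1"
        by (rule \<nu>_small_parts[OF n r2])
      also have "\<dots> \<le> 4 * \<theta>2\<^sup>2 * (\<eta> * c1 / (4 * \<theta>2\<^sup>2)) / c1"
      proof -
        have "real r / real n \<le> \<rho>" using r n by (simp add: pos_divide_le_eq)
        then have "real r / real n \<le> \<eta> * c1 / (4 * \<theta>2\<^sup>2)" using \<rho>(3) by linarith
        then show ?thesis using c1_pos by (intro divide_right_mono mult_left_mono) auto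
      qed
      also have "\<dots> = \<eta>" using \<theta> c1_pos by simp
      finally show "measure_pmf.prob (\<nu> n) {x. n < 2 * ell {1..r} x} \<le> \<eta>" .
    qed
    finally show ?thesis by (simp add: r_def)
  qed
  then show ?thesis using \<rho>(1,2) C by blast
qed

lemma poisson_ge_2: "1 \<le> j \<Longrightarrow> measure_pmf.prob (poisson_pmf (lam j)) {k. 2 \<le> k} \<le> (lam j)\<^sup>2"
proof -
  assume j: "1 \<le> j"
  have l: "0 < lam j" using lam_pos[OF j] by simp
  have "{k. 2 \<le> k} = UNIV - {0, 1 :: nat}" by auto
  then have "measure_pmf.prob (poisson_pmf (lam j)) {k. 2 \<le> k} = 1 - measure_pmf.prob (poisson_pmf (lam j)) {0, 1}"
    using measure_pmf.prob_compl[of "{0, 1}" "poisson_pmf (lam j)"] by simp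
  also have "measure_pmf.prob (poisson_pmf (lam j)) {0, 1} = exp (- lam j) + lam j * exp (- lam j)"
    by (subst measure_measure_pmf_finite) (auto simp: pmf_poisson[OF l])
  also have "1 - (exp (- lam j) + lam j * exp (- lam j)) \<le> (lam j)\<^sup>2"
  proof -
    have "1 - lam j \<le> exp (- lam j)" using exp_ge_add_one_self[of "- lam j"] by simp
    then have "(1 + lam j) * (1 - lam j) \<le> (1 + lam j) * exp (- lam j)" using l by (intro mult_left_mono) auto
    then show ?thesis by (simp add: algebra_simps power2_eq_square)
  qed
  finally show ?thesis .
qed

lemma multiple_parts_PP:
  assumes \<eta>: "0 < \<eta>"
  shows "\<exists>J. \<forall>R. measure_pmf.prob (PP {1..R}) {x. \<exists>j\<in>{J<..R}. 2 \<le> x j} \<le> \<eta>"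
proof -
  define f where "f = (\<lambda>j. \<theta>2\<^sup>2 * (1 / (real j)\<^sup>2))"
  have "summable (\<lambda>j. 1 / (real j)\<^sup>2)" using inverse_power_summable[of 2, where 'a = real] by (simp add: inverse_eq_divide)
  then have "summable f" unfolding f_def by (rule summable_mult)
  then obtain J where J: "\<And>m n. J \<le> m \<Longrightarrow> norm (sum f {m..<n}) < \<eta>" using \<eta> unfolding summable_Cauchy by blast
  have "measure_pmf.prob (PP {1..R}) {x. \<exists>j\<in>{J<..R}. 2 \<le> x j} \<le> \<eta>" for R
  proof -
 have eq: "{x. \<exists>j\<in>{J<..R}. 2 \<le> x j} = (\<Union>j\<in>{J<..R}. {x :: nat \<Rightarrow> nat. 2 \<le> x j})" by auto
    have "measure_pmf.prob (PP {1..R}) {x. \<exists>j\<in>{J<..R}. 2 \<le> x j} \<le> (\<Sum>j\<in>{J<..R}. measure_pmf.prob (PP {1..R}) {x. 2 \<le> x j})"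
      unfolding eq by (rule measure_pmf.finite_measure_subadditive_finite) auto
    also have "\<dots> \<le> (\<Sum>j\<in>{J<..R}. f j)"
    proof (rule sum_mono)
      fix j assume j: "j \<in> {J<..R}"
      have "map_pmf (\<lambda>x. x j) (PP {1..R}) = poisson_pmf (lam j)"
        using j Pi_pmf_component[of "{1..R}" j 0 "\<lambda>j. poisson_pmf (lam j)"] by auto
      then have "measure_pmf.prob (PP {1..R}) {x. 2 \<le> x j} = measure_pmf.prob (poisson_pmf (lam j)) {k. 2 \<le> k}"
        by (metis measure_map_pmf vimage_Collect_eq)
      also have "\<dots> \<le> (lam j)\<^sup>2" using j by (intro poisson_ge_2) auto
      also have "\<dots> \<le> (\<theta>2 / real j)\<^sup>2" using lam_upper[of j] lam_pos[of j] j by (intro power_mono) auto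
      finally show "measure_pmf.prob (PP {1..R}) {x. 2 \<le> x j} \<le> f j" by (simp add: f_def power_divide)
    qed
    also have "\<dots> = (\<Sum>j\<in>{Suc J..<Suc R}. f j)" by (rule sum.cong) auto
 also have "\<dots> \<le> \<eta>" using J[of "Suc J" "Suc R"] by (simp add: abs_less_iff less_imp_le)
    finally show ?thesis .
  qed
  then show ?thesis by blast
qed

text \<open>
  Both sides give every vector \<open>s\<close> on \<open>{1..n}\<close> the same weight.  The numerators are products of Poisson weights,
  and for the denominators the event \<open>ell = n\<close> is split into its finitely many atoms \<open>T\<close>.
\<close>

theorem count_law:
  assumes wl: "weakly_logarithmic ms \<mu> M \<xi> lam" and n: "1 \<le> n"
  shows "map_pmf (\<lambda>\<sigma> j. if j \<in> {1..n} then comp_count \<sigma> j else 0) (\<mu> n) = \<nu> n"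
proof (rule pmf_eqI)
  fix s :: "nat \<Rightarrow> nat"
  define A where "A = {1..n}"
  define cnt where "cnt = (\<lambda>\<sigma> j. if j \<in> A then comp_count \<sigma> j else 0)"
  have A: "finite A" "A \<noteq> {}" "\<And>j. j \<in> A \<Longrightarrow> 1 \<le> j" using n by (auto simp: A_def)
  have pM: "prob_space M" using wl by (simp add: weakly_logarithmic_def)
  interpret M: prob_space M by (rule pM)
  have ind: "M.indep_vars (\<lambda>_. count_space UNIV) \<xi> {1..}" using wl by (simp add: weakly_logarithmic_def)
  have dist: "distr M (count_space UNIV) (\<xi> j) = measure_pmf (poisson_pmf (lam j))" if "1 \<le> j" for j
    using wl that by (simp add: weakly_logarithmic_def)
  have cond: "measure_pmf.prob (\<mu> n) {\<sigma>. \<forall>j\<in>{1..n}. comp_count \<sigma> j = s j} =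
        \<P>(\<omega> in M. (\<forall>j\<in>{1..n}. \<xi> j \<omega> = s j) \<bar> (\<Sum>j=1..n. j * \<xi> j \<omega>) = n)" for s
    using wl n by (simp add: weakly_logarithmic_def)
  have meas: "\<xi> j \<in> measurable M (count_space UNIV)" if "1 \<le> j" for j
    using ind that unfolding M.indep_vars_def2 by auto
  have atom_set: "{\<omega> \<in> space M. \<forall>j\<in>A. \<xi> j \<omega> = t j} = (\<Inter>j\<in>A. \<xi> j -` {t j} \<inter> space M)" for t
    using A(2) by auto
  have sets: "{\<omega> \<in> space M. \<forall>j\<in>A. \<xi> j \<omega> = t j} \<in> sets M" for t
    unfolding atom_set using A meas by (intro sets.finite_INT measurable_sets) auto
  have atom: "M.prob {\<omega> \<in> space M. \<forall>j\<in>A. \<xi> j \<omega> = t j} = (\<Prod>j\<in>A. pmf (poisson_pmf (lam j)) (t j))" for t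
  proof -
    have "M.prob {\<omega> \<in> space M. \<forall>j\<in>A. \<xi> j \<omega> = t j} = (\<Prod>j\<in>A. M.prob (\<xi> j -` {t j} \<inter> space M))"
      unfolding atom_set using A by (intro M.indep_varsD[OF ind]) auto
    also have "\<dots> = (\<Prod>j\<in>A. pmf (poisson_pmf (lam j)) (t j))"
    proof (rule prod.cong[OF refl])
      fix j assume "j \<in> A"
      then have j: "1 \<le> j" using A by auto
      have "M.prob (\<xi> j -` {t j} \<inter> space M) = measure (distr M (count_space UNIV) (\<xi> j)) {t j}"
        by (rule measure_distr[symmetric]) (use meas[OF j] in auto)
      then show "M.prob (\<xi> j -` {t j} \<inter> space M) = pmf (poisson_pmf (lam j)) (t j)"
        unfolding dist[OF j] by (simp add: measure_pmf_single)
    qed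
    finally show ?thesis .
  qed
  have pmfPP: "pmf (PP A) t = (\<Prod>j\<in>A. pmf (poisson_pmf (lam j)) (t j))" if "\<And>j. j \<notin> A \<Longrightarrow> t j = 0" for t
    using pmf_Pi'[OF A(1), of t 0] that by simp
  define T where "T = {t \<in> PiE_dflt A 0 (\<lambda>_. {..n}). ell A t = n}"
  have fT: "finite T" unfolding T_def by (rule finite_subset[OF _ finite_PiE_dflt[OF A(1), of "\<lambda>_. {..n}" 0]]) auto
  have T0: "t j = 0" if "t \<in> T" "j \<notin> A" for t j using that by (auto simp: T_def PiE_dflt_def)
  have inT: "(\<lambda>j. if j \<in> A then f j else 0) \<in> T" if "ell A f = n" for f
  proof -
    have "f j \<le> n" if j: "j \<in> A" for j
    proof -
      have "f j \<le> j * f j" using A(3)[OF j] by simp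
      also have "\<dots> \<le> ell A f" unfolding ell_def using A(1) j by (intro member_le_sum) auto
      finally show ?thesis using \<open>ell A f = n\<close> by simp
    qed
    moreover have "ell A (\<lambda>j. if j \<in> A then f j else 0) = ell A f" by (rule ell_cong) simp
    ultimately show ?thesis using that by (simp add: T_def PiE_dflt_def)
  qed
  have denM: "M.prob {\<omega> \<in> space M. ell A (\<lambda>j. \<xi> j \<omega>) = n} = (\<Sum>t\<in>T. pmf (PP A) t)"
  proof -
    have "{\<omega> \<in> space M. ell A (\<lambda>j. \<xi> j \<omega>) = n} = (\<Union>t\<in>T. {\<omega> \<in> space M. \<forall>j\<in>A. \<xi> j \<omega> = t j})"
    proof (intro set_eqI iffI)
      fix \<omega> assume w: "\<omega> \<in> {\<omega> \<in> space M. ell A (\<lambda>j. \<xi> j \<omega>) = n}"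
      then show "\<omega> \<in> (\<Union>t\<in>T. {\<omega> \<in> space M. \<forall>j\<in>A. \<xi> j \<omega> = t j})"
        using inT[of "\<lambda>j. \<xi> j \<omega>"] by (intro UN_I[of "\<lambda>j. if j \<in> A then \<xi> j \<omega> else 0"]) auto
    next
      fix \<omega> assume "\<omega> \<in> (\<Union>t\<in>T. {\<omega> \<in> space M. \<forall>j\<in>A. \<xi> j \<omega> = t j})"
      then obtain t where t: "t \<in> T" "\<omega> \<in> space M" "\<forall>j\<in>A. \<xi> j \<omega> = t j" by auto
      then have "ell A (\<lambda>j. \<xi> j \<omega>) = ell A t" by (intro ell_cong) auto
      then show "\<omega> \<in> {\<omega> \<in> space M. ell A (\<lambda>j. \<xi> j \<omega>) = n}" using t by (simp add: T_def)
    qed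
    moreover have "disjoint_family_on (\<lambda>t. {\<omega> \<in> space M. \<forall>j\<in>A. \<xi> j \<omega> = t j}) T"
      unfolding disjoint_family_on_def
    proof (intro ballI impI)
      fix t u assume tu: "t \<in> T" "u \<in> T" "t \<noteq> u"
      then obtain j where j: "t j \<noteq> u j" by auto
      then have "j \<in> A" using T0[OF tu(1), of j] T0[OF tu(2), of j] j by (cases "j \<in> A") auto
      then show "{\<omega> \<in> space M. \<forall>j\<in>A. \<xi> j \<omega> = t j} \<inter> {\<omega> \<in> space M. \<forall>j\<in>A. \<xi> j \<omega> = u j} = {}" using j by force
    qed
    ultimately have "M.prob {\<omega> \<in> space M. ell A (\<lambda>j. \<xi> j \<omega>) = n} = (\<Sum>t\<in>T. M.prob {\<omega> \<in> space M. \<forall>j\<in>A. \<xi> j \<omega> = t j})"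
      using M.finite_measure_finite_Union[OF fT, of "\<lambda>t. {\<omega> \<in> space M. \<forall>j\<in>A. \<xi> j \<omega> = t j}"] sets by auto
    also have "\<dots> = (\<Sum>t\<in>T. pmf (PP A) t)" using atom pmfPP T0 by (intro sum.cong) auto
    finally show ?thesis .
  qed
  have denP: "measure_pmf.prob (PP A) {x. ell A x = n} = (\<Sum>t\<in>T. pmf (PP A) t)"
  proof -
    have "measure_pmf.prob (PP A) {x. ell A x = n} = measure_pmf.prob (PP A) T"
    proof (rule measure_pmf.finite_measure_eq_AE)
      have "x \<in> {x. ell A x = n} \<longleftrightarrow> x \<in> T" if x: "x \<in> set_pmf (PP A)" for x
      proof -
        have "x j = 0" if "j \<notin> A" for j using set_Pi_pmf_subset[OF A(1)] x that by fastforce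
        then have "(\<lambda>j. if j \<in> A then x j else 0) = x" by auto
        then show ?thesis using inT[of x] by (auto simp: T_def)
      qed
      then show "AE x in PP A. x \<in> {x. ell A x = n} \<longleftrightarrow> x \<in> T" by (simp add: AE_measure_pmf_iff)
    qed auto
    then show ?thesis using fT by (simp add: measure_measure_pmf_finite)
  qed
  have pos: "measure_pmf.prob (PP A) {x. ell A x = n} \<noteq> 0"
  proof
    assume "measure_pmf.prob (PP A) {x. ell A x = n} = 0"
    then show False using local_lower[OF n] c1_pos by (simp add: A_def)
  qed
  have ne: "set_pmf (PP A) \<inter> {x. ell A x = n} \<noteq> {}" using pos by (auto simp: measure_pmf_zero_iff)
  have "pmf (map_pmf cnt (\<mu> n)) s = pmf (cond_pmf (PP A) {x. ell A x = n}) s"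
  proof (cases "\<forall>j. j \<notin> A \<longrightarrow> s j = 0")
    case True
    have "cnt -` {s} = {\<sigma>. \<forall>j\<in>A. comp_count \<sigma> j = s j}" using True by (auto simp: cnt_def fun_eq_iff)
    then have "pmf (map_pmf cnt (\<mu> n)) s = measure_pmf.prob (\<mu> n) {\<sigma>. \<forall>j\<in>A. comp_count \<sigma> j = s j}" by (simp add: pmf_map)
    also have "\<dots> = M.prob {\<omega> \<in> space M. (\<forall>j\<in>A. \<xi> j \<omega> = s j) \<and> ell A (\<lambda>j. \<xi> j \<omega>) = n} / M.prob {\<omega> \<in> space M. ell A (\<lambda>j. \<xi> j \<omega>) = n}"
      unfolding A_def cond cond_prob_def ell_def ..
    also have "M.prob {\<omega> \<in> space M. (\<forall>j\<in>A. \<xi> j \<omega> = s j) \<and> ell A (\<lambda>j. \<xi> j \<omega>) = n} = (if ell A s = n then pmf (PP A) s else 0)"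
    proof (cases "ell A s = n")
      case t: True
      have "{\<omega> \<in> space M. (\<forall>j\<in>A. \<xi> j \<omega> = s j) \<and> ell A (\<lambda>j. \<xi> j \<omega>) = n} = {\<omega> \<in> space M. \<forall>j\<in>A. \<xi> j \<omega> = s j}"
      proof (intro set_eqI iffI)
        fix \<omega> assume w: "\<omega> \<in> {\<omega> \<in> space M. \<forall>j\<in>A. \<xi> j \<omega> = s j}"
        then have "ell A (\<lambda>j. \<xi> j \<omega>) = ell A s" by (intro ell_cong) auto
        then show "\<omega> \<in> {\<omega> \<in> space M. (\<forall>j\<in>A. \<xi> j \<omega> = s j) \<and> ell A (\<lambda>j. \<xi> j \<omega>) = n}" using w t by simp
      qed auto
      then show ?thesis using t atom pmfPP[of s] True by simp
    next
      case f: False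
      have "{\<omega> \<in> space M. (\<forall>j\<in>A. \<xi> j \<omega> = s j) \<and> ell A (\<lambda>j. \<xi> j \<omega>) = n} = {}"
      proof (intro set_eqI iffI)
        fix \<omega> assume w: "\<omega> \<in> {\<omega> \<in> space M. (\<forall>j\<in>A. \<xi> j \<omega> = s j) \<and> ell A (\<lambda>j. \<xi> j \<omega>) = n}"
        then have "ell A (\<lambda>j. \<xi> j \<omega>) = ell A s" by (intro ell_cong) auto
        then show "\<omega> \<in> {}" using w f by simp
      qed simp
      with f show ?thesis by (simp only: measure_empty if_False)
    qed
    also have "(if ell A s = n then pmf (PP A) s else 0) / M.prob {\<omega> \<in> space M. ell A (\<lambda>j. \<xi> j \<omega>) = n} = pmf (cond_pmf (PP A) {x. ell A x = n}) s"
      unfolding denM denP[symmetric] by (simp add: pmf_cond[OF ne])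
    finally show ?thesis .
  next
    case False
    then obtain j where j: "j \<notin> A" "s j \<noteq> 0" by auto
    have "cnt -` {s} = {}" using j by (auto simp: cnt_def fun_eq_iff)
    then have "pmf (map_pmf cnt (\<mu> n)) s = 0" by (simp add: pmf_map)
    moreover have "pmf (PP A) s = 0" using pmf_Pi_outside[OF A(1), of s 0] j by auto
    ultimately show ?thesis by (simp add: pmf_cond[OF ne])
  qed
  then show "pmf (map_pmf (\<lambda>\<sigma> j. if j \<in> {1..n} then comp_count \<sigma> j else 0) (\<mu> n)) s = pmf (\<nu> n) s"
    by (simp add: cnt_def A_def \<nu>_def)
qed

lemma set_pmf_\<nu>:
  assumes "1 \<le> n" "x \<in> set_pmf (\<nu> n)"
  shows "ell {1..n} x = n"
proof -
  have "measure_pmf.prob (PP {1..n}) {x. ell {1..n} x = n} \<noteq> 0"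
  proof
    assume "measure_pmf.prob (PP {1..n}) {x. ell {1..n} x = n} = 0"
    then show False using local_lower[OF assms(1)] c1_pos by simp
  qed
  then have "set_pmf (PP {1..n}) \<inter> {x. ell {1..n} x = n} \<noteq> {}" by (auto simp: measure_pmf_zero_iff)
  then show ?thesis using assms(2) unfolding \<nu>_def by (simp add: set_cond_pmf)
qed

end


section \<open>Additive functions of random assemblies\<close>

lemma dist_to_set_le:
  assumes "A \<noteq> {}" "Z \<in> A" "mdist S Y Z \<le> e"
  shows "dist_to_set S Y A \<le> e"
proof -
  have "bdd_below ((\<lambda>Z. mdist S Y Z) ` A)" by (rule bdd_belowI2[of _ 0]) simp
  then have "dist_to_set S Y A \<le> mdist S Y Z" unfolding dist_to_set_def using assms by (intro cINF_lower)
  then show ?thesis using assms by simp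
qed

lemma vertices_cong: "(\<And>i. 1 \<le> i \<Longrightarrow> i \<le> m \<Longrightarrow> s i = s' i) \<Longrightarrow> vertices a lam s m = vertices a lam s' m"
  unfolding vertices_def by (auto intro!: map_cong)

lemma tendsto_zero_ereal:
  fixes f :: "nat \<Rightarrow> ereal"
  assumes "\<And>n. 0 \<le> f n" "\<And>\<eta>. 0 < \<eta> \<Longrightarrow> \<exists>n0. \<forall>n\<ge>n0. f n \<le> ereal \<eta>"
  shows "f \<longlonglongrightarrow> 0"
proof (rule order_tendstoI)
  fix z :: ereal assume "z < 0"
  then have "z < f n" for n using assms(1)[of n] by (rule less_le_trans)
  then show "eventually (\<lambda>n. z < f n) sequentially" by simp
next
  fix z :: ereal assume "0 < z"
  then obtain \<eta> where \<eta>: "0 < ereal \<eta>" "ereal \<eta> < z" using ereal_dense2 by blast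
  then obtain n0 where "\<forall>n\<ge>n0. f n \<le> ereal \<eta>" using assms(2)[of \<eta>] by auto
  then show "eventually (\<lambda>n. f n < z) sequentially" using \<eta>(2) by (auto simp: eventually_sequentially intro: le_less_trans)
qed

lemma sum_initial_diff:
  fixes f :: "nat \<Rightarrow> real"
  assumes "i \<le> j"
  shows "sum f {1..j} - sum f {1..i} = sum f {i<..j}"
proof -
  have "{1..j} = {1..i} \<union> {i<..j}" using assms by auto
  then show ?thesis by (simp only:) (subst sum.union_disjoint, auto)
qed

text \<open>
  The hypotheses of the theorem, with the Poisson means in place of the random assembly.
\<close>

locale additive_function = log_poisson lam \<theta>1 \<theta>2 for lam \<theta>1 \<theta>2 +
  fixes h :: "nat \<Rightarrow> nat \<Rightarrow> real" and a :: "nat \<Rightarrow> real"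
  assumes h_0: "\<And>j. 1 \<le> j \<Longrightarrow> h j 0 = 0" and a_eq: "\<And>j. a j = h j 1"
    and B_top: "filterlim (Bnorm a lam) at_top sequentially"
    and a_small: "a \<in> o(\<lambda>j. Bnorm a lam j / sqrt (LLg (Bnorm a lam j)))"
begin

text \<open>
  The centred indicator of \<open>k \<ge> 1\<close>, a bounded substitute for the contribution of the components of
  size \<open>j\<close>, which agrees with it, up to centring, when \<open>k \<le> 1\<close>.
\<close>

definition Y :: "nat \<Rightarrow> nat \<Rightarrow> real" where
  "Y j k = a j * (indicator {1..} k - (1 - exp (- lam j)))"

lemma Bsq_sum: "(\<Sum>j=1..m. bvar a lam j) = Bsq a lam m"
  by (simp add: Bsq_def bvar_def)

lemma Bsq_ge_0: "0 \<le> Bsq a lam m" by (rule Bsq_nonneg[OF lam_pos])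

sublocale kolmogorov_array "\<lambda>j. poisson_pmf (lam j)" Y "\<lambda>j. \<bar>a j\<bar>" "bvar a lam" 0
proof
  fix j :: nat assume j: "1 \<le> j"
  have l: "0 < lam j" by (rule lam_pos[OF j])
  define p where "p = 1 - exp (- lam j)"
  have p: "0 \<le> p" "p \<le> 1" using l by (auto simp: p_def)
  show "\<bar>Y j k\<bar> \<le> \<bar>a j\<bar>" for k
  proof -
    have "\<bar>indicator {1..} k - p\<bar> \<le> 1" using p by (auto simp: indicator_def)
    then show ?thesis unfolding Y_def p_def[symmetric] abs_mult by (simp add: mult_left_le)
  qed
  have "{1..} = UNIV - {0 :: nat}" by auto
  then have "measure_pmf.prob (poisson_pmf (lam j)) {1..} = 1 - measure_pmf.prob (poisson_pmf (lam j)) {0}"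
    using measure_pmf.prob_compl[of "{0}" "poisson_pmf (lam j)"] by simp
  then have pr: "measure_pmf.prob (poisson_pmf (lam j)) {1..} = p"
    by (simp add: p_def measure_pmf_single pmf_poisson[OF l])
  have "measure_pmf.expectation (poisson_pmf (lam j)) (Y j) =
      a j * (measure_pmf.prob (poisson_pmf (lam j)) {1..} - p)"
    unfolding Y_def[abs_def] p_def[symmetric] by (simp add: measure_pmf.emeasure_eq_measure)
  then show "measure_pmf.expectation (poisson_pmf (lam j)) (Y j) = 0" unfolding pr by simp
  have "(Y j k)\<^sup>2 = (a j)\<^sup>2 * ((1 - 2 * p) * indicator {1..} k + p\<^sup>2)" for k
    by (auto simp: Y_def p_def[symmetric] indicator_def power2_eq_square algebra_simps)
  then have "measure_pmf.expectation (poisson_pmf (lam j)) (\<lambda>k. (Y j k)\<^sup>2) =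
      (a j)\<^sup>2 * ((1 - 2 * p) * measure_pmf.prob (poisson_pmf (lam j)) {1..} + p\<^sup>2)"
    by (simp add: measure_pmf.emeasure_eq_measure)
  also have "\<dots> = (a j)\<^sup>2 * ((1 - p) * p)" unfolding pr by (simp add: power2_eq_square algebra_simps)
  also have "\<dots> = bvar a lam j" by (simp add: bvar_def p_def)
  finally show "measure_pmf.expectation (poisson_pmf (lam j)) (\<lambda>k. (Y j k)\<^sup>2) = bvar a lam j" .
next
  have "filterlim (\<lambda>m. (Bnorm a lam m)\<^sup>2) at_top sequentially" by (rule filterlim_pow_at_top[OF _ B_top]) simp
  then show "filterlim (\<lambda>m. \<Sum>j=1..m. bvar a lam j) at_top sequentially"
    unfolding Bsq_sum using Bsq_ge_0 by (simp add: Bnorm_def)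
next
  have "(\<lambda>j. \<bar>a j / (Bnorm a lam j / sqrt (LLg (Bnorm a lam j)))\<bar>) \<longlonglongrightarrow> 0"
    by (rule tendsto_rabs_zero[OF smalloD_tendsto[OF a_small]])
  moreover have "\<bar>a j / (Bnorm a lam j / sqrt (LLg (Bnorm a lam j)))\<bar> =
      \<bar>a j\<bar> * sqrt (LLg (sqrt (Bsq a lam j))) / sqrt (Bsq a lam j)" for j
    using LLg_ge_1[of "sqrt (Bsq a lam j)"] Bsq_ge_0[of j] by (simp add: Bnorm_def abs_mult)
  ultimately show "(\<lambda>j. \<bar>a j\<bar> * sqrt (LLg (sqrt (\<Sum>i=1..j. bvar a lam i))) / sqrt (\<Sum>i=1..j. bvar a lam i)) \<longlonglongrightarrow> 0"
    unfolding Bsq_sum by simp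
qed

lemma V_Bsq: "V m = Bsq a lam m" unfolding V_def by (rule Bsq_sum)

lemma bet_\<beta>: "bet m = \<beta> a lam m" by (simp add: bet_def L_def V_Bsq \<beta>_def Bnorm_def)

definition H :: "(nat \<Rightarrow> nat) \<Rightarrow> nat \<Rightarrow> real" where
  "H x i = (\<Sum>j=1..i. h j (x j)) - Acen a lam i"

definition U :: "nat \<Rightarrow> (nat \<Rightarrow> nat) \<Rightarrow> real \<Rightarrow> real" where
  "U m x = (\<lambda>t\<in>{0..1}. polyline (vertices a lam (H x) m) (Bsq a lam m * t) / bet m)"

lemma U_proc_eq:
  assumes "m \<le> n"
  shows "U_proc h lam m \<sigma> = U m (\<lambda>j. if j \<in> {1..n} then comp_count \<sigma> j else 0)"
proof -
  have a: "(\<lambda>j. h j 1) = a" by (rule ext) (simp only: a_eq)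
  have "vertices a lam (\<lambda>i. hsum h \<sigma> i - Acen a lam i) m = vertices a lam (H (\<lambda>j. if j \<in> {1..n} then comp_count \<sigma> j else 0)) m"
    using assms by (intro vertices_cong) (auto simp: H_def hsum_def intro!: sum.cong)
  then show ?thesis unfolding U_proc_def u_line_vertices a Let_def U_def bet_\<beta> by simp
qed

lemma U_C01: "U m x \<in> mspace C01"
  unfolding U_def by (rule polyline_vertices_C01[OF lam_pos])

lemma strassen_C01: "g \<in> strassen_set \<Longrightarrow> g \<in> mspace C01" by (simp add: strassen_set_def)

lemma a_le_bet:
  assumes cu: "\<bar>a j\<bar> * sqrt (L m) \<le> \<kappa> * sqrt (V m)"
  shows "(a j)\<^sup>2 \<le> \<kappa>\<^sup>2 * V m" "0 \<le> \<kappa> \<Longrightarrow> \<bar>a j\<bar> \<le> \<kappa> * bet m"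
proof -
  have "\<bar>a j\<bar> * 1 \<le> \<bar>a j\<bar> * sqrt (L m)" using L_ge_1[of m] by (intro mult_left_mono) auto
  then have 1: "\<bar>a j\<bar> \<le> \<kappa> * sqrt (V m)" using cu by linarith
  then have "\<bar>a j\<bar>\<^sup>2 \<le> (\<kappa> * sqrt (V m))\<^sup>2" by (intro power_mono) auto
  then show "(a j)\<^sup>2 \<le> \<kappa>\<^sup>2 * V m" using V_nonneg[of m] by (simp add: power_mult_distrib)
  assume \<kappa>: "0 \<le> \<kappa>"
  have "sqrt (V m) * 1 \<le> bet m" unfolding bet_def using L_ge_1[of m] V_nonneg[of m] by (intro mult_left_mono) auto
  then have "\<kappa> * sqrt (V m) \<le> \<kappa> * bet m" using \<kappa> by (intro mult_left_mono) auto
  then show "\<bar>a j\<bar> \<le> \<kappa> * bet m" using 1 by linarith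
qed

lemma U_near:
  assumes g: "g \<in> strassen_set" and V: "0 < V m" and \<kappa>: "0 \<le> \<kappa>" and e: "0 \<le> e"
    and cu: "\<And>j. 1 \<le> j \<Longrightarrow> j \<le> m \<Longrightarrow> \<bar>a j\<bar> * sqrt (L m) \<le> \<kappa> * sqrt (V m)"
    and near: "\<And>i. 1 \<le> i \<Longrightarrow> i \<le> m \<Longrightarrow> \<bar>H x i / bet m - g (V i / V m)\<bar> \<le> e"
  shows "mdist C01 (U m x) g \<le> e + \<kappa>"
proof -
  have "\<bar>U m x t - g t\<bar> \<le> e + \<kappa>" if t: "t \<in> {0..1}" for t
  proof -
    have gap: "bvar a lam j \<le> \<kappa>\<^sup>2 * Bsq a lam m" if "1 \<le> j" "j \<le> m" for j
      using b_le[OF that(1)] a_le_bet(1)[OF cu[OF that]] by (simp add: V_Bsq)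
    have "\<bar>polyline (vertices a lam (H x) m) (Bsq a lam m * t) / bet m - g t\<bar> \<le> e + sqrt (\<kappa>\<^sup>2)"
      by (rule polyline_vertices_near[OF lam_pos g _ bet_pos[OF V] _ gap t e])
        (use V near in \<open>auto simp: V_Bsq\<close>)
    then show ?thesis using t \<kappa> by (simp add: U_def)
  qed
  then show ?thesis using C01_mdist_le[OF U_C01 strassen_C01[OF g]] by blast
qed

text \<open>
  The total error made by the substitution of indicators among the first \<open>J\<close> indices; when no later count exceeds
  one, it bounds the error along the whole path.
\<close>

definition R :: "nat \<Rightarrow> (nat \<Rightarrow> nat) \<Rightarrow> real" where
  "R J x = (\<Sum>j=1..J. \<bar>h j (x j) - a j * indicator {1..} (x j)\<bar>)"

lemma h_single: "1 \<le> j \<Longrightarrow> k < 2 \<Longrightarrow> h j k = a j * real k"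
  using h_0[of j] a_eq[of j] by (auto simp: less_2_cases_iff)

lemma H_S:
  assumes "\<And>j. J < j \<Longrightarrow> j \<le> i \<Longrightarrow> x j < 2"
  shows "\<bar>H x i - S x i\<bar> \<le> R J x"
proof -
  define d where "d = (\<lambda>j. h j (x j) - a j * indicator {1..} (x j))"
  define I where "I = {1..i}"
  define A where "A = {1..J}"
  have "H x i - S x i = (\<Sum>j\<in>I. d j)"
    unfolding H_def S_def Acen_def Y_def d_def I_def by (simp add: sum_subtractf right_diff_distrib)
  then have "\<bar>H x i - S x i\<bar> \<le> (\<Sum>j\<in>I. \<bar>d j\<bar>)" by simp
  also have "\<dots> = (\<Sum>j\<in>I \<inter> A. \<bar>d j\<bar>)"
  proof (rule sum.mono_neutral_right)
    have "d j = 0" if "j \<in> I - I \<inter> A" for j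
    proof -
      have j: "1 \<le> j" "x j < 2" using that assms[of j] by (auto simp: I_def A_def)
      then show ?thesis unfolding d_def h_single[OF j] by (auto simp: less_2_cases_iff)
    qed
    then show "\<forall>j\<in>I - I \<inter> A. \<bar>d j\<bar> = 0" by simp
  qed (auto simp: I_def)
  also have "\<dots> \<le> (\<Sum>j\<in>A. \<bar>d j\<bar>)" by (rule sum_mono2) (auto simp: A_def)
  finally show ?thesis by (simp add: R_def d_def A_def)
qed

lemma close_imp_mdist:
  assumes g: "g \<in> strassen_set" and V: "0 < V m" and \<kappa>: "0 \<le> \<kappa>" and e: "0 \<le> e"
    and cu: "\<And>j. 1 \<le> j \<Longrightarrow> j \<le> m \<Longrightarrow> \<bar>a j\<bar> * sqrt (L m) \<le> \<kappa> * sqrt (V m)"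
    and x: "\<And>j. J < j \<Longrightarrow> j \<le> m \<Longrightarrow> x j < 2" and R: "R J x \<le> e * bet m" and cl: "close g m x e"
  shows "mdist C01 (U m x) g \<le> 2 * e + \<kappa>"
proof (rule U_near[OF g V \<kappa> _ cu])
  fix i assume i: "1 \<le> i" "i \<le> m"
  have b: "0 < bet m" by (rule bet_pos[OF V])
  have "\<bar>H x i - S x i\<bar> \<le> e * bet m" using H_S[of J i x] x R i by fastforce
  then have "\<bar>H x i / bet m - S x i / bet m\<bar> \<le> e"
    using b unfolding diff_divide_distrib[symmetric] abs_divide by (simp add: pos_divide_le_eq)
  moreover have "\<bar>S x i / bet m - g (V i / V m)\<bar> \<le> e" using cl i by (simp add: close_def)
  ultimately show "\<bar>H x i / bet m - g (V i / V m)\<bar> \<le> 2 * e" by linarith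
qed (use e in auto)

lemma near_imp_dist:
  assumes "near m x e" "0 < V m" "0 \<le> \<kappa>" "0 \<le> e"
    and "\<And>j. 1 \<le> j \<Longrightarrow> j \<le> m \<Longrightarrow> \<bar>a j\<bar> * sqrt (L m) \<le> \<kappa> * sqrt (V m)"
    and "\<And>j. J < j \<Longrightarrow> j \<le> m \<Longrightarrow> x j < 2" "R J x \<le> e * bet m"
  shows "dist_to_set C01 (U m x) strassen_set \<le> 2 * e + \<kappa>"
proof -
  obtain g where "g \<in> strassen_set" "close g m x e" using assms(1) by (auto simp: near_def close_def)
  then show ?thesis
    using close_imp_mdist[of g m \<kappa> e J x] assms by (intro dist_to_set_le[of _ g]) auto
qed

text \<open>
  At most \<open>n / r\<close> components have sizes above \<open>r\<close>, because their sizes add up to at most \<open>n\<close>.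
\<close>

lemma late_sum_le:
  assumes r: "1 \<le> r" and ell: "ell {1..n} x = n"
  shows "(\<Sum>j\<in>{r<..n}. real (x j) + lam j) \<le> (1 + \<theta>2) * (real n / real r)"
proof -
  define A where "A = {1..n}"
  have "r * (\<Sum>j\<in>{r<..n}. x j) = (\<Sum>j\<in>{r<..n}. r * x j)" by (rule sum_distrib_left)
  also have "\<dots> \<le> (\<Sum>j\<in>{r<..n}. j * x j)" by (intro sum_mono) auto
  also have "\<dots> \<le> (\<Sum>j\<in>A. j * x j)" by (rule sum_mono2) (auto simp: A_def)
  also have "\<dots> = n" using ell by (simp add: ell_def A_def)
  finally have "real r * (\<Sum>j\<in>{r<..n}. real (x j)) \<le> real n"
    unfolding of_nat_sum[symmetric] of_nat_mult[symmetric] of_nat_le_iff .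
  then have 1: "(\<Sum>j\<in>{r<..n}. real (x j)) \<le> real n / real r" using r by (simp add: pos_le_divide_eq mult.commute)
  have "(\<Sum>j\<in>{r<..n}. lam j) \<le> (\<Sum>j\<in>{r<..n}. \<theta>2 / real r)"
  proof (rule sum_mono)
    fix j assume j: "j \<in> {r<..n}"
    have "lam j \<le> \<theta>2 / real j" using lam_upper[of j] j by simp
    also have "\<dots> \<le> \<theta>2 / real r" using j r \<theta> by (intro divide_left_mono) auto
    finally show "lam j \<le> \<theta>2 / real r" .
  qed
  also have "\<dots> = real (n - r) * (\<theta>2 / real r)" by simp
  also have "\<dots> \<le> real n * (\<theta>2 / real r)" using \<theta> by (intro mult_right_mono) auto
  finally have "(\<Sum>j\<in>{r<..n}. lam j) \<le> \<theta>2 * (real n / real r)" by (simp add: mult.commute)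
  then show ?thesis using 1 unfolding sum.distrib distrib_right mult_1_left by linarith
qed

text \<open>
  Beyond \<open>r\<close> both the path and the variance are controlled by the number \<open>M\<close> of components that can occur
  there, up to a constant, and by the bound \<open>s / M\<close> for the size of a single term relative to \<open>bet m\<close>.  So the path may be
  frozen at \<open>r\<close>, where \<open>near_extend\<close> applies.
\<close>

lemma far_imp_dist:
  assumes r: "1 \<le> r" "J \<le> r" "r \<le> m" "m \<le> n" and ell: "ell {1..n} x = n"
    and x: "\<And>j. J < j \<Longrightarrow> j \<le> n \<Longrightarrow> x j < 2" and R: "R J x \<le> e * bet m" and nr: "near r x e"
    and e: "0 \<le> e" "e \<le> 1" and V: "0 < V m" and D: "(1 + \<theta>2) * (real n / real r) \<le> M" "1 \<le> M"
    and s: "0 < s" "s \<le> 1 / 2"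
    and cu: "\<And>j. 1 \<le> j \<Longrightarrow> j \<le> m \<Longrightarrow> \<bar>a j\<bar> * sqrt (L m) \<le> s / M * sqrt (V m)"
  shows "dist_to_set C01 (U m x) strassen_set \<le> 2 * e + 5 * s"
proof -
  define \<kappa> where "\<kappa> = s / M"
  have \<kappa>: "0 < \<kappa>" "\<kappa> * M = s" "\<kappa> \<le> s" using s D by (auto simp: \<kappa>_def pos_divide_le_eq)
  note cu' = cu[folded \<kappa>_def]
  have b: "0 < bet m" by (rule bet_pos[OF V])
  have tail: "(\<Sum>j\<in>{r<..i}. real (x j) + lam j) \<le> M" if i: "i \<le> m" for i
  proof -
    have "(\<Sum>j\<in>{r<..i}. real (x j) + lam j) \<le> (\<Sum>j\<in>{r<..n}. real (x j) + lam j)"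
    proof (rule sum_mono2)
      show "{r<..i} \<subseteq> {r<..n}" using i r by auto
      show "0 \<le> real (x j) + lam j" if "j \<in> {r<..n} - {r<..i}" for j using lam_pos[of j] that by simp
    qed simp
    then show ?thesis using late_sum_le[OF r(1) ell] D(1) by linarith
  qed
  (* the terms of the variance are at most \<kappa>^2 * V m * lam j, and the lam j beyond r
     add up to at most M *)
  have Vr: "(1 - s\<^sup>2) * V m \<le> V r"
  proof -
    have "V m - V r = (\<Sum>j\<in>{r<..m}. bvar a lam j)"
      unfolding V_def by (rule sum_initial_diff[OF r(3)])
    also have "\<dots> \<le> (\<Sum>j\<in>{r<..m}. (\<kappa>\<^sup>2 * V m) * (real (x j) + lam j))"
    proof (rule sum_mono)
      fix j assume j: "j \<in> {r<..m}"
      then have j1: "1 \<le> j" "j \<le> m" by auto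
      have l: "0 < lam j" by (rule lam_pos[OF j1(1)])
      have "1 - exp (- lam j) \<le> lam j" using exp_ge_add_one_self[of "- lam j"] by linarith
      then have "exp (- lam j) * (1 - exp (- lam j)) \<le> 1 * lam j" using l by (intro mult_mono) auto
      then have "exp (- lam j) * (1 - exp (- lam j)) \<le> real (x j) + lam j" by simp
      then have "(a j)\<^sup>2 * (exp (- lam j) * (1 - exp (- lam j))) \<le> (\<kappa>\<^sup>2 * V m) * (real (x j) + lam j)"
        using a_le_bet(1)[OF cu'[OF j1]] l V by (intro mult_mono) auto
      then show "bvar a lam j \<le> (\<kappa>\<^sup>2 * V m) * (real (x j) + lam j)" by (simp add: bvar_def mult.assoc)
    qed
    also have "\<dots> = (\<kappa>\<^sup>2 * V m) * (\<Sum>j\<in>{r<..m}. real (x j) + lam j)" by (rule sum_distrib_left[symmetric])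
    also have "\<dots> \<le> (\<kappa>\<^sup>2 * V m) * M\<^sup>2"
    proof (rule mult_left_mono)
      have "M \<le> M * M" using D(2) by simp
      then show "(\<Sum>j\<in>{r<..m}. real (x j) + lam j) \<le> M\<^sup>2" using tail[of m] by (simp add: power2_eq_square)
    qed (use V in simp)
    also have "\<dots> = s\<^sup>2 * V m" by (simp add: \<kappa>(2)[symmetric] power_mult_distrib)
    finally show ?thesis by (simp add: algebra_simps)
  qed
  have s2: "0 \<le> s\<^sup>2" "s\<^sup>2 < 1" "s\<^sup>2 \<le> s / 2" "sqrt (s\<^sup>2) = s"
  proof -
    have "s * s \<le> s * (1 / 2)" using s by (intro mult_left_mono) auto
    then show "s\<^sup>2 \<le> s / 2" by (simp add: power2_eq_square)
    then show "s\<^sup>2 < 1" using s by linarith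
  qed (use s in auto)
  obtain g where g: "g \<in> strassen_set" "\<And>i. i \<le> m \<Longrightarrow> \<bar>S x (min i r) / bet m - g (V i / V m)\<bar> \<le> e + 2 * s\<^sup>2 + 2 * s"
    using near_extend[OF nr r(3) s2(1,2) V Vr e] unfolding s2(4) by blast
  have "mdist C01 (U m x) g \<le> (2 * e + 4 * s) + \<kappa>"
  proof (rule U_near[OF g(1) V _ _ cu'])
    fix i assume i: "1 \<le> i" "i \<le> m"
    define k where "k = min i r"
    have "\<bar>H x k - S x k\<bar> \<le> e * bet m" using H_S[of J k x] x R i r unfolding k_def by fastforce
    moreover have "\<bar>H x i - H x k\<bar> \<le> s * bet m"
    proof -
      have ki: "k \<le> i" by (simp add: k_def)
      have "H x i - H x k = (\<Sum>j\<in>{k<..i}. h j (x j) - a j * (1 - exp (- lam j)))"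
      proof -
        have "H x i = (\<Sum>j=1..i. h j (x j) - a j * (1 - exp (- lam j)))" for i
          by (simp add: H_def Acen_def sum_subtractf)
        then show ?thesis using sum_initial_diff[OF ki] by simp
      qed
      also have "\<bar>\<dots>\<bar> \<le> (\<Sum>j\<in>{k<..i}. \<bar>h j (x j) - a j * (1 - exp (- lam j))\<bar>)" by (rule sum_abs)
      also have "\<dots> \<le> (\<Sum>j\<in>{k<..i}. (\<kappa> * bet m) * (real (x j) + lam j))"
      proof (rule sum_mono)
        fix j assume j: "j \<in> {k<..i}"
        then have jr: "r < j" "j \<le> m" using i unfolding k_def by auto
        then have j1: "1 \<le> j" "x j < 2" using x[of j] r by auto
        have l: "0 < lam j" by (rule lam_pos[OF j1(1)])
        have "1 - exp (- lam j) \<le> lam j" using exp_ge_add_one_self[of "- lam j"] by linarith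
        moreover have "0 \<le> 1 - exp (- lam j)" using l by simp
        ultimately have "\<bar>real (x j) - (1 - exp (- lam j))\<bar> \<le> real (x j) + lam j" by linarith
        then have "\<bar>a j\<bar> * \<bar>real (x j) - (1 - exp (- lam j))\<bar> \<le> (\<kappa> * bet m) * (real (x j) + lam j)"
          using a_le_bet(2)[OF cu'[OF j1(1) jr(2)]] \<kappa> b by (intro mult_mono) auto
        then show "\<bar>h j (x j) - a j * (1 - exp (- lam j))\<bar> \<le> (\<kappa> * bet m) * (real (x j) + lam j)"
          unfolding h_single[OF j1] right_diff_distrib[symmetric] abs_mult .
      qed
      also have "\<dots> = (\<kappa> * bet m) * (\<Sum>j\<in>{k<..i}. real (x j) + lam j)" by (rule sum_distrib_left[symmetric])
      also have "\<dots> \<le> (\<kappa> * bet m) * M"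
      proof (rule mult_left_mono)
        have "{k<..i} = {r<..i}" by (auto simp: k_def)
        then show "(\<Sum>j\<in>{k<..i}. real (x j) + lam j) \<le> M" using tail[OF i(2)] by simp
      qed (use \<kappa> b in simp)
      also have "\<dots> = (\<kappa> * M) * bet m" by simp
      finally show ?thesis unfolding \<kappa>(2) .
    qed
    ultimately have "\<bar>H x i - S x k\<bar> \<le> (e + s) * bet m" by (simp add: distrib_right)
    then have "\<bar>H x i / bet m - S x k / bet m\<bar> \<le> e + s"
      using b unfolding diff_divide_distrib[symmetric] abs_divide by (simp add: pos_divide_le_eq)
    moreover have "\<bar>S x k / bet m - g (V i / V m)\<bar> \<le> e + 2 * s\<^sup>2 + 2 * s" using g(2)[OF i(2)] by (simp add: k_def)
    ultimately show "\<bar>H x i / bet m - g (V i / V m)\<bar> \<le> 2 * e + 4 * s" using s2(3) by linarith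
  qed (use e s \<kappa> in auto)
  then show ?thesis using g(1) \<kappa>(3) by (intro dist_to_set_le[of _ g]) auto
qed

lemma R_cong: "(\<And>j. j \<in> {1..J} \<Longrightarrow> x j = y j) \<Longrightarrow> R J x = R J y"
  unfolding R_def by (rule sum.cong) auto

text \<open>
  \<open>J\<close> is chosen from the convergence of the sum of \<open>(lam j)\<^sup>2\<close>, and then \<open>K\<close> from the tightness of a single
  random variable.
\<close>

lemma few_irregularities:
  assumes \<eta>: "0 < \<eta>"
  shows "\<exists>J K. \<forall>r\<ge>J. depends_on {1..r} ({x. \<exists>j\<in>{J<..r}. 2 \<le> x j} \<union> {x. K < R J x}) \<and>
    measure_pmf.prob (PP {1..r}) ({x. \<exists>j\<in>{J<..r}. 2 \<le> x j} \<union> {x. K < R J x}) \<le> \<eta>"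
proof -
  have \<eta>2: "0 < \<eta> / 2" using \<eta> by simp
  obtain J where J: "\<And>r. measure_pmf.prob (PP {1..r}) {x. \<exists>j\<in>{J<..r}. 2 \<le> x j} \<le> \<eta> / 2"
    using multiple_parts_PP[OF \<eta>2] by blast
  obtain K where K: "measure_pmf.prob (PP {1..J}) {x. K < R J x} \<le> \<eta> / 2"
    using pmf_tight[OF \<eta>2] by blast
  have dR: "depends_on {1..J} {x. K < R J x}"
    unfolding depends_on_def using R_cong by (metis mem_Collect_eq)
  have d: "depends_on {1..r} ({x. \<exists>j\<in>{J<..r}. 2 \<le> x j} \<union> {x. K < R J x})" if r: "J \<le> r" for r
    unfolding depends_on_def
  proof (intro allI impI)
    fix x y :: "nat \<Rightarrow> nat" assume xy: "\<forall>i\<in>{1..r}. x i = y i"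
    have "R J x = R J y" by (rule R_cong) (use xy r in auto)
    moreover have "(\<exists>j\<in>{J<..r}. 2 \<le> x j) \<longleftrightarrow> (\<exists>j\<in>{J<..r}. 2 \<le> y j)" by (rule bex_cong) (use xy in auto)
    ultimately show "x \<in> {x. \<exists>j\<in>{J<..r}. 2 \<le> x j} \<union> {x. K < R J x} \<longleftrightarrow> y \<in> {x. \<exists>j\<in>{J<..r}. 2 \<le> x j} \<union> {x. K < R J x}"
      by simp
  qed
  have "measure_pmf.prob (PP {1..r}) ({x. \<exists>j\<in>{J<..r}. 2 \<le> x j} \<union> {x. K < R J x}) \<le> \<eta>" if r: "J \<le> r" for r
  proof -
    have "measure_pmf.prob (PP {1..r}) {x. K < R J x} = measure_pmf.prob (PP {1..J}) {x. K < R J x}"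
      by (rule prob_Pi_pmf_marginal) (use r dR in auto)
    moreover have "measure_pmf.prob (PP {1..r}) ({x. \<exists>j\<in>{J<..r}. 2 \<le> x j} \<union> {x. K < R J x}) \<le>
        measure_pmf.prob (PP {1..r}) {x. \<exists>j\<in>{J<..r}. 2 \<le> x j} + measure_pmf.prob (PP {1..r}) {x. K < R J x}"
      by (rule measure_Un_le) auto
    ultimately show ?thesis using J[of r] K by linarith
  qed
  with d show ?thesis by blast
qed

lemma bet_large: "\<exists>m0. \<forall>m\<ge>m0. K \<le> bet m"
proof -
  obtain m0 where m0: "\<And>m. m0 \<le> m \<Longrightarrow> (max 0 K)\<^sup>2 \<le> V m" using V_large by blast
  have "K \<le> bet m" if "m0 \<le> m" for m
  proof -
    have "V m \<le> V m * L m" using L_ge_1[of m] V_nonneg[of m] mult_left_mono[of 1 "L m" "V m"] by simp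
    moreover have "0 \<le> V m * L m" using L_ge_1[of m] V_nonneg[of m] by simp
    ultimately have "(max 0 K)\<^sup>2 \<le> (bet m)\<^sup>2" unfolding bet_sq using m0[OF that] by linarith
    then have "max 0 K \<le> bet m" by (rule power2_le_imp_le[OF _ bet_nonneg])
    then show ?thesis by simp
  qed
  then show ?thesis by blast
qed

text \<open>
  Of the total \<open>\<eta>\<close>, a quarter goes to repeated sizes above \<open>\<rho> n\<close>, a quarter to the error term of \<open>transfer\<close>, and
  a quarter each to the irregular small counts and to the failure of \<open>upper_LIL\<close>, both multiplied by the
  constant of \<open>transfer\<close>.
\<close>

theorem upper_U:
  assumes \<epsilon>: "0 < \<epsilon>" and \<eta>: "0 < \<eta>"
  shows "\<exists>n1 N. \<forall>n\<ge>N. measure_pmf.prob (\<nu> n) {x. \<exists>m\<in>{n1..n}. \<epsilon> \<le> dist_to_set C01 (U m x) strassen_set} \<le> \<eta>"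
proof -
  define e where "e = min 1 (\<epsilon> / 8)"
  have e: "0 < e" "e \<le> 1" "e \<le> \<epsilon> / 8" using \<epsilon> by (auto simp: e_def)
  have \<eta>4: "0 < \<eta> / 4" using \<eta> by simp
  obtain \<rho> C where \<rho>: "0 < \<rho>" "\<rho> \<le> 1 / 2" and C: "0 < C" and
    tr: "\<And>n E. 1 \<le> n \<Longrightarrow> depends_on {1..nat \<lfloor>\<rho> * real n\<rfloor>} E \<Longrightarrow>
      measure_pmf.prob (\<nu> n) E \<le> \<eta> / 4 + C * measure_pmf.prob (PP {1..nat \<lfloor>\<rho> * real n\<rfloor>}) E"
    using transfer[OF \<eta>4] by blast
  have \<eta>C: "0 < \<eta> / (4 * C)" using \<eta> C by simp
  obtain J K where d1: "\<And>r. J \<le> r \<Longrightarrow> depends_on {1..r} ({x. \<exists>j\<in>{J<..r}. 2 \<le> x j} \<union> {x. K < R J x})"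
    and p1: "\<And>r. J \<le> r \<Longrightarrow> measure_pmf.prob (PP {1..r}) ({x. \<exists>j\<in>{J<..r}. 2 \<le> x j} \<union> {x. K < R J x}) \<le> \<eta> / (4 * C)"
    using few_irregularities[OF \<eta>C] by blast
  (* 2 / \<rho> bounds n / r, where r = \<lfloor>\<rho> n\<rfloor> is at least \<rho> n / 2 *)
  define M where "M = (1 + \<theta>2) * (2 / \<rho>)"
  have M: "1 \<le> M"
  proof -
    have "1 \<le> 2 / \<rho>" using \<rho> by simp
    then have "1 * 1 \<le> M" unfolding M_def using \<theta> by (intro mult_mono) auto
    then show ?thesis by simp
  qed
  define s where "s = min (1 / 2) (\<epsilon> / 16)"
  have s: "0 < s" "s \<le> 1 / 2" "s \<le> \<epsilon> / 16" using \<epsilon> by (auto simp: s_def)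
  have sM: "0 < s / M" "s / M \<le> s" using s M by (auto simp: pos_divide_le_eq)
  obtain n2 where n2: "\<And>n. measure_pmf.prob (P n) {x. \<exists>m\<in>{n2..n}. \<not> near m x e} \<le> \<eta> / (4 * C)"
    using upper_LIL[OF e(1) \<eta>C] by blast
  obtain n3 where n3: "\<And>m. n3 \<le> m \<Longrightarrow> 1 \<le> V m"
      "\<And>m j. n3 \<le> m \<Longrightarrow> 1 \<le> j \<Longrightarrow> j \<le> m \<Longrightarrow> \<bar>a j\<bar> * sqrt (L m) \<le> s / M * sqrt (V m)"
    using c_uniform[OF sM(1)] by blast
  obtain n4 where n4: "\<And>m. n4 \<le> m \<Longrightarrow> K / e \<le> bet m" using bet_large by blast
  define n1 where "n1 = Max {n2, n3, n4}"
  have n1: "n2 \<le> n1" "n3 \<le> n1" "n4 \<le> n1" by (auto simp: n1_def)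
  (* beyond Q repeated sizes in (r, n] have probability at most \<eta> / 4 *)
  define Q where "Q = 2 * \<theta>2\<^sup>2 / (\<rho> * c1) * (4 / \<eta>)"
  define N where "N = nat \<lceil>(Q + real J + real n1 + 2) / \<rho>\<rceil>"
  have Q: "0 \<le> Q" using \<rho> c1_pos \<eta> by (simp add: Q_def)
  have "measure_pmf.prob (\<nu> n) {x. \<exists>m\<in>{n1..n}. \<epsilon> \<le> dist_to_set C01 (U m x) strassen_set} \<le> \<eta>" if n: "N \<le> n" for n
  proof -
    define r where "r = nat \<lfloor>\<rho> * real n\<rfloor>"
    have "(Q + real J + real n1 + 2) / \<rho> \<le> real n" using n unfolding N_def by linarith
    then have "Q + real J + real n1 + 2 \<le> \<rho> * real n" using \<rho> by (simp add: pos_divide_le_eq mult.commute)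
    moreover have r0: "\<rho> * real n < real r + 1" "real r \<le> \<rho> * real n" using \<rho> by (auto simp: r_def)
    ultimately have r: "Q \<le> real r" "J \<le> r" "n1 \<le> r" "1 \<le> r" using Q by linarith+
    have "\<rho> * real n \<le> 1 * real n" using \<rho> by (intro mult_right_mono) auto
    then have rn: "r \<le> n" "1 \<le> n" using r0 r(4) by linarith+
    have nr: "real n / real r \<le> 2 / \<rho>"
    proof -
      have "\<rho> * real n \<le> 2 * real r" using r0 r(4) by linarith
      then show ?thesis using r(4) \<rho> by (simp add: field_simps)
    qed
    define A where "A = {x :: nat \<Rightarrow> nat. \<exists>j\<in>{r<..n}. 2 \<le> x j}"
    define E1 where "E1 = {x. \<exists>j\<in>{J<..r}. 2 \<le> x j} \<union> {x. K < R J x}"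
    define E2 where "E2 = {x. \<exists>m\<in>{n2..r}. \<not> near m x e}"
    have pA: "measure_pmf.prob (\<nu> n) A \<le> \<eta> / 4"
    proof -
      have "measure_pmf.prob (\<nu> n) A \<le> (real n * (\<theta>2 / real r)\<^sup>2) / c1"
        unfolding A_def by (rule \<nu>_multiple_parts[OF rn(2) r(4)])
      also have "\<dots> = (real n / real r) * (\<theta>2\<^sup>2 / (real r * c1))" by (simp add: power2_eq_square)
      also have "\<dots> \<le> (2 / \<rho>) * (\<theta>2\<^sup>2 / (real r * c1))" using nr r c1_pos by (intro mult_right_mono) auto
      also have "\<dots> \<le> \<eta> / 4"
      proof -
        have "2 * \<theta>2\<^sup>2 * 4 \<le> real r * (\<rho> * c1 * \<eta>)"
          using r(1) \<rho> c1_pos \<eta> unfolding Q_def by (simp add: pos_divide_le_eq mult_ac)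
        then show ?thesis using r(4) \<rho> c1_pos \<eta> by (simp add: field_simps)
      qed
      finally show ?thesis .
    qed
    have dE2: "depends_on {1..r} E2"
      unfolding depends_on_def
    proof (intro allI impI)
      fix x y :: "nat \<Rightarrow> nat" assume xy: "\<forall>i\<in>{1..r}. x i = y i"
      have "near m x e \<longleftrightarrow> near m y e" if "m \<in> {n2..r}" for m
        using depends_onD[OF near_depends[of m r e], of x y] xy that by auto
      then show "x \<in> E2 \<longleftrightarrow> y \<in> E2" by (auto simp: E2_def)
    qed
    have dE: "depends_on {1..r} (E1 \<union> E2)"
      using d1[OF r(2), folded E1_def] dE2 unfolding depends_on_def by (metis UnE UnI1 UnI2)
    have "measure_pmf.prob (PP {1..r}) (E1 \<union> E2) \<le> measure_pmf.prob (PP {1..r}) E1 + measure_pmf.prob (PP {1..r}) E2"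
      by (rule measure_Un_le) auto
    also have "\<dots> \<le> \<eta> / (4 * C) + \<eta> / (4 * C)"
      using p1[OF r(2)] n2[of r] unfolding E1_def E2_def by (rule add_mono)
    finally have "C * measure_pmf.prob (PP {1..r}) (E1 \<union> E2) \<le> C * (\<eta> / (4 * C) + \<eta> / (4 * C))"
      using C by (intro mult_left_mono) auto
    also have "\<dots> = \<eta> / 2" using C by (simp add: field_simps)
    finally have pE: "measure_pmf.prob (\<nu> n) (E1 \<union> E2) \<le> \<eta> / 4 + \<eta> / 2"
      using tr[OF rn(2) dE[unfolded r_def]] unfolding r_def[symmetric] by linarith
    have "measure_pmf.prob (\<nu> n) {x. \<exists>m\<in>{n1..n}. \<epsilon> \<le> dist_to_set C01 (U m x) strassen_set} \<le> measure_pmf.prob (\<nu> n) (A \<union> (E1 \<union> E2))"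
    proof (rule prob_mono_on_support, rule ccontr)
      fix x assume x: "x \<in> set_pmf (\<nu> n)" "x \<in> {x. \<exists>m\<in>{n1..n}. \<epsilon> \<le> dist_to_set C01 (U m x) strassen_set}"
        and bad: "x \<notin> A \<union> (E1 \<union> E2)"
      obtain m where m: "n1 \<le> m" "m \<le> n" "\<epsilon> \<le> dist_to_set C01 (U m x) strassen_set" using x(2) by auto
      have ell: "ell {1..n} x = n" by (rule set_pmf_\<nu>[OF rn(2) x(1)])
      have x2: "x j < 2" if "J < j" "j \<le> n" for j
        using bad that unfolding A_def E1_def by (cases "j \<le> r") (auto simp: not_le)
      have "R J x \<le> K" using bad unfolding E1_def by (simp add: not_less)
      also have "K \<le> e * bet m" using n4[of m] n1 m(1) e(1) by (simp add: pos_divide_le_eq mult.commute)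
      finally have RK: "R J x \<le> e * bet m" .
      have nearE: "near k x e" if "n2 \<le> k" "k \<le> r" for k using bad that unfolding E2_def by auto
      have Vm: "0 < V m" using n3(1)[of m] n1 m(1) by simp
      have cu: "\<bar>a j\<bar> * sqrt (L m) \<le> s / M * sqrt (V m)" if "1 \<le> j" "j \<le> m" for j
        using n3(2)[of m j] n1 m(1) that by simp
      have "dist_to_set C01 (U m x) strassen_set \<le> 2 * e + 5 * s"
      proof (cases "m \<le> r")
        case True
        have "dist_to_set C01 (U m x) strassen_set \<le> 2 * e + s / M"
          by (rule near_imp_dist[OF nearE Vm _ _ cu _ RK]) (use True n1 m e sM x2 in auto)
        then show ?thesis using sM s by linarith
      next
        case False
        have D: "(1 + \<theta>2) * (real n / real r) \<le> M" unfolding M_def using nr \<theta> by (intro mult_left_mono) auto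
        show ?thesis
          by (rule far_imp_dist[OF r(4,2) _ m(2) ell x2 RK nearE _ e(2) Vm D M s(1,2) cu]) (use False n1 r e in auto)
      qed
      then show False using m(3) e(3) s(3) \<epsilon> by linarith
    qed
    also have "\<dots> \<le> measure_pmf.prob (\<nu> n) A + measure_pmf.prob (\<nu> n) (E1 \<union> E2)" by (rule measure_Un_le) auto
    also have "\<dots> \<le> \<eta>" using pA pE by linarith
    finally show ?thesis .
  qed
  then show ?thesis by blast
qed

text \<open>
  Only indices up to \<open>\<rho> n\<close> are needed: one of them is already close to \<open>g\<close> with high probability.
\<close>

theorem lower_U:
  assumes g: "g \<in> strassen_set" and \<epsilon>: "0 < \<epsilon>" and \<eta>: "0 < \<eta>"
  shows "\<exists>N. \<forall>n\<ge>N. measure_pmf.prob (\<nu> n) {x. \<forall>m\<in>{n1..n}. \<epsilon> \<le> mdist C01 (U m x) g} \<le> \<eta>"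
proof -
  define e where "e = \<epsilon> / 8"
  have e: "0 < e" using \<epsilon> by (simp add: e_def)
  have \<eta>4: "0 < \<eta> / 4" using \<eta> by simp
  obtain \<rho> C where \<rho>: "0 < \<rho>" "\<rho> \<le> 1 / 2" and C: "0 < C" and
    tr: "\<And>n E. 1 \<le> n \<Longrightarrow> depends_on {1..nat \<lfloor>\<rho> * real n\<rfloor>} E \<Longrightarrow>
      measure_pmf.prob (\<nu> n) E \<le> \<eta> / 4 + C * measure_pmf.prob (PP {1..nat \<lfloor>\<rho> * real n\<rfloor>}) E"
    using transfer[OF \<eta>4] by blast
  have \<eta>C: "0 < \<eta> / (4 * C)" using \<eta> C by simp
  obtain J K where d1: "\<And>r. J \<le> r \<Longrightarrow> depends_on {1..r} ({x. \<exists>j\<in>{J<..r}. 2 \<le> x j} \<union> {x. K < R J x})"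
    and p1: "\<And>r. J \<le> r \<Longrightarrow> measure_pmf.prob (PP {1..r}) ({x. \<exists>j\<in>{J<..r}. 2 \<le> x j} \<union> {x. K < R J x}) \<le> \<eta> / (4 * C)"
    using few_irregularities[OF \<eta>C] by blast
  obtain n3 where n3: "\<And>m. n3 \<le> m \<Longrightarrow> 1 \<le> V m"
      "\<And>m j. n3 \<le> m \<Longrightarrow> 1 \<le> j \<Longrightarrow> j \<le> m \<Longrightarrow> \<bar>a j\<bar> * sqrt (L m) \<le> e * sqrt (V m)"
    using c_uniform[OF e] by blast
  obtain n4 where n4: "\<And>m. n4 \<le> m \<Longrightarrow> K / e \<le> bet m" using bet_large by blast
  define n5 where "n5 = Max {n1, n3, n4}"
  have n5: "n1 \<le> n5" "n3 \<le> n5" "n4 \<le> n5" by (auto simp: n5_def)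
  obtain n2 where n2: "\<And>n. n2 \<le> n \<Longrightarrow> measure_pmf.prob (P n) {x. \<forall>m\<in>{n5..n}. \<not> close g m x e} \<le> \<eta> / (4 * C)"
    using lower_LIL[OF g e \<eta>C] by blast
  define N where "N = nat \<lceil>(real J + real n2 + 2) / \<rho>\<rceil>"
  have "measure_pmf.prob (\<nu> n) {x. \<forall>m\<in>{n1..n}. \<epsilon> \<le> mdist C01 (U m x) g} \<le> \<eta>" if n: "N \<le> n" for n
  proof -
    define r where "r = nat \<lfloor>\<rho> * real n\<rfloor>"
    have "(real J + real n2 + 2) / \<rho> \<le> real n" using n unfolding N_def by linarith
    then have "real J + real n2 + 2 \<le> \<rho> * real n" using \<rho> by (simp add: pos_divide_le_eq mult.commute)
    moreover have r0: "\<rho> * real n < real r + 1" "real r \<le> \<rho> * real n" using \<rho> by (auto simp: r_def)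
    ultimately have r: "J \<le> r" "n2 \<le> r" "1 \<le> r" by linarith+
    have "\<rho> * real n \<le> 1 * real n" using \<rho> by (intro mult_right_mono) auto
    then have rn: "r \<le> n" "1 \<le> n" using r0 r(3) by linarith+
    define E1 where "E1 = {x. \<exists>j\<in>{J<..r}. 2 \<le> x j} \<union> {x. K < R J x}"
    define E2 where "E2 = {x. \<forall>m\<in>{n5..r}. \<not> close g m x e}"
    have dE2: "depends_on {1..r} E2"
      unfolding depends_on_def
    proof (intro allI impI)
      fix x y :: "nat \<Rightarrow> nat" assume xy: "\<forall>i\<in>{1..r}. x i = y i"
      have "S x i = S y i" if "i \<le> r" for i unfolding S_def by (rule sum.cong) (use xy that in auto)
      then have "close g m x e \<longleftrightarrow> close g m y e" if "m \<in> {n5..r}" for m using that by (simp add: close_def)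
      then show "x \<in> E2 \<longleftrightarrow> y \<in> E2" by (auto simp: E2_def)
    qed
    have dE: "depends_on {1..r} (E1 \<union> E2)"
      using d1[OF r(1), folded E1_def] dE2 unfolding depends_on_def by (metis UnE UnI1 UnI2)
    have "measure_pmf.prob (PP {1..r}) (E1 \<union> E2) \<le> measure_pmf.prob (PP {1..r}) E1 + measure_pmf.prob (PP {1..r}) E2"
      by (rule measure_Un_le) auto
    also have "\<dots> \<le> \<eta> / (4 * C) + \<eta> / (4 * C)"
      using p1[OF r(1)] n2[OF r(2)] unfolding E1_def E2_def by (rule add_mono)
    finally have "C * measure_pmf.prob (PP {1..r}) (E1 \<union> E2) \<le> C * (\<eta> / (4 * C) + \<eta> / (4 * C))"
      using C by (intro mult_left_mono) auto
    also have "\<dots> = \<eta> / 2" using C by (simp add: field_simps)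
    finally have pE: "measure_pmf.prob (\<nu> n) (E1 \<union> E2) \<le> \<eta> / 4 + \<eta> / 2"
      using tr[OF rn(2) dE[unfolded r_def]] unfolding r_def[symmetric] by linarith
    have "{x. \<forall>m\<in>{n1..n}. \<epsilon> \<le> mdist C01 (U m x) g} \<subseteq> E1 \<union> E2"
    proof (rule subsetI, rule ccontr)
      fix x assume x: "x \<in> {x. \<forall>m\<in>{n1..n}. \<epsilon> \<le> mdist C01 (U m x) g}" and bad: "x \<notin> E1 \<union> E2"
      obtain m where m: "n5 \<le> m" "m \<le> r" "close g m x e" using bad unfolding E2_def by auto
      have x2: "x j < 2" if "J < j" "j \<le> m" for j using bad that m unfolding E1_def by (auto simp: not_le)
      have "R J x \<le> K" using bad unfolding E1_def by (simp add: not_less)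
      also have "K \<le> e * bet m" using n4[of m] n5 m(1) e by (simp add: pos_divide_le_eq mult.commute)
      finally have RK: "R J x \<le> e * bet m" .
      have Vm: "0 < V m" using n3(1)[of m] n5 m(1) by simp
      have cu: "\<bar>a j\<bar> * sqrt (L m) \<le> e * sqrt (V m)" if "1 \<le> j" "j \<le> m" for j
        using n3(2)[of m j] n5 m(1) that by simp
      have "mdist C01 (U m x) g \<le> 2 * e + e"
        by (rule close_imp_mdist[OF g Vm _ _ cu x2 RK m(3)]) (use e in auto)
      moreover have "\<epsilon> \<le> mdist C01 (U m x) g" using x n5 m rn by auto
      ultimately show False using \<epsilon> by (simp add: e_def)
    qed
    then have "measure_pmf.prob (\<nu> n) {x. \<forall>m\<in>{n1..n}. \<epsilon> \<le> mdist C01 (U m x) g} \<le> measure_pmf.prob (\<nu> n) (E1 \<union> E2)"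
      by (intro measure_pmf.finite_measure_mono) auto
    then show ?thesis using pE \<eta> by linarith
  qed
  then show ?thesis by blast
qed

end

theorem theorem2:
  fixes ms :: "nat \<Rightarrow> nat"
    and \<mu> :: "nat \<Rightarrow> assembly pmf"
    and M :: "'w measure"
    and \<xi> :: "nat \<Rightarrow> 'w \<Rightarrow> nat"
    and lam :: "nat \<Rightarrow> real"
    and h :: "nat \<Rightarrow> nat \<Rightarrow> real"
    and a :: "nat \<Rightarrow> real"
  assumes "\<And>j. j \<ge> 1 \<Longrightarrow> ms j \<ge> 1"
    and "weakly_logarithmic ms \<mu> M \<xi> lam"
    and "\<And>j. j \<ge> 1 \<Longrightarrow> h j 0 = 0"
    and "\<And>j. a j = h j 1"
    and "filterlim (Bnorm a lam) at_top sequentially"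
    and "a \<in> o(\<lambda>j. Bnorm a lam j / sqrt (LLg (Bnorm a lam j)))"
  shows "is_cluster C01 (\<lambda>n. measure_pmf (\<mu> n)) (\<lambda>n m \<sigma>. U_proc h lam m \<sigma>) strassen_set"
proof -
  obtain \<theta>1 \<theta>2 where \<theta>: "0 < \<theta>1" "\<theta>1 \<le> \<theta>2" "\<And>j. 1 \<le> j \<Longrightarrow> \<theta>1 / real j \<le> lam j" "\<And>j. 1 \<le> j \<Longrightarrow> lam j \<le> \<theta>2 / real j"
    using assms(2) unfolding weakly_logarithmic_def by metis
  interpret additive_function lam \<theta>1 \<theta>2 h a
    by unfold_locales (use \<theta> assms in auto)
  define cnt where "cnt = (\<lambda>n \<sigma> j. if j \<in> {1..n} then comp_count \<sigma> j else (0::nat))"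
  have law: "map_pmf (cnt n) (\<mu> n) = \<nu> n" if "1 \<le> n" for n
    unfolding cnt_def by (rule count_law[OF assms(2) that])
  have U: "U_proc h lam m \<sigma> = U m (cnt n \<sigma>)" if "m \<le> n" for m n \<sigma>
    unfolding cnt_def by (rule U_proc_eq[OF that])
  (* probabilities of events that depend on the counts only *)
  have push: "measure_pmf.prob (\<mu> n) {\<sigma>. Q (cnt n \<sigma>)} = measure_pmf.prob (\<nu> n) {x. Q x}" if "1 \<le> n" for n Q
    unfolding law[OF that, symmetric] measure_map_pmf by (simp add: vimage_def)
  have meas: "U_proc h lam m \<in> measurable (measure_pmf (\<mu> n)) (metric_borel C01)" for m n
    using U_C01 U[of m m] by (auto simp: metric_borel_def space_measure_of_conv)
  have upper: "(\<lambda>n1. limsup (\<lambda>n. ereal \<P>(\<sigma> in \<mu> n. Max ((\<lambda>m. dist_to_set C01 (U_proc h lam m \<sigma>) strassen_set) ` {n1..n}) \<ge> \<epsilon>))) \<longlonglongrightarrow> 0"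
    if \<epsilon>: "0 < \<epsilon>" for \<epsilon>
  proof (rule tendsto_zero_ereal)
    fix n1
    show "0 \<le> limsup (\<lambda>n. ereal \<P>(\<sigma> in \<mu> n. Max ((\<lambda>m. dist_to_set C01 (U_proc h lam m \<sigma>) strassen_set) ` {n1..n}) \<ge> \<epsilon>))"
      by (rule le_Limsup) auto
  next
    fix \<eta> :: real assume \<eta>: "0 < \<eta>"
    obtain n0 N where N: "\<And>n. N \<le> n \<Longrightarrow> measure_pmf.prob (\<nu> n) {x. \<exists>m\<in>{n0..n}. \<epsilon> \<le> dist_to_set C01 (U m x) strassen_set} \<le> \<eta>"
      using upper_U[OF \<epsilon> \<eta>] by blast
    have "limsup (\<lambda>n. ereal \<P>(\<sigma> in \<mu> n. Max ((\<lambda>m. dist_to_set C01 (U_proc h lam m \<sigma>) strassen_set) ` {n1..n}) \<ge> \<epsilon>)) \<le> ereal \<eta>" if n1: "n0 \<le> n1" for n1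
    proof (rule Limsup_bounded, rule eventually_sequentiallyI)
      fix n assume n: "Max {1, N, n1} \<le> n"
      then have n': "1 \<le> n" "N \<le> n" "n1 \<le> n" by auto
      have "{\<sigma> \<in> space (\<mu> n). Max ((\<lambda>m. dist_to_set C01 (U_proc h lam m \<sigma>) strassen_set) ` {n1..n}) \<ge> \<epsilon>} \<subseteq>
          {\<sigma>. \<exists>m\<in>{n0..n}. \<epsilon> \<le> dist_to_set C01 (U m (cnt n \<sigma>)) strassen_set}"
      proof (rule subsetI)
        fix \<sigma> assume "\<sigma> \<in> {\<sigma> \<in> space (\<mu> n). Max ((\<lambda>m. dist_to_set C01 (U_proc h lam m \<sigma>) strassen_set) ` {n1..n}) \<ge> \<epsilon>}"
        then obtain m where "m \<in> {n1..n}" "\<epsilon> \<le> dist_to_set C01 (U_proc h lam m \<sigma>) strassen_set"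
          using n' by (auto simp: Max_ge_iff)
        then show "\<sigma> \<in> {\<sigma>. \<exists>m\<in>{n0..n}. \<epsilon> \<le> dist_to_set C01 (U m (cnt n \<sigma>)) strassen_set}"
          using n1 U[of m n \<sigma>] by auto
      qed
      then have "\<P>(\<sigma> in \<mu> n. Max ((\<lambda>m. dist_to_set C01 (U_proc h lam m \<sigma>) strassen_set) ` {n1..n}) \<ge> \<epsilon>) \<le>
          measure_pmf.prob (\<mu> n) {\<sigma>. \<exists>m\<in>{n0..n}. \<epsilon> \<le> dist_to_set C01 (U m (cnt n \<sigma>)) strassen_set}"
        by (rule measure_pmf.finite_measure_mono) auto
      also have "\<dots> \<le> \<eta>" using N[OF n'(2)] push[OF n'(1), where Q = "\<lambda>x. \<exists>m\<in>{n0..n}. \<epsilon> \<le> dist_to_set C01 (U m x) strassen_set"] by linarith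
      finally show "ereal \<P>(\<sigma> in \<mu> n. Max ((\<lambda>m. dist_to_set C01 (U_proc h lam m \<sigma>) strassen_set) ` {n1..n}) \<ge> \<epsilon>) \<le> ereal \<eta>" by simp
    qed
    then show "\<exists>n0. \<forall>n1\<ge>n0. limsup (\<lambda>n. ereal \<P>(\<sigma> in \<mu> n. Max ((\<lambda>m. dist_to_set C01 (U_proc h lam m \<sigma>) strassen_set) ` {n1..n}) \<ge> \<epsilon>)) \<le> ereal \<eta>"
      by blast
  qed
  (* the lower bound holds for each n1, not only in the limit *)
  have lower: "liminf (\<lambda>n. ereal \<P>(\<sigma> in \<mu> n. Min ((\<lambda>m. mdist C01 (U_proc h lam m \<sigma>) g) ` {n1..n}) < \<epsilon>)) = 1"
    if \<epsilon>: "0 < \<epsilon>" and g: "g \<in> strassen_set" for \<epsilon> g n1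
  proof (rule antisym)
    have "liminf (\<lambda>n. ereal \<P>(\<sigma> in \<mu> n. Min ((\<lambda>m. mdist C01 (U_proc h lam m \<sigma>) g) ` {n1..n}) < \<epsilon>)) \<le> liminf (\<lambda>n. 1)"
      by (rule Liminf_mono) (simp add: one_ereal_def)
    then show "liminf (\<lambda>n. ereal \<P>(\<sigma> in \<mu> n. Min ((\<lambda>m. mdist C01 (U_proc h lam m \<sigma>) g) ` {n1..n}) < \<epsilon>)) \<le> 1"
      by (simp add: Liminf_const)
    have "ereal (1 - \<eta>) \<le> liminf (\<lambda>n. ereal \<P>(\<sigma> in \<mu> n. Min ((\<lambda>m. mdist C01 (U_proc h lam m \<sigma>) g) ` {n1..n}) < \<epsilon>))"
      if \<eta>: "0 < \<eta>" for \<eta>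
    proof -
      obtain N where N: "\<And>n. N \<le> n \<Longrightarrow> measure_pmf.prob (\<nu> n) {x. \<forall>m\<in>{n1..n}. \<epsilon> \<le> mdist C01 (U m x) g} \<le> \<eta>"
        using lower_U[OF g \<epsilon> \<eta>] by blast
      show ?thesis
      proof (rule Liminf_bounded, rule eventually_sequentiallyI)
        fix n assume n: "Max {1, N, n1} \<le> n"
        then have n': "1 \<le> n" "N \<le> n" "n1 \<le> n" by auto
        have "- {\<sigma>. \<forall>m\<in>{n1..n}. \<epsilon> \<le> mdist C01 (U m (cnt n \<sigma>)) g} \<subseteq>
            {\<sigma> \<in> space (\<mu> n). Min ((\<lambda>m. mdist C01 (U_proc h lam m \<sigma>) g) ` {n1..n}) < \<epsilon>}"
        proof (rule subsetI)
          fix \<sigma> assume "\<sigma> \<in> - {\<sigma>. \<forall>m\<in>{n1..n}. \<epsilon> \<le> mdist C01 (U m (cnt n \<sigma>)) g}"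
          then obtain m where "m \<in> {n1..n}" "mdist C01 (U m (cnt n \<sigma>)) g < \<epsilon>" by (auto simp: not_le)
          then have "\<exists>m\<in>{n1..n}. mdist C01 (U_proc h lam m \<sigma>) g < \<epsilon>" using U[of m n \<sigma>] by (intro bexI[of _ m]) auto
          then show "\<sigma> \<in> {\<sigma> \<in> space (\<mu> n). Min ((\<lambda>m. mdist C01 (U_proc h lam m \<sigma>) g) ` {n1..n}) < \<epsilon>}"
            using n' by (auto simp: Min_less_iff)
        qed
        then have "measure_pmf.prob (\<mu> n) (- {\<sigma>. \<forall>m\<in>{n1..n}. \<epsilon> \<le> mdist C01 (U m (cnt n \<sigma>)) g}) \<le>
            \<P>(\<sigma> in \<mu> n. Min ((\<lambda>m. mdist C01 (U_proc h lam m \<sigma>) g) ` {n1..n}) < \<epsilon>)"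
          by (rule measure_pmf.finite_measure_mono) auto
        moreover have "measure_pmf.prob (\<mu> n) (- {\<sigma>. \<forall>m\<in>{n1..n}. \<epsilon> \<le> mdist C01 (U m (cnt n \<sigma>)) g}) =
            1 - measure_pmf.prob (\<mu> n) {\<sigma>. \<forall>m\<in>{n1..n}. \<epsilon> \<le> mdist C01 (U m (cnt n \<sigma>)) g}"
          using measure_pmf.prob_compl[of "{\<sigma>. \<forall>m\<in>{n1..n}. \<epsilon> \<le> mdist C01 (U m (cnt n \<sigma>)) g}" "\<mu> n"]
          by (simp add: Compl_eq_Diff_UNIV)
        moreover have "measure_pmf.prob (\<mu> n) {\<sigma>. \<forall>m\<in>{n1..n}. \<epsilon> \<le> mdist C01 (U m (cnt n \<sigma>)) g} \<le> \<eta>"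
          using N[OF n'(2)] push[OF n'(1), where Q = "\<lambda>x. \<forall>m\<in>{n1..n}. \<epsilon> \<le> mdist C01 (U m x) g"] by linarith
        ultimately show "ereal (1 - \<eta>) \<le> ereal \<P>(\<sigma> in \<mu> n. Min ((\<lambda>m. mdist C01 (U_proc h lam m \<sigma>) g) ` {n1..n}) < \<epsilon>)" by simp
      qed
    qed
    note bound = this
    show "1 \<le> liminf (\<lambda>n. ereal \<P>(\<sigma> in \<mu> n. Min ((\<lambda>m. mdist C01 (U_proc h lam m \<sigma>) g) ` {n1..n}) < \<epsilon>))" (is "1 \<le> ?l")
    proof (rule ereal_le_epsilon2)
      fix \<eta> :: real assume "0 < \<eta>"
      have "1 = ereal (1 - \<eta>) + ereal \<eta>" by (simp add: one_ereal_def)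
      also have "\<dots> \<le> ?l + ereal \<eta>" by (rule add_right_mono[OF bound[OF \<open>0 < \<eta>\<close>]])
      finally show "1 \<le> ?l + ereal \<eta>" .
    qed
  qed
  show ?thesis
    unfolding is_cluster_def
  proof (intro conjI allI ballI impI)
    show "prob_space (measure_pmf (\<mu> n))" for n by (rule measure_pmf.prob_space_axioms)
    show "strassen_set \<noteq> {}" using zero_in_strassen_set by blast
    show "(\<lambda>n1. liminf (\<lambda>n. ereal \<P>(\<sigma> in \<mu> n. Min ((\<lambda>m. mdist C01 (U_proc h lam m \<sigma>) g) ` {n1..n}) < \<epsilon>))) \<longlonglongrightarrow> 1"
      if "0 < \<epsilon>" "g \<in> strassen_set" for \<epsilon> g
      unfolding lower[OF that] by (rule tendsto_const)
  qed (rule separable_C01 compactin_strassen_set meas upper, assumption?)+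
qed

end
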